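(* Let $E$ be an elliptic curve over $K=\mathbb{Q}(t)$ given by a minimal short Weierstrass equation $y^2=x^3+Ax+B$ with $A,B\in\mathbb{Q}[t]$, let $P\in E(K)$ be a non-torsion point, and let $(B_n)$ be the elliptic divisibility sequence arising from $P$. There is a uniform constant $N_0$ such that for all $n\geqslant N_0$, $B_n$ has a primitive divisor. Specifically: (i) in general, $N_0=190000$; (ii) if $P$ has everywhere good reduction, $N_0=7$; (iii) if $P$ has everywhere good reduction except at infinity, $N_0=11$; (iv) if $E$ is isotrivial, $N_0=133$; (v) if $E$ has a polynomial $j$-invariant, $N_0=151$.
   Context: For $Q\in E(K)$ write $x(Q)=A_Q/B_Q^2$ with $A_Q,B_Q\in\mathbb{Q}[t]$ coprime, $B_Q$ monic; $B_n:=B_{nP}$. A nonzero term $B_n$ has a primitive divisor $d\in\mathbb{Q}[t]$ if $d$ is not a unit, $d\mid B_n$, and $\gcd(B_m,d)$ is a unit for all $m<n$ with $B_m\neq0$. "$P$ has everywhere good reduction" means that at every place $v$ of $K$ (finite places and the infinite place with valuation $-\deg$), $P$ reduces to a nonsingular point of the reduction of a $v$-minimal model of $E$; "except at infinity" means at every finite place. $E$ is isotrivial if its $j$-invariant is constant, and has polynomial $j$-invariant if $j_E\in\mathbb{Q}[t]$.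
   Formalization: The formal statement assumes that A and B are not both constant; for a constant curve, such as y^2=x^3-2 with P=(3,5), every multiple of P has B_n=1, so no B_n has a primitive divisor and the claim as stated fails. *)

theory Defs
  imports "HOL-Computational_Algebra.Computational_Algebra" "HOL-Computational_Algebra.Field_as_Ring"
begin

type_synonym K = "rat poly fract"

definition polyK :: "rat poly \<Rightarrow> K" where
  "polyK p = Fract p 1"

text \<open>Valuation at the finite place given by a (monic) irreducible polynomial p,
  and at the infinite place (valuation = - degree).  Only meaningful for z \<noteq> 0.\<close>
definition vfin :: "rat poly \<Rightarrow> K \<Rightarrow> int" where
  "vfin p z = (THE e. \<exists>a b. b \<noteq> 0 \<and> z = Fract a b \<and>
      e = int (multiplicity p a) - int (multiplicity p b))"

definition vinf :: "K \<Rightarrow> int" where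
  "vinf z = (THE e. \<exists>a b. b \<noteq> 0 \<and> z = Fract a b \<and>
      e = int (degree b) - int (degree a))"

text \<open>v(z) \<ge> k, with the convention v(0) = +infinity.\<close>
definition val_ge :: "(K \<Rightarrow> int) \<Rightarrow> int \<Rightarrow> K \<Rightarrow> bool" where
  "val_ge w k z \<longleftrightarrow> z = 0 \<or> w z \<ge> k"

type_synonym 'a ec_point = "('a \<times> 'a) option"  \<comment> \<open>None = point at infinity O\<close>

definition on_curve :: "'a::field \<Rightarrow> 'a \<Rightarrow> 'a ec_point \<Rightarrow> bool" where
  "on_curve a b P = (case P of None \<Rightarrow> True
     | Some (x, y) \<Rightarrow> y ^ 2 = x ^ 3 + a * x + b)"

definition ec_add :: "'a::field \<Rightarrow> 'a ec_point \<Rightarrow> 'a ec_point \<Rightarrow> 'a ec_point" where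
  "ec_add a P Q = (case P of None \<Rightarrow> Q | Some (x1, y1) \<Rightarrow>
     (case Q of None \<Rightarrow> P | Some (x2, y2) \<Rightarrow>
       (if x1 = x2 \<and> y1 = - y2 then None
        else let l = (if x1 = x2 then (3 * x1 ^ 2 + a) / (2 * y1)
                      else (y2 - y1) / (x2 - x1));
                 x3 = l ^ 2 - x1 - x2;
                 y3 = l * (x1 - x3) - y1
             in Some (x3, y3))))"

fun ec_mult :: "'a::field \<Rightarrow> nat \<Rightarrow> 'a ec_point \<Rightarrow> 'a ec_point" where
  "ec_mult a 0 P = None"
| "ec_mult a (Suc n) P = ec_add a P (ec_mult a n P)"

definition non_torsion :: "'a::field \<Rightarrow> 'a ec_point \<Rightarrow> bool" where
  "non_torsion a P \<longleftrightarrow> (\<forall>n::nat. n \<ge> 1 \<longrightarrow> ec_mult a n P \<noteq> None)"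

definition denomB :: "K ec_point \<Rightarrow> rat poly" where
  "denomB Q = (case Q of None \<Rightarrow> 0 | Some (x, y) \<Rightarrow>
     (THE d. \<exists>n. coprime n d \<and> lead_coeff d = 1 \<and> x = polyK n / polyK d ^ 2))"

definition eds :: "rat poly \<Rightarrow> K ec_point \<Rightarrow> nat \<Rightarrow> rat poly" where
  "eds A P n = denomB (ec_mult (polyK A) n P)"

definition has_primitive_divisor :: "rat poly \<Rightarrow> K ec_point \<Rightarrow> nat \<Rightarrow> bool" where
  "has_primitive_divisor A P n \<longleftrightarrow>
     (\<exists>d. \<not> is_unit d \<and> d dvd eds A P n \<and>
        (\<forall>m. m < n \<and> eds A P m \<noteq> 0 \<longrightarrow> is_unit (gcd (eds A P m) d)))"

definition minimal_poly_model :: "rat poly \<Rightarrow> rat poly \<Rightarrow> bool" where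
  "minimal_poly_model A B \<longleftrightarrow>
     (\<forall>p. irreducible p \<longrightarrow> \<not> (p ^ 4 dvd A \<and> p ^ 6 dvd B))"

text \<open>A short Weierstrass equation with coefficients a, b in K is w-minimal
  (residue characteristic 0, so short models suffice).\<close>
definition minimal_at :: "(K \<Rightarrow> int) \<Rightarrow> K \<Rightarrow> K \<Rightarrow> bool" where
  "minimal_at w a b \<longleftrightarrow> val_ge w 0 a \<and> val_ge w 0 b \<and>
     \<not> (val_ge w 4 a \<and> val_ge w 6 b)"

text \<open>The point (x,y) of y^2 = x^3 + a x + b (an integral model at w) reduces to a
  nonsingular point of the reduction: either it reduces to O (v(x) < 0), or
  the partial derivatives 2y and 3x^2 + a do not both vanish modulo the place.\<close>
definition nonsing_reduction :: "(K \<Rightarrow> int) \<Rightarrow> K \<Rightarrow> K ec_point \<Rightarrow> bool" where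
  "nonsing_reduction w a P = (case P of None \<Rightarrow> True | Some (x, y) \<Rightarrow>
     \<not> val_ge w 0 x \<or> \<not> (val_ge w 1 (2 * y) \<and> val_ge w 1 (3 * x ^ 2 + a)))"

text \<open>P has good reduction at the place w: it reduces to a nonsingular point on the
  reduction of a w-minimal model, obtained from the given one by a change of
  variables (x,y) \<mapsto> (x/u^2, y/u^3), u \<in> K^*.\<close>
definition good_reduction_at :: "(K \<Rightarrow> int) \<Rightarrow> K \<Rightarrow> K \<Rightarrow> K ec_point \<Rightarrow> bool" where
  "good_reduction_at w a b P \<longleftrightarrow>
     (\<exists>u. u \<noteq> 0 \<and> minimal_at w (a / u ^ 4) (b / u ^ 6) \<and>
        nonsing_reduction w (a / u ^ 4)
          (map_option (\<lambda>(x, y). (x / u ^ 2, y / u ^ 3)) P))"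

definition good_reduction_finite :: "rat poly \<Rightarrow> rat poly \<Rightarrow> K ec_point \<Rightarrow> bool" where
  "good_reduction_finite A B P \<longleftrightarrow>
     (\<forall>p. irreducible p \<and> lead_coeff p = 1 \<longrightarrow>
        good_reduction_at (vfin p) (polyK A) (polyK B) P)"

definition good_reduction_everywhere :: "rat poly \<Rightarrow> rat poly \<Rightarrow> K ec_point \<Rightarrow> bool" where
  "good_reduction_everywhere A B P \<longleftrightarrow>
     good_reduction_finite A B P \<and> good_reduction_at vinf (polyK A) (polyK B) P"

definition j_inv :: "rat poly \<Rightarrow> rat poly \<Rightarrow> K" where
  "j_inv A B = 1728 * (4 * polyK A ^ 3) / (4 * polyK A ^ 3 + 27 * polyK B ^ 2)"

definition isotrivial :: "rat poly \<Rightarrow> rat poly \<Rightarrow> bool" where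
  "isotrivial A B \<longleftrightarrow> (\<exists>c::rat. j_inv A B = polyK [:c:])"

definition polynomial_j :: "rat poly \<Rightarrow> rat poly \<Rightarrow> bool" where
  "polynomial_j A B \<longleftrightarrow> (\<exists>f::rat poly. j_inv A B = polyK f)"

end

theory Submission
  imports Defs
begin

text \<open>
  The Neron local heights at the places of \<open>\<rat>(t)\<close> sum to a quadratic function \<open>n\<^sup>2 h\<close> of the multiple
  \<open>n P\<close>, and each of them is the order of the pole of \<open>x(n P)\<close> halved, up to a correction that depends
  only on the component of the fibre hit by \<open>n P\<close>. If \<open>B_n\<close> has no primitive divisor, then every prime
  dividing \<open>B_n\<close> divides some \<open>B_{n/q}\<close> with \<open>q\<close> prime to the same power, so that
  \<open>n\<^sup>2 (1 - \<Sum> 1/q\<^sup>2) h\<close> is bounded by the corrections and the order of contact of \<open>n P\<close> with the zero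
  section at infinity. That order is bounded by the degree of the Manin map, a differential invariant
  of the point that vanishes to the order of contact. A lower bound for \<open>h\<close> comes from averaging the
  corrections over many multiples (they form a kernel of negative type) together with Szpiro's
  inequality, or from a few small multiples if the reduction is restricted.
\<close>

section \<open>Multiples of a point of infinite order\<close>

text \<open>No general group law is proved. Only the symmetric functions of x((m+n)P) and x((m-n)P)
  and the duplication formula enter, so the local theory is about the valuations of the two roots of
  one explicit quadratic. They are compared with the fractional threshold \<open>2 * mu\<close>,
  which replaces a ramified extension with semistable reduction. The obstacle in the general case is
  that the corrections may use up the whole main term \<open>chi\<close>, so that a single multiple
  gives no lower bound for the height. Multiples of 6 have no correction at potentially good places
  and at most 1/2 at fibres of type I_N^*. At multiplicative fibres the average over differences of
  multiples is at most (N - 1/N)/12, and Szpiro's inequality converts the small gain from 1/N into a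
  gain of \<open>chi / 36\<close>. In (iii), and in (v) after multiplication by 6, only the fibre at
  infinity needs a correction, and it is small for one of the first four multiples. The thresholds
  7, 11 and 151 are near the limit of the inequalities; 190000 and 133 leave ample room.\<close>

text \<open>Coefficient comparison in \<open>(d + c x + a x^2)^2 - (x^3 + A x + B) = a^2 (x - x1) (x
  - x2) (x - x3) (x - w)\<close>: the parabola meets the curve at these four abscissae. In this form
  coincident abscissae mean tangency and need no separate case.\<close>

definition quad_interp ::
    "'a::field \<Rightarrow> 'a \<Rightarrow> 'a \<Rightarrow> 'a \<Rightarrow> 'a \<Rightarrow> 'a \<Rightarrow> 'a \<Rightarrow> 'a \<Rightarrow> 'a \<Rightarrow> bool" where
  "quad_interp A B a c d x1 x2 x3 w \<longleftrightarrow>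
     1 - 2 * a * c = a^2 * (x1 + x2 + x3 + w) \<and>
     2 * a * d + c^2 = a^2 * (x1 * x2 + x1 * x3 + x2 * x3 + w * (x1 + x2 + x3)) \<and>
     A - 2 * c * d = a^2 * (x1 * x2 * x3 + w * (x1 * x2 + x1 * x3 + x2 * x3)) \<and>
     d^2 - B = a^2 * (x1 * x2 * x3 * w)"

lemma quad_interp_rotate:
  "quad_interp A B a c d x1 x2 x3 w \<Longrightarrow> quad_interp A B a c d x2 x3 x1 w"
  unfolding quad_interp_def by (simp add: algebra_simps)

definition ec_slope :: "'a::field \<Rightarrow> 'a \<Rightarrow> 'a \<Rightarrow> 'a \<Rightarrow> 'a \<Rightarrow> 'a" where
  "ec_slope A x1 y1 x2 y2 =
     (if x1 = x2 then (3 * x1 ^ 2 + A) / (2 * y1) else (y2 - y1) / (x2 - x1))"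

lemma ec_add_Some:
  assumes "\<not> (x1 = x2 \<and> y1 = - y2)" and "l = ec_slope A x1 y1 x2 y2"
  shows "ec_add A (Some (x1, y1)) (Some (x2, y2)) =
    Some (l^2 - x1 - x2, l * (x1 - (l^2 - x1 - x2)) - y1)"
  using assms by (auto simp: ec_add_def ec_slope_def Let_def)

lemma same_x:
  fixes y1 y2 :: "'a::field"
  assumes "y1^2 = y2^2" "y1 \<noteq> - y2" shows "y1 = y2"
  using assms by (metis power2_eq_iff)

text \<open>The right-hand side is the slope of a secant of the parabola. When the abscissae
  coincide, the factorisation behind \<open>quad_interp\<close> makes parabola and curve tangent, so
  the tangent of the curve has the same slope.\<close>

lemma ec_slope_quad:
  fixes A :: "'a::field_char_0"
  assumes q: "quad_interp A B a c d x1 x2 x3 w"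
    and y: "y1 = d + c * x1 + a * x1^2" "y2 = d + c * x2 + a * x2^2"
    and ne: "\<not> (x1 = x2 \<and> y1 = - y2)"
  shows "ec_slope A x1 y1 x2 y2 = c + a * (x1 + x2)"
proof (cases "x1 = x2")
  case True
  then have "y1 = y2" using y by simp
  then have "y1 \<noteq> 0" using ne True by auto
  have "3 * x1^2 + A = 2 * y1 * (c + a * (x1 + x2))"
    using q y True unfolding quad_interp_def by algebra
  then show ?thesis using True \<open>y1 \<noteq> 0\<close> by (simp add: ec_slope_def field_simps)
next
  case False
  have "y2 - y1 = (c + a * (x1 + x2)) * (x2 - x1)"
    using y by (simp add: algebra_simps power2_eq_square)
  then show ?thesis using False by (simp add: ec_slope_def field_simps)
qed

text \<open>The parabola through three points meets the curve in a fourth point, the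
  negative of their sum; the description is symmetric in the three points.\<close>
lemma ec_add3_quad:
  fixes A :: "'a::field_char_0"
  assumes q: "quad_interp A B a c d x1 x2 x3 w" and a: "a \<noteq> 0"
    and y1: "y1 = d + c * x1 + a * x1^2" and y2: "y2 = d + c * x2 + a * x2^2"
    and y3: "y3 = d + c * x3 + a * x3^2"
    and ne: "\<not> (x1 = x2 \<and> y1 = - y2)"
    and P4: "ec_add A (Some (x1, y1)) (Some (x2, y2)) = Some (x4, y4)"
    and ne4: "\<not> (x4 = x3 \<and> y4 = - y3)"
  shows "ec_add A (Some (x4, y4)) (Some (x3, y3)) = Some (w, - (d + c * w + a * w^2))"
proof -
  define l where "l = c + a * (x1 + x2)"
  have sl: "ec_slope A x1 y1 x2 y2 = l" unfolding l_def by (rule ec_slope_quad[OF q y1 y2 ne])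
  have x4: "x4 = l^2 - x1 - x2" and y4: "y4 = l * (x1 - x4) - y1"
    using ec_add_Some[OF ne sl[symmetric]] P4 by auto
  \<comment> \<open>The slope of the line from P1 + P2 to P3, as \<open>y34\<close> shows; the
    tangent case has to produce the same value.\<close>
  define k where "k = 1 / a - l"
  have ak: "a * k = 1 - a * l" using a by (simp add: k_def field_simps)
  have y34: "a * (y3 - y4) = (1 - a * l) * (x3 - x4)"
    using q y1 y2 y3 x4 y4 l_def unfolding quad_interp_def by algebra
  then have y34': "y3 - y4 = k * (x3 - x4)" using a ak by (metis mult.assoc mult_left_cancel)
  have sl2: "ec_slope A x4 y4 x3 y3 = k"
  proof (cases "x4 = x3")
    case True
    with y34' have yy: "y4 = y3" by simp
    then have y0: "y4 \<noteq> 0" using ne4 True by auto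
    have e1: "a^2 * (x3 + w) = 1 - 2 * a * l + a^2 * (x1 + x2)"
      using q l_def unfolding quad_interp_def by algebra
    have "a * (3 * x4^2 + A) = 2 * y4 * (a * k)"
      using q y1 y2 y3 x4 y4 l_def ak True yy a e1 unfolding quad_interp_def by algebra
    then have "3 * x4^2 + A = 2 * y4 * k" using a by (metis mult.left_commute mult_left_cancel)
    then show ?thesis using True y0 by (simp add: ec_slope_def field_simps)
  next
    case False
    then show ?thesis using y34' by (simp add: ec_slope_def field_simps)
  qed
  have "a^2 * (k^2 - x4 - x3) = a^2 * w"
    using q x4 l_def ak unfolding quad_interp_def by algebra
  then have w: "k^2 - x4 - x3 = w" using a by simp
  have "a * (k * (x4 - w) - y4) = a * (- (d + c * w + a * w^2))"
    using q y1 y2 x4 y4 l_def ak w unfolding quad_interp_def by algebra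
  then have "k * (x4 - w) - y4 = - (d + c * w + a * w^2)" using a by (metis mult_left_cancel)
  then show ?thesis using ec_add_Some[OF ne4 sl2[symmetric]] w by simp
qed

text \<open>Add \<open>a * (x - x1) * (x - x2)\<close> to the line through the first two points and
  choose \<open>a\<close> so that the third point is hit, which needs x3 different from x1 and x2.
  If \<open>a\<close> were 0, the points would be collinear and P1 + P2 = -P3, against
  \<open>ne4\<close>.\<close>

lemma quad_interp_exists:
  fixes A :: "'a::field_char_0"
  assumes c1: "y1^2 = x1^3 + A * x1 + B" and c2: "y2^2 = x2^3 + A * x2 + B"
    and c3: "y3^2 = x3^3 + A * x3 + B"
    and ne: "\<not> (x1 = x2 \<and> y1 = - y2)"
    and P4: "ec_add A (Some (x1, y1)) (Some (x2, y2)) = Some (x4, y4)"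
    and ne4: "\<not> (x4 = x3 \<and> y4 = - y3)"
    and d: "x3 \<noteq> x1" "x3 \<noteq> x2"
  obtains a c d w where "a \<noteq> 0" "quad_interp A B a c d x1 x2 x3 w"
    "y1 = d + c * x1 + a * x1^2" "y2 = d + c * x2 + a * x2^2" "y3 = d + c * x3 + a * x3^2"
proof -
  define l where "l = ec_slope A x1 y1 x2 y2"
  have x4: "x4 = l^2 - x1 - x2" and y4: "y4 = l * (x1 - x4) - y1"
    using ec_add_Some[OF ne l_def] P4 by auto
  have l1: "y2 - y1 = l * (x2 - x1) \<and> 3 * x1^2 + A = 2 * l * y1 + (x1 - x4) * (x1 - x2)"
  proof (cases "x1 = x2")
    case True
    then have "y1 = y2" using same_x[of y1 y2] c1 c2 ne by auto
    then have "y1 \<noteq> 0" using ne True by auto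
    then show ?thesis using True \<open>y1 = y2\<close> by (simp add: l_def ec_slope_def)
  next
    case False
    then have e: "y2 - y1 = l * (x2 - x1)" by (simp add: l_def ec_slope_def)
    have "(x2 - x1) * (3 * x1^2 + A) = (x2 - x1) * (2 * l * y1 + (x1 - x4) * (x1 - x2))"
      using e c1 c2 x4 by algebra
    then show ?thesis using False e by simp
  qed
  define m where "m = y1 - l * x1"
  have L1: "y1 = l * x1 + m" and L2: "y2 = l * x2 + m" using l1 by (auto simp: m_def algebra_simps)
  have l2: "3 * x1^2 + A = 2 * l * y1 + (x1 - x4) * (x1 - x2)" using l1 by blast
  have r0: "B - m^2 = - x1 * x2 * x4" using c1 L1 l2 x4 by algebra
  have r1: "A - 2 * l * m = x1 * x2 + x4 * (x1 + x2)" using L1 l2 x4 by algebra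
  define a where "a = (y3 - (l * x3 + m)) / ((x3 - x1) * (x3 - x2))"
  have ad: "y3 = l * x3 + m + a * (x3 - x1) * (x3 - x2)" 
  proof -
    have "(x3 - x1) * (x3 - x2) \<noteq> 0" using d by simp
    then have "a * ((x3 - x1) * (x3 - x2)) = y3 - (l * x3 + m)" unfolding a_def by simp
    then show ?thesis by (simp add: algebra_simps)
  qed
  have s3: "(x3 - x1) * (x3 - x2) * ((x3 - x4) - 2 * a * (l * x3 + m) - a^2 * (x3 - x1) * (x3 - x2)) = 0"
    using c3 ad r0 r1 x4 by algebra
  then have s3: "(x3 - x4) - 2 * a * (l * x3 + m) - a^2 * (x3 - x1) * (x3 - x2) = 0"
    using d by simp
  have a0: "a \<noteq> 0"
  proof
    assume "a = 0"
    then have "x3 = x4" using s3 by simp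
    moreover have "y4 = - y3" using ad \<open>a = 0\<close> y4 \<open>x3 = x4\<close> L1 by (simp add: algebra_simps)
    ultimately show False using ne4 by simp
  qed
  define w where "w = (1 - 2 * a * l) / a^2 + x1 + x2 - x3"
  have w: "a^2 * w = 1 - 2 * a * l + a^2 * (x1 + x2 - x3)" using a0 by (simp add: w_def field_simps)
  have q: "quad_interp A B a (l - a * (x1 + x2)) (m + a * x1 * x2) x1 x2 x3 w"
    unfolding quad_interp_def
    apply (intro conjI)
    subgoal using w by algebra
    subgoal using w s3 x4 by algebra
    subgoal using w s3 x4 r1 by algebra
    subgoal using w s3 x4 r0 by algebra
    done
  show ?thesis
    by (rule that[OF a0 q]) (use L1 L2 ad in \<open>simp_all add: algebra_simps power2_eq_square\<close>)
qed

lemma ec_add_commute: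
  fixes A :: "'a::field_char_0"
  assumes "on_curve A B P" "on_curve A B Q"
  shows "ec_add A P Q = ec_add A Q P"
proof (cases P; cases Q)
  fix p q assume P: "P = Some p" and Q: "Q = Some q"
  obtain x1 y1 x2 y2 where p: "p = (x1, y1)" and q: "q = (x2, y2)" by (cases p; cases q)
  have c: "y1^2 = x1^3 + A * x1 + B" "y2^2 = x2^3 + A * x2 + B"
    using assms P Q p q by (auto simp: on_curve_def)
  show ?thesis
  proof (cases "x1 = x2 \<and> y1 = - y2")
    case True
    then show ?thesis by (simp add: P Q p q ec_add_def)
  next
    case False
    then have F: "\<not> (x2 = x1 \<and> y2 = - y1)" by auto
    have y: "x1 = x2 \<Longrightarrow> y1 = y2" using same_x[of y1 y2] c False by auto
    define l where "l = ec_slope A x1 y1 x2 y2"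
    have l2: "l = ec_slope A x2 y2 x1 y1" using y
      by (auto simp: l_def ec_slope_def divide_simps) (auto simp: algebra_simps)
    have "l * (x1 - x2) = y1 - y2" using y
      by (auto simp: l_def ec_slope_def divide_simps) (auto simp: algebra_simps)
    then show ?thesis
      unfolding P Q p q ec_add_Some[OF False l_def] ec_add_Some[OF F l2]
      by (simp add: algebra_simps)
  qed
qed (auto simp: ec_add_def)

lemma ec_add_on_curve:
  fixes A :: "'a::field_char_0"
  assumes "on_curve A B P" "on_curve A B Q"
  shows "on_curve A B (ec_add A P Q)"
proof (cases P; cases Q)
  fix p q assume P: "P = Some p" and Q: "Q = Some q"
  obtain x1 y1 x2 y2 where p: "p = (x1, y1)" and q: "q = (x2, y2)" by (cases p; cases q)
  have c: "y1^2 = x1^3 + A * x1 + B" "y2^2 = x2^3 + A * x2 + B"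
    using assms P Q p q by (auto simp: on_curve_def)
  show ?thesis
  proof (cases "x1 = x2 \<and> y1 = - y2")
    case True
    then show ?thesis by (simp add: P Q p q ec_add_def on_curve_def)
  next
    case False
    define l where "l = ec_slope A x1 y1 x2 y2"
    define x4 where "x4 = l^2 - x1 - x2"
    have "3 * x1^2 + A = 2 * l * y1 + (x1 - x4) * (x1 - x2)"
    proof (cases "x1 = x2")
      case True
      then have "y1 = y2" using same_x[of y1 y2] c False by auto
      then have "y1 \<noteq> 0" using False True by auto
      then show ?thesis using True \<open>y1 = y2\<close> by (simp add: l_def ec_slope_def)
    next
      case False
      then have e: "y2 - y1 = l * (x2 - x1)" by (simp add: l_def ec_slope_def)
      have "(x2 - x1) * (3 * x1^2 + A) = (x2 - x1) * (2 * l * y1 + (x1 - x4) * (x1 - x2))"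
        using e c x4_def by algebra
      then show ?thesis using False by simp
    qed
    then have "(l * (x1 - x4) - y1)^2 = x4^3 + A * x4 + B" using c(1) x4_def by algebra
    then show ?thesis
      unfolding P Q p q ec_add_Some[OF False l_def] by (simp add: on_curve_def x4_def)
  qed
qed (use assms in \<open>auto simp: ec_add_def\<close>)

lemma ec_mult_on_curve:
  fixes A :: "'a::field_char_0"
  assumes "on_curve A B P" shows "on_curve A B (ec_mult A n P)"
proof (induction n)
  case 0 show ?case by (simp add: on_curve_def)
next
  case (Suc n) then show ?case using assms ec_add_on_curve by simp
qed

text \<open>Both bracketings are read off from the same parabola with the three points rotated; each
  time \<open>ec_add3_quad\<close> returns the reflected fourth intersection point.\<close>

lemma ec_add_assoc_distinct:
  fixes A :: "'a::field_char_0"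
  assumes c1: "y1^2 = x1^3 + A * x1 + B" and c2: "y2^2 = x2^3 + A * x2 + B"
    and c3: "y3^2 = x3^3 + A * x3 + B"
    and P4: "ec_add A (Some (x1, y1)) (Some (x2, y2)) = Some P4"
    and ne4: "ec_add A (Some P4) (Some (x3, y3)) \<noteq> None"
    and P5: "ec_add A (Some (x2, y2)) (Some (x3, y3)) = Some (x5, y5)"
    and ne5: "\<not> (x5 = x1 \<and> y5 = - y1)"
    and q: "a \<noteq> 0" "quad_interp A B a c d x1 x2 x3 w"
    "y1 = d + c * x1 + a * x1^2" "y2 = d + c * x2 + a * x2^2" "y3 = d + c * x3 + a * x3^2"
  shows "ec_add A (Some P4) (Some (x3, y3)) = ec_add A (Some (x5, y5)) (Some (x1, y1))"
proof -
  obtain x4 y4 where p4: "P4 = (x4, y4)" by (cases P4)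
  have n1: "\<not> (x1 = x2 \<and> y1 = - y2)" using P4 by (auto simp: ec_add_def)
  have n2: "\<not> (x4 = x3 \<and> y4 = - y3)" using ne4 p4 by (auto simp: ec_add_def)
  have n3: "\<not> (x2 = x3 \<and> y2 = - y3)" using P5 by (auto simp: ec_add_def)
  show ?thesis
    using ec_add3_quad[OF q(2,1,3,4,5) n1 P4[unfolded p4] n2]
      ec_add3_quad[OF quad_interp_rotate[OF q(2)] q(1,4,5,3) n3 P5 ne5]
    by (simp add: p4)
qed

text \<open>The cubic minus the square of the line is \<open>(x - x1) * (x - x2) * (x - x4)\<close>,
  and its derivative at x1 is the fourth identity. It holds for chord and tangent alike and later
  replaces the case distinction of \<open>ec_add\<close>.\<close>

lemma ec_line:
  fixes A :: "'a::field_char_0"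
  assumes c1: "y1^2 = x1^3 + A * x1 + B" and c2: "y2^2 = x2^3 + A * x2 + B"
    and T: "ec_add A (Some (x1, y1)) (Some (x2, y2)) = Some (x4, y4)"
  obtains l where "x4 = l^2 - x1 - x2" "y4 = l * (x1 - x4) - y1" "y2 - y1 = l * (x2 - x1)"
    "3 * x1^2 + A = 2 * l * y1 + (x1 - x4) * (x1 - x2)" "l = ec_slope A x1 y1 x2 y2"
proof -
  have F: "\<not> (x1 = x2 \<and> y1 = - y2)" using T by (auto simp: ec_add_def)
  define l where "l = ec_slope A x1 y1 x2 y2"
  have x4: "x4 = l^2 - x1 - x2" and y4: "y4 = l * (x1 - x4) - y1"
    using ec_add_Some[OF F l_def] T by auto
  have "y2 - y1 = l * (x2 - x1) \<and> 3 * x1^2 + A = 2 * l * y1 + (x1 - x4) * (x1 - x2)"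
  proof (cases "x1 = x2")
    case True
    then have "y1 = y2" using same_x[of y1 y2] c1 c2 F by auto
    then have "y1 \<noteq> 0" using F True by auto
    then show ?thesis using True \<open>y1 = y2\<close> by (simp add: l_def ec_slope_def)
  next
    case False
    then have e: "y2 - y1 = l * (x2 - x1)" by (simp add: l_def ec_slope_def)
    have "(x2 - x1) * (3 * x1^2 + A) = (x2 - x1) * (2 * l * y1 + (x1 - x4) * (x1 - x2))"
      using e c1 c2 x4 by algebra
    then show ?thesis using False e by simp
  qed
  then show ?thesis using that x4 y4 l_def by blast
qed

text \<open>-(P + Q), P and Q lie on one line, so adding P to -(P + Q) gives -Q. The hypothesis
  \<open>y\<close> excludes the doubling of a 2-torsion point.\<close>

lemma ec_add_cancel:
  fixes A :: "'a::field_char_0"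
  assumes c1: "y1^2 = x1^3 + A * x1 + B" and c2: "y2^2 = x2^3 + A * x2 + B"
    and T: "ec_add A (Some (x1, y1)) (Some (x2, y2)) = Some (x4, y4)" and y: "y1 \<noteq> 0"
  shows "ec_add A (Some (x4, - y4)) (Some (x1, y1)) = Some (x2, - y2)"
proof -
  obtain l where l: "x4 = l^2 - x1 - x2" "y4 = l * (x1 - x4) - y1" "y2 - y1 = l * (x2 - x1)"
    "3 * x1^2 + A = 2 * l * y1 + (x1 - x4) * (x1 - x2)"
    using ec_line[OF c1 c2 T] by blast
  have ne: "\<not> (x4 = x1 \<and> - y4 = - y1)" using l(2) y by auto
  have sl: "l = ec_slope A x4 (- y4) x1 y1"
  proof (cases "x4 = x1")
    case True
    then show ?thesis using l(2,4) y by (simp add: ec_slope_def)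
  next
    case False
    then show ?thesis using l(2) by (simp add: ec_slope_def field_simps)
  qed
  have "l^2 - x4 - x1 = x2" "l * (x4 - x2) - (- y4) = - y2" using l by algebra+
  then show ?thesis using ec_add_Some[OF ne sl] by simp
qed

lemma ec_add_no_fix:
  fixes A :: "'a::field_char_0"
  assumes c1: "y1^2 = x1^3 + A * x1 + B" and c2: "y2^2 = x2^3 + A * x2 + B" and y: "y1 \<noteq> 0"
  shows "ec_add A (Some (x1, y1)) (Some (x2, y2)) \<noteq> Some (x1, y1)"
proof
  assume T: "ec_add A (Some (x1, y1)) (Some (x2, y2)) = Some (x1, y1)"
  obtain l where "y1 = l * (x1 - x1) - y1" using ec_line[OF c1 c2 T] by blast
  then show False using y by simp
qed

text \<open>Associativity is needed only among the multiples of one point, where infinite order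
  removes most degenerate configurations.\<close>

locale nontorsion_point =
  fixes A B :: "'a::field_char_0" and P :: "'a ec_point"
  assumes onE: "on_curve A B P" and nontors: "non_torsion A P"
begin

definition X :: "nat \<Rightarrow> 'a" where "X n = fst (the (ec_mult A n P))"
definition Y :: "nat \<Rightarrow> 'a" where "Y n = snd (the (ec_mult A n P))"

lemma mult_Some: "n \<ge> 1 \<Longrightarrow> ec_mult A n P = Some (X n, Y n)"
  using nontors unfolding non_torsion_def X_def Y_def by (cases "ec_mult A n P") auto

lemma P_eq: "P = Some (X 1, Y 1)"
  using mult_Some[of 1] by (auto simp: ec_add_def split: option.splits)

lemma curve: "n \<ge> 1 \<Longrightarrow> (Y n)^2 = (X n)^3 + A * X n + B"
  using ec_mult_on_curve[OF onE, of n] mult_Some[of n] by (simp add: on_curve_def)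

lemma add_P: "n \<ge> 1 \<Longrightarrow> ec_add A (Some (X 1, Y 1)) (Some (X n, Y n)) = Some (X (Suc n), Y (Suc n))"
  using mult_Some[of n] mult_Some[of "Suc n"] P_eq by simp

lemma add_P': "n \<ge> 1 \<Longrightarrow> ec_add A (Some (X n, Y n)) (Some (X 1, Y 1)) = Some (X (Suc n), Y (Suc n))"
  using add_P[of n] ec_add_commute[of A B "Some (X n, Y n)" "Some (X 1, Y 1)"] curve[of n] curve[of 1]
  by (simp add: on_curve_def)

lemma Y1: "Y 1 \<noteq> 0" using add_P[of 1] by (auto simp: ec_add_def)

lemma opp_P: "n \<ge> 1 \<Longrightarrow> \<not> (X n = X 1 \<and> Y n = - Y 1)"
  using add_P'[of n] by (auto simp: ec_add_def)

lemma X_ne_X1: assumes "n \<ge> 2" shows "X n \<noteq> X 1"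
proof
  assume e: "X n = X 1"
  obtain k where k: "n = Suc k" "k \<ge> 1" using assms by (cases n) auto
  have "(Y n)^2 = (Y 1)^2" using curve[of n] curve[of 1] assms e by simp
  then have "Y n = Y 1" using same_x[of "Y n" "Y 1"] opp_P[of n] e assms by auto
  then show False using add_P[of k] ec_add_no_fix[OF curve[of 1] curve[of k] Y1] k e by simp
qed

text \<open>Induction on n through mP + (n+1)P = (mP + nP) + P, that is, one parabola through mP, nP
  and P. The induction hypothesis for m + 1 excludes (n+1)P = -mP.\<close>

lemma add_mult:
  "m \<ge> 1 \<Longrightarrow> n \<ge> 1 \<Longrightarrow>
    ec_add A (Some (X m, Y m)) (Some (X n, Y n)) = Some (X (m + n), Y (m + n))"
proof (induction n arbitrary: m)
  case 0 then show ?case by simp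
next
  case (Suc n)
  note IH = Suc.IH
  show ?case
  proof (cases "m = 1 \<or> n = 0")
    case True
    then show ?thesis using add_P[of "Suc n"] add_P'[of m] Suc.prems by auto
  next
    case False
    then have mn: "m \<ge> 2" "n \<ge> 1" using Suc.prems by auto
    have cm: "(Y m)^2 = (X m)^3 + A * X m + B" and cn: "(Y n)^2 = (X n)^3 + A * X n + B"
      and c1: "(Y 1)^2 = (X 1)^3 + A * X 1 + B" using curve mn by auto
    have P4: "ec_add A (Some (X m, Y m)) (Some (X n, Y n)) = Some (X (m + n), Y (m + n))"
      using IH mn by simp
    have P6: "ec_add A (Some (X (m + n), Y (m + n))) (Some (X 1, Y 1)) =
        Some (X (m + Suc n), Y (m + Suc n))" using add_P'[of "m + n"] mn by simp
    have P5: "ec_add A (Some (X n, Y n)) (Some (X 1, Y 1)) = Some (X (Suc n), Y (Suc n))"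
      using add_P' mn by simp
    have ne5: "\<not> (X (Suc n) = X m \<and> Y (Suc n) = - Y m)"
    proof
      assume e: "X (Suc n) = X m \<and> Y (Suc n) = - Y m"
      have "ec_add A (Some (X (Suc n), - Y (Suc n))) (Some (X 1, Y 1)) = Some (X n, - Y n)"
        by (rule ec_add_cancel[OF c1 cn add_P Y1]) (use mn in auto)
      then have "X (Suc m) = X n" "Y (Suc m) = - Y n" using add_P'[of m] mn e by auto
      then have "ec_add A (Some (X (Suc m), Y (Suc m))) (Some (X n, Y n)) = None"
        by (simp add: ec_add_def)
      then show False using IH[of "Suc m"] mn by simp
    qed
    obtain a c d w where q: "a \<noteq> 0" "quad_interp A B a c d (X m) (X n) (X 1) w"
      "Y m = d + c * X m + a * (X m)^2" "Y n = d + c * X n + a * (X n)^2"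
      "Y 1 = d + c * X 1 + a * (X 1)^2"
    proof (cases "n = 1")
      \<comment> \<open>For n = 1 the points nP and P coincide, so the parabola is built with P as
        double point and mP as third point, and then rotated.\<close>
      case True
      have P2: "ec_add A (Some (X 1, Y 1)) (Some (X 1, Y 1)) = Some (X 2, Y 2)"
        using add_P[of 1] by (simp add: numeral_2_eq_2)
      have ne: "\<not> (X 1 = X 1 \<and> Y 1 = - Y 1)" using Y1 by simp
      have ne2: "\<not> (X 2 = X m \<and> Y 2 = - Y m)"
        using ne5 True by (simp add: numeral_2_eq_2)
      show ?thesis
      proof (rule quad_interp_exists[OF c1 c1 cm ne P2 ne2])
        fix a c d w
        assume q: "a \<noteq> 0" "quad_interp A B a c d (X 1) (X 1) (X m) w"
          "Y 1 = d + c * X 1 + a * (X 1)^2" "Y m = d + c * X m + a * (X m)^2"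
        show thesis
          by (rule that[of a c d w]) (use q True quad_interp_rotate[OF quad_interp_rotate[OF q(2)]] in auto)
      qed (use X_ne_X1[of m] mn in auto)
    next
      case False
      have ne: "\<not> (X m = X n \<and> Y m = - Y n)" using P4 by (auto simp: ec_add_def)
      have ne4: "\<not> (X (m + n) = X 1 \<and> Y (m + n) = - Y 1)" using opp_P[of "m + n"] mn by auto
      show ?thesis
        by (rule quad_interp_exists[OF cm cn c1 ne P4 ne4])
          (use X_ne_X1[of m] X_ne_X1[of n] False mn that in auto)
    qed
    have "ec_add A (Some (X (Suc n), Y (Suc n))) (Some (X m, Y m)) =
        Some (X (m + Suc n), Y (m + Suc n))"
      using ec_add_assoc_distinct[OF cm cn c1 P4 _ P5 ne5 q] P6 by simp
    then show ?thesis
      using ec_add_commute[of A B "Some (X m, Y m)" "Some (X (Suc n), Y (Suc n))"] curve[of m]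
        curve[of "Suc n"] mn by (simp add: on_curve_def)
  qed
qed

lemma Y_ne_0: assumes "n \<ge> 1" shows "Y n \<noteq> 0"
  using add_mult[OF assms assms] by (auto simp: ec_add_def)

lemma X_inj: assumes "m \<ge> 1" "n \<ge> 1" "m \<noteq> n" shows "X m \<noteq> X n"
proof -
  have *: "X m \<noteq> X n" if "m > n" "n \<ge> 1" for m n
  proof
    assume e: "X m = X n"
    have "(Y m)^2 = (Y n)^2" using curve[of m] curve[of n] that e by simp
    moreover have "Y m \<noteq> - Y n" using add_mult[of m n] that e by (auto simp: ec_add_def)
    ultimately have "Y m = Y n" by (rule same_x)
    moreover obtain k where k: "m = n + k" "k \<ge> 1"
      using \<open>m > n\<close> by (metis add_diff_inverse_nat less_imp_le_nat not_less zero_less_diff less_one)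
    ultimately show False
      using add_mult[of n k] ec_add_no_fix[OF curve[of n] curve[of k] Y_ne_0[of n]] that e by simp
  qed
  show ?thesis using *[of m n] *[of n m] assms by (cases m n rule: linorder_cases) auto
qed

text \<open>The lines from mP to nP and from -mP to nP have slopes l and k with computable l^2 + k^2
  and l k. Hence the abscissae of (m+n)P and (m-n)P are the roots of a quadratic that involves only
  \<open>X m\<close> and \<open>X n\<close>; with \<open>X_double\<close> this is all that the
  height theory uses.\<close>

lemma X_add_sub:
  assumes "n \<ge> 1" "m > n"
  shows "(X (m + n) + X (m - n)) * (X m - X n)^2 = 2 * ((X m * X n + A) * (X m + X n) + 2 * B)"
    and "X (m + n) * X (m - n) * (X m - X n)^2 = (X m * X n - A)^2 - 4 * B * (X m + X n)"
proof -
  have ne: "X m \<noteq> X n" using X_inj assms by auto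
  have cm: "(Y m)^2 = (X m)^3 + A * X m + B" and cn: "(Y n)^2 = (X n)^3 + A * X n + B"
    using curve assms by auto
  obtain l where l: "X (m + n) = l^2 - X m - X n" "Y n - Y m = l * (X n - X m)"
    using ec_line[OF cm cn add_mult] assms by auto
  have "ec_add A (Some (X n, Y n)) (Some (X (m - n), Y (m - n))) = Some (X m, Y m)"
    using add_mult[of n "m - n"] assms by simp
  then have s: "ec_add A (Some (X m, - Y m)) (Some (X n, Y n)) = Some (X (m - n), - Y (m - n))"
    by (intro ec_add_cancel[OF cn curve]) (use assms Y_ne_0 in auto)
  obtain k where k: "X (m - n) = k^2 - X m - X n" "Y n - (- Y m) = k * (X n - X m)"
    by (rule ec_line[OF _ cn s]) (use cm in auto)
  have lk: "Y m = l * (X m - X n) + Y n" "Y m = - k * (X m - X n) - Y n"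
    using l(2) k(2) by (simp_all add: algebra_simps)
  have l2: "l^2 * (X m - X n)^2 = (Y m - Y n)^2" and k2: "k^2 * (X m - X n)^2 = (Y m + Y n)^2"
    using l(2) k(2) by algebra+
  show "(X (m + n) + X (m - n)) * (X m - X n)^2 = 2 * ((X m * X n + A) * (X m + X n) + 2 * B)"
    using l(1) k(1) l2 k2 cm cn by algebra
  have "(l * k) * (X m - X n)^2 = (Y n)^2 - (Y m)^2"
    using l(2) k(2) by algebra
  then have "(l * k) * (X m - X n) * (X m - X n) =
      - ((X m)^2 + X m * X n + (X n)^2 + A) * (X m - X n)"
    using cm cn by algebra
  then have "(l * k) * (X m - X n) = - ((X m)^2 + X m * X n + (X n)^2 + A)"
    using ne by simp
  then show "X (m + n) * X (m - n) * (X m - X n)^2 = (X m * X n - A)^2 - 4 * B * (X m + X n)"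
    using l(1) k(1) l2 k2 cm cn by algebra
qed

lemma X_double:
  assumes "n \<ge> 1"
  shows "X (2 * n) * (4 * (Y n)^2) = ((X n)^2 - A)^2 - 8 * B * X n"
proof -
  have cn: "(Y n)^2 = (X n)^3 + A * X n + B" using curve assms by auto
  obtain l where l: "X (n + n) = l^2 - X n - X n" "l = ec_slope A (X n) (Y n) (X n) (Y n)"
    using ec_line[OF cn cn add_mult] assms by blast
  have "l * (2 * Y n) = 3 * (X n)^2 + A" using l(2) Y_ne_0[OF assms] by (simp add: ec_slope_def)
  then show ?thesis using l(1) cn unfolding mult_2 by algebra
qed

end

section \<open>Valuations of residue characteristic zero\<close>

text \<open>Real values, with integrality as an axiom, admit fractional thresholds such as
  \<open>2 * mu\<close>. \<open>v 0\<close> is unspecified; \<open>vge\<close>, \<open>vgt\<close>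
  and \<open>veq\<close> encode that 0 has infinite valuation.\<close>

locale valuation =
  fixes v :: "'a::field_char_0 \<Rightarrow> real"
  assumes v_mult: "x \<noteq> 0 \<Longrightarrow> y \<noteq> 0 \<Longrightarrow> v (x * y) = v x + v y"
    and v_add: "x \<noteq> 0 \<Longrightarrow> y \<noteq> 0 \<Longrightarrow> x + y \<noteq> 0 \<Longrightarrow> min (v x) (v y) \<le> v (x + y)"
    and v_of_nat: "n \<noteq> 0 \<Longrightarrow> v (of_nat n) = 0"
    and v_int: "x \<noteq> 0 \<Longrightarrow> v x \<in> \<int>"
begin

definition vge :: "real \<Rightarrow> 'a \<Rightarrow> bool" where "vge k x \<longleftrightarrow> x = 0 \<or> k \<le> v x"
definition vgt :: "real \<Rightarrow> 'a \<Rightarrow> bool" where "vgt k x \<longleftrightarrow> x = 0 \<or> k < v x"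
definition veq :: "real \<Rightarrow> 'a \<Rightarrow> bool" where "veq k x \<longleftrightarrow> x \<noteq> 0 \<and> v x = k"

lemma v_one [simp]: "v 1 = 0" using v_of_nat[of 1] by simp
lemma v_numeral [simp]: "v (numeral n) = 0" using v_of_nat[of "numeral n"] by simp
lemma v_minus1: "v (- 1) = 0" using v_mult[of "-1" "-1"] by simp
lemma v_minus [simp]: "v (- x) = v x"
  using v_mult[of "-1" x] v_minus1 by (cases "x = 0") auto
lemma v_inverse: "x \<noteq> 0 \<Longrightarrow> v (inverse x) = - v x" using v_mult[of x "inverse x"] by simp
lemma v_divide: "x \<noteq> 0 \<Longrightarrow> y \<noteq> 0 \<Longrightarrow> v (x / y) = v x - v y"
  by (simp add: divide_inverse v_mult v_inverse)
lemma v_power: "x \<noteq> 0 \<Longrightarrow> v (x ^ n) = n * v x"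
  by (induction n) (auto simp: v_mult algebra_simps)

lemma vge_0 [simp]: "vge k 0" by (simp add: vge_def)
lemma vgt_0 [simp]: "vgt k 0" by (simp add: vgt_def)
lemma vge_numeral [simp]: "vge 0 (numeral n)" "vge 0 1" by (auto simp: vge_def)
lemma vge_of_nat [simp]: "vge 0 (of_nat n)" using v_of_nat[of n] by (cases n) (auto simp: vge_def)
lemma vge_uminus [simp]: "vge k (- x) \<longleftrightarrow> vge k x" by (simp add: vge_def)
lemma vgt_uminus [simp]: "vgt k (- x) \<longleftrightarrow> vgt k x" by (simp add: vgt_def)
lemma veq_uminus [simp]: "veq k (- x) \<longleftrightarrow> veq k x" by (simp add: veq_def)

lemma vge_add: "vge k x \<Longrightarrow> vge k y \<Longrightarrow> vge k (x + y)"
  unfolding vge_def using v_add[of x y] by (cases "x + y = 0"; cases "x = 0"; cases "y = 0") auto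
lemma vgt_add: "vgt k x \<Longrightarrow> vgt k y \<Longrightarrow> vgt k (x + y)"
  unfolding vgt_def using v_add[of x y] by (cases "x + y = 0"; cases "x = 0"; cases "y = 0") auto
lemma vge_diff: "vge k x \<Longrightarrow> vge k y \<Longrightarrow> vge k (x - y)" using vge_add[of k x "- y"] by simp
lemma vgt_diff: "vgt k x \<Longrightarrow> vgt k y \<Longrightarrow> vgt k (x - y)" using vgt_add[of k x "- y"] by simp
lemma vge_mult: "vge k x \<Longrightarrow> vge l y \<Longrightarrow> vge (k + l) (x * y)"
  unfolding vge_def using v_mult[of x y] by (cases "x = 0"; cases "y = 0") auto
lemma vgt_vge_mult: "vgt k x \<Longrightarrow> vge l y \<Longrightarrow> vgt (k + l) (x * y)"
  unfolding vge_def vgt_def using v_mult[of x y] by (cases "x = 0"; cases "y = 0") auto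
lemma veq_mult: "veq k x \<Longrightarrow> veq l y \<Longrightarrow> veq (k + l) (x * y)"
  unfolding veq_def using v_mult[of x y] by auto
lemma veq_divide: "veq k x \<Longrightarrow> veq l y \<Longrightarrow> veq (k - l) (x / y)"
  unfolding veq_def using v_divide[of x y] by auto
lemma vge_divide: "vge k x \<Longrightarrow> veq l y \<Longrightarrow> vge (k - l) (x / y)"
  unfolding veq_def vge_def using v_divide[of x y] by (cases "x = 0") auto
lemma vgt_divide: "vgt k x \<Longrightarrow> veq l y \<Longrightarrow> vgt (k - l) (x / y)"
  unfolding veq_def vgt_def using v_divide[of x y] by (cases "x = 0") auto
lemma vge_power: "vge k x \<Longrightarrow> vge (n * k) (x ^ n)"
proof (induction n)
  case (Suc n)
  then show ?case using vge_mult[of k x "n * k" "x ^ n"] by (simp add: algebra_simps)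
qed simp
lemma veq_power: "veq k x \<Longrightarrow> veq (n * k) (x ^ n)"
  unfolding veq_def using v_power by auto
lemma veq_numeral [simp]: "veq 0 (numeral n)" "veq 0 1" by (auto simp: veq_def)
lemma veq_add: "veq k x \<Longrightarrow> vgt k y \<Longrightarrow> veq k (x + y)"
proof -
  assume x: "veq k x" and y: "vgt k y"
  have n0: "x + y \<noteq> 0"
  proof
    assume "x + y = 0"
    then have "x = - y" by (simp add: eq_neg_iff_add_eq_0)
    then show False using x y by (auto simp: veq_def vgt_def)
  qed
  have "vge k (x + y)" using x y by (intro vge_add) (auto simp: veq_def vgt_def vge_def)
  moreover have "\<not> vgt k (x + y)"
  proof
    assume "vgt k (x + y)"
    from vgt_diff[OF this y] show False using x by (simp add: vgt_def veq_def)
  qed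
  ultimately show ?thesis using n0 by (auto simp: veq_def vge_def vgt_def)
qed
lemma veq_add': "vgt k x \<Longrightarrow> veq k y \<Longrightarrow> veq k (x + y)" using veq_add[of k y x] by (simp add: add.commute)
lemma veq_diff: "veq k x \<Longrightarrow> vgt k y \<Longrightarrow> veq k (x - y)" using veq_add[of k x "- y"] by simp
lemma veq_diff': "vgt k x \<Longrightarrow> veq k y \<Longrightarrow> veq k (x - y)" using veq_add'[of k x "- y"] by simp

lemma vge_mono: "vge k x \<Longrightarrow> l \<le> k \<Longrightarrow> vge l x" by (auto simp: vge_def)
lemma vgt_mono: "vgt k x \<Longrightarrow> l \<le> k \<Longrightarrow> vgt l x" by (auto simp: vgt_def)
lemma vge_vgt: "vge k x \<Longrightarrow> l < k \<Longrightarrow> vgt l x" by (auto simp: vge_def vgt_def)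
lemma vgt_vge: "vgt k x \<Longrightarrow> vge k x" by (auto simp: vge_def vgt_def)
lemma veq_vge: "veq k x \<Longrightarrow> vge k x" by (auto simp: vge_def veq_def)
lemma veq_nz: "veq k x \<Longrightarrow> x \<noteq> 0" by (simp add: veq_def)
lemma veq_v: "x \<noteq> 0 \<Longrightarrow> veq (v x) x" by (simp add: veq_def)
lemma veqD: "veq k x \<Longrightarrow> v x = k" by (simp add: veq_def)
lemma vge_or_vgt: "vge k x \<Longrightarrow> veq k x \<or> vgt k x" by (auto simp: vge_def vgt_def veq_def)
lemma vge_cmult [simp]: "vge k (numeral n * x) \<longleftrightarrow> vge k x"
  using v_mult[of "numeral n" x] by (cases "x = 0") (auto simp: vge_def)
lemma vgt_cmult [simp]: "vgt k (numeral n * x) \<longleftrightarrow> vgt k x"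
  using v_mult[of "numeral n" x] by (cases "x = 0") (auto simp: vgt_def)
lemma veq_cmult [simp]: "veq k (numeral n * x) \<longleftrightarrow> veq k x"
  using v_mult[of "numeral n" x] by (cases "x = 0") (auto simp: veq_def)

lemmas vge0_ring = vge_add[of 0] vge_diff[of 0] vge_mult[of 0 _ 0, simplified]
  vge_power[of 0, simplified]

subsection \<open>Newton polygon of a quadratic polynomial\<close>

text \<open>Newton polygon with two different slopes: the root of smaller valuation carries the sum,
  the other one takes the rest of the product.\<close>

lemma roots_distinct:
  assumes s: "veq S (a + b)" and p: "vge T (a * b)" and T: "T > 2 * S"
  shows "veq S a \<and> vge (T - S) b \<or> veq S b \<and> vge (T - S) a"
proof -
  have *: "veq S a \<and> vge (T - S) b" if s: "veq S (a + b)" and p: "vge T (a * b)"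
    and ab: "a \<noteq> 0" "vge (v a) b" for a b
  proof (cases "vgt (v a) b")
    case True
    then have "veq (v a) (a + b)" using veq_add[OF veq_v] ab by auto
    then have S: "S = v a" using s by (simp add: veq_def)
    then show ?thesis using p ab v_mult[of a b] by (cases "b = 0") (auto simp: veq_def vge_def)
  next
    case False
    then have b: "b \<noteq> 0" "v b = v a" using ab by (auto simp: vge_def vgt_def)
    have "vge (v a) (a + b)" using ab by (intro vge_add) (auto simp: vge_def)
    then have "S \<ge> v a" using s by (auto simp: veq_def vge_def)
    moreover have "2 * v a \<ge> T" using p b ab v_mult[of a b] by (auto simp: vge_def)
    ultimately show ?thesis using T by linarith
  qed
  show ?thesis
  proof (cases "a \<noteq> 0 \<and> vge (v a) b")
    case True then show ?thesis using *[of a b] s p by blast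
  next
    case False
    then have "b \<noteq> 0 \<and> vge (v b) a" using s by (auto simp: vge_def veq_def)
    then show ?thesis using *[of b a] s p by (simp add: add.commute mult.commute)
  qed
qed

lemma roots_ge:
  assumes s: "vge S (a + b)" and p: "vge (2 * S) (a * b)"
  shows "vge S a \<and> vge S b"
proof -
  have *: "vge S a \<and> vge S b" if s: "vge S (a + b)" and p: "vge (2 * S) (a * b)"
    and ab: "a \<noteq> 0" "vge (v a) b" for a b
  proof (rule ccontr)
    assume "\<not> ?thesis"
    then have a: "v a < S" using ab by (auto simp: vge_def)
    show False
    proof (cases "vgt (v a) b")
      case True
      then have "veq (v a) (a + b)" using veq_add[OF veq_v] ab by auto
      then show False using s a by (auto simp: veq_def vge_def)
    next
      case False
      then have b: "b \<noteq> 0" "v b = v a" using ab by (auto simp: vge_def vgt_def)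
      then show False using p a ab v_mult[of a b] by (auto simp: vge_def)
    qed
  qed
  show ?thesis
  proof (cases "a = 0")
    case True then show ?thesis using s by simp
  next
    case a: False
    show ?thesis
    proof (cases "vge (v a) b")
      case True then show ?thesis using *[of a b] s p a by blast
    next
      case False
      then have "b \<noteq> 0 \<and> vge (v b) a" using a by (auto simp: vge_def)
      then show ?thesis using *[of b a] s p by (auto simp: add.commute mult.commute)
    qed
  qed
qed

lemma roots_eq:
  assumes s: "vge S (a + b)" and p: "veq (2 * S) (a * b)"
  shows "veq S a \<and> veq S b"
proof -
  have "vge S a" "vge S b" using roots_ge[OF s veq_vge[OF p]] by auto
  moreover have "a \<noteq> 0" "b \<noteq> 0" using p by (auto simp: veq_def)
  ultimately show ?thesis using p v_mult[of a b] by (auto simp: veq_def vge_def)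
qed

text \<open>The reciprocals have integral sum and product, so \<open>roots_ge\<close> applies to
  them.\<close>

lemma roots_nonpos:
  assumes s: "vge T (a + b)" and p: "veq T (a * b)" and T: "T \<le> 0"
  shows "a \<noteq> 0 \<and> b \<noteq> 0 \<and> v a \<le> 0 \<and> v b \<le> 0 \<and> v a + v b = T"
proof -
  have ab: "a \<noteq> 0" "b \<noteq> 0" using p by (auto simp: veq_def)
  have e: "inverse a + inverse b = (a + b) / (a * b)" using ab by (simp add: field_simps)
  have "vge 0 (inverse a + inverse b)" unfolding e using vge_divide[OF s p] by simp
  moreover have "vge (2 * 0) (inverse a * inverse b)"
    using p ab T v_mult[of a b] by (auto simp: vge_def veq_def v_mult v_inverse)
  ultimately have "vge 0 (inverse a) \<and> vge 0 (inverse b)" by (rule roots_ge)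
  then show ?thesis using ab p by (auto simp: vge_def veq_def v_inverse v_mult)
qed

text \<open>The valuation capped at c, or the content of \<open>T - x\<close> when T is given
  valuation c; this is the quantity that Gauss' lemma below adds up.\<close>

definition vmin :: "real \<Rightarrow> 'a \<Rightarrow> real" where "vmin c x = (if x = 0 then c else min (v x) c)"

lemma vmin_le: "vmin c x \<le> c" by (simp add: vmin_def)
lemma vge_vmin: "vge (vmin c x) x" by (simp add: vmin_def vge_def)
lemma vmin_veq: "vmin c x < c \<Longrightarrow> veq (vmin c x) x" by (auto simp: vmin_def veq_def min_def split: if_splits)
lemma vmin_eqI: "veq k x \<Longrightarrow> k \<le> c \<Longrightarrow> vmin c x = k" by (auto simp: vmin_def veq_def)
lemma vmin_topI: "vge c x \<Longrightarrow> vmin c x = c" by (auto simp: vmin_def vge_def)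

text \<open>Gauss' lemma for the content of \<open>(T - a)(T - b)\<close> at the radius given by \<open>c\<close>.\<close>
lemma vmin_roots:
  assumes s: "vge (T - c) (a + b)" and p: "vge T (a * b)" and T: "T \<le> 2 * c"
    and eq: "T = 2 * c \<or> veq (T - c) (a + b) \<or> veq T (a * b)"
  shows "vmin c a + vmin c b = T"
proof -
  have *: "vmin c a + vmin c b = T" if s: "vge (T - c) (a + b)" and p: "vge T (a * b)"
     and eq: "T = 2 * c \<or> veq (T - c) (a + b) \<or> veq T (a * b)"
     and ab: "vge (vmin c a) b" for a b
  proof (cases "vmin c a = c")
    case True
    then have "vge c a" "vge c b" using vge_vmin[of c a] ab by auto
    then have "vge c (a + b)" "vge (2 * c) (a * b)" using vge_add vge_mult[of c a c b] by auto
    moreover have "vmin c b = c" using \<open>vge c b\<close> vmin_topI by blast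
    ultimately show ?thesis using True eq T by (auto simp: veq_def vge_def)
  next
    case False
    then have a: "veq (vmin c a) a" "vmin c a < c" using vmin_le[of c a] vmin_veq[of c a] by auto
    show ?thesis
    proof (cases "vmin c b = c")
      case True
      then have b: "vge c b" using vge_vmin[of c b] by simp
      then have s2: "veq (vmin c a) (a + b)" using veq_add[OF a(1)] vge_vgt a(2) by auto
      have p2: "vge (vmin c a + c) (a * b)" using vge_mult[OF veq_vge[OF a(1)] b] .
      show ?thesis using s s2 p2 eq a(2) True by (auto simp: veq_def vge_def)
    next
      case False
      then have b: "veq (vmin c b) b" "vmin c b < c" using vmin_le[of c b] vmin_veq[of c b] by auto
      have p2: "veq (vmin c a + vmin c b) (a * b)" using veq_mult[OF a(1) b(1)] .
      have s2: "vge (vmin c a) (a + b)" using vge_add[OF veq_vge[OF a(1)] ab] .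
      show ?thesis using p p2 s2 eq a(2) b(2) by (auto simp: veq_def vge_def)
    qed
  qed
  show ?thesis
  proof (cases "vge (vmin c a) b")
    case True then show ?thesis using *[of a b] s p eq by blast
  next
    case False
    then have "vge (vmin c b) a" unfolding vge_def vmin_def by (auto split: if_splits)
    then show ?thesis using *[of b a] s p eq by (simp add: add.commute mult.commute)
  qed
qed

end

section \<open>The local height correction\<close>

context valuation
begin

lemma v_cmult [simp]: "v (numeral n * x) = v x"
  using v_mult[of "numeral n" x] by (cases "x = 0") auto

text \<open>Denominator and numerator of the duplication formula are coprime: the cofactors
  \<open>12 x^2 + 16 A\<close> and \<open>3 x^3 - 5 A x - 27 B\<close> combine them to a multiple of
  the discriminant, homogeneously in the weight c.\<close>

lemma vgt_F1_F2_False: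
  assumes A: "vge (2 * c) A" and B: "vge (3 * c) B" and D: "veq (6 * c) (4 * A^3 + 27 * B^2)"
    and x: "vge c x" and f: "vgt (3 * c) (x^3 + A * x + B)"
    and g: "vgt (4 * c) ((x^2 - A)^2 - 8 * B * x)"
  shows False
proof -
  have x2: "vge (2 * c) (x^2)" using vge_power[OF x, of 2] by simp
  have x3: "vge (3 * c) (x^3)" using vge_power[OF x, of 3] by simp
  have Ax: "vge (3 * c) (A * x)" using vge_mult[OF A x] by simp
  have "vgt (4 * c + 2 * c) (((x^2 - A)^2 - 8 * B * x) * (12 * x^2 + 16 * A))"
    by (rule vgt_vge_mult[OF g]) (use x2 A in \<open>auto intro!: vge_add\<close>)
  moreover have "vgt (3 * c + 3 * c) ((x^3 + A * x + B) * (3 * x^3 - 5 * (A * x) - 27 * B))"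
    by (rule vgt_vge_mult[OF f]) (use x3 Ax B in \<open>auto intro!: vge_diff\<close>)
  ultimately have "vgt (6 * c) (((x^2 - A)^2 - 8 * B * x) * (12 * x^2 + 16 * A)
      - 4 * ((x^3 + A * x + B) * (3 * x^3 - 5 * (A * x) - 27 * B)))"
    by (intro vgt_diff) auto
  also have "((x^2 - A)^2 - 8 * B * x) * (12 * x^2 + 16 * A)
      - 4 * ((x^3 + A * x + B) * (3 * x^3 - 5 * (A * x) - 27 * B)) = 4 * (4 * A^3 + 27 * B^2)"
    by algebra
  finally show False using D by (simp add: vgt_def veq_def del: distrib_left_numeral)
qed

text \<open>Parallelogram law for potentially good reduction, with c = \<open>2 * mu\<close>. By
  Gauss' lemma one coefficient of the quadratic with roots a, b has to reach the least valuation
  permitted. This could fail only for points with equal reduction, where the coefficients become the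
  duplication polynomials, which do not vanish together.\<close>

lemma good_pair:
  assumes A: "vge (2 * c) A" and B: "vge (3 * c) B" and D: "veq (6 * c) (4 * A^3 + 27 * B^2)"
    and ne: "x1 \<noteq> x2"
    and s: "(a + b) * (x1 - x2)^2 = 2 * ((x1 * x2 + A) * (x1 + x2) + 2 * B)"
    and p: "a * b * (x1 - x2)^2 = (x1 * x2 - A)^2 - 4 * B * (x1 + x2)"
  shows "vmin c a + vmin c b = 2 * vmin c x1 + 2 * vmin c x2 - 2 * v (x1 - x2)"
proof -
  define m1 m2 d where "m1 = vmin c x1" and "m2 = vmin c x2" and "d = v (x1 - x2)"
  have m: "m1 \<le> c" "m2 \<le> c" using vmin_le m1_def m2_def by auto
  have x1: "vge m1 x1" and x2: "vge m2 x2" using vge_vmin m1_def m2_def by auto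
  have dd: "veq d (x1 - x2)" using ne by (simp add: d_def veq_def)
  have F0: "veq (2 * d) ((x1 - x2)^2)" using veq_power[OF dd, of 2] by simp
  have "vge (min m1 m2) (x1 - x2)" using x1 x2 by (intro vge_diff) (auto elim: vge_mono)
  then have dm: "min m1 m2 \<le> d" using dd by (auto simp: vge_def veq_def)
  define T where "T = 2 * m1 + 2 * m2 - 2 * d"
  have T: "T \<le> 2 * c" using dm m unfolding T_def by linarith
  have x12: "vge (m1 + m2) (x1 * x2)" using vge_mult[OF x1 x2] .
  have Ax1: "vge (2 * c + m1) (A * x1)" and Ax2: "vge (2 * c + m2) (A * x2)"
    using vge_mult[OF A] x1 x2 by auto
  define F1 where "F1 = 2 * ((x1 * x2 + A) * (x1 + x2) + 2 * B)"
  define F2 where "F2 = (x1 * x2 - A)^2 - 4 * B * (x1 + x2)"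
  have F1e: "F1 = 2 * (x1 * x2 * x1 + x1 * x2 * x2 + A * x1 + A * x2 + 2 * B)"
    unfolding F1_def by algebra
  have F2e: "F2 = (x1 * x2)^2 + (A * A - 2 * (A * (x1 * x2)) - 4 * (B * x1) - 4 * (B * x2))"
    unfolding F2_def by algebra
  have g1: "vge (2 * m1 + 2 * m2 - c) F1"
    unfolding F1e
    using vge_mono[OF vge_mult[OF x12 x1]] vge_mono[OF vge_mult[OF x12 x2]] vge_mono[OF Ax1]
      vge_mono[OF Ax2] vge_mono[OF B] m by (auto intro!: vge_add)
  have r2: "vge k (A * A - 2 * (A * (x1 * x2)) - 4 * (B * x1) - 4 * (B * x2))"
    if "k \<le> 4 * c" "k \<le> 2 * c + m1 + m2" "k \<le> 3 * c + m1" "k \<le> 3 * c + m2" for k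
    using vge_mono[OF vge_mult[OF A A]] vge_mono[OF vge_mult[OF A x12]]
      vge_mono[OF vge_mult[OF B x1]] vge_mono[OF vge_mult[OF B x2]] that
    by (auto intro!: vge_diff)
  have x12s: "vge (2 * m1 + 2 * m2) ((x1 * x2)^2)" using vge_power[OF x12, of 2] by (simp add: algebra_simps)
  have g2: "vge (2 * m1 + 2 * m2) F2"
    unfolding F2e using m by (intro vge_add x12s r2) auto
  have ne0: "(x1 - x2)^2 \<noteq> 0" using ne by simp
  have s': "a + b = F1 / (x1 - x2)^2" using s ne0 unfolding F1_def by (simp add: field_simps)
  have p': "a * b = F2 / (x1 - x2)^2" using p ne0 unfolding F2_def by (simp add: field_simps)
  have gs: "vge (T - c) (a + b)" unfolding s' T_def using vge_divide[OF g1 F0] by (simp add: algebra_simps)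
  have gp: "vge T (a * b)" unfolding p' T_def using vge_divide[OF g2 F0] by (simp add: algebra_simps)
  have "T = 2 * c \<or> veq (T - c) (a + b) \<or> veq T (a * b)"
  proof (cases "m1 = c \<and> m2 = c")
    case True
    show ?thesis
    proof (cases "d = c")
      case True then show ?thesis using \<open>m1 = c \<and> m2 = c\<close> by (simp add: T_def)
    next
      case False
      then have dc: "d > c" using dm True by auto
      have x2c: "vge c x2" and x1c: "vge c x1" using x1 x2 True by auto
      have D1: "vgt c (x1 - x2)" using dd dc by (simp add: vgt_def veq_def)
      have x22: "vge (2 * c) (x2^2)" using vge_power[OF x2c, of 2] by simp
      have x12c: "vge (2 * c) (x1 * x2)" using x12 True by simp
      \<comment> \<open>Modulo \<open>x1 - x2\<close> the two forms turn into the denominator and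
        the numerator of the duplication formula.\<close>
      have e1: "F1 = 4 * (x2^3 + A * x2 + B) + (x1 - x2) * (4 * x2^2 + 2 * (x1 * x2) + 2 * A)"
        unfolding F1_def by algebra
      have e2: "F2 = ((x2^2 - A)^2 - 8 * B * x2) + (x1 - x2) * (x2 * (x1 * x2 + x2^2 - 2 * A) - 4 * B)"
        unfolding F2_def by algebra
      have t1: "vgt (3 * c) ((x1 - x2) * (4 * x2^2 + 2 * (x1 * x2) + 2 * A))"
      proof -
        have "vge (2 * c) (4 * x2^2 + 2 * (x1 * x2) + 2 * A)"
          using x22 x12c A by (auto intro!: vge_add)
        from vgt_vge_mult[OF D1 this] show ?thesis by simp
      qed
      have "vge (3 * c) (x2 * (x1 * x2 + x2^2 - 2 * A))"
      proof -
        have "vge (2 * c) (x1 * x2 + x2^2 - 2 * A)"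
          using x22 x12c A by (auto intro!: vge_add vge_diff)
        from vge_mult[OF x2c this] show ?thesis by simp
      qed
      then have t2: "vgt (4 * c) ((x1 - x2) * (x2 * (x1 * x2 + x2^2 - 2 * A) - 4 * B))"
      proof -
        assume "vge (3 * c) (x2 * (x1 * x2 + x2^2 - 2 * A))"
        then have "vge (3 * c) (x2 * (x1 * x2 + x2^2 - 2 * A) - 4 * B)"
          using B by (auto intro!: vge_diff)
        from vgt_vge_mult[OF D1 this] show ?thesis by simp
      qed
      have "\<not> (vgt (3 * c) F1 \<and> vgt (4 * c) F2)"
      proof
        assume h: "vgt (3 * c) F1 \<and> vgt (4 * c) F2"
        have "vgt (3 * c) (4 * (x2^3 + A * x2 + B))"
          using vgt_diff[OF conjunct1[OF h] t1] e1 by simp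
        moreover have "vgt (4 * c) ((x2^2 - A)^2 - 8 * B * x2)"
          using vgt_diff[OF conjunct2[OF h] t2] e2 by simp
        ultimately show False using vgt_F1_F2_False[OF A B D x2c] unfolding vgt_cmult by blast
      qed
      moreover have "vge (3 * c) F1" "vge (4 * c) F2" using g1 g2 True by auto
      ultimately have "veq (3 * c) F1 \<or> veq (4 * c) F2" using vge_or_vgt by blast
      then show ?thesis
        using veq_divide[of "3 * c" F1, OF _ F0] veq_divide[of "4 * c" F2, OF _ F0] True
        unfolding s' p' T_def by (auto simp: algebra_simps)
    qed
  next
    case False
    show ?thesis
    proof (cases "m1 < c \<and> m2 < c")
      case True
      then have e1: "veq m1 x1" and e2: "veq m2 x2" using vmin_veq m1_def m2_def by auto
      have "veq (2 * m1 + 2 * m2) ((x1 * x2)^2)"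
        using veq_power[OF veq_mult[OF e1 e2], of 2] by (simp add: algebra_simps)
      moreover have "vgt (2 * m1 + 2 * m2) (A * A - 2 * (A * (x1 * x2)) - 4 * (B * x1) - 4 * (B * x2))"
        by (rule vge_vgt[OF r2[of "min (min (4 * c) (2 * c + m1 + m2)) (min (3 * c + m1) (3 * c + m2))"]])
          (use True in auto)
      ultimately have "veq (2 * m1 + 2 * m2) F2" unfolding F2e by (rule veq_add)
      then have "veq T (a * b)" using veq_divide[OF _ F0] unfolding p' T_def by blast
      then show ?thesis by simp
    next
      case nb: False
      have "d = min m1 m2"
      proof (cases "m1 < c")
        case True
        then have "m2 = c" using nb m by auto
        moreover have "veq m1 x1" using vmin_veq True m1_def by auto
        ultimately have "veq m1 (x1 - x2)" using veq_diff[OF _ vge_vgt[OF x2]] True by auto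
        then show ?thesis using dd True \<open>m2 = c\<close> by (auto simp: veq_def)
      next
        case False2: False
        then have "m1 = c" "m2 < c" using m False by auto
        then have "veq m2 x2" using vmin_veq m2_def by auto
        then have "veq m2 (x1 - x2)" using veq_diff'[OF vge_vgt[OF x1]] \<open>m1 = c\<close> \<open>m2 < c\<close> by auto
        then show ?thesis using dd \<open>m1 = c\<close> \<open>m2 < c\<close> by (auto simp: veq_def)
      qed
      then have "T = 2 * c" using m nb False unfolding T_def by auto
      then show ?thesis by simp
    qed
  qed
  then have "vmin c a + vmin c b = T" by (rule vmin_roots[OF gs gp T])
  then show ?thesis unfolding T_def m1_def m2_def d_def by simp
qed

text \<open>If f has excess valuation, then \<open>vgt_F1_F2_False\<close> pins down the numerator
  exactly; otherwise the cap at c makes a lower bound enough.\<close>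

lemma good_double:
  assumes A: "vge (2 * c) A" and B: "vge (3 * c) B" and D: "veq (6 * c) (4 * A^3 + 27 * B^2)"
    and f: "f = x^3 + A * x + B" and f0: "f \<noteq> 0"
    and a: "a * (4 * f) = (x^2 - A)^2 - 8 * B * x"
  shows "vmin c a = 4 * vmin c x - v f"
proof -
  define m where "m = vmin c x"
  have m: "m \<le> c" and x: "vge m x" using vmin_le vge_vmin m_def by auto
  define G where "G = (x^2 - A)^2 - 8 * B * x"
  have x2: "vge (2 * m) (x^2)" and x3: "vge (3 * m) (x^3)" and x4: "vge (4 * m) (x^4)"
    using vge_power[OF x, of 2] vge_power[OF x, of 3] vge_power[OF x, of 4] by auto
  have Ax: "vge (2 * c + m) (A * x)" using vge_mult[OF A x] .
  have Bx: "vge (3 * c + m) (B * x)" using vge_mult[OF B x] .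
  have A2: "vge (4 * c) (A * A)" using vge_mult[OF A A] by simp
  have Ax2: "vge (2 * c + 2 * m) (A * x^2)" using vge_mult[OF A x2] .
  have Ge: "G = x^4 + (A * A - 2 * (A * x^2) - 8 * (B * x))" unfolding G_def by algebra
  have ae: "a = G / (4 * f)" using a f0 unfolding G_def by (simp add: field_simps)
  have f4: "veq (v f) (4 * f)" using f0 by (simp add: veq_def)
  show ?thesis
  proof (cases "m < c")
    case True
    have xe: "veq m x" using vmin_veq True m_def by auto
    have "vgt (4 * m) (A * A - 2 * (A * x^2) - 8 * (B * x))"
      using vge_vgt[OF A2, of "4 * m"] vge_vgt[OF Ax2, of "4 * m"] vge_vgt[OF Bx, of "4 * m"] True
      by (auto intro!: vgt_diff)
    then have G: "veq (4 * m) G" unfolding Ge using veq_add[OF _] veq_power[OF xe, of 4] by simp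
    have "veq (3 * m) (x^3 + (A * x + B))"
      using veq_power[OF xe, of 3] vge_vgt[OF Ax, of "3 * m"] vge_vgt[OF B, of "3 * m"] True
      by (intro veq_add vgt_add) auto
    then have fe: "v f = 3 * m" unfolding f by (simp add: veq_def add.assoc)
    have "veq m a" unfolding ae using veq_divide[OF G f4] fe by simp
    then show ?thesis using vmin_eqI[of m a c] True fe m_def by simp
  next
    case False
    then have mc: "m = c" using m by simp
    have xc: "vge c x" using x mc by simp
    have G: "vge (4 * c) G" unfolding Ge using x4 A2 Ax2 Bx mc
      by (auto intro!: vge_add vge_diff)
    have fg: "vge (3 * c) f" unfolding f using x3 Ax B mc by (auto intro!: vge_add)
    show ?thesis
    proof (cases "v f = 3 * c")
      case True
      then have "vge c a" unfolding ae using vge_divide[OF G f4] by simp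
      then show ?thesis using vmin_topI True mc m_def by simp
    next
      case False
      then have "vgt (3 * c) f" using fg f0 by (auto simp: vge_def vgt_def)
      then have "\<not> vgt (4 * c) G" using vgt_F1_F2_False[OF A B D xc] unfolding f G_def by blast
      then have "veq (4 * c) G" using G vge_or_vgt by blast
      then have "veq (4 * c - v f) a" unfolding ae using veq_divide f4 by blast
      moreover have "4 * c - v f \<le> c" using fg f0 by (auto simp: vge_def)
      ultimately show ?thesis using vmin_eqI mc m_def by simp
    qed
  qed
qed

text \<open>For the node-centred equation \<open>y^2 = x^3 + 3 x^2 + a4 x + a6\<close> with
  \<open>v a4 >= N\<close> and \<open>v a6 = N\<close> the fibre is an N-gon. \<open>kap\<close> is
  the index of the component hit, counted from the identity component in the nearer direction, and
  \<open>nu\<close> is the pole order of x.\<close>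

definition kap :: "real \<Rightarrow> 'a \<Rightarrow> real" where "kap N x = max 0 (vmin (N / 2) x)"
definition nu :: "real \<Rightarrow> 'a \<Rightarrow> real" where "nu N x = max 0 (- vmin (N / 2) x)"

lemma kap_nonneg: "0 \<le> kap N x" by (simp add: kap_def)
lemma nu_nonneg: "0 \<le> nu N x" by (simp add: nu_def)
lemma kap_le: "0 \<le> N \<Longrightarrow> kap N x \<le> N / 2" using vmin_le[of "N / 2" x] by (simp add: kap_def)

lemma kap_nu_zero:
  assumes "N > 0" "kap N x = 0"
  shows "veq (- nu N x) x"
  using assms unfolding kap_def nu_def vmin_def by (auto simp: veq_def split: if_splits)

lemma kap_eqI:
  assumes "veq k x" "k > 0" "k \<le> N / 2" shows "kap N x = k" "nu N x = 0"
  using vmin_eqI[OF assms(1,3)] assms by (auto simp: kap_def nu_def)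

lemma kap_topI:
  assumes "vge (N / 2) x" "N > 0" shows "kap N x = N / 2" "nu N x = 0"
  using vmin_topI[OF assms(1)] assms by (auto simp: kap_def nu_def)

lemma kap_zeroI:
  assumes "veq k x" "k \<le> 0" "N > 0" shows "kap N x = 0" "nu N x = - k"
  using vmin_eqI[OF assms(1), of "N / 2"] assms by (auto simp: kap_def nu_def)

lemma kap_mid:
  assumes "0 < kap N x" "kap N x < N / 2" shows "veq (kap N x) x" "nu N x = 0"
  using assms vmin_veq[of "N / 2" x] unfolding kap_def nu_def by (auto simp: max_def split: if_splits)

lemma kap_topD:
  assumes "N > 0" "kap N x = N / 2" shows "vge (N / 2) x" "nu N x = 0"
proof -
  have e: "vmin (N / 2) x = N / 2" using assms unfolding kap_def by (auto simp: max_def split: if_splits)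
  show "vge (N / 2) x" using vge_vmin[of "N / 2" x] unfolding e .
  show "nu N x = 0" using e assms(1) by (simp add: nu_def)
qed

text \<open>Component indices add modulo N and are known only up to sign, so one of P + Q, P - Q has
  the folded sum and the other the difference; which is which stays open. The Newton polygon of the
  quadratic with roots a, b shows this in each configuration.\<close>

lemma node_pair_aux:
  assumes N: "N > 0" and a4: "vge N a4" and a6: "veq N a6" and ne: "x1 \<noteq> x2"
    and s: "(a + b) * (x1 - x2)^2 = 2 * ((x1 * x2 + a4) * (x1 + x2) + 6 * (x1 * x2) + 2 * a6)"
    and p: "a * b * (x1 - x2)^2 = (x1 * x2 - a4)^2 - 4 * a6 * (x1 + x2 + 3)"
    and le: "kap N x1 \<le> kap N x2"
  shows "nu N a + nu N b = 2 * nu N x1 + 2 * nu N x2 + 2 * v (x1 - x2) - 2 * kap N x1 \<and>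
    (kap N a = min (kap N x1 + kap N x2) (N - kap N x1 - kap N x2) \<and> kap N b = kap N x2 - kap N x1 \<or>
     kap N b = min (kap N x1 + kap N x2) (N - kap N x1 - kap N x2) \<and> kap N a = kap N x2 - kap N x1)"
proof -
  define d where "d = v (x1 - x2)"
  have dd: "veq d (x1 - x2)" using ne by (simp add: d_def veq_def)
  have F0: "veq (2 * d) ((x1 - x2)^2)" using veq_power[OF dd, of 2] by simp
  define F1 where "F1 = 2 * ((x1 * x2 + a4) * (x1 + x2) + 6 * (x1 * x2) + 2 * a6)"
  define F2 where "F2 = (x1 * x2 - a4)^2 - 4 * a6 * (x1 + x2 + 3)"
  have ne0: "(x1 - x2)^2 \<noteq> 0" using ne by simp
  have s': "a + b = F1 / (x1 - x2)^2" using s ne0 unfolding F1_def by (simp add: field_simps)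
  have p': "a * b = F2 / (x1 - x2)^2" using p ne0 unfolding F2_def by (simp add: field_simps)
  have F1e: "F1 = 2 * (6 * (x1 * x2) + (x1 * x2 * x1 + x1 * x2 * x2 + a4 * x1 + a4 * x2 + 2 * a6))"
    unfolding F1_def by algebra
  have F2e: "F2 = (x1 * x2)^2 + (a4 * a4 - 2 * (a4 * (x1 * x2)) - 4 * (a6 * x1) - 4 * (a6 * x2)) - 12 * a6"
    unfolding F2_def by algebra
  note a6g = veq_vge[OF a6]
  have r1: "vge k (x1 * x2 * x1 + x1 * x2 * x2 + a4 * x1 + a4 * x2 + 2 * a6)"
    if "vge u x1" "vge w x2" "k \<le> 2 * u + w" "k \<le> u + 2 * w" "k \<le> N + u" "k \<le> N + w" "k \<le> N" for k u w
    using vge_mono[OF vge_mult[OF vge_mult[OF that(1,2)] that(1)], of k]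
      vge_mono[OF vge_mult[OF vge_mult[OF that(1,2)] that(2)], of k]
      vge_mono[OF vge_mult[OF a4 that(1)], of k] vge_mono[OF vge_mult[OF a4 that(2)], of k]
      vge_mono[OF a6g, of k] that by (auto intro!: vge_add)
  have F1ge: "vge k F1"
    if "vge u x1" "vge w x2" "k \<le> 2 * u + w" "k \<le> u + 2 * w" "k \<le> N + u" "k \<le> N + w" "k \<le> N"
      "k \<le> u + w" for k u w
  proof -
    have "vge k (6 * (x1 * x2))" using vge_mono[OF vge_mult[OF that(1,2)] that(8)] by simp
    from vge_add[OF this r1[OF that(1-7)]] show ?thesis by (simp only: F1e vge_cmult)
  qed
  have r2: "vge k (a4 * a4 - 2 * (a4 * (x1 * x2)) - 4 * (a6 * x1) - 4 * (a6 * x2))"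
    if "vge u x1" "vge w x2" "k \<le> N + u + w" "k \<le> N + u" "k \<le> N + w" "k \<le> N + N" for k u w
    using vge_mono[OF vge_mult[OF a4 a4], of k] vge_mono[OF vge_mult[OF a4 vge_mult[OF that(1,2)]], of k]
      vge_mono[OF vge_mult[OF a6g that(1)], of k] vge_mono[OF vge_mult[OF a6g that(2)], of k] that
    by (auto intro!: vge_diff)
  have sge: "vge (k - 2 * d) (a + b)" if "vge k F1" for k unfolding s' by (rule vge_divide[OF that F0])
  have seq: "veq (k - 2 * d) (a + b)" if "veq k F1" for k unfolding s' by (rule veq_divide[OF that F0])
  have pge: "vge (k - 2 * d) (a * b)" if "vge k F2" for k unfolding p' by (rule vge_divide[OF that F0])
  have peq: "veq (k - 2 * d) (a * b)" if "veq k F2" for k unfolding p' by (rule veq_divide[OF that F0])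
  define k1 k2 where "k1 = kap N x1" and "k2 = kap N x2"
  have kk: "0 \<le> k1" "k1 \<le> k2" "k2 \<le> N / 2"
    using kap_nonneg le kap_le[of N x2] N unfolding k1_def k2_def by auto
  \<comment> \<open>At index N/2 only a lower bound for the valuation of x is available, and at
    index 0 a pole is possible; hence the extreme indices are cases of their own.\<close>
  consider (A) "k2 = 0" | (B) "k1 = 0" "0 < k2" "k2 < N / 2" | (C) "k1 = 0" "k2 = N / 2"
    | (D) "0 < k1" "k1 < k2" "k2 < N / 2" | (E) "0 < k1" "k1 < k2" "k2 = N / 2"
    | (F) "0 < k1" "k1 = k2" "k2 < N / 2" | (G) "k1 = N / 2" "k2 = N / 2"
    using kk N by linarith
  then show ?thesis
  proof cases
    case A
    define n1 n2 where "n1 = nu N x1" and "n2 = nu N x2"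
    have x1: "veq (- n1) x1" and x2: "veq (- n2) x2"
      using kap_nu_zero[OF N] A kk k1_def k2_def n1_def n2_def by auto
    have n: "n1 \<ge> 0" "n2 \<ge> 0" using nu_nonneg n1_def n2_def by auto
    have dm: "d \<ge> - n1 - n2"
    proof -
      have "vge (- n1 - n2) (x1 - x2)"
        using vge_mono[OF veq_vge[OF x1]] vge_mono[OF veq_vge[OF x2]] n by (auto intro!: vge_diff)
      then show ?thesis using dd by (auto simp: vge_def veq_def)
    qed
    have F2: "veq (- 2 * n1 - 2 * n2) F2"
    proof -
      have "veq (- 2 * n1 - 2 * n2) ((x1 * x2)^2)"
        using veq_power[OF veq_mult[OF x1 x2], of 2] by (simp add: algebra_simps)
      moreover have "vgt (- 2 * n1 - 2 * n2) (a4 * a4 - 2 * (a4 * (x1 * x2)) - 4 * (a6 * x1) - 4 * (a6 * x2))"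
        by (rule vge_vgt[OF r2[OF veq_vge[OF x1] veq_vge[OF x2], of "N - n1 - n2"]]) (use n N in auto)
      moreover have "vgt (- 2 * n1 - 2 * n2) (12 * a6)" using vge_vgt[OF a6g, of "- 2 * n1 - 2 * n2"] n N by auto
      ultimately show ?thesis unfolding F2e by (intro veq_diff veq_add)
    qed
    have F1: "vge (- 2 * n1 - 2 * n2) F1"
      by (rule F1ge[OF veq_vge[OF x1] veq_vge[OF x2]]) (use n N in auto)
    have "a \<noteq> 0 \<and> b \<noteq> 0 \<and> v a \<le> 0 \<and> v b \<le> 0 \<and> v a + v b = - 2 * n1 - 2 * n2 - 2 * d"
      by (rule roots_nonpos[OF sge[OF F1] peq[OF F2]]) (use dm in auto)
    then show ?thesis
      using kap_zeroI[OF veq_v, of a] kap_zeroI[OF veq_v, of b] N A kk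
      by (auto simp: k1_def[symmetric] k2_def[symmetric] n1_def[symmetric] n2_def[symmetric] d_def[symmetric])
  next
    case B
    define n1 where "n1 = nu N x1"
    have x1: "veq (- n1) x1" using kap_nu_zero[OF N] B k1_def n1_def by auto
    have x2: "veq k2 x2" and nx2: "nu N x2 = 0" using kap_mid[of N x2] B k2_def by auto
    have n: "n1 \<ge> 0" using nu_nonneg n1_def by auto
    have d: "d = - n1" using veq_diff[OF x1 vge_vgt[OF veq_vge[OF x2]]] dd B n by (auto simp: veq_def)
    have F2: "veq (2 * k2 - 2 * n1) F2"
    proof -
      have "veq (2 * k2 - 2 * n1) ((x1 * x2)^2)"
        using veq_power[OF veq_mult[OF x1 x2], of 2] by (simp add: algebra_simps)
      moreover have "vgt (2 * k2 - 2 * n1) (a4 * a4 - 2 * (a4 * (x1 * x2)) - 4 * (a6 * x1) - 4 * (a6 * x2))"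
        by (rule vge_vgt[OF r2[OF veq_vge[OF x1] veq_vge[OF x2], of "N - n1"]]) (use n N B in auto)
      moreover have "vgt (2 * k2 - 2 * n1) (12 * a6)" using vge_vgt[OF a6g, of "2 * k2 - 2 * n1"] n N B by auto
      ultimately show ?thesis unfolding F2e by (intro veq_diff veq_add)
    qed
    have F1: "vge (k2 - 2 * n1) F1"
      by (rule F1ge[OF veq_vge[OF x1] veq_vge[OF x2]]) (use n N B in auto)
    have "veq k2 a \<and> veq k2 b"
      by (rule roots_eq) (use sge[OF F1] peq[OF F2] d in auto)
    then show ?thesis
      using kap_eqI[of k2 a N] kap_eqI[of k2 b N] B d nx2
      by (auto simp: k1_def[symmetric] k2_def[symmetric] n1_def[symmetric] d_def[symmetric])
  next
    case C
    define n1 where "n1 = nu N x1"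
    have x1: "veq (- n1) x1" using kap_nu_zero[OF N] C k1_def n1_def by auto
    have x2: "vge (N / 2) x2" and nx2: "nu N x2 = 0" using kap_topD[OF N, of x2] C k2_def by auto
    have n: "n1 \<ge> 0" using nu_nonneg n1_def by auto
    have d: "d = - n1" using veq_diff[OF x1 vge_vgt[OF x2]] dd C n N by (auto simp: veq_def)
    have F2: "vge (N - 2 * n1) F2"
    proof -
      have "vge (N - 2 * n1) ((x1 * x2)^2)"
        using vge_power[OF vge_mult[OF veq_vge[OF x1] x2], of 2] by (simp add: algebra_simps)
      moreover have "vge (N - 2 * n1) (a4 * a4 - 2 * (a4 * (x1 * x2)) - 4 * (a6 * x1) - 4 * (a6 * x2))"
        by (rule r2[OF veq_vge[OF x1] x2]) (use n N C in auto)
      moreover have "vge (N - 2 * n1) (12 * a6)" using vge_mono[OF a6g, of "N - 2 * n1"] n by auto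
      ultimately show ?thesis unfolding F2e by (intro vge_diff[OF vge_add])
    qed
    have F1: "vge (N / 2 - 2 * n1) F1"
      by (rule F1ge[OF veq_vge[OF x1] x2]) (use n N C in auto)
    have "vge (N / 2) a \<and> vge (N / 2) b"
      by (rule roots_ge) (use sge[OF F1] pge[OF F2] d in auto)
    then show ?thesis
      using kap_topI[of N a] kap_topI[of N b] C d N nx2
      by (auto simp: k1_def[symmetric] k2_def[symmetric] n1_def[symmetric] d_def[symmetric])
  next
    case D
    have x1: "veq k1 x1" and nx1: "nu N x1 = 0" using kap_mid[of N x1] D k1_def by auto
    have x2: "veq k2 x2" and nx2: "nu N x2 = 0" using kap_mid[of N x2] D k2_def by auto
    have d: "d = k1" using veq_diff[OF x1 vge_vgt[OF veq_vge[OF x2]]] dd D by (auto simp: veq_def)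
    have F1: "veq (k1 + k2) F1"
    proof -
      have "veq (k1 + k2) (6 * (x1 * x2))" using veq_mult[OF x1 x2] by simp
      moreover have "vgt (k1 + k2) (x1 * x2 * x1 + x1 * x2 * x2 + a4 * x1 + a4 * x2 + 2 * a6)"
        by (rule vge_vgt[OF r1[OF veq_vge[OF x1] veq_vge[OF x2], of "min (2 * k1 + k2) N"]])
          (use D in auto)
      ultimately show ?thesis unfolding F1e by (subst veq_cmult) (rule veq_add)
    qed
    have xx: "veq (2 * k1 + 2 * k2) ((x1 * x2)^2)"
      using veq_power[OF veq_mult[OF x1 x2], of 2] by (simp add: algebra_simps)
    have rr: "vgt N (a4 * a4 - 2 * (a4 * (x1 * x2)) - 4 * (a6 * x1) - 4 * (a6 * x2))"
      by (rule vge_vgt[OF r2[OF veq_vge[OF x1] veq_vge[OF x2], of "N + k1"]]) (use D in auto)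
    have aa: "veq N (12 * a6)" using a6 by simp
    have S: "veq (k2 - k1) (a + b)" using seq[OF F1] d by simp
    have key: "(veq (k2 - k1) a \<and> vge (T - (k2 - k1)) b \<or> veq (k2 - k1) b \<and> vge (T - (k2 - k1)) a)"
      if "vge T (a * b)" "T > 2 * (k2 - k1)" for T using roots_distinct[OF S that] .
    have fin: ?thesis if "kap N b = min (k1 + k2) (N - k1 - k2) \<and> nu N b = 0 \<and> veq (k2 - k1) a \<or>
        kap N a = min (k1 + k2) (N - k1 - k2) \<and> nu N a = 0 \<and> veq (k2 - k1) b"
      using that kap_eqI[of "k2 - k1" a N] kap_eqI[of "k2 - k1" b N] D d nx1 nx2
      by (auto simp: k1_def[symmetric] k2_def[symmetric] d_def[symmetric])
    consider "2 * k1 + 2 * k2 < N" | "2 * k1 + 2 * k2 > N" | "2 * k1 + 2 * k2 = N" by linarith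
    then show ?thesis
    proof cases
      case 1
      have "veq (2 * k1 + 2 * k2) F2" unfolding F2e
        using xx vgt_mono[OF rr, of "2 * k1 + 2 * k2"] vge_vgt[OF veq_vge[OF aa], of "2 * k1 + 2 * k2"] 1
        by (intro veq_diff veq_add) auto
      from peq[OF this] have P: "veq (2 * k2) (a * b)" using d by simp
      from key[OF veq_vge[OF P]] D
      have "veq (k2 - k1) a \<and> veq (k1 + k2) b \<or> veq (k2 - k1) b \<and> veq (k1 + k2) a"
        using P v_mult[of a b] by (auto simp: veq_def)
      then show ?thesis using fin kap_eqI[of "k1 + k2" a N] kap_eqI[of "k1 + k2" b N] 1 D by auto
    next
      case 2
      have "vgt N ((x1 * x2)^2)" using vge_vgt[OF veq_vge[OF xx]] 2 by auto
      then have "veq N F2" unfolding F2e by (intro veq_diff' vgt_add rr aa)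
      from peq[OF this] have P: "veq (N - 2 * k1) (a * b)" using d by simp
      from key[OF veq_vge[OF P]] D
      have "veq (k2 - k1) a \<and> veq (N - k1 - k2) b \<or> veq (k2 - k1) b \<and> veq (N - k1 - k2) a"
        using P v_mult[of a b] by (auto simp: veq_def)
      then show ?thesis using fin kap_eqI[of "N - k1 - k2" a N] kap_eqI[of "N - k1 - k2" b N] 2 D by auto
    next
      \<comment> \<open>\<open>(x1 * x2)^2\<close> and \<open>12 * a6\<close> now have equal
        valuation and may cancel. Only a lower bound remains, which the cap N/2 in
        \<open>kap\<close> absorbs.\<close>
      case 3
      have "vge N F2" unfolding F2e
        using veq_vge[OF xx] 3 vgt_vge[OF rr] veq_vge[OF aa] by (intro vge_diff[OF vge_add]) auto
      from pge[OF this] have P: "vge (2 * k2) (a * b)" using d 3 by (auto elim: vge_mono)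
      from key[OF P] D
      have "veq (k2 - k1) a \<and> vge (N / 2) b \<or> veq (k2 - k1) b \<and> vge (N / 2) a"
        using 3 by (auto elim!: vge_mono)
      then show ?thesis using fin kap_topI[of N a] kap_topI[of N b] 3 N by auto
    qed
  next
    case E
    have x1: "veq k1 x1" and nx1: "nu N x1 = 0" using kap_mid[of N x1] E k1_def by auto
    have "kap N x2 = N / 2" using E k2_def by simp
    from kap_topD[OF N this] have x2: "vge k2 x2" and nx2: "nu N x2 = 0" unfolding E(3) by auto
    have d: "d = k1" using veq_diff[OF x1 vge_vgt[OF x2]] dd E by (auto simp: veq_def)
    have F1: "vge (k1 + N / 2) F1"
      by (rule F1ge[OF veq_vge[OF x1] x2]) (use N E in auto)
    have F2: "veq N F2"
    proof -
      have "vge (2 * k1 + 2 * k2) ((x1 * x2)^2)"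
        using vge_power[OF vge_mult[OF veq_vge[OF x1] x2], of 2] by (simp add: algebra_simps)
      then have "vgt N ((x1 * x2)^2)" by (rule vge_vgt) (use E in auto)
      moreover have "vgt N (a4 * a4 - 2 * (a4 * (x1 * x2)) - 4 * (a6 * x1) - 4 * (a6 * x2))"
        by (rule vge_vgt[OF r2[OF veq_vge[OF x1] x2, of "N + k1"]]) (use E in auto)
      ultimately show ?thesis unfolding F2e using a6 by (intro veq_diff' vgt_add) auto
    qed
    have "veq (N / 2 - k1) a \<and> veq (N / 2 - k1) b"
      by (rule roots_eq) (use sge[OF F1] peq[OF F2] d in \<open>auto elim!: vge_mono\<close>)
    then show ?thesis
      using kap_eqI[of "N / 2 - k1" a N] kap_eqI[of "N / 2 - k1" b N] E d nx1 nx2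
      by (auto simp: k1_def[symmetric] k2_def[symmetric] d_def[symmetric])
  next
    case F
    define k where "k = k2"
    have k: "k1 = k" "k2 = k" "0 < k" "k < N / 2" using F k_def by auto
    have x1: "veq k x1" and nx1: "nu N x1 = 0" using kap_mid[of N x1] k k1_def by auto
    have x2: "veq k x2" and nx2: "nu N x2 = 0" using kap_mid[of N x2] k k2_def by auto
    have "vge k (x1 - x2)" using veq_vge[OF x1] veq_vge[OF x2] by (rule vge_diff)
    then have d: "d \<ge> k" using dd by (auto simp: vge_def veq_def)
    have F1: "veq (2 * k) F1"
    proof -
      have "veq (2 * k) (6 * (x1 * x2))" using veq_mult[OF x1 x2] by simp
      moreover have "vgt (2 * k) (x1 * x2 * x1 + x1 * x2 * x2 + a4 * x1 + a4 * x2 + 2 * a6)"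
        by (rule vge_vgt[OF r1[OF veq_vge[OF x1] veq_vge[OF x2], of "min (3 * k) N"]])
          (use k in auto)
      ultimately show ?thesis unfolding F1e by (subst veq_cmult) (rule veq_add)
    qed
    have xx: "veq (4 * k) ((x1 * x2)^2)"
      using veq_power[OF veq_mult[OF x1 x2], of 2] by (simp add: algebra_simps)
    have rr: "vgt N (a4 * a4 - 2 * (a4 * (x1 * x2)) - 4 * (a6 * x1) - 4 * (a6 * x2))"
      by (rule vge_vgt[OF r2[OF veq_vge[OF x1] veq_vge[OF x2], of "N + k"]]) (use k in auto)
    have aa: "veq N (12 * a6)" using a6 by simp
    have S: "veq (2 * k - 2 * d) (a + b)" using seq[OF F1] by simp
    have key: "(veq (2 * k - 2 * d) a \<and> vge (T - 2 * k) b \<or> veq (2 * k - 2 * d) b \<and> vge (T - 2 * k) a)"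
      if "vge (T - 2 * d) (a * b)" "T > 2 * k" for T
      using roots_distinct[OF S that(1)] that(2) d by (auto simp: algebra_simps)
    have fin: ?thesis if "kap N b = min (2 * k) (N - 2 * k) \<and> nu N b = 0 \<and> veq (2 * k - 2 * d) a \<or>
        kap N a = min (2 * k) (N - 2 * k) \<and> nu N a = 0 \<and> veq (2 * k - 2 * d) b"
      using that kap_zeroI[of "2 * k - 2 * d" a N] kap_zeroI[of "2 * k - 2 * d" b N] d nx1 nx2 N k
      by (auto simp: k1_def[symmetric] k2_def[symmetric] d_def[symmetric])
    consider "4 * k < N" | "4 * k > N" | "4 * k = N" by linarith
    then show ?thesis
    proof cases
      case 1
      have "veq (4 * k) F2" unfolding F2e
        using xx vgt_mono[OF rr, of "4 * k"] vge_vgt[OF veq_vge[OF aa], of "4 * k"] 1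
        by (intro veq_diff veq_add) auto
      note P = peq[OF this]
      from key[OF veq_vge[OF P]] k
      have "veq (2 * k - 2 * d) a \<and> veq (2 * k) b \<or> veq (2 * k - 2 * d) b \<and> veq (2 * k) a"
        using P v_mult[of a b] by (auto simp: veq_def)
      then show ?thesis using fin kap_eqI[of "2 * k" a N] kap_eqI[of "2 * k" b N] 1 k by auto
    next
      case 2
      have "vgt N ((x1 * x2)^2)" using vge_vgt[OF veq_vge[OF xx]] 2 by auto
      then have "veq N F2" unfolding F2e by (intro veq_diff' vgt_add rr aa)
      note P = peq[OF this]
      from key[OF veq_vge[OF P]] k
      have "veq (2 * k - 2 * d) a \<and> veq (N - 2 * k) b \<or> veq (2 * k - 2 * d) b \<and> veq (N - 2 * k) a"
        using P v_mult[of a b] by (auto simp: veq_def)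
      then show ?thesis using fin kap_eqI[of "N - 2 * k" a N] kap_eqI[of "N - 2 * k" b N] 2 k by auto
    next
      case 3
      have "vge N F2" unfolding F2e
        using veq_vge[OF xx] 3 vgt_vge[OF rr] veq_vge[OF aa] by (intro vge_diff[OF vge_add]) auto
      note P = pge[OF this]
      from key[OF P] k
      have "veq (2 * k - 2 * d) a \<and> vge (N / 2) b \<or> veq (2 * k - 2 * d) b \<and> vge (N / 2) a"
        using 3 by (auto elim!: vge_mono)
      then show ?thesis using fin kap_topI[of N a] kap_topI[of N b] 3 N by auto
    qed
  next
    case G
    have x1: "vge (N / 2) x1" and nx1: "nu N x1 = 0" using kap_topD[OF N, of x1] G k1_def by auto
    have x2: "vge (N / 2) x2" and nx2: "nu N x2 = 0" using kap_topD[OF N, of x2] G k2_def by auto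
    have "vge (N / 2) (x1 - x2)" using x1 x2 by (rule vge_diff)
    then have d: "d \<ge> N / 2" using dd by (auto simp: vge_def veq_def)
    have F1: "vge N F1" by (rule F1ge[OF x1 x2]) (use N in auto)
    have F2: "veq N F2"
    proof -
      have "vge (2 * N) ((x1 * x2)^2)"
        using vge_power[OF vge_mult[OF x1 x2], of 2] by (simp add: algebra_simps)
      then have "vgt N ((x1 * x2)^2)" by (rule vge_vgt) (use N in auto)
      moreover have "vgt N (a4 * a4 - 2 * (a4 * (x1 * x2)) - 4 * (a6 * x1) - 4 * (a6 * x2))"
        by (rule vge_vgt[OF r2[OF x1 x2, of "N + N / 2"]]) (use N in auto)
      ultimately show ?thesis unfolding F2e using a6 by (intro veq_diff' vgt_add) auto
    qed
    have "a \<noteq> 0 \<and> b \<noteq> 0 \<and> v a \<le> 0 \<and> v b \<le> 0 \<and> v a + v b = N - 2 * d"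
      by (rule roots_nonpos[OF sge[OF F1] peq[OF F2]]) (use d in auto)
    then show ?thesis
      using kap_zeroI[OF veq_v, of a] kap_zeroI[OF veq_v, of b] N G nx1 nx2
      by (auto simp: k1_def[symmetric] k2_def[symmetric] d_def[symmetric])
  qed
qed

lemma node_pair:
  assumes N: "N > 0" and a4: "vge N a4" and a6: "veq N a6" and ne: "x1 \<noteq> x2"
    and s: "(a + b) * (x1 - x2)^2 = 2 * ((x1 * x2 + a4) * (x1 + x2) + 6 * (x1 * x2) + 2 * a6)"
    and p: "a * b * (x1 - x2)^2 = (x1 * x2 - a4)^2 - 4 * a6 * (x1 + x2 + 3)"
  shows "nu N a + nu N b = 2 * nu N x1 + 2 * nu N x2 + 2 * v (x1 - x2) - 2 * min (kap N x1) (kap N x2)"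
    and "(let u = min (kap N x1 + kap N x2) (N - kap N x1 - kap N x2); w = \<bar>kap N x1 - kap N x2\<bar> in
      kap N a = u \<and> kap N b = w \<or> kap N b = u \<and> kap N a = w)"
proof -
  have s2: "(a + b) * (x2 - x1)^2 = 2 * ((x2 * x1 + a4) * (x2 + x1) + 6 * (x2 * x1) + 2 * a6)"
    and p2: "a * b * (x2 - x1)^2 = (x2 * x1 - a4)^2 - 4 * a6 * (x2 + x1 + 3)"
    using s p by (simp_all add: power2_commute[of x2 x1] mult.commute[of x2 x1] add.commute[of x2 x1])
  have v2: "v (x2 - x1) = v (x1 - x2)" using v_minus[of "x1 - x2"] by simp
  consider "kap N x1 \<le> kap N x2" | "kap N x2 \<le> kap N x1" by linarith
  then have "nu N a + nu N b = 2 * nu N x1 + 2 * nu N x2 + 2 * v (x1 - x2) - 2 * min (kap N x1) (kap N x2) \<and>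
    (let u = min (kap N x1 + kap N x2) (N - kap N x1 - kap N x2); w = \<bar>kap N x1 - kap N x2\<bar> in
      kap N a = u \<and> kap N b = w \<or> kap N b = u \<and> kap N a = w)"
  proof cases
    case 1
    then show ?thesis using node_pair_aux[OF N a4 a6 ne s p 1] by (auto simp: Let_def min_def)
  next
    case 2
    then show ?thesis using node_pair_aux[OF N a4 a6 ne[symmetric] s2 p2 2] v2
      by (auto simp: Let_def min_def algebra_simps)
  qed
  then show "nu N a + nu N b = 2 * nu N x1 + 2 * nu N x2 + 2 * v (x1 - x2) - 2 * min (kap N x1) (kap N x2)"
    and "(let u = min (kap N x1 + kap N x2) (N - kap N x1 - kap N x2); w = \<bar>kap N x1 - kap N x2\<bar> in
      kap N a = u \<and> kap N b = w \<or> kap N b = u \<and> kap N a = w)" by auto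
qed

text \<open>Duplication is not an instance of \<open>node_pair\<close>, which requires different
  abscissae.\<close>

lemma node_double:
  assumes N: "N > 0" and a4: "vge N a4" and a6: "veq N a6"
    and f: "f = x^3 + 3 * x^2 + a4 * x + a6" and f0: "f \<noteq> 0"
    and a: "a * (4 * f) = (x^2 - a4)^2 - 4 * a6 * (2 * x + 3)"
  shows "nu N a = 4 * nu N x + v f - 2 * kap N x"
    and "kap N a = min (2 * kap N x) (N - 2 * kap N x)"
proof -
  define G where "G = (x^2 - a4)^2 - 4 * a6 * (2 * x + 3)"
  have Ge: "G = x^4 + (a4 * a4 - 2 * (a4 * x^2) - 8 * (a6 * x)) - 12 * a6" unfolding G_def by algebra
  have ae: "a = G / (4 * f)" using a f0 unfolding G_def by (simp add: field_simps)
  have f4: "veq (v f) (4 * f)" using f0 by (simp add: veq_def)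
  note a6g = veq_vge[OF a6]
  have r2: "vge k (a4 * a4 - 2 * (a4 * x^2) - 8 * (a6 * x))"
    if "vge u x" "k \<le> 2 * N" "k \<le> N + 2 * u" "k \<le> N + u" for k u
    using vge_mono[OF vge_mult[OF a4 a4], of k] vge_mono[OF vge_mult[OF a4 vge_power[OF that(1), of 2]], of k]
      vge_mono[OF vge_mult[OF a6g that(1)], of k] that by (auto intro!: vge_diff)
  have rf: "vge k (a4 * x + a6)" if "vge u x" "k \<le> N" "k \<le> N + u" for k u
    using vge_mono[OF vge_mult[OF a4 that(1)], of k] vge_mono[OF a6g, of k] that by (auto intro!: vge_add)
  define k where "k = kap N x"
  have kk: "0 \<le> k" "k \<le> N / 2" using kap_nonneg kap_le[of N x] N unfolding k_def by auto
  consider (A) "k = 0" | (B) "0 < k" "k < N / 2" | (C) "k = N / 2" using kk by linarith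
  then have "nu N a = 4 * nu N x + v f - 2 * kap N x \<and> kap N a = min (2 * kap N x) (N - 2 * kap N x)"
  proof cases
    case A
    define n where "n = nu N x"
    have x: "veq (- n) x" using kap_nu_zero[OF N] A k_def n_def by auto
    have n: "n \<ge> 0" using nu_nonneg n_def by auto
    have G: "veq (- 4 * n) G"
    proof -
      have "veq (- 4 * n) (x^4)" using veq_power[OF x, of 4] by simp
      moreover have "vgt (- 4 * n) (a4 * a4 - 2 * (a4 * x^2) - 8 * (a6 * x))"
        by (rule vge_vgt[OF r2[OF veq_vge[OF x], of "N - 2 * n"]]) (use n N in auto)
      moreover have "vgt (- 4 * n) (12 * a6)" using vge_vgt[OF a6g, of "- 4 * n"] n N by auto
      ultimately show ?thesis unfolding Ge by (intro veq_diff veq_add)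
    qed
    have "- 3 * n \<le> v f"
    proof -
      have "vge (- 3 * n) (x^3)" "vge (- 3 * n) (3 * x^2)"
        using veq_vge[OF veq_power[OF x, of 3]] vge_mono[OF veq_vge[OF veq_power[OF x, of 2]], of "- 3 * n"] n by auto
      then have "vge (- 3 * n) (x^3 + 3 * x^2 + (a4 * x + a6))"
        using rf[OF veq_vge[OF x], of "- 3 * n"] n N by (intro vge_add[OF vge_add]) auto
      then show ?thesis using f f0 by (simp add: vge_def add.assoc)
    qed
    have fl: "- 4 * n - v f \<le> 0"
    proof (cases "n = 0")
      case True then show ?thesis using \<open>- 3 * n \<le> v f\<close> by simp
    next
      case False
      show ?thesis using \<open>- 3 * n \<le> v f\<close> n by linarith
    qed
    have "veq (- 4 * n - v f) a" unfolding ae by (rule veq_divide[OF G f4])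
    then show ?thesis using kap_zeroI[of "- 4 * n - v f" a N] fl N A k_def n_def by simp
  next
    case B
    have x: "veq k x" and nx: "nu N x = 0" using kap_mid[of N x] B k_def by auto
    have f2: "v f = 2 * k"
    proof -
      have "veq (2 * k) (3 * x^2 + (x^3 + (a4 * x + a6)))"
      proof (intro veq_add vgt_add)
        show "veq (2 * k) (3 * x^2)" using veq_power[OF x, of 2] by simp
        show "vgt (2 * k) (x^3)" using vge_vgt[OF veq_vge[OF veq_power[OF x, of 3]], of "2 * k"] B by simp
        show "vgt (2 * k) (a4 * x)" using vge_vgt[OF vge_mult[OF a4 veq_vge[OF x]], of "2 * k"] B by simp
        show "vgt (2 * k) a6" using vge_vgt[OF a6g, of "2 * k"] B by simp
      qed
      then show ?thesis using f by (simp add: veq_def algebra_simps)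
    qed
    have x4: "veq (4 * k) (x^4)" using veq_power[OF x, of 4] by simp
    have rr: "vgt N (a4 * a4 - 2 * (a4 * x^2) - 8 * (a6 * x))"
      by (rule vge_vgt[OF r2[OF veq_vge[OF x], of "N + k"]]) (use B in auto)
    have aa: "veq N (12 * a6)" using a6 by simp
    consider "4 * k < N" | "4 * k > N" | "4 * k = N" by linarith
    then show ?thesis
    proof cases
      case 1
      have "veq (4 * k) G" unfolding Ge
        using x4 vgt_mono[OF rr, of "4 * k"] vge_vgt[OF veq_vge[OF aa], of "4 * k"] 1
        by (intro veq_diff veq_add) auto
      from veq_divide[OF this f4] have "veq (2 * k) a" using f2 ae by simp
      then show ?thesis using kap_eqI[of "2 * k" a N] 1 B f2 nx k_def by auto
    next
      case 2
      have "vgt N (x^4)" using vge_vgt[OF veq_vge[OF x4]] 2 by auto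
      then have "veq N G" unfolding Ge by (intro veq_diff' vgt_add rr aa)
      from veq_divide[OF this f4] have "veq (N - 2 * k) a" using f2 ae by simp
      then show ?thesis using kap_eqI[of "N - 2 * k" a N] 2 B f2 nx k_def by auto
    next
      case 3
      have "vge N G" unfolding Ge
        using veq_vge[OF x4] 3 vgt_vge[OF rr] veq_vge[OF aa] by (intro vge_diff[OF vge_add]) auto
      from vge_divide[OF this f4] have "vge (N / 2) a" using f2 ae 3 by (auto elim: vge_mono)
      then show ?thesis using kap_topI[of N a] 3 N f2 nx k_def by auto
    qed
  next
    case C
    have x: "vge (N / 2) x" and nx: "nu N x = 0" using kap_topD[OF N, of x] C k_def by auto
    have G: "veq N G"
    proof -
      have "vgt N (x^4)" using vge_vgt[OF vge_power[OF x, of 4], of N] N by simp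
      moreover have "vgt N (a4 * a4 - 2 * (a4 * x^2) - 8 * (a6 * x))"
        by (rule vge_vgt[OF r2[OF x, of "N + N / 2"]]) (use N in auto)
      ultimately show ?thesis unfolding Ge using a6 by (intro veq_diff' vgt_add) auto
    qed
    have fN: "N \<le> v f"
    proof -
      have "vge N (x^3)" "vge N (3 * x^2)"
        using vge_mono[OF vge_power[OF x, of 3], of N] vge_power[OF x, of 2] N by auto
      then have "vge N (x^3 + 3 * x^2 + (a4 * x + a6))"
        using rf[OF x, of N] N by (intro vge_add[OF vge_add]) auto
      then show ?thesis using f f0 by (simp add: vge_def add.assoc)
    qed
    have "veq (N - v f) a" unfolding ae by (rule veq_divide[OF G f4])
    then show ?thesis using kap_zeroI[of "N - v f" a N] fN N C nx k_def by auto
  qed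
  then show "nu N a = 4 * nu N x + v f - 2 * kap N x"
    and "kap N a = min (2 * kap N x) (N - 2 * kap N x)" by auto
qed

end

locale place = valuation v for v :: "'a::field_char_0 \<Rightarrow> real" +
  fixes A B :: 'a
  assumes disc_nz: "4 * A^3 + 27 * B^2 \<noteq> 0"
begin

abbreviation "Disc \<equiv> 4 * A^3 + 27 * B^2"

text \<open>Scaling x and y by valuations \<open>2 * mu\<close> and \<open>3 * mu\<close> makes the
  equation minimal over a ramified extension; the exponent may therefore be fractional.\<close>

definition mu :: real where
  "mu = (if A = 0 then v B / 6 else if B = 0 then v A / 4 else min (v A / 4) (v B / 6))"

text \<open>The valuation of the discriminant after that scaling: 0 for potentially good reduction,
  otherwise the pole order of j (\<open>j_val\<close>).\<close>

definition NN :: real where "NN = v Disc - 12 * mu"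

text \<open>For multiplicative reduction \<open>ee\<close> is congruent to the abscissa of the node.\<close>
definition ee :: 'a where "ee = - 3 * B / (2 * A)"

definition K :: "'a \<Rightarrow> real" where "K x = (if NN = 0 then 0 else kap NN ((x - ee) / ee))"
definition U :: "'a \<Rightarrow> real" where "U x = 2 * mu - vmin (2 * mu) x"
text \<open>Up to sign and an additive constant, the second Bernoulli polynomial in Tate's formula
  for the local height on an N-gon. For \<open>NN = 0\<close> it vanishes because \<open>K\<close>
  does.\<close>

definition corr :: "'a \<Rightarrow> real" where "corr x = K x * (NN - K x) / (2 * NN)"
text \<open>Neron's local height, normalised so that \<open>v (x1 - x2)\<close> is the only error
  term in \<open>lam_pair\<close>; the summand \<open>- mu\<close> undoes the scaling.\<close>

definition lam :: "'a \<Rightarrow> real" where "lam x = - mu + U x / 2 - corr x"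

lemma vA: "vge (4 * mu) A" and vB: "vge (6 * mu) B"
  and v_or: "veq (4 * mu) A \<or> veq (6 * mu) B"
  using disc_nz unfolding mu_def vge_def veq_def by (auto simp: min_def)

lemma vDisc_ge: "vge (12 * mu) Disc"
  using vge_power[OF vA, of 3] vge_power[OF vB, of 2] by (auto intro!: vge_add)

lemma vDisc: "veq (12 * mu + NN) Disc" using disc_nz by (simp add: NN_def veq_def)

lemma NN_nonneg: "0 \<le> NN" using vDisc_ge disc_nz by (simp add: NN_def vge_def)

text \<open>For \<open>NN > 0\<close> the leading parts of \<open>4 * A^3\<close> and
  \<open>27 * B^2\<close> cancel, so both terms attain the minimal valuation.\<close>

lemma NN_pos_eq: assumes "NN > 0" shows "veq (4 * mu) A" "veq (6 * mu) B"
proof -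
  have gt: "vgt (12 * mu) Disc" using assms disc_nz by (simp add: NN_def vgt_def)
  have 1: "veq (4 * mu) A \<Longrightarrow> veq (6 * mu) B"
  proof (rule ccontr)
    assume a: "veq (4 * mu) A" and "\<not> veq (6 * mu) B"
    then have "vgt (6 * mu) B" using vB vge_or_vgt by blast
    then have "vgt (12 * mu) (27 * B^2)"
      using vgt_vge_mult[of "6 * mu" B "6 * mu" B] vB by (simp add: power2_eq_square)
    from vgt_diff[OF gt this] have "vgt (12 * mu) (4 * A^3)" by simp
    then show False using veq_power[OF a, of 3] by (simp add: veq_def vgt_def)
  qed
  have 2: "veq (6 * mu) B \<Longrightarrow> veq (4 * mu) A"
  proof (rule ccontr)
    assume a: "veq (6 * mu) B" and "\<not> veq (4 * mu) A"
    then have "vgt (4 * mu) A" using vA vge_or_vgt by blast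
    then have "vgt (12 * mu) (4 * A^3)"
      using vgt_vge_mult[of "4 * mu" A "8 * mu" "A^2"] vge_power[OF vA, of 2]
      by (simp add: power3_eq_cube power2_eq_square mult.assoc)
    from vgt_diff[OF gt this] have "vgt (12 * mu) (27 * B^2)" by simp
    then show False using veq_power[OF a, of 2] by (simp add: veq_def vgt_def)
  qed
  show "veq (4 * mu) A" "veq (6 * mu) B" using 1 2 v_or by auto
qed

lemma mu_int: "12 * mu \<in> \<int>"
proof -
  have "4 * mu \<in> \<int> \<or> 6 * mu \<in> \<int>" using v_or v_int[of A] v_int[of B] by (auto simp: veq_def)
  then show ?thesis
  proof
    assume "4 * mu \<in> \<int>"
    then show ?thesis using Ints_mult[OF Ints_numeral[of "num.Bit1 num.One"], of "4 * mu"] by simp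
  next
    assume "6 * mu \<in> \<int>"
    then show ?thesis using Ints_mult[OF Ints_numeral[of "num.Bit0 num.One"], of "6 * mu"] by simp
  qed
qed

lemma NN_int: "NN \<in> \<int>" unfolding NN_def using mu_int v_int[OF disc_nz] by (intro Ints_diff)

lemma two_mu_int: assumes "NN > 0" shows "2 * mu \<in> \<int>"
proof -
  have "4 * mu \<in> \<int>" "6 * mu \<in> \<int>" using NN_pos_eq[OF assms] v_int[of A] v_int[of B] by (auto simp: veq_def)
  then have "6 * mu - 4 * mu \<in> \<int>" by (intro Ints_diff)
  then show ?thesis by simp
qed

context
  assumes N: "NN > 0"
begin

lemma A_nz: "A \<noteq> 0" and B_nz: "B \<noteq> 0" using NN_pos_eq[OF N] by (auto simp: veq_def)

lemma ee: "veq (2 * mu) ee"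
proof -
  have "veq (6 * mu - 4 * mu) (3 * B / (2 * A))"
    by (rule veq_divide) (use NN_pos_eq[OF N] in auto)
  then show ?thesis unfolding ee_def by (simp add: minus_divide_left[symmetric])
qed

lemma ee_nz: "ee \<noteq> 0" using ee by (simp add: veq_def)

lemma ee_A: "2 * A * ee = - 3 * B" using A_nz by (simp add: ee_def)

lemma a4: "veq NN ((3 * ee^2 + A) / ee^2)"
proof -
  have "(3 * ee^2 + A) * (4 * A^2) = Disc" using ee_A by algebra
  then have e: "3 * ee^2 + A = Disc / (4 * A^2)" using A_nz by (simp add: field_simps)
  have "veq ((12 * mu + NN - 8 * mu) - 4 * mu) ((3 * ee^2 + A) / ee^2)"
    unfolding e using vDisc veq_power[OF NN_pos_eq(1)[OF N], of 2] veq_power[OF ee, of 2]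
    by (intro veq_divide) auto
  then show ?thesis by simp
qed

lemma a6: "veq NN ((ee^3 + A * ee + B) / ee^3)"
proof -
  have "(ee^3 + A * ee + B) * (8 * A^3) = - B * Disc" using ee_A by algebra
  then have e: "ee^3 + A * ee + B = - (B * Disc) / (8 * A^3)" using A_nz by (simp add: field_simps)
  have "veq ((6 * mu + (12 * mu + NN) - 12 * mu) - 6 * mu) ((ee^3 + A * ee + B) / ee^3)"
    unfolding e
    using veq_mult[OF NN_pos_eq(2)[OF N] vDisc] veq_power[OF NN_pos_eq(1)[OF N], of 3] veq_power[OF ee, of 3]
    by (intro veq_divide) auto
  then show ?thesis by simp
qed

lemma nu_node: "nu NN ((x - ee) / ee) = U x"
proof (cases "vge (2 * mu) x")
  case True
  then have U: "U x = 0" using vmin_topI by (simp add: U_def)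
  have "vge (2 * mu - 2 * mu) ((x - ee) / ee)"
    by (rule vge_divide[OF vge_diff[OF True veq_vge[OF ee]] ee])
  then have "0 \<le> vmin (NN / 2) ((x - ee) / ee)" using N by (auto simp: vmin_def vge_def)
  then show ?thesis using U by (simp add: nu_def)
next
  case False
  then have x: "veq (v x) x" "v x < 2 * mu" by (auto simp: vge_def veq_def)
  then have "veq (v x) (x - ee)" using veq_diff[OF _ vge_vgt[OF veq_vge[OF ee]]] by auto
  then have "veq (v x - 2 * mu) ((x - ee) / ee)" by (rule veq_divide[OF _ ee])
  then have "vmin (NN / 2) ((x - ee) / ee) = v x - 2 * mu" using vmin_eqI x N by auto
  moreover have "vmin (2 * mu) x = v x" using x vmin_eqI[of "v x" x "2 * mu"] by auto
  ultimately show ?thesis using x by (simp add: nu_def U_def)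
qed

end

text \<open>For \<open>NN > 0\<close> the substitution \<open>x = ee * (1 + t)\<close> moves the
  node to t = 0 and produces the model of \<open>node_pair\<close>; for \<open>NN = 0\<close> this
  is \<open>good_pair\<close>.\<close>

lemma place_pair:
  assumes ne: "x1 \<noteq> x2"
    and s: "(a + b) * (x1 - x2)^2 = 2 * ((x1 * x2 + A) * (x1 + x2) + 2 * B)"
    and p: "a * b * (x1 - x2)^2 = (x1 * x2 - A)^2 - 4 * B * (x1 + x2)"
  shows "U a + U b = 2 * U x1 + 2 * U x2 + 2 * (v (x1 - x2) - 2 * mu) - 2 * min (K x1) (K x2)"
    and "(let u = min (K x1 + K x2) (NN - K x1 - K x2); w = \<bar>K x1 - K x2\<bar> in
      K a = u \<and> K b = w \<or> K b = u \<and> K a = w)"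
proof -
  have "(U a + U b = 2 * U x1 + 2 * U x2 + 2 * (v (x1 - x2) - 2 * mu) - 2 * min (K x1) (K x2)) \<and>
    (let u = min (K x1 + K x2) (NN - K x1 - K x2); w = \<bar>K x1 - K x2\<bar> in
      K a = u \<and> K b = w \<or> K b = u \<and> K a = w)"
  proof (cases "NN = 0")
    case True
    have "vmin (2 * mu) a + vmin (2 * mu) b = 2 * vmin (2 * mu) x1 + 2 * vmin (2 * mu) x2 - 2 * v (x1 - x2)"
      using good_pair[of "2 * mu" A B x1 x2 a b] vA vB vDisc True ne s p by simp
    then show ?thesis by (simp add: U_def K_def True)
  next
    case False
    then have N: "NN > 0" using NN_nonneg by simp
    define e where "e = ee"
    have e0: "e \<noteq> 0" using ee_nz[OF N] e_def by simp
    define t where "t x = (x - e) / e" for x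
    have tx: "x = e * (1 + t x)" for x using e0 by (simp add: t_def field_simps)
    define a4 where "a4 = (3 * e^2 + A) / e^2"
    define a6 where "a6 = (e^3 + A * e + B) / e^3"
    have A: "A = e^2 * (a4 - 3)" using e0 by (simp add: a4_def field_simps)
    have "e^3 + A * e + B = e^3 * a6" using e0 by (simp add: a6_def)
    then have B: "B = e^3 * (a6 - a4 + 2)" using A by algebra
    have ne': "t x1 \<noteq> t x2" using ne e0 by (simp add: t_def)
    have "e^3 * ((t a + t b) * (t x1 - t x2)^2) =
        e^3 * (2 * ((t x1 * t x2 + a4) * (t x1 + t x2) + 6 * (t x1 * t x2) + 2 * a6))"
      using s A B tx[of a] tx[of b] tx[of x1] tx[of x2] by algebra
    then have s': "(t a + t b) * (t x1 - t x2)^2 =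
        2 * ((t x1 * t x2 + a4) * (t x1 + t x2) + 6 * (t x1 * t x2) + 2 * a6)" using e0 by simp
    have "e^4 * (t a * t b * (t x1 - t x2)^2) =
        e^4 * ((t x1 * t x2 - a4)^2 - 4 * a6 * (t x1 + t x2 + 3))"
      using s p A B tx[of a] tx[of b] tx[of x1] tx[of x2] by algebra
    then have p': "t a * t b * (t x1 - t x2)^2 = (t x1 * t x2 - a4)^2 - 4 * a6 * (t x1 + t x2 + 3)"
      using e0 by simp
    have vv: "v (t x1 - t x2) = v (x1 - x2) - 2 * mu"
    proof -
      have "t x1 - t x2 = (x1 - x2) / e" by (simp add: t_def diff_divide_distrib[symmetric])
      then show ?thesis using v_divide[of "x1 - x2" e] ne e0 veqD[OF ee[OF N]] e_def by simp
    qed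
    have K: "K x = kap NN (t x)" for x using N by (simp add: K_def t_def e_def)
    have U: "U x = nu NN (t x)" for x using nu_node[OF N] by (simp add: t_def e_def)
    have w4: "vge NN a4" and w6: "veq NN a6"
      using a4[OF N] a6[OF N] veq_vge unfolding a4_def a6_def e_def by auto
    show ?thesis
      unfolding K U using node_pair[OF N w4 w6 ne' s' p'] unfolding vv by blast
  qed
  then show "U a + U b = 2 * U x1 + 2 * U x2 + 2 * (v (x1 - x2) - 2 * mu) - 2 * min (K x1) (K x2)"
    and "(let u = min (K x1 + K x2) (NN - K x1 - K x2); w = \<bar>K x1 - K x2\<bar> in
      K a = u \<and> K b = w \<or> K b = u \<and> K a = w)" by blast+
qed

lemma place_double:
  assumes f: "f = x^3 + A * x + B" and f0: "f \<noteq> 0"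
    and a: "a * (4 * f) = (x^2 - A)^2 - 8 * B * x"
  shows "U a = 4 * U x + v f - 6 * mu - 2 * K x" and "K a = min (2 * K x) (NN - 2 * K x)"
proof -
  have "U a = 4 * U x + v f - 6 * mu - 2 * K x \<and> K a = min (2 * K x) (NN - 2 * K x)"
  proof (cases "NN = 0")
    case True
    have "vmin (2 * mu) a = 4 * vmin (2 * mu) x - v f"
      using good_double[of "2 * mu" A B f x a] vA vB vDisc True f f0 a by simp
    then show ?thesis by (simp add: U_def K_def True)
  next
    case False
    then have N: "NN > 0" using NN_nonneg by simp
    define e where "e = ee"
    have e0: "e \<noteq> 0" using ee_nz[OF N] e_def by simp
    define t where "t x = (x - e) / e" for x
    have tx: "x = e * (1 + t x)" for x using e0 by (simp add: t_def field_simps)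
    define a4 where "a4 = (3 * e^2 + A) / e^2"
    define a6 where "a6 = (e^3 + A * e + B) / e^3"
    have A: "A = e^2 * (a4 - 3)" using e0 by (simp add: a4_def field_simps)
    have "e^3 + A * e + B = e^3 * a6" using e0 by (simp add: a6_def)
    then have B: "B = e^3 * (a6 - a4 + 2)" using A by algebra
    define g where "g = (t x)^3 + 3 * (t x)^2 + a4 * t x + a6"
    have fg: "f = e^3 * g" using f A B tx[of x] unfolding g_def by algebra
    then have g0: "g \<noteq> 0" using f0 by auto
    have "e^4 * (t a * (4 * g)) = e^4 * (((t x)^2 - a4)^2 - 4 * a6 * (2 * t x + 3))"
      using a f A B tx[of a] tx[of x] fg unfolding g_def by algebra
    then have a': "t a * (4 * g) = ((t x)^2 - a4)^2 - 4 * a6 * (2 * t x + 3)" using e0 by simp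
    have vf: "v f = 6 * mu + v g"
      using fg v_mult[of "e^3" g] v_power[of e 3] e0 g0 veqD[OF ee[OF N]] e_def by simp
    have K: "K x = kap NN (t x)" for x using N by (simp add: K_def t_def e_def)
    have U: "U x = nu NN (t x)" for x using nu_node[OF N] by (simp add: t_def e_def)
    have w4: "vge NN a4" and w6: "veq NN a6"
      using a4[OF N] a6[OF N] veq_vge unfolding a4_def a6_def e_def by auto
    show ?thesis
      unfolding K U vf using node_double[OF N w4 w6 g_def g0 a'] by simp
  qed
  then show "U a = 4 * U x + v f - 6 * mu - 2 * K x" and "K a = min (2 * K x) (NN - 2 * K x)" by blast+
qed

text \<open>Write \<open>k (N - k) / (2 N)\<close> as \<open>k / 2 - k^2 / (2 N)\<close>. Folding k
  to N - k leaves it unchanged, the squares obey the parallelogram law, and the linear parts produce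
  the \<open>min (K x1) (K x2)\<close> that cancels the one in \<open>place_pair\<close>.\<close>

lemma lam_pair:
  assumes "x1 \<noteq> x2"
    and "(a + b) * (x1 - x2)^2 = 2 * ((x1 * x2 + A) * (x1 + x2) + 2 * B)"
    and "a * b * (x1 - x2)^2 = (x1 * x2 - A)^2 - 4 * B * (x1 + x2)"
  shows "lam a + lam b = 2 * lam x1 + 2 * lam x2 + v (x1 - x2)"
proof -
  have c: "k * (NN - k) / (2 * NN) = k / 2 - k^2 / (2 * NN)" if "NN \<noteq> 0" for k
    using that by (simp add: field_simps power2_eq_square)
  have "K a * (NN - K a) / (2 * NN) + K b * (NN - K b) / (2 * NN) =
      2 * (K x1 * (NN - K x1) / (2 * NN)) + 2 * (K x2 * (NN - K x2) / (2 * NN)) - min (K x1) (K x2)"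
  proof (cases "NN = 0")
    case True then show ?thesis by (simp add: K_def)
  next
    case False
    have fold: "m * (NN - m) = (K x1 + K x2) * (NN - (K x1 + K x2))"
      if "m = min (K x1 + K x2) (NN - K x1 - K x2)" for m
      unfolding that min_def by (auto simp: algebra_simps)
    have ab: "w * (NN - w) / (2 * NN) = \<bar>K x1 - K x2\<bar> / 2 - (K x1 - K x2)^2 / (2 * NN)"
      if "w = \<bar>K x1 - K x2\<bar>" for w unfolding that c[OF False] by simp
    have u: "(K x1 + K x2) * (NN - (K x1 + K x2)) / (2 * NN) = (K x1 + K x2) / 2 - (K x1 + K x2)^2 / (2 * NN)"
      using c[OF False] .
    have "K a * (NN - K a) / (2 * NN) + K b * (NN - K b) / (2 * NN) =
        (K x1 + K x2) / 2 - (K x1 + K x2)^2 / (2 * NN) + (\<bar>K x1 - K x2\<bar> / 2 - (K x1 - K x2)^2 / (2 * NN))"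
      using place_pair(2)[OF assms] fold ab u unfolding Let_def by (metis add.commute)
    also have "\<dots> = 2 * (K x1 / 2 - (K x1)^2 / (2 * NN)) + 2 * (K x2 / 2 - (K x2)^2 / (2 * NN))
        - min (K x1) (K x2)"
      using False by (auto simp: min_def field_simps power2_eq_square)
    finally show ?thesis unfolding c[OF False] .
  qed
  then have "corr a + corr b = 2 * corr x1 + 2 * corr x2 - min (K x1) (K x2)" unfolding corr_def .
  then show ?thesis using place_pair(1)[OF assms] unfolding lam_def by argo
qed

lemma lam_double:
  assumes f: "f = x^3 + A * x + B" and f0: "f \<noteq> 0"
    and a: "a * (4 * f) = (x^2 - A)^2 - 8 * B * x"
  shows "lam a = 4 * lam x + v f / 2"
proof -
  have "K a * (NN - K a) / (2 * NN) = 4 * (K x * (NN - K x) / (2 * NN)) - K x"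
  proof (cases "NN = 0")
    case True then show ?thesis by (simp add: K_def)
  next
    case False
    have "K a * (NN - K a) = 2 * K x * (NN - 2 * K x)"
      unfolding place_double(2)[OF assms] min_def by (auto simp: algebra_simps)
    then show ?thesis using False by (simp add: field_simps)
  qed
  then have "corr a = 4 * corr x - K x" unfolding corr_def .
  then show ?thesis using place_double(1)[OF assms] unfolding lam_def by argo
qed

end

section \<open>Distance to the nearest multiple\<close>

definition fr :: "real \<Rightarrow> real \<Rightarrow> real" where "fr N t = t - N * of_int \<lfloor>t / N\<rfloor>"
definition dst :: "real \<Rightarrow> real \<Rightarrow> real" where "dst N t = min (fr N t) (N - fr N t)"

lemma fr_bounds: assumes "N > 0" shows "0 \<le> fr N t" "fr N t < N"
proof -
  have "N * of_int \<lfloor>t / N\<rfloor> \<le> N * (t / N)" "N * (t / N) < N * (of_int \<lfloor>t / N\<rfloor> + 1)"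
    using assms by (intro mult_left_mono mult_strict_left_mono; linarith)+
  then show "0 \<le> fr N t" "fr N t < N" using assms by (simp_all add: fr_def field_simps)
qed

lemma fr_unique:
  assumes "N > 0" "t = N * of_int k + r" "0 \<le> r" "r < N" shows "fr N t = r"
proof -
  have e: "t / N = of_int k + r / N" using assms(1,2) by (simp add: add_divide_distrib)
  have "0 \<le> r / N" "r / N < 1" using assms by auto
  then have "\<lfloor>t / N\<rfloor> = k" unfolding e by (intro floor_unique) auto
  then show ?thesis using assms by (simp add: fr_def)
qed

lemma fr_decomp: "N > 0 \<Longrightarrow> \<exists>k::int. t = N * of_int k + fr N t"
  by (rule exI[of _ "\<lfloor>t / N\<rfloor>"]) (simp add: fr_def)

lemma dst_eqI:
  assumes N: "N > 0" and t: "t = N * of_int k + r \<or> t = N * of_int k - r" and r: "0 \<le> r" "r \<le> N"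
  shows "dst N t = min r (N - r)"
proof -
  consider "r = 0" | "r = N" | "0 < r" "r < N" using r by linarith
  then show ?thesis
  proof cases
    case 1
    then have "fr N t = 0" using fr_unique[OF N, of t k 0] t N by auto
    then show ?thesis using 1 N by (simp add: dst_def)
  next
    case 2
    then have "t = N * of_int (k + 1) + 0 \<or> t = N * of_int (k - 1) + 0" using t by (auto simp: algebra_simps)
    then have "fr N t = 0" using fr_unique[OF N, of t "k + 1" 0] fr_unique[OF N, of t "k - 1" 0] N by auto
    then show ?thesis using 2 N by (simp add: dst_def)
  next
    case 3
    from t show ?thesis
    proof
      assume "t = N * of_int k + r"
      then have "fr N t = r" using fr_unique[OF N] 3 by auto
      then show ?thesis by (simp add: dst_def)
    next
      assume "t = N * of_int k - r"
      then have "t = N * of_int (k - 1) + (N - r)" by (simp add: algebra_simps)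
      from fr_unique[OF N this] have "fr N t = N - r" using 3 by simp
      then show ?thesis by (simp add: dst_def)
    qed
  qed
qed

lemma dst_decomp: assumes "N > 0" shows "\<exists>k::int. t = N * of_int k + dst N t \<or> t = N * of_int k - dst N t"
proof -
  obtain k :: int where k: "t = N * of_int k + fr N t" using fr_decomp[OF assms] by blast
  have "t = N * of_int (k + 1) - (N - fr N t)" using k by (simp add: algebra_simps)
  then show ?thesis unfolding dst_def min_def using k by metis
qed

lemma dst_bounds: assumes "N > 0" shows "0 \<le> dst N t" "dst N t \<le> N / 2"
  using fr_bounds[OF assms, of t] by (auto simp: dst_def min_def)

lemma dst_self: "N > 0 \<Longrightarrow> 0 \<le> t \<Longrightarrow> t \<le> N / 2 \<Longrightarrow> dst N t = t"
  using dst_eqI[of N t 0 t] by simp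

lemma dst_mult_fr: "dst N t * (N - dst N t) = fr N t * (N - fr N t)"
  by (auto simp: dst_def min_def algebra_simps)

text \<open>Given the shape of the second part of \<open>place_pair\<close>, so that component
  indices can be matched with distances in \<open>K_seq\<close>.\<close>

lemma dst_pair:
  assumes N: "N > 0"
  shows "let u = min (dst N s + dst N t) (N - dst N s - dst N t); w = \<bar>dst N s - dst N t\<bar> in
    dst N (s + t) = u \<and> dst N (s - t) = w \<or> dst N (s - t) = u \<and> dst N (s + t) = w"
proof -
  define a b where "a = dst N s" and "b = dst N t"
  have ab: "0 \<le> a" "a \<le> N / 2" "0 \<le> b" "b \<le> N / 2" using dst_bounds[OF N] a_def b_def by auto
  obtain k l :: int where k: "s = N * of_int k + a \<or> s = N * of_int k - a"
    and l: "t = N * of_int l + b \<or> t = N * of_int l - b"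
    using dst_decomp[OF N] a_def b_def by metis
  have p: "dst N r = min (a + b) (N - (a + b))" if "r = N * of_int j + (a + b) \<or> r = N * of_int j - (a + b)" for r j
    using dst_eqI[OF N that] ab by auto
  have q: "dst N r = \<bar>a - b\<bar>" if "r = N * of_int j + (a - b) \<or> r = N * of_int j - (a - b)" for r j
  proof -
    have "r = N * of_int j + \<bar>a - b\<bar> \<or> r = N * of_int j - \<bar>a - b\<bar>" using that by (auto simp: abs_if)
    then have "dst N r = min \<bar>a - b\<bar> (N - \<bar>a - b\<bar>)" by (rule dst_eqI[OF N]) (use ab in auto)
    then show ?thesis using ab by auto
  qed
  have "dst N (s + t) = min (a + b) (N - (a + b)) \<and> dst N (s - t) = \<bar>a - b\<bar> \<or>
      dst N (s - t) = min (a + b) (N - (a + b)) \<and> dst N (s + t) = \<bar>a - b\<bar>"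
    using k l
  proof (elim disjE)
    assume "s = N * of_int k + a" "t = N * of_int l + b"
    then show ?thesis using p[of "s + t" "k + l"] q[of "s - t" "k - l"] by (simp add: algebra_simps)
  next
    assume "s = N * of_int k + a" "t = N * of_int l - b"
    then show ?thesis using q[of "s + t" "k + l"] p[of "s - t" "k - l"] by (simp add: algebra_simps)
  next
    assume "s = N * of_int k - a" "t = N * of_int l + b"
    then show ?thesis using q[of "s + t" "k + l"] p[of "s - t" "k - l"] by (simp add: algebra_simps)
  next
    assume "s = N * of_int k - a" "t = N * of_int l - b"
    then show ?thesis using p[of "s + t" "k + l"] q[of "s - t" "k - l"] by (simp add: algebra_simps)
  qed
  then show ?thesis unfolding a_def b_def Let_def by (simp add: algebra_simps)
qed

text \<open>\<open>d (N - d) / N\<close> is the squared distance of two translates of a sawtooth vector in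
  \<open>N\<close>-dimensional space; this makes the correction term a kernel of negative type.\<close>
lemma sawtooth_distance:
  fixes N :: nat and s t :: int
  assumes N: "N > 0"
  shows "(\<Sum>u<N. (real_of_int ((int u - s) mod int N) / N - real_of_int ((int u - t) mod int N) / N)^2)
    = real_of_int ((s - t) mod int N) * (N - real_of_int ((s - t) mod int N)) / N"
proof -
  define d where "d = nat ((s - t) mod int N)"
  have d: "(s - t) mod int N = int d" "d < N" using N by (auto simp: d_def nat_less_iff)
  \<comment> \<open>Moving the argument by d changes the sawtooth by d/N, or by d/N - 1 when it
    wraps around.\<close>
  define g where "g w = (if w + d < N then real d / N else real d / N - 1)^2" for w :: nat
  have bij: "bij_betw (\<lambda>u. nat ((int u - s) mod int N)) {..<N} {..<N}"
  proof (rule bij_betw_byWitness[where f' = "\<lambda>w. nat ((int w + s) mod int N)"])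
    show "\<forall>u\<in>{..<N}. nat ((int (nat ((int u - s) mod int N)) + s) mod int N) = u"
      using N by (auto simp: mod_simps)
    show "\<forall>w\<in>{..<N}. nat ((int (nat ((int w + s) mod int N)) - s) mod int N) = w"
      using N by (auto simp: mod_simps)
  qed (use N in \<open>auto simp: nat_less_iff\<close>)
  have "(\<Sum>u<N. (real_of_int ((int u - s) mod int N) / N - real_of_int ((int u - t) mod int N) / N)^2)
      = (\<Sum>u<N. g (nat ((int u - s) mod int N)))"
  proof (rule sum.cong[OF refl])
    fix u assume "u \<in> {..<N}"
    define w where "w = nat ((int u - s) mod int N)"
    have w: "(int u - s) mod int N = int w" "w < N" using N by (auto simp: w_def nat_less_iff)
    have "(int u - t) mod int N = (((int u - s) mod int N) + ((s - t) mod int N)) mod int N"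
      by (simp add: mod_simps)
    also have "\<dots> = (if w + d < N then int w + int d else int w + int d - int N)"
    proof -
      have e: "(int w + int d) mod int N = (int w + int d - int N) mod int N" by simp
      show ?thesis
      proof (cases "w + d < N")
        case False
        then have "(int w + int d - int N) mod int N = int w + int d - int N"
          using w(2) d(2) by (intro mod_pos_pos_trivial) auto
        from trans[OF e this] show ?thesis unfolding w d using False by simp
      qed (use w d in auto)
    qed
    finally have e: "(int u - t) mod int N = (if w + d < N then int w + int d else int w + int d - int N)" .
    have "real w / N - real_of_int (if w + d < N then int w + int d else int w + int d - int N) / N =
        - (if w + d < N then real d / N else real d / N - 1)"
      using N by (auto simp: field_simps)
    then show "(real_of_int ((int u - s) mod int N) / N - real_of_int ((int u - t) mod int N) / N)^2
        = g (nat ((int u - s) mod int N))"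
      unfolding e w(1) g_def by (simp add: power2_eq_square)
  qed
  also have "\<dots> = (\<Sum>w<N. g w)" by (rule sum.reindex_bij_betw[OF bij])
  also have "\<dots> = (\<Sum>w\<in>{..<N-d}. g w) + (\<Sum>w\<in>{N-d..<N}. g w)"
    using d(2) by (subst sum.union_disjoint[symmetric]) (auto intro!: sum.cong)
  also have "(\<Sum>w\<in>{..<N-d}. g w) = (\<Sum>w\<in>{..<N-d}. (real d / N)^2)"
    by (rule sum.cong) (auto simp: g_def)
  also have "(\<Sum>w\<in>{N-d..<N}. g w) = (\<Sum>w\<in>{N-d..<N}. (real d / N - 1)^2)"
    by (rule sum.cong) (auto simp: g_def)
  also have "(\<Sum>w\<in>{..<N-d}. (real d / N)^2) + (\<Sum>w\<in>{N-d..<N}. (real d / N - 1)^2) =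
      real d * (N - real d) / N"
    using d(2) N by (simp add: of_nat_diff field_simps power2_eq_square)
  finally show ?thesis using d(1) by simp
qed

text \<open>\<open>(N - 1) / (2 N)\<close> is the mean of the sawtooth; centring makes the norm used
  in \<open>negative_type\<close> as small as possible.\<close>

lemma sawtooth_norm:
  assumes "N > 0"
  shows "(\<Sum>u<N. (real u / N - (real N - 1) / (2 * N))^2) = (real N ^ 2 - 1) / (12 * N)"
proof -
  have "(\<Sum>u<n. (real u - c)^2) = real n * (real n - 1) * (2 * real n - 1) / 6 - c * (real n * (real n - 1)) + n * c^2" for n c
    by (induction n) (auto simp: field_simps power2_eq_square)
  note q = this[of "(real N - 1) / 2" N]
  have e: "(\<Sum>u<N. (real u - (real N - 1) / 2)^2) = real N * (real N ^ 2 - 1) / 12"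
    unfolding q by (simp add: field_simps power2_eq_square)
  have "(\<Sum>u<N. (real u / N - (real N - 1) / (2 * N))^2) = (\<Sum>u<N. (real u - (real N - 1) / 2)^2 / N^2)"
    using assms by (intro sum.cong) (auto simp: field_simps power2_eq_square)
  also have "\<dots> = real N * (real N ^ 2 - 1) / 12 / N^2"
    by (simp add: sum_divide_distrib[symmetric] e)
  also have "\<dots> = (real N ^ 2 - 1) / (12 * N)" using assms by (simp add: field_simps power2_eq_square)
  finally show ?thesis by simp
qed

text \<open>For M vectors of equal norm the squared distances sum to \<open>2 M\<close> times the
  sum of the squared norms, minus twice the squared norm of the vector sum; the last term is
  dropped.\<close>

lemma negative_type:
  fixes N M :: nat and t :: "nat \<Rightarrow> int"
  assumes N: "N > 0"
  shows "(\<Sum>i<M. \<Sum>j<M. real_of_int ((t i - t j) mod int N) * (N - real_of_int ((t i - t j) mod int N)) / N)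
    \<le> real M ^ 2 * (real N - 1 / N) / 6"
proof -
  define c where "c = (real N - 1) / (2 * N)"
  define S where "S i u = real_of_int ((int u - t i) mod int N) / N - c" for i u
  have nrm: "(\<Sum>u<N. (S i u)^2) = (real N ^ 2 - 1) / (12 * N)" for i
  proof -
    have bij: "bij_betw (\<lambda>u. nat ((int u - t i) mod int N)) {..<N} {..<N}"
    proof (rule bij_betw_byWitness[where f' = "\<lambda>w. nat ((int w + t i) mod int N)"])
      show "\<forall>u\<in>{..<N}. nat ((int (nat ((int u - t i) mod int N)) + t i) mod int N) = u"
        using N by (auto simp: mod_simps)
      show "\<forall>w\<in>{..<N}. nat ((int (nat ((int w + t i) mod int N)) - t i) mod int N) = w"
        using N by (auto simp: mod_simps)
    qed (use N in \<open>auto simp: nat_less_iff\<close>)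
    have "(\<Sum>u<N. (S i u)^2) = (\<Sum>u<N. (\<lambda>w. (real w / N - c)^2) (nat ((int u - t i) mod int N)))"
      using N by (intro sum.cong) (auto simp: S_def)
    also have "\<dots> = (\<Sum>w<N. (real w / N - c)^2)" by (rule sum.reindex_bij_betw[OF bij])
    finally show ?thesis using sawtooth_norm[OF N] by (simp add: c_def)
  qed
  have "(\<Sum>i<M. \<Sum>j<M. real_of_int ((t i - t j) mod int N) * (N - real_of_int ((t i - t j) mod int N)) / N)
      = (\<Sum>i<M. \<Sum>j<M. \<Sum>u<N. (S i u - S j u)^2)"
    unfolding sawtooth_distance[OF N, symmetric] S_def by simp
  also have "\<dots> = (\<Sum>u<N. \<Sum>i<M. \<Sum>j<M. (S i u - S j u)^2)"
  proof -
    have "(\<Sum>i<M. \<Sum>j<M. \<Sum>u<N. (S i u - S j u)^2) = (\<Sum>i<M. \<Sum>u<N. \<Sum>j<M. (S i u - S j u)^2)"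
      by (intro sum.cong refl sum.swap)
    also have "\<dots> = (\<Sum>u<N. \<Sum>i<M. \<Sum>j<M. (S i u - S j u)^2)" by (rule sum.swap)
    finally show ?thesis .
  qed
  also have "\<dots> \<le> (\<Sum>u<N. 2 * real M * (\<Sum>i<M. (S i u)^2))"
  proof (rule sum_mono)
    fix u assume "u \<in> {..<N}"
    have "(\<Sum>i<M. \<Sum>j<M. (S i u - S j u)^2) =
        (\<Sum>i<M. \<Sum>j<M. (S i u)^2 + (S j u)^2 - 2 * (S i u * S j u))"
      by (intro sum.cong refl) (simp add: power2_eq_square algebra_simps)
    also have "\<dots> = 2 * real M * (\<Sum>i<M. (S i u)^2) - 2 * (\<Sum>i<M. S i u)^2"
    proof -
      define Q T where "Q = (\<Sum>j<M. (S j u)^2)" and "T = (\<Sum>j<M. S j u)"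
      have "(\<Sum>j<M. (S i u)^2 + (S j u)^2 - 2 * (S i u * S j u)) = real M * (S i u)^2 + Q - 2 * T * S i u" for i
        unfolding sum_subtractf sum.distrib Q_def T_def
        by (simp add: sum_distrib_left mult.commute mult.left_commute)
      then have "(\<Sum>i<M. \<Sum>j<M. (S i u)^2 + (S j u)^2 - 2 * (S i u * S j u)) =
          (\<Sum>i<M. real M * (S i u)^2 + Q - 2 * T * S i u)" by simp
      also have "\<dots> = real M * Q + real M * Q - 2 * T * T"
        unfolding sum_subtractf sum.distrib sum_distrib_left[symmetric] Q_def[symmetric] T_def[symmetric] by simp
      finally show ?thesis unfolding Q_def T_def by (simp add: power2_eq_square)
    qed
    also have "\<dots> \<le> 2 * real M * (\<Sum>i<M. (S i u)^2)" by simp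
    finally show "(\<Sum>i<M. \<Sum>j<M. (S i u - S j u)^2) \<le> 2 * real M * (\<Sum>i<M. (S i u)^2)" .
  qed
  also have "\<dots> = 2 * real M * (\<Sum>i<M. \<Sum>u<N. (S i u)^2)"
    unfolding sum_distrib_left[symmetric] by (subst sum.swap) simp
  also have "\<dots> = real M ^ 2 * (real N - 1 / N) / 6"
    unfolding nrm using N by (simp add: field_simps power2_eq_square)
  finally show ?thesis .
qed

section \<open>Multiples of a point at one place\<close>

text \<open>Only the addition formulas, without a point: the interface also covers rescaled
  equations and subsequences \<open>X (c * j)\<close>.\<close>

locale ec_seq =
  fixes A B :: "'a::field_char_0" and X Y :: "nat \<Rightarrow> 'a"
  assumes curve: "n \<ge> 1 \<Longrightarrow> (Y n)^2 = (X n)^3 + A * X n + B"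
    and Y_ne_0: "n \<ge> 1 \<Longrightarrow> Y n \<noteq> 0"
    and X_inj: "m \<ge> 1 \<Longrightarrow> n \<ge> 1 \<Longrightarrow> m \<noteq> n \<Longrightarrow> X m \<noteq> X n"
    and X_add: "n \<ge> 1 \<Longrightarrow> m > n \<Longrightarrow>
      (X (m + n) + X (m - n)) * (X m - X n)^2 = 2 * ((X m * X n + A) * (X m + X n) + 2 * B)"
    and X_mult: "n \<ge> 1 \<Longrightarrow> m > n \<Longrightarrow>
      X (m + n) * X (m - n) * (X m - X n)^2 = (X m * X n - A)^2 - 4 * B * (X m + X n)"
    and X_double: "n \<ge> 1 \<Longrightarrow> X (2 * n) * (4 * (Y n)^2) = ((X n)^2 - A)^2 - 8 * B * X n"

sublocale nontorsion_point \<subseteq> ec_seq A B X Y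
  by (unfold_locales; rule curve Y_ne_0 X_inj X_add_sub X_double)

lemma (in ec_seq) scaled: 
  assumes "u \<noteq> 0"
  shows "ec_seq (A / u^4) (B / u^6) (\<lambda>n. X n / u^2) (\<lambda>n. Y n / u^3)"
proof
  fix m n :: nat
  assume n: "n \<ge> 1"
  have u: "u ^ 4 \<noteq> 0" "u^6 \<noteq> 0" "u^8 \<noteq> 0" "u^2 \<noteq> 0" "u^3 \<noteq> 0" using assms by auto
  show "Y n / u^3 \<noteq> 0" using Y_ne_0[OF n] assms by simp
  define p x y A' B' where "p = X (2 * n) / u^2" and "x = X n / u^2" and "y = Y n / u^3"
    and "A' = A / u^4" and "B' = B / u^6"
  have e: "X (2 * n) = u^2 * p" "X n = u^2 * x" "Y n = u^3 * y" "A = u^4 * A'" "B = u^6 * B'"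
    using assms by (auto simp: p_def x_def y_def A'_def B'_def)
  have "u^6 * y^2 = u^6 * (x^3 + A' * x + B')" using curve[OF n] e by algebra
  then have "y^2 = x^3 + A' * x + B'" using u(2) by simp
  then show "(Y n / u^3)^2 = (X n / u^2)^3 + A / u^4 * (X n / u^2) + B / u^6"
    unfolding x_def y_def A'_def B'_def .
  have "u^8 * (p * (4 * y^2)) = u^8 * ((x^2 - A')^2 - 8 * B' * x)" using X_double[OF n] e by algebra
  then have "p * (4 * y^2) = (x^2 - A')^2 - 8 * B' * x" using u(3) by simp
  then show "X (2 * n) / u^2 * (4 * (Y n / u^3)^2) = ((X n / u^2)^2 - A / u^4)^2 - 8 * (B / u^6) * (X n / u^2)"
    unfolding p_def x_def y_def A'_def B'_def .
  { assume m: "m \<ge> 1" "m \<noteq> n"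
    show "X m / u^2 \<noteq> X n / u^2" using X_inj[OF m(1) n m(2)] assms by simp }
  assume m: "m > n"
  define a b c d where "a = X (m + n) / u^2" and "b = X (m - n) / u^2" and "c = X m / u^2" and "d = X n / u^2"
  have e: "X (m + n) = u^2 * a" "X (m - n) = u^2 * b" "X m = u^2 * c" "X n = u^2 * d" "A = u^4 * A'" "B = u^6 * B'"
    using assms by (auto simp: a_def b_def c_def d_def A'_def B'_def)
  have "u^6 * ((a + b) * (c - d)^2) = u^6 * (2 * ((c * d + A') * (c + d) + 2 * B'))"
    using X_add[OF n m] e by algebra
  then have "(a + b) * (c - d)^2 = 2 * ((c * d + A') * (c + d) + 2 * B')" using u(2) by simp
  then show "(X (m + n) / u^2 + X (m - n) / u^2) * (X m / u^2 - X n / u^2)^2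
      = 2 * ((X m / u^2 * (X n / u^2) + A / u^4) * (X m / u^2 + X n / u^2) + 2 * (B / u^6))"
    unfolding a_def b_def c_def d_def A'_def B'_def .
  have "u^8 * (a * b * (c - d)^2) = u^8 * ((c * d - A')^2 - 4 * B' * (c + d))"
    using X_mult[OF n m] e by algebra
  then have "a * b * (c - d)^2 = (c * d - A')^2 - 4 * B' * (c + d)" using u(3) by simp
  then show "X (m + n) / u^2 * (X (m - n) / u^2) * (X m / u^2 - X n / u^2)^2
      = (X m / u^2 * (X n / u^2) - A / u^4)^2 - 4 * (B / u^6) * (X m / u^2 + X n / u^2)"
    unfolding a_def b_def c_def d_def A'_def B'_def .
qed

text \<open>The bounds on \<open>mu\<close> say that the equation is integral and minimal at
  v.\<close>

locale place_seq = place v A B + ec_seq A B X Y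
  for v :: "'a::field_char_0 \<Rightarrow> real" and A B X Y +
  assumes mu0: "0 \<le> mu" and mu1: "mu < 1"
begin

lemma vY: "n \<ge> 1 \<Longrightarrow> v ((X n)^3 + A * X n + B) = 2 * v (Y n)"
  using curve[of n] Y_ne_0[of n] v_power[of "Y n" 2] by simp

lemma f_nz: "n \<ge> 1 \<Longrightarrow> (X n)^3 + A * X n + B \<noteq> 0" by (metis curve Y_ne_0 power_not_zero)

lemma f_parity: assumes "n \<ge> 1" "veq k ((X n)^3 + A * X n + B)" shows "k / 2 \<in> \<int>"
proof -
  have "k / 2 = v (Y n)" using vY[OF assms(1)] veqD[OF assms(2)] by simp
  then show ?thesis using v_int[OF Y_ne_0[OF assms(1)]] by simp
qed

lemma lam_add_seq: "n \<ge> 1 \<Longrightarrow> m > n \<Longrightarrow>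
    lam (X (m + n)) + lam (X (m - n)) = 2 * lam (X m) + 2 * lam (X n) + v (X m - X n)"
  by (rule lam_pair[OF X_inj X_add X_mult]) auto

lemma lam_double_seq: assumes "n \<ge> 1" shows "lam (X (2 * n)) = 4 * lam (X n) + v (Y n)"
  using lam_double[OF refl f_nz[OF assms], of "X (2 * n)"] X_double[OF assms] curve[OF assms] vY[OF assms]
  by simp

text \<open>\<open>place_pair\<close> gives only the unordered pair of indices at m + 1 and m - 1.
  As the index at m - 1 is known by induction, the other one is determined.\<close>

lemma K_seq:
  assumes N: "NN > 0" shows "n \<ge> 1 \<Longrightarrow> K (X n) = dst NN (n * K (X 1))"
proof (induction n rule: less_induct)
  case (less n)
  define k where "k = K (X 1)"
  have k: "0 \<le> k" "k \<le> NN / 2" using kap_nonneg kap_le[of NN] N unfolding k_def K_def by auto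
  have dk: "dst NN k = k" using dst_self[OF N k] .
  consider "n = 1" | "n = 2" | "n \<ge> 3" using less.prems by linarith
  then show ?case
  proof cases
    case 1 then show ?thesis using dk k_def by simp
  next
    case 2
    have f1: "(X 1)^3 + A * X 1 + B \<noteq> 0" using f_nz[of 1] by simp
    have "K (X 2) = min (2 * k) (NN - 2 * k)"
      using place_double(2)[OF refl f1, of "X 2"] X_double[of 1] curve[of 1] k_def by simp
    moreover have "dst NN (2 * k) = min (2 * k) (NN - 2 * k)"
      using dst_eqI[OF N, of "2 * k" 0 "2 * k"] k by simp
    ultimately show ?thesis using 2 k_def by simp
  next
    case 3
    define m where "m = n - 1"
    have m: "m > 1" "m + 1 = n" "m - 1 \<ge> 1" using 3 by (auto simp: m_def)
    have I: "K (X m) = dst NN (m * k)" "K (X (m - 1)) = dst NN (m * k - k)" "K (X 1) = dst NN k"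
      using less.IH[of m] less.IH[of "m - 1"] m dk k_def by (auto simp: of_nat_diff algebra_simps)
    have "K (X n) = dst NN (m * k + k)"
    proof -
      have ne: "X m \<noteq> X 1" using X_inj[of m 1] m by auto
      have "(let u = min (K (X m) + K (X 1)) (NN - K (X m) - K (X 1)); w = \<bar>K (X m) - K (X 1)\<bar> in
          K (X (m + 1)) = u \<and> K (X (m - 1)) = w \<or> K (X (m - 1)) = u \<and> K (X (m + 1)) = w)"
        by (rule place_pair(2)[OF ne X_add X_mult]) (use m in auto)
      with dst_pair[OF N, of "m * k" k] show ?thesis
        unfolding Let_def I m(2) by (elim disjE conjE) auto
    qed
    then show ?thesis unfolding k_def[symmetric] m(2)[symmetric] by (simp add: algebra_simps)
  qed
qed

lemma K_bounds: "0 \<le> K x" "K x \<le> NN / 2"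
  using kap_nonneg kap_le[OF NN_nonneg] NN_nonneg by (auto simp: K_def)

lemma corr_bounds: "0 \<le> corr x" "corr x \<le> NN / 8"
proof -
  show "0 \<le> corr x" using K_bounds[of x] NN_nonneg by (simp add: corr_def)
  show "corr x \<le> NN / 8"
  proof (cases "NN = 0")
    case False
    then have N: "NN > 0" using NN_nonneg by simp
    have "0 \<le> (NN / 2 - K x)^2" by simp
    then have "K x * (NN - K x) \<le> NN^2 / 4" by (simp add: power2_eq_square field_simps)
    then have "K x * (NN - K x) / (2 * NN) \<le> NN^2 / 4 / (2 * NN)" using N by (intro divide_right_mono) auto
    then show ?thesis using N by (simp add: corr_def power2_eq_square)
  qed (simp add: corr_def)
qed

lemma K_zero: assumes "x \<noteq> 0" "v x < 2 * mu" shows "K x = 0"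
proof (cases "NN = 0")
  case False
  then have N: "NN > 0" using NN_nonneg by simp
  have "veq (v x) (x - ee)" using veq_diff[OF veq_v vge_vgt[OF veq_vge[OF ee[OF N]]]] assms by auto
  then have "veq (v x - 2 * mu) ((x - ee) / ee)" by (rule veq_divide[OF _ ee[OF N]])
  then show ?thesis using kap_zeroI(1)[of "v x - 2 * mu" _ NN] assms N by (simp add: K_def)
qed (simp add: K_def)

text \<open>Order of contact with the zero section.\<close>

definition beta :: "'a \<Rightarrow> real" where "beta x = (if x = 0 then 0 else max 0 (- v x / 2))"
text \<open>Fibre correction: it is nonnegative and vanishes for points of nonsingular reduction
  (\<open>good_eps\<close>).\<close>

definition eps :: "'a \<Rightarrow> real" where "eps x = beta x - lam x"

lemma beta_nonneg: "0 \<le> beta x" by (simp add: beta_def)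
lemma beta_pos: "0 < beta x \<longleftrightarrow> x \<noteq> 0 \<and> v x < 0" by (auto simp: beta_def)

lemma eps_neg: assumes "x \<noteq> 0" "v x < 0" shows "eps x = 0"
proof -
  have "K x = 0" using K_zero assms mu0 by auto
  moreover have "vmin (2 * mu) x = v x" using assms mu0 by (simp add: vmin_def)
  ultimately show ?thesis using assms by (simp add: eps_def beta_def lam_def U_def corr_def diff_divide_distrib)
qed

lemma eps_nonneg_val: assumes "vge 0 x" shows "eps x = vmin (2 * mu) x / 2 + corr x"
proof -
  have "beta x = 0" using assms by (auto simp: beta_def vge_def)
  then show ?thesis unfolding eps_def lam_def U_def by argo
qed

lemma eps_bounds: "0 \<le> eps x" "eps x \<le> mu + corr x"
proof -
  show "0 \<le> eps x"
  proof (cases "vge 0 x")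
    case True
    then have "0 \<le> vmin (2 * mu) x" using mu0 by (auto simp: vmin_def vge_def)
    then show ?thesis using eps_nonneg_val[OF True] corr_bounds[of x] by simp
  qed (use eps_neg[of x] in \<open>auto simp: vge_def\<close>)
  show "eps x \<le> mu + corr x"
  proof (cases "vge 0 x")
    case True
    then show ?thesis using eps_nonneg_val[OF True] vmin_le[of "2 * mu" x] by simp
  next
    case False
    then have "eps x = 0" using eps_neg[of x] by (auto simp: vge_def)
    then show ?thesis using corr_bounds[of x] mu0 by simp
  qed
qed

lemma eps_le: "eps x \<le> mu + NN / 8" using eps_bounds(2)[of x] corr_bounds(2)[of x] by simp

end

section \<open>Residues of integral elements\<close>

context valuation
begin

text \<open>\<open>cg z q\<close>: the residue of \<open>z\<close> is the rational number \<open>q\<close>.\<close>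
definition cg :: "'a \<Rightarrow> rat \<Rightarrow> bool" where "cg z q \<longleftrightarrow> vgt 0 (z - of_rat q)"

lemma v_of_rat: "q \<noteq> 0 \<Longrightarrow> v (of_rat q) = 0"
proof (cases q)
  case (Fract a b)
  assume q: "q \<noteq> 0"
  have i: "v (of_int k) = 0" if "k \<noteq> 0" for k
  proof (cases "k \<ge> 0")
    case True
    then show ?thesis using v_of_nat[of "nat k"] that by simp
  next
    case False
    then show ?thesis using v_of_nat[of "nat (- k)"] v_minus[of "of_int (- k)"] by simp
  qed
  have "a \<noteq> 0" using q Fract by (auto simp: rat_number_collapse)
  then show ?thesis using Fract i[of a] i[of b] v_divide[of "of_int a" "of_int b"] by (simp add: of_rat_rat)
qed

lemma vge_of_rat: "vge 0 (of_rat q)" using v_of_rat[of q] by (cases "q = 0") (auto simp: vge_def)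

lemma cg_of_rat: "cg (of_rat q) q" by (simp add: cg_def)
lemma cg_numeral: "cg (numeral n) (numeral n)" "cg 1 1" "cg 0 0"
  using cg_of_rat[of "numeral n"] cg_of_rat[of 1] cg_of_rat[of 0] by auto
lemma cg_vge: "cg z q \<Longrightarrow> vge 0 z"
  using vge_add[OF vgt_vge, of 0 "z - of_rat q" "of_rat q"] vge_of_rat[of q] by (simp add: cg_def)
lemma cg_add: "cg z q \<Longrightarrow> cg w r \<Longrightarrow> cg (z + w) (q + r)"
  using vgt_add[of 0 "z - of_rat q" "w - of_rat r"] by (simp add: cg_def of_rat_add algebra_simps)
lemma cg_diff: "cg z q \<Longrightarrow> cg w r \<Longrightarrow> cg (z - w) (q - r)"
  using vgt_diff[of 0 "z - of_rat q" "w - of_rat r"] by (simp add: cg_def of_rat_diff algebra_simps)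
lemma cg_uminus: "cg z q \<Longrightarrow> cg (- z) (- q)"
  using cg_diff[OF cg_numeral(3), of z q] by simp
lemma cg_mult: assumes "cg z q" "cg w r" shows "cg (z * w) (q * r)"
proof -
  have "vgt (0 + 0) ((z - of_rat q) * w)" using assms(1) cg_vge[OF assms(2)] by (intro vgt_vge_mult) (auto simp: cg_def)
  moreover have "vgt (0 + 0) ((w - of_rat r) * of_rat q)"
    using assms(2) vge_of_rat by (intro vgt_vge_mult) (auto simp: cg_def)
  ultimately have "vgt 0 ((z - of_rat q) * w + (w - of_rat r) * of_rat q)" by (intro vgt_add) auto
  then show ?thesis by (simp add: cg_def of_rat_mult algebra_simps)
qed
lemma cg_power: "cg z q \<Longrightarrow> cg (z ^ n) (q ^ n)"
  by (induction n) (auto intro: cg_mult cg_numeral)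
lemma cg_nz: assumes "cg z q" "q \<noteq> 0" shows "veq 0 z"
proof -
  have "veq 0 (of_rat q)" using assms(2) v_of_rat[of q] by (simp add: veq_def)
  from veq_add[OF this, of "z - of_rat q"] show ?thesis using assms(1) by (simp add: cg_def)
qed
lemma cg_inverse: assumes "cg z q" "q \<noteq> 0" shows "cg (inverse z) (inverse q)"
proof -
  have z: "veq 0 z" using cg_nz[OF assms] .
  then have z0: "z \<noteq> 0" by (simp add: veq_def)
  have "vgt (0 - (0 + 0)) ((of_rat q - z) / (z * of_rat q))"
    using assms z v_of_rat[of q] vgt_uminus[of 0 "z - of_rat q"]
    by (intro vgt_divide veq_mult) (auto simp: cg_def veq_def)
  also have "(of_rat q - z) / (z * of_rat q) = inverse z - of_rat (inverse q)"
    using z0 assms(2) unfolding of_rat_inverse by (simp add: field_simps)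
  finally show ?thesis by (simp add: cg_def)
qed
lemma cg_divide: "cg z q \<Longrightarrow> cg w r \<Longrightarrow> r \<noteq> 0 \<Longrightarrow> cg (z / w) (q / r)"
  using cg_mult[OF _ cg_inverse] by (simp add: divide_inverse)
lemma cg_0: "cg z 0 \<longleftrightarrow> vgt 0 z" by (simp add: cg_def)

lemma v_int_ex: "x \<noteq> 0 \<Longrightarrow> \<exists>i::int. v x = of_int i" using v_int[of x] by (auto elim!: Ints_cases)

lemma vge_int: assumes "vge k x" "k > of_int j - 1" shows "vge (of_int j) x"
proof (cases "x = 0")
  case False
  then obtain i :: int where i: "v x = of_int i" using v_int_ex by blast
  then have "real_of_int i > of_int (j - 1)" using assms False by (simp add: vge_def)
  then show ?thesis using i by (simp add: vge_def)
qed simp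

lemma vgt_int: assumes "vgt (of_int j) x" shows "vge (of_int j + 1) x"
proof (cases "x = 0")
  case False
  then obtain i :: int where i: "v x = of_int i" using v_int_ex by blast
  then have "j < i" using assms False by (simp add: vgt_def)
  then have "real_of_int (j + 1) \<le> real_of_int i" by simp
  then show ?thesis using i by (simp add: vge_def)
qed simp

end

section \<open>Fibre components and nonsingular reduction\<close>

context place_seq
begin

text \<open>For \<open>mu > 0\<close> the reduction is \<open>y^2 = x^3\<close>, and the condition
  says that the point avoids the cusp at the origin.\<close>

definition nsg :: "'a \<Rightarrow> bool" where "nsg x \<longleftrightarrow> x \<noteq> 0 \<and> v x \<le> 0"

lemma nsg_eps: "nsg x \<Longrightarrow> mu > 0 \<Longrightarrow> eps x = 0"
proof -
  assume x: "nsg x" and m: "mu > 0"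
  have "K x = 0" using K_zero x m by (auto simp: nsg_def)
  moreover have "vmin (2 * mu) x = v x" using x m by (simp add: vmin_def nsg_def)
  ultimately show ?thesis using x
    by (simp add: eps_def beta_def lam_def U_def corr_def diff_divide_distrib nsg_def)
qed

lemma nsg_lam: assumes "mu > 0" "NN = 0" "0 \<le> lam x" shows "nsg x"
proof -
  have "vmin (2 * mu) x \<le> 0" using assms(3) unfolding lam_def U_def corr_def assms(2) by simp
  then show ?thesis using assms(1) by (auto simp: vmin_def nsg_def min_def split: if_splits)
qed

text \<open>The smooth points of the cuspidal cubic form a group. In coordinates: A and B reduce to
  0, \<open>F2\<close> is dominated by \<open>(x1 * x2)^2\<close>, and \<open>roots_nonpos\<close>
  applies.\<close>

lemma nsg_pair:
  assumes m: "mu > 0" and ne: "x1 \<noteq> x2" and n1: "nsg x1" and n2: "nsg x2"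
    and s: "(a + b) * (x1 - x2)^2 = 2 * ((x1 * x2 + A) * (x1 + x2) + 2 * B)"
    and p: "a * b * (x1 - x2)^2 = (x1 * x2 - A)^2 - 4 * B * (x1 + x2)"
  shows "nsg a"
proof -
  define m1 m2 d where "m1 = - v x1" and "m2 = - v x2" and "d = v (x1 - x2)"
  have mm: "m1 \<ge> 0" "m2 \<ge> 0" using n1 n2 by (auto simp: m1_def m2_def nsg_def)
  have x1: "veq (- m1) x1" and x2: "veq (- m2) x2" using n1 n2 by (auto simp: m1_def m2_def nsg_def veq_def)
  note g1 = veq_vge[OF x1] and g2 = veq_vge[OF x2]
  have A0: "vgt 0 A" and B0: "vgt 0 B" using vge_vgt[OF vA, of 0] vge_vgt[OF vB, of 0] m by auto
  have dd: "veq d (x1 - x2)" using ne by (simp add: d_def veq_def)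
  have F0: "veq (2 * d) ((x1 - x2)^2)" using veq_power[OF dd, of 2] by simp
  have "vge (- m1 - m2) (x1 - x2)"
    using vge_mono[OF g1, of "- m1 - m2"] vge_mono[OF g2, of "- m1 - m2"] mm by (auto intro!: vge_diff)
  then have dm: "d \<ge> - m1 - m2" using dd by (auto simp: vge_def veq_def)
  define F1 where "F1 = 2 * ((x1 * x2 + A) * (x1 + x2) + 2 * B)"
  define F2 where "F2 = (x1 * x2 - A)^2 - 4 * B * (x1 + x2)"
  have F1e: "F1 = 2 * (x1 * x2 * x1 + x1 * x2 * x2 + A * x1 + A * x2 + 2 * B)"
    unfolding F1_def by algebra
  have F2e: "F2 = (x1 * x2)^2 + (A * A - 2 * (A * (x1 * x2)) - 4 * (B * x1) - 4 * (B * x2))"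
    unfolding F2_def by algebra
  define k where "k = - 2 * m1 - 2 * m2"
  note x12 = vge_mult[OF g1 g2]
  have Ag: "vge 0 A" "vge 0 B" using A0 B0 vgt_vge by auto
  have F1: "vge k F1"
    unfolding F1e vge_cmult k_def
    using vge_mono[OF vge_mult[OF x12 g1], of k] vge_mono[OF vge_mult[OF x12 g2], of k]
      vge_mono[OF vge_mult[OF Ag(1) g1], of k] vge_mono[OF vge_mult[OF Ag(1) g2], of k] vge_mono[OF Ag(2), of k] mm
    unfolding k_def by (intro vge_add) auto
  have F2: "veq k F2"
  proof -
    have "veq k ((x1 * x2)^2)" using veq_power[OF veq_mult[OF x1 x2], of 2] by (simp add: k_def algebra_simps)
    moreover have "vgt k (A * A - 2 * (A * (x1 * x2)) - 4 * (B * x1) - 4 * (B * x2))"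
      using vgt_mono[OF vgt_vge_mult[OF A0 Ag(1)], of k] vgt_mono[OF vgt_vge_mult[OF A0 x12], of k]
        vgt_mono[OF vgt_vge_mult[OF B0 g1], of k] vgt_mono[OF vgt_vge_mult[OF B0 g2], of k] mm
      unfolding k_def by (intro vgt_diff) auto
    ultimately show ?thesis unfolding F2e by (rule veq_add)
  qed
  have ne0: "(x1 - x2)^2 \<noteq> 0" using ne by simp
  have s': "a + b = F1 / (x1 - x2)^2" using s ne0 unfolding F1_def by (simp add: field_simps)
  have p': "a * b = F2 / (x1 - x2)^2" using p ne0 unfolding F2_def by (simp add: field_simps)
  have gs: "vge (k - 2 * d) (a + b)" unfolding s' by (rule vge_divide[OF F1 F0])
  have gp: "veq (k - 2 * d) (a * b)" unfolding p' by (rule veq_divide[OF F2 F0])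
  show ?thesis using roots_nonpos[OF gs gp] dm by (simp add: nsg_def k_def)
qed

lemma nsg_double:
  assumes m: "mu > 0" and n: "n \<ge> 1" "nsg (X n)"
  shows "nsg (X (2 * n))"
proof -
  define x where "x = X n"
  define k where "k = v x"
  have x: "veq k x" "k \<le> 0" using n by (auto simp: x_def k_def veq_def nsg_def)
  note g = veq_vge[OF x(1)]
  have A0: "vgt 0 A" and B0: "vgt 0 B" using vge_vgt[OF vA, of 0] vge_vgt[OF vB, of 0] m by auto
  have Ag: "vge 0 A" "vge 0 B" using A0 B0 vgt_vge by auto
  have f: "veq (3 * k) (x^3 + (A * x + B))"
    using veq_power[OF x(1), of 3] vgt_mono[OF vgt_vge_mult[OF A0 g], of "3 * k"] vgt_mono[OF B0, of "3 * k"] x(2)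
    by (intro veq_add vgt_add) auto
  have "veq (4 * k) (x^4 + (A * A - 2 * (A * x^2) - 8 * (B * x)))"
    using veq_power[OF x(1), of 4] vgt_mono[OF vgt_vge_mult[OF A0 Ag(1)], of "4 * k"]
      vgt_mono[OF vgt_vge_mult[OF A0 vge_power[OF g, of 2]], of "4 * k"]
      vgt_mono[OF vgt_vge_mult[OF B0 g], of "4 * k"] x(2)
    by (intro veq_add vgt_diff) auto
  also have "x^4 + (A * A - 2 * (A * x^2) - 8 * (B * x)) = (x^2 - A)^2 - 8 * B * x" by algebra
  finally have G: "veq (4 * k) ((x^2 - A)^2 - 8 * B * x)" .
  have f4: "veq (3 * k) (4 * (Y n)^2)" using f unfolding curve[OF n(1)] veq_cmult by (simp add: x_def add.assoc)
  have "X (2 * n) = ((x^2 - A)^2 - 8 * B * x) / (4 * (Y n)^2)"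
    using X_double[OF n(1)] Y_ne_0[OF n(1)] by (simp add: x_def field_simps)
  then have "veq (4 * k - 3 * k) (X (2 * n))" using veq_divide[OF G f4] by simp
  then show ?thesis using x(2) by (simp add: nsg_def veq_def)
qed

lemma nsg_multiples:
  assumes m: "mu > 0" and n: "n \<ge> 1" "nsg (X n)"
  shows "k \<ge> 1 \<Longrightarrow> nsg (X (k * n))"
proof (induction k rule: less_induct)
  case (less k)
  consider "k = 1" | "k = 2" | "k \<ge> 3" using less.prems by linarith
  then show ?case
  proof cases
    case 1 then show ?thesis using n by simp
  next
    case 2 then show ?thesis using nsg_double[OF m n] by simp
  next
    case 3
    define j where "j = k - 1"
    have j: "j \<ge> 2" "k = j + 1" using 3 by (auto simp: j_def)
    have jn: "j * n > n" "j * n \<ge> 1" using j n by (auto simp: mult_strict_right_mono)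
    have "nsg (X (j * n))" using less.IH[of j] j by simp
    have ne: "X (j * n) \<noteq> X n" using X_inj[of "j * n" n] jn n by auto
    have "nsg (X (j * n + n))"
      by (rule nsg_pair[OF m ne \<open>nsg (X (j * n))\<close> n(2) X_add X_mult]) (use jn n in auto)
    then show ?thesis using j by (simp add: algebra_simps)
  qed
qed

text \<open>Component groups of additive, potentially good fibres have exponent 1, 2 or 3. If nP,
  2nP and 3nP all met the cusp, their local heights would be negative, and duplication would force
  \<open>v (Y n) < 4 * mu\<close>. The seven possible values of \<open>mu\<close> are excluded by
  this bound, by the parity of \<open>v f\<close>, or by the height of 3nP.\<close>

lemma good_multiple_6:
  assumes m: "mu > 0" and N: "NN = 0" and n: "n \<ge> 1"
  shows "nsg (X n) \<or> nsg (X (2 * n)) \<or> nsg (X (3 * n))"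
proof (rule ccontr)
  assume neg: "\<not> ?thesis"
  define x f w where "x = X n" and "f = x^3 + A * x + B" and "w = v (Y n)"
  have x1: "vge 1 x"
    using vgt_int[of 0 x] neg unfolding x_def nsg_def vgt_def by auto
  have w: "w \<in> \<int>" using v_int[OF Y_ne_0[OF n]] w_def by simp
  have fw: "v f = 2 * w" "f \<noteq> 0" using vY[OF n] f_nz[OF n] by (auto simp: f_def x_def w_def)
  have par: False if "veq k f" "k / 2 \<notin> \<int>" for k using f_parity[OF n] that by (auto simp: f_def x_def)
  have lam_ge: "- mu \<le> lam y" for y using vmin_le[of "2 * mu" y] by (simp add: lam_def U_def corr_def N)
  have l2: "lam (X (2 * n)) = 4 * lam x + w" using lam_double_seq[OF n] by (simp add: x_def w_def)
  have l2n: "lam (X (2 * n)) < 0" "lam (X (3 * n)) < 0" using neg nsg_lam[OF m N] by (meson linorder_not_le)+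
  have w4: "w < 4 * mu" using l2 l2n lam_ge[of x] by linarith
  have three: "lam (X (3 * n)) + lam x = 2 * lam (X (2 * n)) + 2 * lam x + v (X (2 * n) - x)"
    using lam_add_seq[of n "2 * n"] n by (simp add: x_def algebra_simps numeral_3_eq_3)
  have ne: "X (2 * n) \<noteq> x" using X_inj[of "2 * n" n] n by (simp add: x_def)
  have lam_top: "lam y = - mu" if "vge (2 * mu) y" for y
    using vmin_topI[OF that] by (simp add: lam_def U_def corr_def N)
  have lam_top': "vge (2 * mu) y" if "lam y = - mu" for y
    using vge_vmin[of "2 * mu" y] that by (simp add: lam_def U_def corr_def N)
  have fge: "k \<le> 2 * w" if "vge k f" for k using that fw by (simp add: vge_def)
  have fsum: "vge k f" if "vge a x" "vge b A" "vge c B" "k \<le> 3 * a" "k \<le> a + b" "k \<le> c" for a b c k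
    unfolding f_def using vge_mono[OF vge_power[OF that(1), of 3], of k]
      vge_mono[OF vge_mult[OF that(2,1)], of k] vge_mono[OF that(3), of k] that(4-6)
    by (intro vge_add) auto
  have feqB: "veq k f" if "vge a x" "vge b A" "veq k B" "k < 3 * a" "k < a + b" for a b k
  proof -
    have "veq k (B + (x^3 + A * x))"
      using vge_vgt[OF vge_power[OF that(1), of 3], of k] vge_vgt[OF vge_mult[OF that(2,1)], of k] that
      by (intro veq_add vgt_add) auto
    then show ?thesis unfolding f_def by (simp add: algebra_simps)
  qed
  have feqx: "veq 3 f" if "veq 1 x" "vge 3 A" "vge 4 B"
  proof -
    have "veq 3 (x^3 + (A * x + B))"
      using veq_power[OF that(1), of 3] vge_vgt[OF vge_mult[OF that(2) veq_vge[OF that(1)]], of 3] vge_vgt[OF that(3), of 3]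
      by (intro veq_add vgt_add) auto
    then show ?thesis unfolding f_def by (simp add: add.assoc)
  qed
  have odd: "(1::real) / 2 \<notin> \<int>" "(3::real) / 2 \<notin> \<int>" "(5::real) / 2 \<notin> \<int>"
    by (auto elim!: Ints_cases simp: field_simps)
  have wint: "w \<ge> of_int j" if "w > of_int j - 1" for j :: int
    using w that by (auto elim!: Ints_cases)
  have x2: "vge 2 x" if "vge 3 A" "vge 4 B"
  proof -
    have "\<not> veq 1 x" using feqx par odd that by blast
    then have "vgt 1 x" using x1 vge_or_vgt by blast
    then show ?thesis using vgt_int[of 1 x] by simp
  qed
  consider (a) "veq (4 * mu) A" | (b) "veq (6 * mu) B" using v_or by blast
  then show False
  proof cases
    case a
    \<comment> \<open>\<open>mu\<close> is 1/4, 1/2 or 3/4: Kodaira types III, I_0^*, III^*.\<close>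
    then have "4 * mu \<in> \<int>" using v_int[of A] by (auto simp: veq_def)
    then obtain i where i: "4 * mu = of_int i" by (auto elim: Ints_cases)
    have "0 < i" "i < 4" using i m mu1 by linarith+
    then consider "i = 1" | "i = 2" | "i = 3" by linarith
    then show False
    proof cases
      case 1
      then have mu: "mu = 1/4" using i by simp
      have "vge 2 f" by (rule fsum[OF x1 vA vge_int[OF vB, of 2]]) (use mu in auto)
      then show False using fge[of 2] w4 mu by simp
    next
      case 2
      then have mu: "mu = 1/2" using i by simp
      have "vge 3 f" by (rule fsum[OF x1 vA vB]) (use mu in auto)
      then show False using fge[of 3] w4 mu wint[of 2] by simp
    next
      case 3
      then have mu: "mu = 3/4" using i by simp
      have B5: "vge 5 B" using vge_int[OF vB, of 5] mu by simp
      have A3: "vge 3 A" using vA mu by simp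
      have "vge 5 f" by (rule fsum[OF x2 A3 B5]) (use A3 vge_mono[OF B5] in auto)
      then show False using fge[of 5] w4 mu wint[of 3] by simp
    qed
  next
    case b
    \<comment> \<open>\<open>mu\<close> is i/6 with i from 1 to 5: Kodaira types II, IV, I_0^*,
      IV^*, II^*.\<close>
    then have "6 * mu \<in> \<int>" using v_int[of B] by (auto simp: veq_def)
    then obtain i where i: "6 * mu = of_int i" by (auto elim: Ints_cases)
    have "0 < i" "i < 6" using i m mu1 by linarith+
    then consider "i = 1" | "i = 2" | "i = 3" | "i = 4" | "i = 5" by linarith
    then show False
    proof cases
      case 1
      then have mu: "mu = 1/6" using i by simp
      have "veq 1 f" by (rule feqB[OF x1 vA]) (use b mu in auto)
      then show False using par odd by blast
    next
      \<comment> \<open>Type IV has a component group of order 3: 2nP still meets the cusp, and only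
        the height of 3nP contradicts. Type IV^* (\<open>mu = 2/3\<close>) is similar.\<close>
      case 2
      then have mu: "mu = 1/3" using i by simp
      have "veq 2 f" by (rule feqB[OF x1 vA]) (use b mu in auto)
      then have w1: "w = 1" using fw by (simp add: veq_def)
      have lx: "lam x = - mu" by (rule lam_top) (use vge_mono[OF x1] mu in auto)
      then have "lam (X (2 * n)) = - mu" using l2 w1 mu by simp
      from vge_int[OF lam_top'[OF this], of 1] have "vge 1 (X (2 * n))" using mu by simp
      from vge_diff[OF this x1] have "v (X (2 * n) - x) \<ge> 1" using ne by (simp add: vge_def)
      then show False using three lx l2 w1 mu l2n by simp
    next
      case 3
      then have mu: "mu = 1/2" using i by simp
      have "vge 3 f" by (rule fsum[OF x1 vA vB]) (use mu in auto)
      then show False using fge[of 3] w4 mu wint[of 2] by simp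
    next
      case 4
      then have mu: "mu = 2/3" using i by simp
      have A3: "vge 3 A" using vge_int[OF vA, of 3] mu by simp
      have B4: "vge 4 B" using veq_vge[OF b] mu by simp
      have "veq 4 f" by (rule feqB[OF x2[OF A3 B4] A3]) (use b mu in auto)
      then have w1: "w = 2" using fw by (simp add: veq_def)
      have lx: "lam x = - mu" by (rule lam_top) (use vge_mono[OF x2[OF A3 B4]] mu in auto)
      then have "lam (X (2 * n)) = - mu" using l2 w1 mu by simp
      from vge_int[OF lam_top'[OF this], of 2] have "vge 2 (X (2 * n))" using mu by simp
      from vge_diff[OF this x2[OF A3 B4]] have "v (X (2 * n) - x) \<ge> 2" using ne by (simp add: vge_def)
      then show False using three lx l2 w1 mu l2n by simp
    next
      case 5
      then have mu: "mu = 5/6" using i by simp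
      have A3: "vge 4 A" using vge_int[OF vA, of 4] mu by simp
      have B4: "vge 5 B" using veq_vge[OF b] mu by simp
      have "veq 5 f" by (rule feqB[OF x2 A3]) (use b mu A3 B4 vge_mono in auto)
      then show False using par odd by blast
    qed
  qed
qed

lemma eps_6: assumes N: "NN = 0" and n: "n \<ge> 1" shows "eps (X (6 * n)) = 0"
proof (cases "mu > 0")
  case True
  have "nsg (X (6 * n))"
    using good_multiple_6[OF True N n] nsg_multiples[OF True n, of 6] nsg_multiples[OF True, of "2 * n" 3]
      nsg_multiples[OF True, of "3 * n" 2] n by auto
  then show ?thesis using nsg_eps True by blast
next
  case False
  then have "mu = 0" using mu0 by simp
  then show ?thesis using eps_bounds[of "X (6 * n)"] corr_bounds[of "X (6 * n)"] N by simp
qed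

text \<open>Near the node \<open>f\<close> behaves like \<open>3 * t^2\<close>, unless t is so small
  that \<open>a6\<close> dominates. The resulting valuations are tested for parity in
  \<open>K_dvd\<close> and \<open>K_int\<close>.\<close>

lemma node_f:
  assumes N: "NN > 0" and k: "vge k ((x - ee) / ee)" "k > 0"
  shows "K x < NN / 2 \<Longrightarrow> K x > 0 \<and> veq (6 * mu + 2 * K x) (x^3 + A * x + B)"
    and "2 * k > NN \<Longrightarrow> veq (6 * mu + NN) (x^3 + A * x + B)"
    and "vgt (6 * mu) (x^3 + A * x + B)" and "vgt (4 * mu) (3 * x^2 + A)"
proof -
  define t where "t = (x - ee) / ee"
  define e where "e = ee"
  have e: "veq (2 * mu) e" and e0: "e \<noteq> 0" using ee[OF N] ee_nz[OF N] e_def by auto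
  have tx: "x = e * (1 + t)" using e0 by (simp add: t_def e_def field_simps)
  define a4 where "a4 = (3 * e^2 + A) / e^2"
  define a6 where "a6 = (e^3 + A * e + B) / e^3"
  have A: "A = e^2 * (a4 - 3)" using e0 by (simp add: a4_def field_simps)
  have "e^3 + A * e + B = e^3 * a6" using e0 by (simp add: a6_def)
  then have B: "B = e^3 * (a6 - a4 + 2)" using A by algebra
  have w4: "vge NN a4" and w6: "veq NN a6"
    using place.a4[OF place_axioms N] place.a6[OF place_axioms N] veq_vge unfolding a4_def a6_def e_def by auto
  have fg: "x^3 + A * x + B = e^3 * (t^3 + 3 * t^2 + a4 * t + a6)" using A B tx by algebra
  have gx: "3 * x^2 + A = e^2 * (6 * t + 3 * t^2 + a4)" using A tx by algebra
  have e3: "veq (6 * mu) (e^3)" and e2: "veq (4 * mu) (e^2)" using veq_power[OF e, of 3] veq_power[OF e, of 2] by auto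
  have t: "vge k t" using k t_def by simp
  have t0: "vgt 0 t" using vge_vgt[OF t] k by simp
  have w40: "vgt 0 a4" "vgt 0 a6" using vge_vgt[OF w4, of 0] vge_vgt[OF veq_vge[OF w6], of 0] N by auto
  have t2: "vgt 0 (t^2)" "vgt 0 (t^3)"
    using vge_vgt[OF vge_power[OF t, of 2], of 0] vge_vgt[OF vge_power[OF t, of 3], of 0] k by auto
  have a4t: "vgt 0 (a4 * t)" using vgt_vge_mult[OF w40(1) vgt_vge[OF t0]] by simp
  have "vgt 0 (t^3 + 3 * t^2 + a4 * t + a6)" using t2 a4t w40 by (intro vgt_add) auto
  from vgt_vge_mult[OF this veq_vge[OF e3]] show "vgt (6 * mu) (x^3 + A * x + B)"
    unfolding fg by (simp add: mult.commute)
  have "vgt 0 (6 * t + 3 * t^2 + a4)" using t2 t0 w40 by (intro vgt_add) auto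
  from vgt_vge_mult[OF this veq_vge[OF e2]] show "vgt (4 * mu) (3 * x^2 + A)"
    unfolding gx by (simp add: mult.commute)
  have Kt: "K x = kap NN t" using N by (simp add: K_def t_def)
  show "K x > 0 \<and> veq (6 * mu + 2 * K x) (x^3 + A * x + B)" if "K x < NN / 2"
  proof -
    have pos: "K x > 0" using t k N vge_vmin[of "NN / 2" t] unfolding Kt kap_def vmin_def vge_def by auto
    have tk: "veq (K x) t" using kap_mid(1)[of NN t] pos that Kt by simp
    have "veq (2 * K x) (3 * t^2 + (t^3 + (a4 * t + a6)))"
    proof (intro veq_add vgt_add)
      show "veq (2 * K x) (3 * t^2)" using veq_power[OF tk, of 2] by simp
      show "vgt (2 * K x) (t^3)" using vge_vgt[OF veq_vge[OF veq_power[OF tk, of 3]], of "2 * K x"] pos by simp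
      show "vgt (2 * K x) (a4 * t)" using vge_vgt[OF vge_mult[OF w4 veq_vge[OF tk]], of "2 * K x"] pos that by simp
      show "vgt (2 * K x) a6" using vge_vgt[OF veq_vge[OF w6], of "2 * K x"] that by simp
    qed
    then have "veq (2 * K x) (t^3 + 3 * t^2 + a4 * t + a6)" by (simp add: algebra_simps)
    from veq_mult[OF e3 this] show ?thesis using pos unfolding fg by simp
  qed
  show "veq (6 * mu + NN) (x^3 + A * x + B)" if kN: "2 * k > NN"
  proof -
    have "veq NN (a6 + (3 * t^2 + (t^3 + a4 * t)))"
    proof (intro veq_add vgt_add)
      show "vgt NN (3 * t^2)" using vge_vgt[OF vge_power[OF t, of 2], of NN] kN by simp
      show "vgt NN (t^3)" using vge_vgt[OF vge_power[OF t, of 3], of NN] kN k by simp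
      show "vgt NN (a4 * t)" using vge_vgt[OF vge_mult[OF w4 t], of NN] k by simp
    qed (rule w6)
    then have "veq NN (t^3 + 3 * t^2 + a4 * t + a6)" by (simp add: algebra_simps)
    from veq_mult[OF e3 this] show ?thesis unfolding fg .
  qed
qed

lemma K_pos_vge:
  assumes N: "NN > 0" and K: "K x > 0" shows "vge (K x) ((x - ee) / ee)"
  using K N vge_mono[OF vge_vmin[of "NN / 2" "(x - ee) / ee"], of "K x"]
  unfolding K_def kap_def by (auto simp: max_def split: if_splits)

text \<open>f is a square, so \<open>6 * mu + 2 * K (X n)\<close> is an even integer, while the
  index itself is integral. Intermediate components are thus impossible for I_N^* fibres, where
  \<open>mu = 1/2\<close>.\<close>

lemma K_dvd: assumes N: "NN > 0" and n: "n \<ge> 1" and K: "0 < K (X n)" "K (X n) < NN / 2"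
  shows "K (X n) \<in> \<int>" "3 * mu \<in> \<int>"
proof -
  note g = K_pos_vge[OF N K(1)]
  have "veq (K (X n)) ((X n - ee) / ee)" using kap_mid(1)[of NN] K N by (simp add: K_def)
  then show Ki: "K (X n) \<in> \<int>" using v_int by (metis veq_def)
  have "(6 * mu + 2 * K (X n)) / 2 \<in> \<int>"
    using f_parity[OF n] node_f(1)[OF N g K] K by blast
  then have "3 * mu + K (X n) \<in> \<int>" by (simp add: field_simps)
  from Ints_diff[OF this Ki] show "3 * mu \<in> \<int>" by simp
qed

lemma mu_half: assumes N: "NN > 0" and "mu > 0" shows "mu = 1/2"
proof -
  obtain i :: int where i: "2 * mu = of_int i" using two_mu_int[OF N] by (auto elim: Ints_cases)
  have "0 < i" "i < 2" using i assms mu1 by linarith+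
  then have "i = 1" by simp
  then show ?thesis using i by simp
qed

text \<open>For type I_N^* only the indices 0 and NN/2 are left by \<open>K_dvd\<close>, and
  doubling kills both.\<close>

lemma K_double_zero: assumes N: "NN > 0" and m: "mu > 0" and n: "n \<ge> 1" shows "K (X (2 * n)) = 0"
proof -
  have h: "mu = 1/2" using mu_half[OF N m] .
  have "3 * mu \<notin> \<int>" unfolding h by (auto elim!: Ints_cases simp: field_simps)
  then have "\<not> (0 < K (X n) \<and> K (X n) < NN / 2)" using K_dvd[OF N n] by blast
  then have "K (X n) = 0 \<or> K (X n) = NN / 2" using K_bounds[of "X n"] by linarith
  moreover have "K (X (2 * n)) = min (2 * K (X n)) (NN - 2 * K (X n))"
    using place_double(2)[OF refl f_nz[OF n], of "X (2 * n)"] X_double[OF n] curve[OF n] by simp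
  ultimately show ?thesis using N by auto
qed

text \<open>If NN were odd and the index NN/2, then t would have valuation above NN/2 and
  \<open>v f = NN\<close> would be odd, although f is a square.\<close>

lemma K_int: assumes N: "NN > 0" and m: "mu = 0" and n: "n \<ge> 1" shows "K (X n) \<in> \<int>"
proof (cases "K (X n) = NN / 2")
  case True
  then have "K (X n) > 0" using N by simp
  from K_pos_vge[OF N this] have g: "vge (NN / 2) ((X n - ee) / ee)" unfolding True .
  show ?thesis
  proof (rule ccontr)
    assume "K (X n) \<notin> \<int>"
    then have ni: "NN / 2 \<notin> \<int>" using True by simp
    obtain k where k: "vge k ((X n - ee) / ee)" "2 * k > NN"
    proof (cases "X n = ee")
      case True then show ?thesis using that[of NN] N by simp
    next
      case False
      then have nz: "(X n - ee) / ee \<noteq> 0" using ee_nz[OF N] by simp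
      then have "v ((X n - ee) / ee) \<noteq> NN / 2" using v_int[OF nz] ni by metis
      then show ?thesis using that[of "v ((X n - ee) / ee)"] g nz by (auto simp: vge_def)
    qed
    have "veq (6 * mu + NN) ((X n)^3 + A * X n + B)" by (rule node_f(2)[OF N k(1)]) (use k N in auto)
    from f_parity[OF n this] show False using ni m by simp
  qed
next
  case False
  then show ?thesis using K_dvd(1)[OF N n] K_bounds[of "X n"] by (cases "K (X n) = 0") auto
qed

text \<open>The form of nonsingular reduction that passes to multiples; \<open>nonsing\<close> is
  the form by partial derivatives, and the two are compared in \<open>nonsing_good\<close> and
  \<open>good_nonsing\<close>.\<close>

definition good :: "'a \<Rightarrow> bool" where "good x \<longleftrightarrow> K x = 0 \<and> (mu > 0 \<longrightarrow> nsg x)"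

definition nonsing :: "'a \<Rightarrow> 'a \<Rightarrow> bool" where
  "nonsing x y \<longleftrightarrow> \<not> vge 0 x \<or> \<not> (vgt 0 y \<and> vgt 0 (3 * x^2 + A))"

lemma good_eps: "good x \<Longrightarrow> eps x = 0"
proof (cases "mu > 0")
  case False
  assume "good x"
  then show ?thesis using False mu0 eps_bounds[of x] by (simp add: good_def corr_def)
qed (auto simp: good_def nsg_eps)

lemma good_multiples: assumes "good (X 1)" "n \<ge> 1" shows "good (X n)"
proof -
  have "K (X n) = 0"
  proof (cases "NN > 0")
    case True
    then show ?thesis using K_seq[OF True assms(2)] assms dst_self[OF True, of 0] by (simp add: good_def)
  next
    case False then show ?thesis using NN_nonneg by (simp add: K_def)
  qed
  moreover have "mu > 0 \<Longrightarrow> nsg (X n)" using nsg_multiples[of 1 n] assms by (simp add: good_def)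
  ultimately show ?thesis by (simp add: good_def)
qed

lemma nonsing_good: assumes n: "n \<ge> 1" and ns: "nonsing (X n) (Y n)" shows "good (X n)"
proof (rule ccontr)
  assume ng: "\<not> good (X n)"
  have y0: "vgt 0 (Y n)" if "vgt 0 ((X n)^3 + A * X n + B)"
    using that f_nz[OF n] vY[OF n] by (auto simp: vgt_def)
  consider (1) "vge 0 (X n)" "mu > 0" "\<not> nsg (X n)" | (2) "K (X n) > 0" "vge 0 (X n)" "\<not> mu > 0"
  proof -
    have "vge 0 (X n)"
    proof (rule ccontr)
      assume "\<not> vge 0 (X n)"
      then have x: "X n \<noteq> 0" "v (X n) < 0" by (auto simp: vge_def)
      then show False using ng K_zero[of "X n"] mu0 by (auto simp: good_def nsg_def)
    qed
    moreover have "mu > 0 \<Longrightarrow> nsg (X n) \<Longrightarrow> K (X n) = 0" using K_zero[of "X n"] by (auto simp: nsg_def)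
    ultimately show ?thesis using that ng K_bounds(1)[of "X n"] unfolding good_def by force
  qed
  then show False
  proof cases
    case 1
    have A0: "vgt 0 A" and B0: "vgt 0 B" using vge_vgt[OF vA, of 0] vge_vgt[OF vB, of 0] 1 by auto
    have x0: "vgt 0 (X n)" using 1 by (auto simp: nsg_def vgt_def)
    have x2: "vgt 0 ((X n)^2)" using vgt_vge_mult[OF x0 1(1)] by (simp add: power2_eq_square)
    have x3: "vgt 0 ((X n)^3)" using vgt_vge_mult[OF x2 1(1)] by (simp add: power2_eq_square power3_eq_cube)
    have "vgt 0 ((X n)^3 + A * X n + B)"
      using x3 vgt_vge_mult[OF A0 1(1)] B0 by (intro vgt_add) auto
    moreover have "vgt 0 (3 * (X n)^2 + A)" using x2 A0 by (intro vgt_add) auto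
    ultimately show False using ns y0 1 by (simp add: nonsing_def)
  next
    case 2
    then have N: "NN > 0" using NN_nonneg by (cases "NN = 0") (auto simp: K_def)
    have "mu = 0" using 2 mu0 by simp
    then show False
      using node_f(3,4)[OF N K_pos_vge[OF N 2(1)] 2(1)] ns y0 2 by (simp add: nonsing_def)
  qed
qed

lemma good_nonsing: assumes n: "n \<ge> 1" and g: "good (X n)" shows "nonsing (X n) (Y n)"
proof (rule ccontr)
  assume "\<not> nonsing (X n) (Y n)"
  then have x: "vge 0 (X n)" and y: "vgt 0 (Y n)" and fx: "vgt 0 (3 * (X n)^2 + A)"
    by (auto simp: nonsing_def)
  have f: "vgt 0 ((X n)^3 + A * X n + B)" using y Y_ne_0[OF n] vY[OF n] f_nz[OF n] by (auto simp: vgt_def)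
  show False
  proof (cases "mu > 0")
    case True
    have A0: "vgt 0 A" and B0: "vgt 0 B" using vge_vgt[OF vA, of 0] vge_vgt[OF vB, of 0] True by auto
    have x0: "veq 0 (X n)" using g x True by (auto simp: good_def nsg_def veq_def vge_def)
    have "veq 0 ((X n)^3 + (A * X n + B))"
      using veq_power[OF x0, of 3] vgt_vge_mult[OF A0 x] B0 by (intro veq_add vgt_add) auto
    then show False using f by (simp add: veq_def vgt_def add.assoc)
  next
    case False
    then have m: "mu = 0" using mu0 by simp
    have Ag: "vge 0 A" "vge 0 B" using vA vB m by auto
    show False
    proof (cases "NN = 0")
      case True
      \<comment> \<open>Bezout identity for the cubic and its derivative.\<close>
      have "4 * A^3 + 27 * B^2 = (3 * (X n)^2 + A) * ((3 * (X n)^2 + 4 * A) * (3 * (X n)^2 + A))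
          - ((X n)^3 + A * X n + B) * (27 * ((X n)^3 + A * X n - B))" by algebra
      moreover have "vgt 0 ((3 * (X n)^2 + A) * ((3 * (X n)^2 + 4 * A) * (3 * (X n)^2 + A)))"
        using vgt_vge_mult[OF fx, of 0 "(3 * (X n)^2 + 4 * A) * (3 * (X n)^2 + A)"] x Ag
        by (simp add: vge0_ring)
      moreover have "vgt 0 (((X n)^3 + A * X n + B) * (27 * ((X n)^3 + A * X n - B)))"
        using vgt_vge_mult[OF f, of 0 "27 * ((X n)^3 + A * X n - B)"] x Ag by (simp add: vge0_ring)
      ultimately have "vgt 0 Disc" using vgt_diff by metis
      then show False using vDisc m True by (simp add: veq_def vgt_def)
    next
      case False
      then have N: "NN > 0" using NN_nonneg by simp
      define t where "t = (X n - ee) / ee"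
      define e where "e = ee"
      have e: "veq 0 e" and e0: "e \<noteq> 0" using ee[OF N] ee_nz[OF N] e_def m by auto
      have tx: "X n = e * (1 + t)" using e0 by (simp add: t_def e_def field_simps)
      define a4 where "a4 = (3 * e^2 + A) / e^2"
      define a6 where "a6 = (e^3 + A * e + B) / e^3"
      have A: "A = e^2 * (a4 - 3)" using e0 by (simp add: a4_def field_simps)
      have "e^3 + A * e + B = e^3 * a6" using e0 by (simp add: a6_def)
      then have B: "B = e^3 * (a6 - a4 + 2)" using A by algebra
      have w4: "vgt 0 a4" and w6: "vgt 0 a6"
        using place.a4[OF place_axioms N] place.a6[OF place_axioms N] N
        unfolding a4_def a6_def e_def by (auto simp: vgt_def veq_def)
      have fg: "t^3 + 3 * t^2 + a4 * t + a6 = ((X n)^3 + A * X n + B) / e^3"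
      proof -
        have "(X n)^3 + A * X n + B = e^3 * (t^3 + 3 * t^2 + a4 * t + a6)" using A B tx by algebra
        then show ?thesis using e0 by simp
      qed
      have gx: "6 * t + 3 * t^2 + a4 = (3 * (X n)^2 + A) / e^2"
      proof -
        have "3 * (X n)^2 + A = e^2 * (6 * t + 3 * t^2 + a4)" using A tx by algebra
        then show ?thesis using e0 by simp
      qed
      have h1: "vgt 0 (t^3 + 3 * t^2 + a4 * t + a6)" unfolding fg
        using vgt_divide[OF f veq_power[OF e, of 3]] by simp
      have h2: "vgt 0 (6 * t + 3 * t^2 + a4)" unfolding gx
        using vgt_divide[OF fx veq_power[OF e, of 2]] by simp
      have tg: "vge 0 t" unfolding t_def e_def[symmetric]
        using vge_divide[OF vge_diff[OF x veq_vge[OF e]] e] by simp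
      have "K (X n) = 0" using g by (simp add: good_def)
      then have "veq (- nu NN t) t" using kap_nu_zero[OF N, of t] N by (simp add: K_def t_def)
      then have t0: "veq 0 t" using tg nu_nonneg[of NN t] by (auto simp: veq_def vge_def)
      have "vgt 0 (t^3 + 3 * t^2)"
      proof -
        have "vgt 0 (a4 * t + a6)" using vgt_vge_mult[OF w4 tg] w6 by (intro vgt_add) auto
        from vgt_diff[OF h1 this] show ?thesis by simp
      qed
      moreover have "vgt 0 (t * (6 * t + 3 * t^2))"
      proof -
        from vgt_diff[OF h2 w4] have "vgt 0 (6 * t + 3 * t^2)" by simp
        from vgt_vge_mult[OF this tg] show ?thesis by (simp add: mult.commute)
      qed
      \<comment> \<open>Eliminating the cubic term leaves \<open>3 * t^2\<close>, a unit.\<close>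
      ultimately have "vgt 0 (3 * (t^3 + 3 * t^2) - t * (6 * t + 3 * t^2))"
        by (intro vgt_diff) (simp_all only: vgt_cmult)
      also have "3 * (t^3 + 3 * t^2) - t * (6 * t + 3 * t^2) = 3 * t^2" by algebra
      finally show False using veq_power[OF t0, of 2] by (simp add: veq_def vgt_def)
    qed
  qed
qed

end

section \<open>Strong divisibility in the kernel of reduction\<close>

context place_seq
begin

definition neg :: "'a \<Rightarrow> bool" where "neg x \<longleftrightarrow> x \<noteq> 0 \<and> v x < 0"

lemma A_int: "vge 0 A" and B_int: "vge 0 B"
  using vge_mono[OF vA, of 0] vge_mono[OF vB, of 0] mu0 by auto

text \<open>The kernel of reduction is a group: the reciprocals of the abscissae of P + Q and P - Q
  have sum and product of positive valuation, hence so does each of them.\<close>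

lemma neg_pair:
  assumes ne: "x1 \<noteq> x2" and n1: "neg x1" and n2: "neg x2"
    and s: "(a + b) * (x1 - x2)^2 = 2 * ((x1 * x2 + A) * (x1 + x2) + 2 * B)"
    and p: "a * b * (x1 - x2)^2 = (x1 * x2 - A)^2 - 4 * B * (x1 + x2)"
  shows "neg b"
proof -
  define m1 m2 where "m1 = - v x1" and "m2 = - v x2"
  have mm: "m1 > 0" "m2 > 0" using n1 n2 by (auto simp: m1_def m2_def neg_def)
  have x1: "veq (- m1) x1" and x2: "veq (- m2) x2" using n1 n2 by (auto simp: m1_def m2_def neg_def veq_def)
  note g1 = veq_vge[OF x1] and g2 = veq_vge[OF x2]
  define F1 where "F1 = 2 * ((x1 * x2 + A) * (x1 + x2) + 2 * B)"
  define F2 where "F2 = (x1 * x2 - A)^2 - 4 * B * (x1 + x2)"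
  have F1e: "F1 = 2 * (x1 * x2 * x1 + x1 * x2 * x2 + A * x1 + A * x2 + 2 * B)"
    unfolding F1_def by algebra
  have F2e: "F2 = (x1 * x2)^2 + (A * A - 2 * (A * (x1 * x2)) - 4 * (B * x1) - 4 * (B * x2))"
    unfolding F2_def by algebra
  define k where "k = - 2 * m1 - 2 * m2"
  note x12 = vge_mult[OF g1 g2]
  have F1: "vgt k F1"
    unfolding F1e vgt_cmult
    using vge_vgt[OF vge_mult[OF x12 g1], of k] vge_vgt[OF vge_mult[OF x12 g2], of k]
      vge_vgt[OF vge_mult[OF A_int g1], of k] vge_vgt[OF vge_mult[OF A_int g2], of k] vge_vgt[OF B_int, of k] mm
    unfolding k_def by (intro vgt_add) auto
  have F2: "veq k F2"
  proof -
    have "veq k ((x1 * x2)^2)" using veq_power[OF veq_mult[OF x1 x2], of 2] by (simp add: k_def algebra_simps)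
    moreover have "vgt k (A * A - 2 * (A * (x1 * x2)) - 4 * (B * x1) - 4 * (B * x2))"
      using vge_vgt[OF vge_mult[OF A_int A_int], of k] vge_vgt[OF vge_mult[OF A_int x12], of k]
        vge_vgt[OF vge_mult[OF B_int g1], of k] vge_vgt[OF vge_mult[OF B_int g2], of k] mm
      unfolding k_def by (intro vgt_diff) auto
    ultimately show ?thesis unfolding F2e by (rule veq_add)
  qed
  have "vgt k ((x1 - x2)^2)"
  proof -
    have "vge (min (- 2 * m1) (- 2 * m2)) ((x1 - x2)^2)"
      using vge_power[OF vge_diff[OF vge_mono[OF g1, of "min (- m1) (- m2)"] vge_mono[OF g2, of "min (- m1) (- m2)"]], of 2]
      by (auto simp: min_def split: if_splits)
    then show ?thesis by (rule vge_vgt) (use mm in \<open>auto simp: k_def\<close>)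
  qed
  have ne0: "(x1 - x2)^2 \<noteq> 0" using ne by simp
  have F2n: "F2 \<noteq> 0" using F2 by (simp add: veq_def)
  have ab: "a \<noteq> 0" "b \<noteq> 0" using p F2n unfolding F2_def by auto
  have s': "inverse a + inverse b = F1 / F2"
  proof -
    have "inverse a + inverse b = ((a + b) * (x1 - x2)^2) / (a * b * (x1 - x2)^2)"
      using ab ne0 by (simp add: field_simps)
    then show ?thesis unfolding s p F1_def F2_def .
  qed
  have p': "inverse a * inverse b = (x1 - x2)^2 / F2"
  proof -
    have "inverse a * inverse b = (x1 - x2)^2 / (a * b * (x1 - x2)^2)" using ab ne0 by (simp add: field_simps)
    then show ?thesis unfolding p F2_def .
  qed
  have gs: "vgt 0 (inverse a + inverse b)" unfolding s' using vgt_divide[OF F1 F2] by simp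
  have gp: "vgt 0 (inverse a * inverse b)" unfolding p' using vgt_divide[OF \<open>vgt k ((x1 - x2)^2)\<close> F2] by simp
  have "vge 0 (inverse a) \<and> vge 0 (inverse b)"
    by (rule roots_ge) (use gs gp vgt_vge in auto)
  moreover have "\<not> veq 0 (inverse b)"
  proof
    assume b0: "veq 0 (inverse b)"
    have "vgt 0 (inverse a)"
    proof -
      have "v (inverse a * inverse b) > 0" using gp ab by (simp add: vgt_def)
      then show ?thesis using b0 ab v_mult[of "inverse a" "inverse b"] by (simp add: vgt_def veq_def)
    qed
    from veq_add'[OF this b0] show False using gs by (simp add: veq_def vgt_def)
  qed
  ultimately show ?thesis using ab by (auto simp: neg_def vge_def veq_def v_inverse)
qed

lemma neg_sub: assumes "n \<ge> 1" "m > n" "neg (X m)" "neg (X n)" shows "neg (X (m - n))"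
proof -
  have ne: "X m \<noteq> X n" using X_inj[of m n] assms by auto
  show ?thesis by (rule neg_pair[OF ne assms(3,4) X_add X_mult]) (use assms in auto)
qed

text \<open>Subtractive Euclidean algorithm, with \<open>neg_sub\<close> as the single step.\<close>

lemma neg_gcd: "m \<ge> 1 \<Longrightarrow> n \<ge> 1 \<Longrightarrow> neg (X m) \<Longrightarrow> neg (X n) \<Longrightarrow> neg (X (gcd m n))"
proof (induction "m + n" arbitrary: m n rule: less_induct)
  case less
  consider "m = n" | "m > n" | "n > m" by linarith
  then show ?case
  proof cases
    case 1 then show ?thesis using less.prems by simp
  next
    case 2
    have "neg (X (gcd (m - n) n))"
      using less.hyps[of "m - n" n] neg_sub[of n m] less.prems 2 by auto
    then show ?thesis using 2 gcd_diff1_nat[of n m] by simp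
  next
    case 3
    have "neg (X (gcd m (n - m)))"
      using less.hyps[of m "n - m"] neg_sub[of m n] less.prems 3 by auto
    then show ?thesis using 3 gcd_diff1_nat[of m n] by (simp add: gcd.commute)
  qed
qed

text \<open>In the formal group z(kQ) equals k z(Q) to first order, and x behaves like
  \<open>1 / z^2\<close>. The proof needs no formal group: the recursion for \<open>X\<close>,
  divided by powers of x, is reduced to residues.\<close>

lemma neg_ratio:
  assumes n: "n \<ge> 1" "neg (X n)"
  shows "k \<ge> 1 \<Longrightarrow> cg (X (k * n) / X n) (1 / (of_nat k)^2)"
proof (induction k rule: less_induct)
  case (less k)
  define x where "x = X n"
  have x: "x \<noteq> 0" "v x < 0" using n by (auto simp: neg_def x_def)
  define a b where "a = A / x^2" and "b = B / x^3"
  have ab: "cg a 0" "cg b 0"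
    unfolding a_def b_def cg_0
    using vgt_mono[OF vge_vgt[OF vge_divide[OF A_int veq_power[OF veq_v[OF x(1)], of 2]]], of 0]
      vgt_mono[OF vge_vgt[OF vge_divide[OF B_int veq_power[OF veq_v[OF x(1)], of 3]]], of 0] x
    by (auto simp: vge_vgt[OF vge_divide[OF A_int veq_power[OF veq_v[OF x(1)], of 2]]]
        vge_vgt[OF vge_divide[OF B_int veq_power[OF veq_v[OF x(1)], of 3]]])
  have AB: "A = x^2 * a" "B = x^3 * b" using x by (auto simp: a_def b_def)
  define r where "r j = X (j * n) / x" for j
  have Xr: "X (j * n) = x * r j" for j using x by (simp add: r_def)
  consider "k = 1" | "k = 2" | "k \<ge> 3" using less.prems by linarith
  then have "cg (r k) (1 / (of_nat k)^2)"
  proof cases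
    case 1 then show ?thesis using x cg_numeral by (simp add: r_def x_def)
  next
    case 2
    have "x^4 * (r 2 * (4 * (1 + a + b))) = x^4 * ((1 - a)^2 - 8 * b)"
      using X_double[OF n(1)] curve[OF n(1)] Xr[of 2] AB unfolding x_def[symmetric] by algebra
    then have e: "r 2 * (4 * (1 + a + b)) = (1 - a)^2 - 8 * b" using x by simp
    have c1: "cg (4 * (1 + a + b)) (4 * (1 + 0 + 0))" by (intro cg_mult cg_add cg_numeral ab)
    have c2: "cg ((1 - a)^2 - 8 * b) ((1 - 0)^2 - 8 * 0)" by (intro cg_mult cg_diff cg_power cg_numeral ab)
    have "4 * (1 + a + b) \<noteq> 0" using cg_nz[OF c1] by (simp add: veq_def)
    then have "r 2 = ((1 - a)^2 - 8 * b) / (4 * (1 + a + b))" using e by (simp add: field_simps)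
    then show ?thesis using cg_divide[OF c2 c1] 2 by simp
  next
    case 3
    define j where "j = k - 1"
    have j: "j \<ge> 2" "k = j + 1" using 3 by (auto simp: j_def)
    have jn: "j * n > n" using j n by (auto simp: mult_strict_right_mono)
    have "(j * n) + n = k * n" "(j * n) - n = (j - 1) * n" using j by (auto simp: algebra_simps)
    then have "X (k * n) * X ((j - 1) * n) * (X (j * n) - X n)^2 =
        (X (j * n) * X n - A)^2 - 4 * B * (X (j * n) + X n)"
      using X_mult[OF n(1) jn] by simp
    then have "x^4 * (r k * (r (j - 1) * (r j - 1)^2)) = x^4 * ((r j - a)^2 - 4 * b * (r j + 1))"
      using Xr[of k] Xr[of "j - 1"] Xr[of j] AB unfolding x_def[symmetric] by algebra
    then have e: "r k * (r (j - 1) * (r j - 1)^2) = (r j - a)^2 - 4 * b * (r j + 1)" using x by simp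
    have I: "cg (r j) (1 / (of_nat j)^2)" "cg (r (j - 1)) (1 / (of_nat (j - 1))^2)"
      using less.IH[of j] less.IH[of "j - 1"] j by (auto simp: r_def x_def)
    have c1: "cg (r (j - 1) * (r j - 1)^2) (1 / (of_nat (j - 1))^2 * (1 / (of_nat j)^2 - 1)^2)"
      by (intro cg_mult cg_diff cg_power cg_numeral I)
    have c2: "cg ((r j - a)^2 - 4 * b * (r j + 1)) ((1 / (of_nat j)^2 - 0)^2 - 4 * 0 * (1 / (of_nat j)^2 + 1))"
      by (intro cg_mult cg_diff cg_add cg_power cg_numeral I ab)
    define J :: rat where "J = of_nat j"
    have J: "J \<ge> 2" "of_nat (j - 1) = J - 1" "of_nat k = J + 1" using j by (auto simp: J_def of_nat_diff)
    have J2: "J^2 > 1" using J(1) power_strict_mono[of 1 J 2] by simp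
    have "J^2 \<noteq> 1" "J - 1 \<noteq> 0" using J2 J(1) by linarith+
    then have q: "1 / (J - 1)^2 * (1 / J^2 - 1)^2 \<noteq> 0" by simp
    have "r (j - 1) * (r j - 1)^2 \<noteq> 0"
      using cg_nz[OF c1] q unfolding J(2) J_def[symmetric] by (simp add: veq_def)
    then have rk: "r k = ((r j - a)^2 - 4 * b * (r j + 1)) / (r (j - 1) * (r j - 1)^2)"
      using e by (simp add: field_simps)
    have "((1 / J^2 - 0)^2 - 4 * 0 * (1 / J^2 + 1)) / (1 / (J - 1)^2 * (1 / J^2 - 1)^2) = 1 / (J + 1)^2"
    proof -
      have "1 / J^2 - 1 = - ((J - 1) * (J + 1)) / J^2" using J by (simp add: field_simps power2_eq_square)
      then have E: "1 / (J - 1)^2 * (1 / J^2 - 1)^2 = (J + 1)^2 / J^4"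
        using J by (simp add: power_divide power_mult_distrib power2_eq_square power4_eq_xxxx)
      have E2: "(1 / J^2 - 0)^2 - 4 * 0 * (1 / J^2 + 1) = 1 / J^4"
        by (simp add: power_divide power2_eq_square power4_eq_xxxx)
      show ?thesis unfolding E E2 using J(1) by simp
    qed
    then show ?thesis
      using cg_divide[OF c2 c1] q unfolding J(2,3) J_def[symmetric] rk by simp
  qed
  then show ?case by (simp add: r_def x_def)
qed

lemma neg_multiple:
  assumes n: "n \<ge> 1" "neg (X n)" and k: "k \<ge> 1"
  shows "X (k * n) \<noteq> 0 \<and> v (X (k * n)) = v (X n)"
proof -
  have "veq 0 (X (k * n) / X n)"
    using cg_nz[OF neg_ratio[OF n k]] k by simp
  then show ?thesis using n v_divide[of "X (k * n)" "X n"] by (auto simp: veq_def neg_def)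
qed

text \<open>Multiples by gcd(m, n) lie in the kernel of reduction, where in residue characteristic 0
  multiplication keeps the pole order. As the gcd is less than n, some n/q is a multiple of
  it.\<close>

lemma neg_imprimitive:
  assumes n: "neg (X n)" and m: "neg (X m)" "0 < m" "m < n"
  shows "\<exists>q. prime q \<and> q dvd n \<and> beta (X (n div q)) = beta (X n)"
proof -
  define g where "g = gcd m n"
  have g: "g \<ge> 1" "neg (X g)" using neg_gcd[of m n] n m by (auto simp: g_def Suc_le_eq)
  obtain k where k: "n = g * k" using gcd_dvd2[of m n] g_def by (auto simp: dvd_def)
  have "g \<le> m" using m by (simp add: g_def)
  then have "k \<noteq> 1" using k m by auto
  have "k \<noteq> 0" using k m by (metis mult_0_right not_less0)
  then obtain q where q: "prime q" "q dvd k" using prime_factor_nat[OF \<open>k \<noteq> 1\<close>] by blast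
  then obtain l where l: "k = q * l" by (auto simp: dvd_def)
  have nq: "n div q = l * g" using k l q by (simp add: prime_gt_0_nat)
  have l1: "l \<ge> 1" using l \<open>k \<noteq> 0\<close> by (cases l) auto
  have "X (l * g) \<noteq> 0 \<and> v (X (l * g)) = v (X g)" using neg_multiple[OF g l1] .
  moreover have "X n \<noteq> 0 \<and> v (X n) = v (X g)"
    using neg_multiple[OF g, of k] \<open>k \<noteq> 0\<close> k by (simp add: mult.commute)
  ultimately have "beta (X (n div q)) = beta (X n)" unfolding nq beta_def by simp
  then show ?thesis using q k l by auto
qed

end

section \<open>A differential invariant of a point\<close>

text \<open>\<open>invZ\<close> and \<open>invM\<close> are the inhomogeneous terms of the first order system and of the
  Picard-Fuchs equation satisfied by the elliptic logarithm of the point \<open>(x, y)\<close>, cleared of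
  numerical denominators. Both are covariant under changes of the Weierstrass equation.\<close>

definition invJ :: "('a \<Rightarrow> 'a) \<Rightarrow> 'a \<Rightarrow> 'a \<Rightarrow> 'a::field_char_0" where
  "invJ d A B = 2 * A * d B - 3 * d A * B"

definition invD :: "('a \<Rightarrow> 'a) \<Rightarrow> 'a \<Rightarrow> 'a \<Rightarrow> 'a::field_char_0" where
  "invD d A B = 12 * A^2 * d A + 54 * B * d B"

definition invW :: "('a \<Rightarrow> 'a) \<Rightarrow> 'a \<Rightarrow> 'a \<Rightarrow> 'a \<Rightarrow> 'a::field_char_0" where
  "invW d A B x = 6 * (4 * A^3 + 27 * B^2) * d x + 18 * invJ d A B * x^2 - invD d A B * x + 12 * A * invJ d A B"

definition invZ :: "('a \<Rightarrow> 'a) \<Rightarrow> 'a \<Rightarrow> 'a \<Rightarrow> 'a \<Rightarrow> 'a \<Rightarrow> 'a::field_char_0" where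
  "invZ d A B x y = invW d A B x / y"

definition invM :: "('a \<Rightarrow> 'a) \<Rightarrow> 'a \<Rightarrow> 'a \<Rightarrow> 'a \<Rightarrow> 'a \<Rightarrow> 'a::field_char_0" where
  "invM d A B x y = 12 * (invJ d A B * d (invZ d A B x y) - d (invJ d A B) * invZ d A B x y)
     - (invD d A B * invJ d A B * invZ d A B x y
        + 18 * (invJ d A B)^2 * (x * invZ d A B x y - 18 * invJ d A B * y)) / (4 * A^3 + 27 * B^2)"

locale derivation =
  fixes d :: "'a::field_char_0 \<Rightarrow> 'a"
  assumes d_add: "d (x + y) = d x + d y" and d_mult: "d (x * y) = d x * y + x * d y"
begin

lemma d_0 [simp]: "d 0 = 0" using d_add[of 0 0] by simp
lemma d_1 [simp]: "d 1 = 0" using d_mult[of 1 1] by simp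
lemma d_minus: "d (- x) = - d x" using d_add[of x "- x"] by (simp add: eq_neg_iff_add_eq_0 add.commute)
lemma d_diff: "d (x - y) = d x - d y" using d_add[of x "- y"] by (simp add: d_minus)
lemma d_of_nat [simp]: "d (of_nat n) = 0" by (induction n) (auto simp: d_add)
lemma d_numeral [simp]: "d (numeral n) = 0" using d_of_nat[of "numeral n"] by simp
lemma d_power: "d (x ^ n) = of_nat n * x ^ (n - 1) * d x"
proof (induction n)
  case (Suc n)
  then show ?case by (cases n) (auto simp: d_mult algebra_simps)
qed simp
lemma d_square: "d (x^2) = 2 * x * d x" and d_cube: "d (x^3) = 3 * x^2 * d x"
  by (simp_all add: d_power)
lemma d_divide: "y \<noteq> 0 \<Longrightarrow> d (x / y) = (d x * y - x * d y) / y^2"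
proof -
  assume y: "y \<noteq> 0"
  have "d x = d (x / y * y)" using y by simp
  also have "\<dots> = d (x / y) * y + x / y * d y" by (rule d_mult)
  finally show ?thesis using y by (simp add: field_simps power2_eq_square)
qed

lemma d_invW_aux: "d (6 * D * p + 18 * J * x^2 - E * x + 12 * A * J) =
    6 * d D * p + 6 * D * d p + 18 * d J * x^2 + 36 * J * x * d x - d E * x - E * d x + 12 * d A * J + 12 * A * d J"
  by (simp add: d_add d_diff d_mult d_square algebra_simps)

lemma d_quotient_aux:
  assumes "Z * y = W" shows "12 * (J * (d Z * y) * y - c * W * y) = 12 * (J * (d W * y - W * d y) - c * W * y)"
proof -
  have "a * y + Z * b = w \<Longrightarrow> Z * y = W \<Longrightarrow>
      12 * (J * (a * y) * y - c * W * y) = 12 * (J * (w * y - W * b) - c * W * y)" for a b w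
  proof -
    assume h: "a * y + Z * b = w" "Z * y = W"
    have "a * y * y = w * y - W * b" unfolding h[symmetric] by (simp add: algebra_simps)
    then show ?thesis by (simp add: mult.assoc)
  qed
  moreover have "d Z * y + Z * d y = d W" using assms d_mult[of Z y] by simp
  ultimately show ?thesis using assms by blast
qed

lemma d_disc: "d (4 * A^3 + 27 * B^2) = invD d A B"
  by (simp add: d_add d_mult d_square d_cube invD_def algebra_simps)

end

locale curve_point = derivation d for d :: "'a::field_char_0 \<Rightarrow> 'a" +
  fixes A B x y :: 'a
  assumes eq: "y^2 = x^3 + A * x + B" and y_nz: "y \<noteq> 0" and D_nz: "4 * A^3 + 27 * B^2 \<noteq> 0"
begin

abbreviation "Dl \<equiv> 4 * A^3 + 27 * B^2"
abbreviation "J \<equiv> invJ d A B"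
abbreviation "D' \<equiv> invD d A B"
abbreviation "W \<equiv> invW d A B x"
abbreviation "Z \<equiv> invZ d A B x y"
abbreviation "M \<equiv> invM d A B x y"
abbreviation "fx \<equiv> 3 * x^2 + A"
abbreviation "V \<equiv> 12 * Dl * d y + 54 * J * x * y - 3 * D' * y"

lemma eq': "2 * y * d y = (3 * x^2 + A) * d x + d A * x + d B"
  using arg_cong[OF eq, of d] by (simp add: d_add d_mult d_square d_cube algebra_simps)

lemma Zy: "Z * y = W" using y_nz by (simp add: invZ_def)

text \<open>A second presentation of \<open>Z\<close>, with denominator \<open>fx\<close> instead of
  y. At a nonsingular point of the reduction one of the two denominators is a unit, whence
  integrality.\<close>

lemma Zfx: "Z * fx = V"
proof -
  have "y * (Z * fx) = y * V"
    using Zy eq' eq unfolding invW_def invJ_def invD_def by algebra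
  then show ?thesis using y_nz by simp
qed

text \<open>Makes the division by the discriminant in \<open>invM\<close> exact once
  \<open>M\<close> is multiplied by \<open>y^2\<close> or \<open>fx^2\<close>.\<close>

lemma kappa: "D'^2 + 108 * A * J^2 = 36 * Dl * (A * (d A)^2 + 3 * (d B)^2)"
  unfolding invD_def invJ_def by algebra

lemma My2: "M * y^2 = 12 * (J * (d W * y - W * d y) - d J * W * y)
    - J * y * (6 * d x * (D' + 18 * J * x) - 36 * (A * (d A)^2 + 3 * (d B)^2) * x + 36 * d A * J)"
proof -
  define Q where "Q = 6 * d x * (D' + 18 * J * x) - 36 * (A * (d A)^2 + 3 * (d B)^2) * x + 36 * d A * J"
  have Q: "D' * W + 18 * J * (x * W - 18 * J * y^2) = Dl * Q"
    using eq kappa unfolding Q_def invW_def invJ_def invD_def by algebra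
  have "M * y^2 = 12 * (J * (d Z * y) * y - d J * (Z * y) * y)
      - J * y * (D' * (Z * y) + 18 * J * (x * (Z * y) - 18 * J * y^2)) / Dl"
    unfolding invM_def by (simp add: field_simps power2_eq_square D_nz)
  also have "\<dots> = 12 * (J * (d Z * y) * y - d J * W * y) - J * y * Q"
    unfolding Zy Q using D_nz by simp
  also have "\<dots> = 12 * (J * (d W * y - W * d y) - d J * W * y) - J * y * Q"
    unfolding d_quotient_aux[OF Zy] ..
  finally show ?thesis unfolding Q_def .
qed

lemma Mfx2: "M * fx^2 = 12 * (J * (d V * fx - V * d fx) - d J * V * fx)
    - J * fx * (12 * d y * (D' + 18 * J * x) - 108 * y * (A * (d A)^2 + 3 * (d B)^2))"
proof -
  define Q where "Q = 12 * d y * (D' + 18 * J * x) - 108 * y * (A * (d A)^2 + 3 * (d B)^2)"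
  have Q: "D' * V + 18 * J * (x * V - 18 * J * y * fx) = Dl * Q"
    using kappa unfolding Q_def by algebra
  have "M * fx^2 = 12 * (J * (d Z * fx) * fx - d J * (Z * fx) * fx)
      - J * fx * (D' * (Z * fx) + 18 * J * (x * (Z * fx) - 18 * J * y * fx)) / Dl"
    unfolding invM_def by (simp add: field_simps power2_eq_square D_nz)
  also have "\<dots> = 12 * (J * (d Z * fx) * fx - d J * V * fx) - J * fx * Q"
    unfolding Zfx Q using D_nz by simp
  also have "\<dots> = 12 * (J * (d V * fx - V * d fx) - d J * V * fx) - J * fx * Q"
    unfolding d_quotient_aux[OF Zfx] ..
  finally show ?thesis unfolding Q_def .
qed

text \<open>With \<open>My2\<close> and \<open>Mfx2\<close> this bounds the pole of \<open>M\<close>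
  at a singular point of the reduction by the valuation of the discriminant.\<close>

lemma disc_comb: "Dl = (3 * x^2 + 4 * A) * fx^2 - 27 * (x^3 + A * x - B) * y^2"
  using eq by algebra

text \<open>Near the origin of the curve: \<open>z = x / y\<close> is a local parameter, \<open>x = 1 / (z\<^sup>2 e)\<close>,
  \<open>y = 1 / (z\<^sup>3 e)\<close>.\<close>
context
  fixes z e P R :: 'a
  assumes x_nz: "x \<noteq> 0" and z: "z = x / y" and e: "e = y^2 / x^3"
    and P: "P = 2 * d z + z * (d e / e)" and R: "R = 3 * d z + z * (d e / e)"
begin

lemma z_nz: "z \<noteq> 0" and e_nz: "e \<noteq> 0" using x_nz y_nz by (auto simp: z e)

lemma xy_z: "x = z * y" "x * z^2 * e = 1" "y * z^3 * e = 1"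
  using x_nz y_nz by (auto simp: z e field_simps power2_eq_square power3_eq_cube)

lemma e_eq: "e = 1 + A * z^4 * e^2 + B * z^6 * e^3"
proof -
  have "x^3 * e = x^3 * (1 + A * z^4 * e^2 + B * z^6 * e^3)"
    using eq xy_z by algebra
  then show ?thesis using x_nz by simp
qed

lemma dx: "d x = - x * P / z"
proof -
  have "d x * z^2 * e + x * (2 * z * d z) * e + x * z^2 * d e = 0"
    using arg_cong[OF xy_z(2), of d] by (simp add: d_mult d_square algebra_simps)
  then have "(d x * z + x * P) * (z * e) = 0" using e_nz unfolding P by (simp add: field_simps power2_eq_square)
  then have "d x * z + x * P = 0" using z_nz e_nz by (metis mult_eq_0_iff)
  then have "d x * z = - x * P" by algebra
  then show ?thesis using z_nz by (simp add: field_simps)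
qed

lemma dy: "d y = - y * R / z"
proof -
  have "d y * z^3 * e + y * (3 * z^2 * d z) * e + y * z^3 * d e = 0"
    using arg_cong[OF xy_z(3), of d] by (simp add: d_mult d_cube algebra_simps)
  then have "(d y * z + y * R) * (z^2 * e) = 0" using e_nz unfolding R
    by (simp add: field_simps power2_eq_square power3_eq_cube)
  then have "d y * z + y * R = 0" using z_nz e_nz by (metis mult_eq_0_iff power_not_zero)
  then have "d y * z = - y * R" by algebra
  then show ?thesis using z_nz by (simp add: field_simps)
qed

text \<open>The term \<open>18 J / (z e)\<close> is a pole at the origin, so \<open>Z\<close> itself
  measures contact only for \<open>J = 0\<close>.\<close>

lemma Z_contact: "Z = - 6 * Dl * P + 18 * J / (z * e) - D' * z + 12 * A * J * z^3 * e"
proof -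
  have "Z = W / y" by (simp add: invZ_def)
  have "W * z^3 * e = (- 6 * Dl * P + 18 * J / (z * e) - D' * z + 12 * A * J * z^3 * e)"
  proof -
    have "z * e * (W * z^3 * e) = z * e * (- 6 * Dl * P - D' * z + 12 * A * J * z^3 * e) + 18 * J"
      using xy_z z_nz unfolding invW_def dx by (simp add: field_simps) algebra
    then show ?thesis using z_nz e_nz by (simp add: field_simps)
  qed
  moreover have "1 / y = z^3 * e" using xy_z(3) y_nz by (simp add: field_simps)
  ultimately show ?thesis by (simp add: invZ_def divide_inverse mult.assoc)
qed

text \<open>The pole of \<open>Z\<close> cancels in \<open>invM\<close>. The only quotient left,
  \<open>d e / (z * e^2)\<close>, is harmless because \<open>de\<close> makes \<open>d e\<close>
  divisible by \<open>z^3\<close>.\<close>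

lemma M_contact: "M = - 72 * J * Dl * d P - 54 * J * D' * P - 12 * J * d D' * z - 12 * J * D' * R
   + 72 * d J * Dl * P + 12 * d J * D' * z + 36 * J * (A * (d A)^2 + 3 * (d B)^2) * z
   - 108 * J^2 * d e / (z * e^2) + 108 * J^2 * d A * z^3 * e + 144 * A * J^2 * z^2 * R * e"
proof -
  have RP: "R = P + d z" by (simp add: P R)
  have ddx: "d (d x) * z^2 = x * P^2 - x * d P * z + x * P * d z"
  proof -
    have e1: "d x * z = - x * P" using dx z_nz by simp
    have "d (d x) * z + d x * d z = - (d x * P + x * d P)"
      using arg_cong[OF e1, of d] by (simp add: d_mult d_minus)
    then have "(d (d x) * z + d x * d z) * z = - (d x * P + x * d P) * z" by simp
    then show ?thesis using e1 by algebra
  qed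
  have dW: "d W = 6 * D' * d x + 6 * Dl * d (d x) + 18 * d J * x^2 + 36 * J * x * d x - d D' * x - D' * d x
      + 12 * d A * J + 12 * A * d J"
    unfolding invW_def d_invW_aux d_disc by (simp add: algebra_simps)
  have dxz: "d x * z = - x * P" and dyz: "d y * z = - y * R" using dx dy z_nz by auto
  have W: "W * z = - 6 * Dl * x * P + 18 * J * x^2 * z - D' * x * z + 12 * A * J * z"
    unfolding invW_def using dxz by algebra
  have dW': "d W * z^2 = - 5 * D' * x * P * z + 6 * Dl * (x * P^2 - x * d P * z + x * P * d z) + 18 * d J * x^2 * z^2
      - 36 * J * x^2 * P * z - d D' * x * z^2 + 12 * d A * J * z^2 + 12 * A * d J * z^2"
    unfolding dW using ddx dxz by algebra
  define Q where "Q = 6 * d x * (D' + 18 * J * x) - 36 * (A * (d A)^2 + 3 * (d B)^2) * x + 36 * d A * J"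
  have Qz: "Q * z = - 6 * x * P * (D' + 18 * J * x) - 36 * (A * (d A)^2 + 3 * (d B)^2) * x * z + 36 * d A * J * z"
    unfolding Q_def using dxz by algebra
  have "M * y^2 * z^2 = y * (12 * (J * (d W * z^2 + W * z * R) - d J * (W * z) * z) - J * (Q * z) * z)"
    using My2 dyz unfolding Q_def[symmetric] by algebra
  then have "y * (M * y * z^2) = y * (12 * (J * (d W * z^2 + W * z * R) - d J * (W * z) * z) - J * (Q * z) * z)"
    by (simp add: algebra_simps power2_eq_square)
  then have My: "M * y * z^2 = 12 * (J * (d W * z^2 + W * z * R) - d J * (W * z) * z) - J * (Q * z) * z"
    using y_nz by simp
  have z_e: "d e = e * (R - 3 * d z) / z" using z_nz e_nz by (simp add: R)
  define T where "T = - 72 * J * Dl * d P - 54 * J * D' * P - 12 * J * d D' * z - 12 * J * D' * R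
   + 72 * d J * Dl * P + 12 * d J * D' * z + 36 * J * (A * (d A)^2 + 3 * (d B)^2) * z
   + 108 * J^2 * d A * z^3 * e + 144 * A * J^2 * z^2 * R * e"
  have T2: "108 * J^2 * d e / (z * e^2) * (z^2 * e) = 108 * J^2 * (R - 3 * d z)"
    unfolding z_e using z_nz e_nz by (simp add: field_simps power2_eq_square)
  have "M * y * z^2 * (z^3 * e) = T * z^2 - 108 * J^2 * (R - 3 * d z) * x * z^2"
    unfolding My W dW' Qz T_def using RP xy_z by algebra
  then have "M * z^2 = T * z^2 - 108 * J^2 * (R - 3 * d z) * x * z^2" using xy_z(3) by algebra
  then have "(M - (T - 108 * J^2 * (R - 3 * d z) * x)) * z^2 = 0" by (simp add: algebra_simps)
  then have "M = T - 108 * J^2 * (R - 3 * d z) * x" using z_nz by (simp del: distrib_left_numeral)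
  also have "108 * J^2 * (R - 3 * d z) * x = 108 * J^2 * d e / (z * e^2)"
  proof -
    have "108 * J^2 * d e / (z * e^2) * (z^2 * e) = 108 * J^2 * (R - 3 * d z) * x * (z^2 * e)"
      unfolding T2 using xy_z(2) by algebra
    moreover have "z^2 * e \<noteq> 0" using z_nz e_nz by simp
    ultimately show ?thesis unfolding mult_right_cancel[OF \<open>z^2 * e \<noteq> 0\<close>] by (simp only:)
  qed
  finally show ?thesis unfolding T_def by simp
qed

text \<open>Implicit differentiation of \<open>e_eq\<close>; in the kernel of reduction the factor
  on the left is a unit (\<open>unit_int\<close>).\<close>

lemma de: "d e * (1 - 2 * A * z^4 * e - 3 * B * z^6 * e^2) =
    z^3 * (d A * z * e^2 + 4 * A * d z * e^2 + d B * z^3 * e^3 + 6 * B * z^2 * d z * e^3)"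
proof -
  have "d e = d A * z^4 * e^2 + A * (4 * z^3 * d z) * e^2 + A * z^4 * (2 * e * d e)
      + d B * z^6 * e^3 + B * (6 * z^5 * d z) * e^3 + B * z^6 * (3 * e^2 * d e)"
    using arg_cong[OF e_eq, of d] by (simp add: d_add d_mult d_power algebra_simps)
  then show ?thesis by algebra
qed

end

end

section \<open>Covariance under change of equation and of derivation\<close>

context derivation
begin

lemma invJ_scale: "invJ d (u^4 * a) (u^6 * b) = u^10 * invJ d a b"
  unfolding invJ_def d_mult d_power by (simp, algebra)

lemma invD_scale: "invD d (u^4 * a) (u^6 * b) = u^12 * invD d a b + 12 * u^11 * d u * (4 * a^3 + 27 * b^2)"
  unfolding invD_def d_mult d_power by (simp, algebra)

lemma invW_scale: "invW d (u^4 * a) (u^6 * b) (u^2 * x) = u^14 * invW d a b x"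
  unfolding invW_def invJ_scale invD_scale d_mult[of "u^2"] d_square by algebra

lemma invZ_scale: "u \<noteq> 0 \<Longrightarrow> invZ d (u^4 * a) (u^6 * b) (u^2 * x) (u^3 * y) = u^11 * invZ d a b x y"
proof -
  assume u: "u \<noteq> 0"
  have "u^14 * w / (u^3 * y) = u^11 * (w / y)" for w
  proof -
    have "u^14 * w / (u^3 * y) = (u^3 * (u^11 * w)) / (u^3 * y)"
      by (simp add: mult.assoc[symmetric] flip: power_add)
    also have "\<dots> = u^11 * w / y" by (rule nonzero_mult_divide_mult_cancel_left) (use u in simp)
    finally show ?thesis by simp
  qed
  then show ?thesis unfolding invZ_def invW_scale .
qed

text \<open>J and Z have weights 10 and 11, and the terms in \<open>d u\<close> cancel between
  \<open>J d Z - d J Z\<close> and the part with \<open>invD\<close>. The weights 10, 11 and 21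
  return as multiples of \<open>chi\<close> in the degree bounds.\<close>

lemma invM_scale:
  assumes u: "u \<noteq> 0" and D: "4 * a^3 + 27 * b^2 \<noteq> 0"
  shows "invM d (u^4 * a) (u^6 * b) (u^2 * x) (u^3 * y) = u^21 * invM d a b x y"
proof -
  define J Z Dl E where "J = invJ d a b" and "Z = invZ d a b x y" and "Dl = 4 * a^3 + 27 * b^2" and "E = invD d a b"
  have Dl: "4 * (u^4 * a)^3 + 27 * (u^6 * b)^2 = u^12 * Dl" unfolding Dl_def by algebra
  have dJ: "d (u^10 * J) = 10 * u^9 * d u * J + u^10 * d J" by (simp add: d_mult d_power)
  have dZ: "d (u^11 * Z) = 11 * u^10 * d u * Z + u^11 * d Z" by (simp add: d_mult d_power)
  define Q where "Q = E * J * Z + 18 * J^2 * (x * Z - 18 * J * y)"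
  have q: "(u^12 * E + 12 * u^11 * d u * Dl) * (u^10 * J) * (u^11 * Z) + 18 * (u^10 * J)^2 * (u^2 * x * (u^11 * Z) - 18 * (u^10 * J) * (u^3 * y))
      = u^12 * (u^21 * Q + 12 * u^20 * d u * Dl * J * Z)"
    unfolding Q_def by algebra
  have "invM d (u^4 * a) (u^6 * b) (u^2 * x) (u^3 * y) =
      12 * (u^10 * J * (11 * u^10 * d u * Z + u^11 * d Z) - (10 * u^9 * d u * J + u^10 * d J) * (u^11 * Z))
      - u^12 * (u^21 * Q + 12 * u^20 * d u * Dl * J * Z) / (u^12 * Dl)"
    unfolding invM_def invJ_scale invZ_scale[OF u] invD_scale Dl J_def[symmetric] Z_def[symmetric] E_def[symmetric]
      dJ dZ Dl_def[symmetric] q ..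
  also have "u^12 * (u^21 * Q + 12 * u^20 * d u * Dl * J * Z) / (u^12 * Dl) = u^21 * (Q / Dl) + 12 * u^20 * d u * J * Z"
    using u D by (simp add: Dl_def[symmetric] add_divide_distrib)
  also have "12 * (u^10 * J * (11 * u^10 * d u * Z + u^11 * d Z) - (10 * u^9 * d u * J + u^10 * d J) * (u^11 * Z))
      - (u^21 * (Q / Dl) + 12 * u^20 * d u * J * Z) = u^21 * (12 * (J * d Z - d J * Z) - Q / Dl)" by algebra
  finally show ?thesis
    unfolding invM_def J_def[symmetric] Z_def[symmetric] E_def[symmetric] Dl_def[symmetric] Q_def .
qed

lemma derivation_scale: "derivation (\<lambda>z. g * d z)"
  by unfold_locales (auto simp: d_add d_mult algebra_simps)

lemma invJ_g: "invJ (\<lambda>z. g * d z) A B = g * invJ d A B" unfolding invJ_def by algebra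
lemma invD_g: "invD (\<lambda>z. g * d z) A B = g * invD d A B" unfolding invD_def by algebra
lemma invW_g: "invW (\<lambda>z. g * d z) A B x = g * invW d A B x" unfolding invW_def invJ_g invD_g by algebra
lemma invZ_g: "invZ (\<lambda>z. g * d z) A B x y = g * invZ d A B x y" unfolding invZ_def invW_g by simp

text \<open>The terms in \<open>d g\<close> cancel in the Wronskian of J and Z.\<close>

lemma invM_g:
  assumes D: "4 * A^3 + 27 * B^2 \<noteq> 0"
  shows "invM (\<lambda>z. g * d z) A B x y = g^3 * invM d A B x y"
proof -
  define J Z Dl E where "J = invJ d A B" and "Z = invZ d A B x y" and "Dl = 4 * A^3 + 27 * B^2" and "E = invD d A B"
  define Q where "Q = E * J * Z + 18 * J^2 * (x * Z - 18 * J * y)"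
  have q: "g * E * (g * J) * (g * Z) + 18 * (g * J)^2 * (x * (g * Z) - 18 * (g * J) * y) = g^3 * Q"
    unfolding Q_def by algebra
  have "invM (\<lambda>z. g * d z) A B x y =
      12 * (g * J * (g * (d g * Z + g * d Z)) - g * (d g * J + g * d J) * (g * Z)) - g^3 * Q / Dl"
    unfolding invM_def invJ_g invZ_g invD_g J_def[symmetric] Z_def[symmetric] E_def[symmetric]
      d_mult[of g] Dl_def[symmetric] q ..
  also have "\<dots> = g^3 * (12 * (J * d Z - d J * Z) - Q / Dl)" by algebra
  finally show ?thesis
    unfolding invM_def J_def[symmetric] Z_def[symmetric] E_def[symmetric] Dl_def[symmetric] Q_def .
qed

end

text \<open>Models d/dt at a finite place; the logarithmic derivation at infinity also has this
  property.\<close>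

locale int_deriv = valuation v + derivation d
  for v :: "'a::field_char_0 \<Rightarrow> real" and d +
  assumes d_int: "vge 0 u \<Longrightarrow> vge 0 (d u)"
begin

lemma vge_quot: "vge 0 (a * b^2) \<Longrightarrow> veq 0 b \<Longrightarrow> vge 0 a"
  using vge_divide[of 0 "a * b^2" 0 "b^2"] veq_power[of 0 b 2] veq_nz[of 0 b] by simp

lemma vge_quot1: "vge 0 (a * b) \<Longrightarrow> veq 0 b \<Longrightarrow> vge 0 a"
  using vge_divide[of 0 "a * b" 0 b] veq_nz[of 0 b] by simp

context
  fixes A B x y
  assumes eq: "y^2 = x^3 + A * x + B" and y_nz: "y \<noteq> 0" and D_nz: "4 * A^3 + 27 * B^2 \<noteq> 0"
    and A: "vge 0 A" and B: "vge 0 B"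
begin

interpretation curve_point d A B x y by unfold_locales (use eq y_nz D_nz in auto)

lemma J_int: "vge 0 J" and D'_int: "vge 0 D'" and Dl_int: "vge 0 Dl"
  unfolding invJ_def invD_def using A B d_int[OF A] d_int[OF B] by (simp_all add: vge0_ring)

context
  assumes x: "vge 0 x"
begin

lemma y_int: "vge 0 y"
proof -
  have "vge 0 (y^2)" unfolding eq using x A B by (simp add: vge0_ring)
  then show ?thesis using y_nz v_power[of y 2] by (simp add: vge_def)
qed

lemma W_int: "vge 0 W" and V_int: "vge 0 V" and fx_int: "vge 0 fx"
  unfolding invW_def using A B x y_int J_int D'_int Dl_int d_int[OF x] d_int[OF y_int] by (simp_all add: vge0_ring)

lemma My2_int: "vge 0 (M * y^2)" and Mfx2_int: "vge 0 (M * fx^2)"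
  unfolding My2 Mfx2
  using A B x y_int J_int D'_int W_int V_int fx_int d_int[OF x] d_int[OF y_int] d_int[OF W_int] d_int[OF V_int]
    d_int[OF fx_int] d_int[OF J_int] d_int[OF A] d_int[OF B]
  by (simp_all add: vge0_ring)

lemma M_int_nonsing: assumes "veq 0 y \<or> veq 0 fx" shows "vge 0 M"
  using assms vge_quot[OF My2_int] vge_quot[OF Mfx2_int] by blast

lemma Z_int_nonsing: assumes "veq 0 y \<or> veq 0 fx" shows "vge 0 Z"
  using assms vge_quot1[of Z y] vge_quot1[of Z fx] W_int V_int unfolding Zy Zfx by blast

lemma M_disc_int: "vge 0 (M * Dl)"
proof -
  have "M * Dl = (3 * x^2 + 4 * A) * (M * fx^2) - 27 * (x^3 + A * x - B) * (M * y^2)"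
    by (subst disc_comb) algebra
  then show ?thesis using My2_int Mfx2_int x A B by (simp add: vge0_ring)
qed

lemma Z_disc_int: "vge 0 (Z * Dl)"
proof -
  have "Z * Dl = (3 * x^2 + 4 * A) * fx * (Z * fx) - 27 * (x^3 + A * x - B) * y * (Z * y)"
    by (subst disc_comb) algebra
  then show ?thesis unfolding Zy Zfx using W_int V_int fx_int y_int x A B by (simp add: vge0_ring)
qed

end

end

end

context int_deriv
begin

context
  fixes A B x y z e
  assumes eq: "y^2 = x^3 + A * x + B" and y_nz: "y \<noteq> 0" and D_nz: "4 * A^3 + 27 * B^2 \<noteq> 0"
    and A: "vge 0 A" and B: "vge 0 B" and x: "x \<noteq> 0" "v x < 0"
    and z: "z = x / y" and e: "e = y^2 / x^3"
begin

interpretation curve_point d A B x y by unfold_locales (use eq y_nz D_nz in auto)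

lemma contact_vals: "veq (- v x / 2) z" "veq 0 e"
proof -
  have x3: "veq (3 * v x) (x^3)" using veq_power[OF veq_v[OF x(1)], of 3] by simp
  have "vgt (3 * v x) (A * x + B)"
    using vge_vgt[OF vge_mult[OF A veq_vge[OF veq_v[OF x(1)]]], of "3 * v x"] vge_vgt[OF B, of "3 * v x"] x
    by (intro vgt_add) auto
  from veq_add[OF x3 this] have y2: "veq (3 * v x) (y^2)" unfolding eq by (simp add: add.assoc)
  then have vy: "v y = 3 * v x / 2" using v_power[OF y_nz, of 2] by (simp add: veq_def)
  have "veq (v x - v y) z" unfolding z using veq_divide[OF veq_v[OF x(1)] veq_v[OF y_nz]] .
  then show "veq (- v x / 2) z" using vy by simp
  show "veq 0 e" unfolding e using veq_divide[OF y2 x3] by simp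
qed

lemma z_int: "vge 0 z" using contact_vals(1) x by (auto simp: veq_def vge_def)

lemma e_int: "vge 0 e" "vge 0 (1 / e)"
  using contact_vals(2) veq_divide[OF veq_numeral(2) contact_vals(2)] veq_vge by auto

lemma unit_int: "veq 0 (1 - 2 * A * z^4 * e - 3 * B * z^6 * e^2)"
proof -
  have z0: "vgt 0 z" using contact_vals(1) x by (auto simp: veq_def vgt_def)
  have "vgt 0 (z * (2 * A * z^3 * e))" "vgt 0 (z * (3 * B * z^5 * e^2))"
    using vgt_vge_mult[OF z0, of 0 "2 * A * z^3 * e"] vgt_vge_mult[OF z0, of 0 "3 * B * z^5 * e^2"] A B z_int e_int
    by (simp_all add: vge0_ring mult.assoc)
  moreover have "z * (2 * A * z^3 * e) = 2 * A * z^4 * e" "z * (3 * B * z^5 * e^2) = 3 * B * z^6 * e^2" by algebra+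
  ultimately have "vgt 0 (2 * A * z^4 * e)" "vgt 0 (3 * B * z^6 * e^2)" by metis+
  then show ?thesis by (intro veq_diff) auto
qed

lemma de_int: "vge 0 (d e / z^3)"
proof -
  have zn: "z \<noteq> 0" using contact_vals(1) by (simp add: veq_def)
  define u where "u = 1 - 2 * A * z^4 * e - 3 * B * z^6 * e^2"
  have u: "veq 0 u" using unit_int u_def by simp
  have "d e / z^3 * u = d A * z * e^2 + 4 * A * d z * e^2 + d B * z^3 * e^3 + 6 * B * z^2 * d z * e^3"
    using de[OF x(1) z e] zn unfolding u_def[symmetric] by (simp add: field_simps)
  moreover have "vge 0 (d A * z * e^2 + 4 * A * d z * e^2 + d B * z^3 * e^3 + 6 * B * z^2 * d z * e^3)"
    using A B z_int e_int d_int[OF A] d_int[OF B] d_int[OF z_int] by (simp add: vge0_ring)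
  ultimately show ?thesis using vge_quot1[of "d e / z^3" u] u by simp
qed

lemma contact_int: "vge 0 M" "J = 0 \<Longrightarrow> vge 0 Z"
proof -
  have zn: "z \<noteq> 0" and en: "e \<noteq> 0" using contact_vals by (auto simp: veq_def)
  define g where "g = d e / z^3"
  have g: "vge 0 g" "d e = z^3 * g" using de_int zn by (auto simp: g_def)
  define P R where "P = 2 * d z + z * (d e / e)" and "R = 3 * d z + z * (d e / e)"
  have PR: "P = 2 * d z + z * (z^3 * g * (1 / e))" "R = 3 * d z + z * (z^3 * g * (1 / e))"
    by (auto simp: P_def R_def g)
  have Pi: "vge 0 P" and Ri: "vge 0 R"
    unfolding PR using z_int e_int g d_int[OF z_int] by (simp_all add: vge0_ring del: times_divide_eq_right)
  note ints = A B z_int e_int g(1) Pi Ri d_int[OF Pi] d_int[OF A] d_int[OF B]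
    J_int[OF eq y_nz D_nz A B] D'_int[OF eq y_nz D_nz A B] Dl_int[OF eq y_nz D_nz A B]
    d_int[OF J_int[OF eq y_nz D_nz A B]] d_int[OF D'_int[OF eq y_nz D_nz A B]]
  have q: "108 * J^2 * d e / (z * e^2) = 108 * J^2 * (z^2 * g * (1 / e)^2)"
    unfolding g(2) using zn en by (simp add: field_simps power2_eq_square power3_eq_cube)
  show "vge 0 M"
    unfolding M_contact[OF x(1) z e P_def R_def] q
    using ints by (simp add: vge0_ring del: times_divide_eq_right)
  show "vge 0 Z" if "J = 0"
  proof -
    have "Z = - (6 * Dl * P) - D' * z"
      unfolding Z_contact[OF x(1) z e P_def refl] that by (simp del: distrib_left_numeral)
    moreover have "vge 0 (- (6 * Dl * P) - D' * z)" using ints by (simp add: vge0_ring)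
    ultimately show ?thesis by (simp only:)
  qed
qed

end

end

text \<open>A logarithmic derivation such as \<open>t d/dt\<close> at infinity.\<close>
locale log_place = place_seq v A B X Y + derivation d
  for v :: "'a::field_char_0 \<Rightarrow> real" and A B X Y and d +
  assumes d_ge: "vge k u \<Longrightarrow> vge k (d u)"
    and d_res: "vge 0 u \<Longrightarrow> vgt 0 (d u)"
    and d_log: "u \<noteq> 0 \<Longrightarrow> v u = of_int i \<Longrightarrow> cg (d u / u) (- of_int i)"
begin

abbreviation "LJ \<equiv> invJ d A B"
abbreviation "LD \<equiv> invD d A B"

lemma J_ge: "vge (10 * mu) LJ"
proof -
  have "vge (4 * mu + 6 * mu) (A * d B)" "vge (4 * mu + 6 * mu) (d A * B)"
    using vge_mult[OF vA d_ge[OF vB]] vge_mult[OF d_ge[OF vA] vB] by auto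
  then have "vge (10 * mu) (2 * (A * d B) - 3 * (d A * B))" by (intro vge_diff) auto
  then show ?thesis unfolding invJ_def by (simp add: mult.assoc)
qed

lemma BJ': "27 * B * LJ = A * LD - 3 * Disc * d A"
  unfolding invD_def invJ_def by algebra

text \<open>\<open>BJ'\<close> expresses J by the logarithmic derivative r of
  \<open>Disc^(1/3) / A\<close>; its residue -i/3 is nonzero, so the valuation of J is exact. The
  second claim uses that \<open>A^3 / B^2\<close> has residue -27/4 when the scaled discriminant
  reduces to 0; it supplies \<open>tau\<close> in \<open>inf_M\<close>.\<close>

lemma J_mult:
  assumes N: "NN > 0" and i: "NN = of_int i"
  shows "veq (10 * mu + NN) LJ" "cg (A * (LJ / Disc)^2) (- ((of_int i)^2 / 108))"
proof -
  have An: "A \<noteq> 0" and Bn: "B \<noteq> 0" using A_nz[OF N] B_nz[OF N] by auto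
  have vAe: "veq (4 * mu) A" and vBe: "veq (6 * mu) B" using NN_pos_eq[OF N] by auto
  obtain k :: int where k: "v A = of_int k" using v_int_ex[OF An] by blast
  have k4: "4 * mu = of_int k" using vAe k by (simp add: veq_def)
  have vD: "v Disc = of_int (3 * k + i)" using vDisc i k4 by (simp add: veq_def)
  define r where "r = LD / Disc / 3 - d A / A"
  have dD: "d Disc = LD" by (rule d_disc)
  have "cg r (- of_int (3 * k + i) / 3 - (- of_int k))"
    unfolding r_def using d_log[OF disc_nz vD] d_log[OF An k] unfolding dD
    by (intro cg_diff cg_divide cg_numeral) auto
  then have cr: "cg r (- of_int i / 3)" by (simp add: field_simps)
  have "i \<noteq> 0" using i N by auto
  then have vr: "veq 0 r" using cg_nz[OF cr] by simp
  have BJr: "9 * B * LJ = A * Disc * r"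
  proof -
    define dl a where "dl = LD / Disc" and "a = d A / A"
    have r': "r = dl / 3 - a" unfolding r_def dl_def a_def ..
    have "LD = Disc * dl" using disc_nz unfolding dl_def by (simp del: distrib_left_numeral)
    moreover have "d A = A * a" using An by (simp add: a_def)
    moreover have "3 * r = dl - 3 * a" unfolding r' by simp
    ultimately have "3 * (9 * B * LJ) = 3 * (A * Disc * r)" using BJ' by algebra
    then show ?thesis by (rule mult_left_cancel[THEN iffD1, rotated]) simp
  qed
  have Je: "LJ = A * Disc * r / (9 * B)" using BJr Bn by (simp add: field_simps)
  have "veq (4 * mu + (12 * mu + NN) + 0 - 6 * mu) LJ"
    unfolding Je using vAe vDisc vr vBe by (intro veq_divide veq_mult) auto
  then show "veq (10 * mu + NN) LJ" by simp
  have e1: "A * (LJ / Disc)^2 = (A^3 / B^2) * r^2 / 81"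
  proof -
    have "LJ = Disc * (A * r / (9 * B))" unfolding Je by (simp add: mult_ac)
    then have jd: "LJ / Disc = A * r / (9 * B)" using disc_nz by (metis nonzero_mult_div_cancel_left)
    show ?thesis unfolding jd using Bn by (simp add: field_simps power2_eq_square power3_eq_cube)
  qed
  have "cg (A^3 / B^2) (- 27 / 4)"
  proof -
    have "vgt 0 (Disc / B^2)"
      using veq_divide[OF vDisc veq_power[OF vBe, of 2]] N by (auto simp: veq_def vgt_def)
    then have "cg ((Disc / B^2 - 27) / 4) ((0 - 27) / 4)"
      by (intro cg_divide cg_diff cg_numeral) (auto simp: cg_0)
    also have "(Disc / B^2 - 27) / 4 = A^3 / B^2" using Bn by (simp add: field_simps)
    finally show ?thesis by simp
  qed
  from cg_divide[OF cg_mult[OF this cg_power[OF cr, of 2]] cg_numeral(1), of "num.Bit1 (num.Bit0 (num.Bit0 (num.Bit0 (num.Bit1 (num.Bit0 num.One)))))"]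
  show "cg (A * (LJ / Disc)^2) (- ((of_int i)^2 / 108))"
    unfolding e1 by (simp add: power2_eq_square field_simps)
qed

text \<open>Here r has residue 0 if A has minimal valuation, so J gains valuation; otherwise A
  itself exceeds \<open>4 * mu\<close>. Either way \<open>tau\<close> is 0.\<close>

lemma J_good: assumes N: "NN = 0" shows "cg (A * (LJ / Disc)^2) 0"
proof (cases "A = 0 \<or> LJ = 0")
  case False
  then have An: "A \<noteq> 0" and Jn: "LJ \<noteq> 0" by auto
  have vD: "v Disc = 12 * mu" using vDisc N by (simp add: veq_def)
  have gt: "vgt (10 * mu) LJ" if vAe: "v A = 4 * mu"
  proof -
    obtain k :: int where k: "v A = of_int k" using v_int_ex[OF An] by blast
    have "v Disc = of_int (3 * k)" using vD vAe k by simp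
    note l1 = d_log[OF disc_nz this]
    note l2 = d_log[OF An k]
    define r where "r = LD / Disc / 3 - d A / A"
    have "cg r (- of_int (3 * k) / 3 - (- of_int k))"
      unfolding r_def using l1 l2 unfolding d_disc by (intro cg_diff cg_divide cg_numeral) auto
    then have r0: "vgt 0 r" by (simp add: cg_0)
    have BJr: "9 * B * LJ = A * Disc * r"
    proof -
    define dl a where "dl = LD / Disc" and "a = d A / A"
    have r': "r = dl / 3 - a" unfolding r_def dl_def a_def ..
    have "LD = Disc * dl" using disc_nz unfolding dl_def by (simp del: distrib_left_numeral)
    moreover have "d A = A * a" using An by (simp add: a_def)
    moreover have "3 * r = dl - 3 * a" unfolding r' by simp
    ultimately have "3 * (9 * B * LJ) = 3 * (A * Disc * r)" using BJ' by algebra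
    then show ?thesis by (rule mult_left_cancel[THEN iffD1, rotated]) simp
  qed
    show ?thesis
    proof (cases "vgt (6 * mu) B")
      case True
      have "vgt (6 * mu + 4 * mu) (B * d A)" by (rule vgt_vge_mult[OF True d_ge[OF vA]])
      moreover have "vgt (6 * mu + 4 * mu) (d B * A)"
      proof -
        have "vgt (6 * mu) (d B)"
        proof (cases "B = 0")
          case False
          then have "v B > 6 * mu" using True by (simp add: vgt_def)
          then show ?thesis using d_ge[OF veq_vge[OF veq_v[OF False]]] vge_vgt by blast
        qed simp
        from vgt_vge_mult[OF this vA] show ?thesis .
      qed
      ultimately have "vgt (10 * mu) (2 * (d B * A) - 3 * (B * d A))" by (intro vgt_diff) auto
      then show ?thesis unfolding invJ_def by (simp add: mult.commute mult.left_commute mult.assoc)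
    next
      case False
      then have vBe: "veq (6 * mu) B" using vB vge_or_vgt by blast
      then have Bn: "B \<noteq> 0" by (simp add: veq_def)
      have Je: "LJ = r * (A * Disc) / (9 * B)" using BJr Bn by (simp add: field_simps)
      have "vgt (0 + (4 * mu + 12 * mu) - 6 * mu) LJ"
        unfolding Je using vBe vgt_vge_mult[OF r0 vge_mult[OF vA vDisc_ge]] by (intro vgt_divide) auto
      then show ?thesis by simp
    qed
  qed
  have "v A + 2 * v LJ > 24 * mu"
  proof (cases "v A = 4 * mu")
    case True then show ?thesis using gt Jn by (simp add: vgt_def)
  next
    case False
    then have "v A > 4 * mu" "v LJ \<ge> 10 * mu" using vA J_ge An Jn by (auto simp: vge_def)
    then show ?thesis by simp
  qed
  moreover have "v (A * (LJ / Disc)^2) = v A + 2 * (v LJ - 12 * mu)"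
    using An Jn disc_nz vD by (simp add: v_mult v_power v_divide)
  ultimately show ?thesis by (simp add: cg_0 vgt_def)
qed (auto simp: cg_0)

end

sublocale log_place \<subseteq> int_deriv v d
  by unfold_locales (use d_ge in blast)

context log_place
begin

lemma J_Disc_ge: "vge (- 2 * mu) (LJ / Disc)"
proof (cases "NN > 0")
  case True
  obtain i :: int where i: "NN = of_int i" using NN_int by (auto elim: Ints_cases)
  show ?thesis using veq_vge[OF veq_divide[OF J_mult(1)[OF True i] vDisc]] by (simp add: algebra_simps)
next
  case False
  then have "NN = 0" using NN_nonneg by simp
  then show ?thesis using vge_divide[OF J_ge vDisc] by simp
qed

context
  fixes n :: nat and x y z e :: 'a and Ri Di :: int and P R :: 'a
  assumes n: "n \<ge> 1" and x: "x = X n" and y: "y = Y n" and z: "z = x / y" and e: "e = y^2 / x^3"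
    and Ri: "v x = - 2 * of_int Ri" and Ri_pos: "Ri > 0" and x_nz: "x \<noteq> 0" and Di: "v Disc = of_int Di"
    and P: "P = 2 * d z + z * (d e / e)" and R: "R = 3 * d z + z * (d e / e)"
begin

lemma eq_xy: "y^2 = x^3 + A * x + B" and y_nz: "y \<noteq> 0" using curve[OF n] Y_ne_0[OF n] x y by auto

interpretation curve_point d A B x y by unfold_locales (use eq_xy y_nz disc_nz in auto)

lemma v_neg: "v x < 0" using Ri Ri_pos by simp

lemma vals: "veq (of_int Ri) z" "veq 0 e"
  using contact_vals[OF eq_xy y_nz disc_nz A_int B_int x_nz v_neg z e] Ri by auto

lemma z0: "z \<noteq> 0" and e0: "e \<noteq> 0" using vals by (auto simp: veq_def)

lemma cg_rho: "cg (d z / z) (- of_int Ri)" using d_log[OF z0] vals(1) by (simp add: veq_def)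
lemma cg_eta: "cg (d e / e) 0" using d_log[OF e0, of 0] vals(2) by (simp add: veq_def)
lemma cg_dl: "cg (D' / Disc) (- of_int Di)" using d_log[OF disc_nz Di] unfolding d_disc .
lemma Pz: "P / z = 2 * (d z / z) + d e / e" and Rz: "R / z = 3 * (d z / z) + d e / e"
  unfolding P R using z0 by (simp_all add: field_simps)
lemma cg_P: "cg (P / z) (- 2 * of_int Ri)"
proof -
  have "cg (2 * (d z / z) + d e / e) (2 * (- of_int Ri) + 0)"
    by (intro cg_add cg_mult cg_numeral cg_rho cg_eta)
  then show ?thesis unfolding Pz by simp
qed
lemma cg_R: "cg (R / z) (- 3 * of_int Ri)"
proof -
  have "cg (3 * (d z / z) + d e / e) (3 * (- of_int Ri) + 0)"
    by (intro cg_add cg_mult cg_numeral cg_rho cg_eta)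
  then show ?thesis unfolding Rz by simp
qed
lemma cg_d: "cg w q \<Longrightarrow> cg (d w) 0" using d_res[OF cg_vge] by (simp add: cg_0)
lemma cg_dP: "cg (d P / z) (2 * (of_int Ri)^2)"
proof -
  have "P = z * (P / z)" using z0 by simp
  then have "d P = d z * (P / z) + z * d (P / z)" by (metis d_mult)
  then have "d P / z = (d z / z) * (P / z) + d (P / z)" using z0 by (simp add: field_simps)
  moreover have "cg ((d z / z) * (P / z) + d (P / z)) ((- of_int Ri) * (- 2 * of_int Ri) + 0)"
    by (intro cg_add cg_mult cg_rho cg_P cg_d[OF cg_P])
  moreover have "(- of_int Ri) * (- 2 * of_int Ri) + 0 = (2 * (of_int Ri)^2 :: rat)" by (simp add: power2_eq_square)
  ultimately show ?thesis by (simp only:)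
qed
lemma cg_dD': "cg (d D' / Disc) ((of_int Di)^2)"
proof -
  have "D' = Disc * (D' / Disc)" using disc_nz by (simp del: distrib_left_numeral)
  then have "d D' = D' * (D' / Disc) + Disc * d (D' / Disc)" by (metis d_mult d_disc)
  then have "d D' / Disc = (D' / Disc) * (D' / Disc) + d (D' / Disc)"
    using disc_nz by (simp add: add_divide_distrib)
  moreover have "cg ((D' / Disc) * (D' / Disc) + d (D' / Disc)) ((- of_int Di) * (- of_int Di) + 0)"
    by (intro cg_add cg_mult cg_dl cg_d[OF cg_dl])
  ultimately show ?thesis by (simp add: power2_eq_square)
qed

text \<open>The leading coefficient is \<open>12 Ri + Di\<close>, positive because the contact order
  is.\<close>

lemma inf_Z: assumes J0: "J = 0" shows "Z \<noteq> 0 \<and> v Z = of_int (Di + Ri) \<and> NN = 0"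
proof -
  have "Z = - (6 * Disc * P) - D' * z"
    unfolding Z_contact[OF x_nz z e P refl] J0 by (simp del: distrib_left_numeral)
  also have "\<dots> = Disc * z * (- (6 * (P / z)) - D' / Disc)"
  proof -
    have "Disc * z * (- (6 * (P / z)) - D' / Disc) = - (6 * Disc * (z * (P / z))) - z * (Disc * (D' / Disc))" by algebra
    moreover have "z * (P / z) = P" "Disc * (D' / Disc) = D'" using z0 disc_nz by (simp_all del: distrib_left_numeral)
    ultimately show ?thesis by (simp only: mult.commute)
  qed
  finally have Ze: "Z = Disc * z * (- (6 * (P / z)) - D' / Disc)" .
  have "cg (- (6 * (P / z)) - D' / Disc) (- (6 * (- 2 * of_int Ri)) - (- of_int Di))"
    by (intro cg_diff cg_uminus cg_mult cg_numeral cg_P cg_dl)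
  moreover have "Di \<ge> 0"
  proof -
    have "v Disc \<ge> 0" using vDisc NN_nonneg mu0 by (simp add: veq_def)
    then show ?thesis using Di by simp
  qed
  ultimately have "veq 0 (- (6 * (P / z)) - D' / Disc)"
    using Ri_pos by (intro cg_nz) (auto simp flip: of_int_mult of_int_add)
  then have "veq (of_int Di + of_int Ri + 0) Z"
    unfolding Ze using Di disc_nz vals(1) by (intro veq_mult) (auto simp: veq_def)
  moreover have "NN = 0"
  proof (rule ccontr)
    assume "NN \<noteq> 0"
    then have N: "NN > 0" using NN_nonneg by simp
    obtain i :: int where "NN = of_int i" using NN_int by (auto elim: Ints_cases)
    then show False using J_mult(1)[OF N] J0 by (simp add: veq_def)
  qed
  ultimately show ?thesis by (simp add: veq_def)
qed

text \<open>The residue is the indicial polynomial of the Picard-Fuchs operator at infinity,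
  evaluated at \<open>Ri\<close>. Where it is nonzero, \<open>M\<close> vanishes there exactly to
  order \<open>v J + v Disc + Ri\<close>.\<close>

lemma inf_M:
  assumes Jn: "J \<noteq> 0" and ii: "v J = of_int ii" and tau: "cg (A * (J / Disc)^2) tau"
  shows "cg (M / (J * Disc * z)) (- 144 * (of_int Ri)^2 - 144 * of_int Ri * of_int Di + 144 * of_int ii * of_int Ri
     - 11 * (of_int Di)^2 + 12 * of_int ii * of_int Di + 108 * tau)"
proof -
  define jd where "jd = J / Disc"
  \<comment> \<open>\<open>T\<close> collects the terms that contribute to the residue,
    \<open>S\<close> those of positive valuation.\<close>
  define T where "T = - (72 * (d P / z)) - 54 * (D' / Disc) * (P / z) - 12 * (d D' / Disc) - 12 * (D' / Disc) * (R / z)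
    + 72 * (d J / J) * (P / z) + 12 * (d J / J) * (D' / Disc) + ((D' / Disc)^2 + 108 * (A * jd^2))"
  define S where "S = - (108 * (jd * (d e / (z^2 * e^2)))) + 108 * (jd * d A * z^2 * e) + 144 * (jd * A * z^2 * e * (R / z))"
  have kap: "36 * (A * (d A)^2 + 3 * (d B)^2) / Disc = (D' / Disc)^2 + 108 * (A * jd^2)"
  proof -
    have "Disc^2 * (36 * (A * (d A)^2 + 3 * (d B)^2) / Disc) = Disc * (36 * (A * (d A)^2 + 3 * (d B)^2))"
      using disc_nz by (simp add: power2_eq_square del: distrib_left_numeral)
    also have "\<dots> = D'^2 + 108 * A * J^2" using kappa by algebra
    also have "\<dots> = Disc^2 * ((D' / Disc)^2 + 108 * (A * jd^2))"
    proof -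
      define dd where "dd = D' / Disc"
      have "D' = Disc * dd" "J = Disc * jd" using disc_nz unfolding jd_def dd_def by (simp_all del: distrib_left_numeral)
      then show ?thesis unfolding dd_def[symmetric] by algebra
    qed
    finally show ?thesis by (rule mult_left_cancel[THEN iffD1, rotated]) (use disc_nz in simp)
  qed
  have MT: "M = J * Disc * z * (T + S)"
  proof -
    define p r q dd jj k f where "p = P / z" and "r = R / z" and "q = d P / z" and "dd = D' / Disc"
      and "jj = d J / J" and "k = d D' / Disc" and "f = d e / (z^2 * e^2)"
    have s: "P = z * p" "R = z * r" "d P = z * q" "D' = Disc * dd" "d J = J * jj" "d D' = Disc * k" "J = Disc * jd"
      using z0 disc_nz Jn by (simp_all add: p_def r_def q_def dd_def jj_def k_def jd_def del: distrib_left_numeral)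
    have kk: "36 * (A * (d A)^2 + 3 * (d B)^2) = Disc * (dd^2 + 108 * (A * jd^2))"
      using kap disc_nz unfolding dd_def by (metis nonzero_divide_eq_eq mult.commute)
    have ff: "108 * J^2 * d e / (z * e^2) = 108 * J^2 * z * f"
      unfolding f_def using z0 e0 by (simp add: field_simps power2_eq_square)
    have "36 * J * (A * (d A)^2 + 3 * (d B)^2) * z = J * z * (36 * (A * (d A)^2 + 3 * (d B)^2))" by algebra
    also have "\<dots> = J * z * (Disc * (dd^2 + 108 * (A * jd^2)))" unfolding kk ..
    finally have k2: "36 * J * (A * (d A)^2 + 3 * (d B)^2) * z = J * z * (Disc * (dd^2 + 108 * (A * jd^2)))" .
    show ?thesis
      unfolding M_contact[OF x_nz z e P R] ff k2 T_def S_def p_def[symmetric] r_def[symmetric] q_def[symmetric]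
        dd_def[symmetric] jj_def[symmetric] k_def[symmetric] f_def[symmetric]
      using s by algebra
  qed
  have "cg T (- (72 * (2 * (of_int Ri)^2)) - 54 * (- of_int Di) * (- 2 * of_int Ri) - 12 * (of_int Di)^2
      - 12 * (- of_int Di) * (- 3 * of_int Ri) + 72 * (- of_int ii) * (- 2 * of_int Ri) + 12 * (- of_int ii) * (- of_int Di)
      + ((- of_int Di)^2 + 108 * tau))"
    unfolding T_def using tau d_log[OF Jn ii]
    by (intro cg_add cg_diff cg_uminus cg_mult cg_power cg_numeral cg_P cg_R cg_dP cg_dl cg_dD') (auto simp: jd_def)
  moreover have "cg S 0"
  proof -
    have jdv: "vge (- 2 * mu) jd" unfolding jd_def by (rule J_Disc_ge)
    have zv: "vge (of_int Ri) z" and ev: "vge 0 e" using vals veq_vge by auto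
    have Rp: "real_of_int Ri > 0" using Ri_pos by simp
    have z2: "vge (2 * of_int Ri) (z^2)" using vge_power[OF zv, of 2] by simp
    have s2: "vgt 0 (jd * d A * z^2 * e)"
      using vge_vgt[OF vge_mult[OF vge_mult[OF vge_mult[OF jdv d_ge[OF vA]] z2] ev], of 0] mu0 Rp by simp
    have "vge ((- 2 * mu) + 4 * mu + 2 * of_int Ri + 0) (jd * A * z^2 * e)"
      by (intro vge_mult jdv vA z2 ev)
    from vge_mult[OF this cg_vge[OF cg_R]] have s3: "vgt 0 (jd * A * z^2 * e * (R / z))"
      using vge_vgt[of _ _ 0] mu0 Rp by auto
    define u where "u = 1 - 2 * A * z^4 * e - 3 * B * z^6 * e^2"
    have u: "veq 0 u" unfolding u_def using unit_int[OF eq_xy y_nz disc_nz A_int B_int x_nz v_neg z e] .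
    define w where "w = d A * z * e^2 + 4 * A * d z * e^2 + d B * z^3 * e^3 + 6 * B * z^2 * d z * e^3"
    have "vge (4 * mu) w"
    proof -
      have zi: "vge 0 z" and dzi: "vge 0 (d z)" using vge_mono[OF zv, of 0] Rp d_ge by auto
      have e2: "vge 0 (e^2)" and e3: "vge 0 (e^3)" and z3: "vge 0 (z^3)" and z2': "vge 0 (z^2)"
        using ev zi by (simp_all add: vge0_ring)
      have "vge (4 * mu + 0 + 0) (d A * z * e^2)" by (intro vge_mult d_ge[OF vA] zi e2)
      moreover have "vge (4 * mu + 0 + 0) (A * d z * e^2)" by (intro vge_mult vA dzi e2)
      moreover have "vge (6 * mu + 0 + 0) (d B * z^3 * e^3)" by (intro vge_mult d_ge[OF vB] z3 e3)
      moreover have "vge (6 * mu + 0 + 0 + 0) (B * z^2 * d z * e^3)" by (intro vge_mult vB z2' dzi e3)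
      ultimately have "vge (4 * mu) (d A * z * e^2)" "vge (4 * mu) (4 * (A * d z * e^2))"
          "vge (4 * mu) (d B * z^3 * e^3)" "vge (4 * mu) (6 * (B * z^2 * d z * e^3))"
        using mu0 by (auto elim: vge_mono)
      from vge_add[OF vge_add[OF vge_add[OF this(1,2)] this(3)] this(4)] show ?thesis
        unfolding w_def by (simp add: mult.assoc)
    qed
    moreover have "jd * (d e / (z^2 * e^2)) = jd * z * w / (u * e^2)"
    proof -
      have "d e * u = z^3 * w" using de[OF x_nz z e P R] unfolding u_def w_def .
      then have "d e = z^3 * w / u" using veq_nz[OF u] by (simp add: field_simps)
      then show ?thesis using z0 e0 by (simp add: field_simps power2_eq_square power3_eq_cube)
    qed
    moreover have "veq (0 + 2 * 0) (u * e^2)" using u veq_power[OF vals(2), of 2] by (intro veq_mult) auto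
    ultimately have "vge (((- 2 * mu) + of_int Ri + 4 * mu) - (0 + 2 * 0)) (jd * (d e / (z^2 * e^2)))"
      using vge_divide[OF vge_mult[OF vge_mult[OF jdv zv]]] by metis
    then have s1: "vgt 0 (jd * (d e / (z^2 * e^2)))" by (rule vge_vgt) (use mu0 Rp in simp)
    show ?thesis unfolding cg_0 S_def using s1 s2 s3 by (intro vgt_add) (simp_all only: vgt_uminus vgt_cmult)
  qed
  ultimately have "cg (T + S) (- (72 * (2 * (of_int Ri)^2)) - 54 * (- of_int Di) * (- 2 * of_int Ri) - 12 * (of_int Di)^2
      - 12 * (- of_int Di) * (- 3 * of_int Ri) + 72 * (- of_int ii) * (- 2 * of_int Ri) + 12 * (- of_int ii) * (- of_int Di)
      + ((- of_int Di)^2 + 108 * tau) + 0)" by (rule cg_add)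
  moreover have "M / (J * Disc * z) = T + S" unfolding MT using Jn disc_nz z0 by (simp del: distrib_left_numeral)
  ultimately show ?thesis by (simp add: power2_eq_square algebra_simps)
qed

text \<open>The indicial polynomial becomes minus the square of \<open>12 Ri + Di - i\<close>, which
  is positive; no contact order is exceptional.\<close>

lemma inf_M_mult:
  assumes N: "NN > 0" shows "M \<noteq> 0 \<and> v M = 22 * mu + 2 * NN + of_int Ri"
proof -
  obtain i :: int where i: "NN = of_int i" using NN_int by (auto elim: Ints_cases)
  have Jv: "veq (10 * mu + NN) J" and tau: "cg (A * (J / Disc)^2) (- ((of_int i)^2 / 108))"
    using J_mult[OF N i] by auto
  have Jn: "J \<noteq> 0" using Jv by (simp add: veq_def)
  obtain ii :: int where ii: "v J = of_int ii" using v_int_ex[OF Jn] by blast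
  have D12: "of_int Di = 12 * mu + NN" using Di vDisc by (simp add: veq_def)
  have "6 * real_of_int ii = 5 * of_int Di + of_int i" using ii Jv D12 i by (simp add: veq_def)
  then have e6: "6 * ii = 5 * Di + i" by linarith
  have e6': "6 * (of_int ii :: rat) = 5 * of_int Di + of_int i"
    using arg_cong[OF e6, of "of_int :: int \<Rightarrow> rat"] by simp
  have "cg (M / (J * Disc * z)) (- ((12 * of_int Ri + of_int Di - of_int i)^2))"
  proof -
    have "- 144 * (of_int Ri)^2 - 144 * of_int Ri * of_int Di + 144 * of_int ii * of_int Ri
     - 11 * (of_int Di)^2 + 12 * of_int ii * of_int Di + 108 * (- ((of_int i)^2 / 108)) =
     (- ((12 * of_int Ri + of_int Di - of_int i)^2) :: rat)"
      using e6' by simp algebra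
    then show ?thesis using inf_M[OF Jn ii tau] by metis
  qed
  moreover have "12 * Ri + Di - i > 0"
  proof -
    have "real_of_int Di - of_int i \<ge> 0" using D12 i mu0 by simp
    then show ?thesis using Ri_pos by linarith
  qed
  then have "- ((12 * of_int Ri + of_int Di - of_int i)^2) \<noteq> (0::rat)"
    by (simp flip: of_int_mult of_int_add of_int_diff)
  ultimately have "veq 0 (M / (J * Disc * z))" using cg_nz by blast
  then have "veq (0 + ((10 * mu + NN) + (12 * mu + NN) + of_int Ri)) (M / (J * Disc * z) * (J * Disc * z))"
    using Jv vDisc vals(1) by (intro veq_mult)
  then show ?thesis using Jn disc_nz z0 by (simp add: veq_def del: distrib_left_numeral)
qed

text \<open>The indicial polynomial splits into two linear factors. \<open>12 Ri + Di\<close> is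
  positive; the other one vanishes for the single contact order \<open>ii - 11 * mu\<close>, where M
  gives no information but the order itself is explicit.\<close>

lemma inf_M_good:
  assumes N: "NN = 0" and Jn: "J \<noteq> 0" and ii: "v J = of_int ii"
  shows "of_int Ri + 11 * mu = of_int ii \<or> M \<noteq> 0 \<and> v M = of_int ii + 12 * mu + of_int Ri"
proof -
  have D12: "of_int Di = 12 * mu" using Di vDisc N by (simp add: veq_def)
  have c: "cg (M / (J * Disc * z)) (- ((12 * of_int Ri + of_int Di) * (12 * of_int Ri + 11 * of_int Di - 12 * of_int ii)))"
    using inf_M[OF Jn ii J_good[OF N]] by (simp add: power2_eq_square algebra_simps)
  show ?thesis
  proof (cases "12 * Ri + 11 * Di - 12 * ii = 0")
    case True
    then have "12 * real_of_int Ri + 11 * of_int Di = 12 * of_int ii" by linarith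
    then show ?thesis using D12 by simp
  next
    case False
    have "12 * Ri + Di > 0"
    proof -
      have "real_of_int Di \<ge> 0" using D12 mu0 by simp
      then show ?thesis using Ri_pos by linarith
    qed
    then have "- ((12 * of_int Ri + of_int Di) * (12 * of_int Ri + 11 * of_int Di - 12 * of_int ii)) \<noteq> (0::rat)"
      using False by (simp flip: of_int_mult of_int_add of_int_diff)
    from cg_nz[OF c this]
    have "veq (0 + (of_int ii + (12 * mu + NN) + of_int Ri)) (M / (J * Disc * z) * (J * Disc * z))"
      using veq_v[OF Jn] vDisc vals(1) ii by (intro veq_mult) auto
    then show ?thesis using Jn disc_nz z0 N by (simp add: veq_def del: distrib_left_numeral)
  qed
qed

end

end

section \<open>The places of the rational function field\<close>

lemma normalize_rat_poly: "normalize (a :: rat poly) = smult (1 / lead_coeff a) a"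
  by (rule poly_eqI) (simp add: coeff_normalize)

lemma prime_rat_poly_iff: "prime (p :: rat poly) \<longleftrightarrow> irreducible p \<and> lead_coeff p = 1"
proof
  assume p: "prime p"
  then have "p \<noteq> 0" and i: "irreducible p" by (auto intro: prime_elem_imp_irreducible)
  have "normalize p = p" using p by (simp add: normalize_prime)
  then have "coeff p (degree p) div lead_coeff p = coeff p (degree p)"
    using coeff_normalize[of p "degree p"] by simp
  then show "irreducible p \<and> lead_coeff p = 1" using i \<open>p \<noteq> 0\<close> by simp
next
  assume p: "irreducible p \<and> lead_coeff p = 1"
  then have "prime_elem p" by (simp add: irreducible_imp_prime_elem_gcd)
  moreover have "normalize p = p" using p by (simp add: normalize_rat_poly)
  ultimately show "prime p" by (simp add: prime_def)
qed

lemma degree_normalize_rat: "degree (normalize (a :: rat poly)) = degree a"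
  by (cases "a = 0") (auto simp: normalize_rat_poly)

lemma polyK_simps [simp]:
  "polyK (p + q) = polyK p + polyK q" "polyK (p * q) = polyK p * polyK q" "polyK (p - q) = polyK p - polyK q"
  "polyK (- p) = - polyK p" "polyK 0 = 0" "polyK 1 = 1" "polyK (p ^ n) = polyK p ^ n"
proof -
  show m: "polyK (p * q) = polyK p * polyK q" for p q by (simp add: polyK_def)
  show "polyK 1 = 1" by (simp add: polyK_def One_fract_def)
  then show "polyK (p ^ n) = polyK p ^ n" by (induction n) (auto simp: m)
qed (auto simp: polyK_def Zero_fract_def)

lemma polyK_of_nat [simp]: "polyK (of_nat n) = of_nat n" by (simp add: polyK_def of_nat_fract)
lemma polyK_numeral [simp]: "polyK (numeral n) = numeral n" using polyK_of_nat[of "numeral n"] by simp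
lemma polyK_eq_iff [simp]: "polyK p = polyK q \<longleftrightarrow> p = q" by (simp add: polyK_def eq_fract)
lemma polyK_eq_0_iff [simp]: "polyK p = 0 \<longleftrightarrow> p = 0" using polyK_eq_iff[of p 0] by (simp del: polyK_eq_iff)
lemma Fract_polyK: "b \<noteq> 0 \<Longrightarrow> Fract a b = polyK a / polyK b" by (simp add: polyK_def)

lemma K_cases: obtains a b where "b \<noteq> 0" "z = polyK a / polyK b"
  by (cases z) (auto simp: Fract_polyK)

lemma Fract_eq_iff: "b \<noteq> 0 \<Longrightarrow> d \<noteq> 0 \<Longrightarrow> polyK a / polyK b = polyK c / polyK d \<longleftrightarrow> a * d = c * b"
  by (simp add: frac_eq_eq flip: polyK_simps(2))

lemma vfin_eq:
  assumes p: "prime p" and ab: "a \<noteq> 0" "b \<noteq> 0"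
  shows "vfin p (polyK a / polyK b) = int (multiplicity p a) - int (multiplicity p b)"
  unfolding vfin_def
proof (rule the_equality)
  show "\<exists>a' b'. b' \<noteq> 0 \<and> polyK a / polyK b = Fract a' b' \<and>
      int (multiplicity p a) - int (multiplicity p b) = int (multiplicity p a') - int (multiplicity p b')"
    using ab by (intro exI[of _ a] exI[of _ b]) (auto simp: Fract_polyK)
next
  fix e assume "\<exists>a' b'. b' \<noteq> 0 \<and> polyK a / polyK b = Fract a' b' \<and> e = int (multiplicity p a') - int (multiplicity p b')"
  then obtain a' b' where b': "b' \<noteq> 0" and eq: "polyK a / polyK b = polyK a' / polyK b'"
    and e: "e = int (multiplicity p a') - int (multiplicity p b')" by (auto simp: Fract_polyK)
  have E: "a * b' = a' * b" using Fract_eq_iff[OF ab(2) b'] eq by blast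
  then have "a' \<noteq> 0" using ab b' by auto
  have "multiplicity p a + multiplicity p b' = multiplicity p a' + multiplicity p b"
    using arg_cong[OF E, of "multiplicity p"] prime_elem_multiplicity_mult_distrib[of p] p ab b' \<open>a' \<noteq> 0\<close> by simp
  then show "e = int (multiplicity p a) - int (multiplicity p b)" using e by linarith
qed

lemma vinf_eq:
  assumes ab: "a \<noteq> 0" "b \<noteq> 0"
  shows "vinf (polyK a / polyK b) = int (degree b) - int (degree a)"
  unfolding vinf_def
proof (rule the_equality)
  show "\<exists>a' b'. b' \<noteq> 0 \<and> polyK a / polyK b = Fract a' b' \<and> int (degree b) - int (degree a) = int (degree b') - int (degree a')"
    using ab by (intro exI[of _ a] exI[of _ b]) (auto simp: Fract_polyK)
next
  fix e assume "\<exists>a' b'. b' \<noteq> 0 \<and> polyK a / polyK b = Fract a' b' \<and> e = int (degree b') - int (degree a')"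
  then obtain a' b' where b': "b' \<noteq> 0" and eq: "polyK a / polyK b = polyK a' / polyK b'"
    and e: "e = int (degree b') - int (degree a')" by (auto simp: Fract_polyK)
  have E: "a * b' = a' * b" using Fract_eq_iff[OF ab(2) b'] eq by blast
  then have "a' \<noteq> 0" using ab b' by auto
  have "degree a + degree b' = degree a' + degree b"
    using arg_cong[OF E, of degree] ab b' \<open>a' \<noteq> 0\<close> by (simp add: degree_mult_eq)
  then show "e = int (degree b) - int (degree a)" using e by linarith
qed

lemma vfin_poly: "prime p \<Longrightarrow> a \<noteq> 0 \<Longrightarrow> vfin p (polyK a) = int (multiplicity p a)"
  using vfin_eq[of p a 1] by simp

lemma vinf_poly: "a \<noteq> 0 \<Longrightarrow> vinf (polyK a) = - int (degree a)"
  using vinf_eq[of a 1] by simp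

lemma valuation_from_poly:
  fixes m :: "rat poly \<Rightarrow> int" and w :: "K \<Rightarrow> int"
  assumes w: "\<And>a b. a \<noteq> 0 \<Longrightarrow> b \<noteq> 0 \<Longrightarrow> w (polyK a / polyK b) = m a - m b"
    and mm: "\<And>a b. a \<noteq> 0 \<Longrightarrow> b \<noteq> 0 \<Longrightarrow> m (a * b) = m a + m b"
    and ma: "\<And>a b. a \<noteq> 0 \<Longrightarrow> b \<noteq> 0 \<Longrightarrow> a + b \<noteq> 0 \<Longrightarrow> m (a + b) \<ge> min (m a) (m b)"
    and mn: "\<And>n. n \<noteq> 0 \<Longrightarrow> m (of_nat n) = 0"
  shows "valuation (\<lambda>z. real_of_int (w z))"
proof
  fix x y :: K
  assume x: "x \<noteq> 0" and y: "y \<noteq> 0"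
  obtain a b where ab: "b \<noteq> 0" "x = polyK a / polyK b" by (rule K_cases)
  obtain c d where cd: "d \<noteq> 0" "y = polyK c / polyK d" by (rule K_cases)
  have n: "a \<noteq> 0" "c \<noteq> 0" using ab cd x y by auto
  have "x * y = polyK (a * c) / polyK (b * d)" using ab cd by simp
  then show "real_of_int (w (x * y)) = real_of_int (w x) + real_of_int (w y)"
    using w[of "a * c" "b * d"] w[of a b] w[of c d] mm n ab cd by simp
  assume xy: "x + y \<noteq> 0"
  have e: "x + y = polyK (a * d + c * b) / polyK (b * d)" using ab cd by (simp add: add_frac_eq)
  then have n2: "a * d + c * b \<noteq> 0" using xy by (metis polyK_simps(5) div_0)
  have "m (a * d + c * b) \<ge> min (m a + m d) (m c + m b)"
    using ma[of "a * d" "c * b"] mm[of a d] mm[of c b] n ab cd n2 by simp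
  then have "w (x + y) \<ge> min (w x) (w y)"
    unfolding e using w[of "a * d + c * b" "b * d"] w[of a b] w[of c d] mm[of b d] n n2 ab cd by auto
  then show "min (real_of_int (w x)) (real_of_int (w y)) \<le> real_of_int (w (x + y))" by linarith
next
  fix n :: nat assume n: "n \<noteq> 0"
  have "of_nat n = polyK (of_nat n) / polyK 1" by simp
  then show "real_of_int (w (of_nat n)) = 0"
    using w[of "of_nat n" 1] mn[of n] mn[of 1] n by (metis diff_self of_int_0 of_nat_1 of_nat_eq_0_iff one_neq_zero)
qed simp

lemma multiplicity_add_ge:
  assumes "prime p" "a \<noteq> 0" "b \<noteq> 0" "a + b \<noteq> (0 :: rat poly)"
  shows "min (multiplicity p a) (multiplicity p b) \<le> multiplicity p (a + b)"
proof -
  define k where "k = min (multiplicity p a) (multiplicity p b)"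
  have "p ^ k dvd a" "p ^ k dvd b" by (auto simp: k_def intro: multiplicity_dvd')
  then have "p ^ k dvd a + b" by simp
  then show ?thesis using assms unfolding k_def by (intro multiplicity_geI) (auto simp: prime_elem_not_unit)
qed

lemma valuation_vfin: assumes p: "prime p" shows "valuation (\<lambda>z. real_of_int (vfin p z))"
proof (rule valuation_from_poly[where m = "\<lambda>a. int (multiplicity p a)"])
  fix a b :: "rat poly" assume "a \<noteq> 0" "b \<noteq> 0"
  then show "vfin p (polyK a / polyK b) = int (multiplicity p a) - int (multiplicity p b)" by (rule vfin_eq[OF p])
  show "int (multiplicity p (a * b)) = int (multiplicity p a) + int (multiplicity p b)"
    using prime_elem_multiplicity_mult_distrib[of p a b] p \<open>a \<noteq> 0\<close> \<open>b \<noteq> 0\<close> by simp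
  assume "a + b \<noteq> 0"
  then show "min (int (multiplicity p a)) (int (multiplicity p b)) \<le> int (multiplicity p (a + b))"
    using multiplicity_add_ge[OF p \<open>a \<noteq> 0\<close> \<open>b \<noteq> 0\<close>] by simp
next
  fix n :: nat assume "n \<noteq> 0"
  have "(of_nat n :: rat poly) = [:of_nat n:]" by (simp add: of_nat_poly)
  then have "is_unit (of_nat n :: rat poly)" using \<open>n \<noteq> 0\<close> by (simp add: is_unit_const_poly_iff dvd_field_iff)
  then show "int (multiplicity p (of_nat n)) = 0" by (simp add: multiplicity_unit_right)
qed

lemma valuation_vinf: "valuation (\<lambda>z. real_of_int (vinf z))"
proof (rule valuation_from_poly[where m = "\<lambda>a. - int (degree a)"])
  fix a b :: "rat poly" assume ab: "a \<noteq> 0" "b \<noteq> 0"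
  show "vinf (polyK a / polyK b) = - int (degree a) - - int (degree b)" using vinf_eq[OF ab] by simp
  show "- int (degree (a * b)) = - int (degree a) + - int (degree b)" using ab by (simp add: degree_mult_eq)
  show "min (- int (degree a)) (- int (degree b)) \<le> - int (degree (a + b))"
    using degree_add_le_max[of a b] by linarith
qed simp

subsection \<open>Product formula\<close>

lemma degree_eq_sum_prime_factors:
  assumes a: "a \<noteq> (0 :: rat poly)"
  shows "degree a = (\<Sum>p\<in>prime_factors a. multiplicity p a * degree p)"
proof -
  have "degree a = degree (\<Prod>p\<in>prime_factors a. p ^ multiplicity p a)"
    using prod_prime_factors[OF a] degree_normalize_rat by simp
  also have "\<dots> = (\<Sum>p\<in>prime_factors a. degree (p ^ multiplicity p a))"
    by (rule degree_prod_sum_eq) (auto simp: in_prime_factors_iff)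
  also have "\<dots> = (\<Sum>p\<in>prime_factors a. multiplicity p a * degree p)"
    by (intro sum.cong refl) (auto simp: degree_power_eq in_prime_factors_iff)
  finally show ?thesis .
qed

lemma degree_eq_sum:
  assumes a: "a \<noteq> (0 :: rat poly)" and S: "finite S" "prime_factors a \<subseteq> S" "S \<subseteq> Collect prime"
  shows "degree a = (\<Sum>p\<in>S. multiplicity p a * degree p)"
  unfolding degree_eq_sum_prime_factors[OF a]
proof (rule sum.mono_neutral_left[OF S(1,2)], rule ballI)
  fix p assume "p \<in> S - prime_factors a"
  then have "prime p" "\<not> p dvd a" using S a by (auto simp: in_prime_factors_iff)
  then show "multiplicity p a * degree p = 0" by (simp add: not_dvd_imp_multiplicity_0)
qed

text \<open>The product formula is required for every larger finite set of primes, so that the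
  supports of several functions can be merged.\<close>

definition places_of :: "K \<Rightarrow> rat poly set" where
  "places_of z = (SOME S. finite S \<and> S \<subseteq> Collect prime \<and>
     (\<forall>S'. finite S' \<and> S \<subseteq> S' \<and> S' \<subseteq> Collect prime \<longrightarrow>
        (\<Sum>p\<in>S'. real (degree p) * real_of_int (vfin p z)) = - real_of_int (vinf z)) \<and>
     (\<forall>p. prime p \<and> p \<notin> S \<longrightarrow> vfin p z = 0))"

lemma places_of:
  assumes z: "z \<noteq> 0"
  shows "finite (places_of z) \<and> places_of z \<subseteq> Collect prime \<and>
     (\<forall>S'. finite S' \<and> places_of z \<subseteq> S' \<and> S' \<subseteq> Collect prime \<longrightarrow>
        (\<Sum>p\<in>S'. real (degree p) * real_of_int (vfin p z)) = - real_of_int (vinf z)) \<and>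
     (\<forall>p. prime p \<and> p \<notin> places_of z \<longrightarrow> vfin p z = 0)"
  unfolding places_of_def
proof (rule someI_ex)
  obtain a b where ab: "b \<noteq> 0" "z = polyK a / polyK b" by (rule K_cases)
  have a: "a \<noteq> 0" using ab z by auto
  define S where "S = prime_factors a \<union> prime_factors b"
  have 1: "finite S" "S \<subseteq> Collect prime" by (auto simp: S_def)
  have 2: "(\<Sum>p\<in>S'. real (degree p) * real_of_int (vfin p z)) = - real_of_int (vinf z)"
    if S': "finite S'" "S \<subseteq> S'" "S' \<subseteq> Collect prime" for S'
  proof -
    have "(\<Sum>p\<in>S'. real (degree p) * real_of_int (vfin p z)) =
        (\<Sum>p\<in>S'. real (multiplicity p a * degree p) - real (multiplicity p b * degree p))"
    proof (rule sum.cong[OF refl])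
      fix p assume "p \<in> S'"
      then have "prime p" using S' by auto
      then have e: "real_of_int (vfin p z) = real (multiplicity p a) - real (multiplicity p b)"
        using vfin_eq[OF _ a ab(1)] ab(2) by simp
      show "real (degree p) * real_of_int (vfin p z) = real (multiplicity p a * degree p) - real (multiplicity p b * degree p)"
        unfolding e by (simp add: algebra_simps)
    qed
    also have "\<dots> = real (degree a) - real (degree b)"
      using degree_eq_sum[OF a, of S'] degree_eq_sum[OF ab(1), of S'] S'
      by (simp add: sum_subtractf S_def)
    finally show ?thesis using vinf_eq[OF a ab(1)] ab by simp
  qed
  have 3: "vfin p z = 0" if "prime p" "p \<notin> S" for p
    using that vfin_eq[of p a b] a ab by (auto simp: S_def in_prime_factors_iff not_dvd_imp_multiplicity_0)
  show "\<exists>S. finite S \<and> S \<subseteq> Collect prime \<and>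
     (\<forall>S'. finite S' \<and> S \<subseteq> S' \<and> S' \<subseteq> Collect prime \<longrightarrow>
        (\<Sum>p\<in>S'. real (degree p) * real_of_int (vfin p z)) = - real_of_int (vinf z)) \<and>
     (\<forall>p. prime p \<and> p \<notin> S \<longrightarrow> vfin p z = 0)"
    using 1 2 3 by blast
qed

subsection \<open>Differentiation\<close>

definition dK :: "K \<Rightarrow> K" where
  "dK z = (THE w. \<exists>a b. b \<noteq> 0 \<and> z = polyK a / polyK b \<and> w = polyK (pderiv a * b - a * pderiv b) / polyK (b^2))"

lemma dK_eq:
  assumes b: "b \<noteq> 0"
  shows "dK (polyK a / polyK b) = polyK (pderiv a * b - a * pderiv b) / polyK (b^2)"
  unfolding dK_def
proof (rule the_equality)
  fix w assume "\<exists>a' b'. b' \<noteq> 0 \<and> polyK a / polyK b = polyK a' / polyK b' \<and>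
    w = polyK (pderiv a' * b' - a' * pderiv b') / polyK (b'^2)"
  then obtain c d where d: "d \<noteq> 0" and eq: "polyK a / polyK b = polyK c / polyK d"
    and w: "w = polyK (pderiv c * d - c * pderiv d) / polyK (d^2)" by auto
  have E: "a * d = c * b" using Fract_eq_iff[OF b d] eq by blast
  have E': "a * pderiv d + pderiv a * d = c * pderiv b + pderiv c * b"
    using arg_cong[OF E, of pderiv] by (simp add: pderiv_mult algebra_simps)
  have "(pderiv c * d - c * pderiv d) * b^2 = (pderiv a * b - a * pderiv b) * d^2"
    using E E' by algebra
  then show "w = polyK (pderiv a * b - a * pderiv b) / polyK (b^2)"
    unfolding w by (subst Fract_eq_iff) (use b d in auto)
qed (use b in auto)

lemma dK_poly: "dK (polyK a) = polyK (pderiv a)" using dK_eq[of 1 a] by simp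

interpretation dK: derivation dK
proof
  fix x y :: K
  obtain a b where ab: "b \<noteq> 0" "x = polyK a / polyK b" by (rule K_cases)
  obtain c d where cd: "d \<noteq> 0" "y = polyK c / polyK d" by (rule K_cases)
  have bd: "b * d \<noteq> 0" using ab cd by simp
  have e1: "x + y = polyK (a * d + c * b) / polyK (b * d)" using ab cd by (simp add: add_frac_eq)
  have e2: "x * y = polyK (a * c) / polyK (b * d)" using ab cd by simp
  note dx = dK_eq[OF ab(1), of a, folded ab(2)] and dy = dK_eq[OF cd(1), of c, folded cd(2)]
  have n: "polyK b \<noteq> 0" "polyK d \<noteq> 0" using ab cd by auto
  show "dK (x + y) = dK x + dK y"
    unfolding e1 dK_eq[OF bd] dx dy pderiv_add pderiv_mult
    using n by (simp add: field_simps power2_eq_square)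
  show "dK (x * y) = dK x * y + x * dK y"
  proof -
    have "polyK (pderiv (a * c) * (b * d) - a * c * pderiv (b * d)) / polyK ((b * d)^2) =
      polyK (pderiv a * b - a * pderiv b) / polyK (b^2) * (polyK c / polyK d) +
      polyK a / polyK b * (polyK (pderiv c * d - c * pderiv d) / polyK (d^2))"
      unfolding pderiv_mult using n by (simp add: field_simps power2_eq_square)
    then show ?thesis unfolding e2 dK_eq[OF bd] dx dy unfolding ab(2) cd(2) .
  qed
qed

text \<open>After the common power of p is cancelled, the denominator is prime to p, and the
  derivative has only its square as denominator.\<close>

lemma int_deriv_vfin: assumes p: "prime p" shows "int_deriv (\<lambda>z. real_of_int (vfin p z)) dK"
proof -
  interpret valuation "\<lambda>z. real_of_int (vfin p z)" by (rule valuation_vfin[OF p])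
  show ?thesis
  proof (unfold_locales)
    fix z assume z: "vge 0 z"
    show "vge 0 (dK z)"
    proof (cases "z = 0")
      case False
      obtain a b where ab: "b \<noteq> 0" "z = polyK a / polyK b" by (rule K_cases)
      have a: "a \<noteq> 0" using ab False by auto
      have le: "multiplicity p b \<le> multiplicity p a" using z vfin_eq[OF p a ab(1)] False ab by (simp add: vge_def)
      define j where "j = multiplicity p b"
      obtain a0 where a0: "a = p ^ j * a0" using multiplicity_dvd'[OF le[folded j_def]] by (auto simp: dvd_def)
      obtain b0 where b0: "b = p ^ j * b0" "\<not> p dvd b0"
        using multiplicity_decompose'[of b p] ab(1) p unfolding j_def
        by (metis not_prime_unit mult.commute)
      have "z = polyK a0 / polyK b0" using p unfolding ab(2) a0 b0(1) by simp
      moreover have b00: "b0 \<noteq> 0" using ab b0 by auto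
      ultimately have dz: "dK z = polyK (pderiv a0 * b0 - a0 * pderiv b0) / polyK (b0^2)" using dK_eq by simp
      have "multiplicity p (b0^2) = 0"
        using p b0(2) by (intro not_dvd_imp_multiplicity_0) (auto simp: prime_dvd_power_iff)
      then have "vge 0 (polyK c / polyK (b0^2))" for c
        using vfin_eq[OF p, of c "b0^2"] b00 by (cases "c = 0") (auto simp: vge_def)
      then show ?thesis unfolding dz .
    qed (simp add: dK.d_0)
  qed
qed

lemma vfin_pderiv:
  assumes p: "prime p" and a: "pderiv a \<noteq> 0"
  shows "vfin p (polyK (pderiv a)) \<ge> vfin p (polyK a) - 1"
proof -
  have a0: "a \<noteq> 0" using a by auto
  obtain k where k: "k = multiplicity p a" by simp
  show ?thesis
  proof (cases k)
    case 0 then show ?thesis using vfin_poly[OF p a0] vfin_poly[OF p a] k by simp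
  next
    case (Suc l)
    obtain b where "a = p ^ k * b" using multiplicity_dvd[of p a] k by (auto simp: dvd_def)
    then have "pderiv a = p ^ l * (p * pderiv b + smult (of_nat (Suc l)) (b * pderiv p))"
      unfolding Suc by (simp add: pderiv_mult pderiv_power_Suc algebra_simps del: power_Suc) (simp add: algebra_simps)
    then have "p ^ l dvd pderiv a" by simp
    then have "l \<le> multiplicity p (pderiv a)" using p a by (intro multiplicity_geI) auto
    then show ?thesis using vfin_poly[OF p a0] vfin_poly[OF p a] k Suc by simp
  qed
qed

abbreviation "tK \<equiv> polyK [:0, 1:]"

text \<open>The top coefficient of \<open>t a'\<close> is \<open>degree a\<close> times that of a,
  so \<open>t a' / a\<close> has the degree as residue at infinity; quotients follow by
  subtraction.\<close>

lemma theta_log: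
  assumes z: "z \<noteq> 0"
  shows "valuation.cg (\<lambda>z. real_of_int (vinf z)) (tK * dK z / z) (- of_int (vinf z))"
proof -
  interpret valuation "\<lambda>z. real_of_int (vinf z)" by (rule valuation_vinf)
  have L: "cg (tK * polyK (pderiv a) / polyK a) (of_nat (degree a))" if a: "a \<noteq> 0" for a
  proof -
    define b where "b = [:0, 1:] * pderiv a - of_nat (degree a) * a"
    have e: "tK * polyK (pderiv a) / polyK a - of_rat (of_nat (degree a)) = polyK b / polyK a"
      using a unfolding b_def polyK_simps polyK_of_nat by (simp add: field_simps)
    have cb: "coeff b n = (of_nat n - of_nat (degree a)) * coeff a n" for n
      unfolding b_def by (cases n) (auto simp: coeff_pderiv of_nat_poly algebra_simps)
    show ?thesis
    proof (cases "b = 0")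
      case True then show ?thesis unfolding cg_def e by simp
    next
      case False
      have "degree b < degree a"
      proof -
        have "coeff b (degree b) \<noteq> 0" using False by simp
        then have "degree b \<noteq> degree a" "coeff a (degree b) \<noteq> 0" unfolding cb by auto
        then show ?thesis using le_degree[of a "degree b"] by simp
      qed
      then show ?thesis unfolding cg_def e vgt_def using vinf_eq[OF False a] by simp
    qed
  qed
  obtain a b where ab: "b \<noteq> 0" "z = polyK a / polyK b" by (rule K_cases)
  have a: "a \<noteq> 0" using ab z by auto
  have "tK * dK z / z = tK * polyK (pderiv a) / polyK a - tK * polyK (pderiv b) / polyK b"
    unfolding ab(2) dK_eq[OF ab(1)] using a ab(1) by (simp add: field_simps power2_eq_square)
  moreover have "- of_int (vinf z) = (of_nat (degree a) - of_nat (degree b) :: rat)"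
    using vinf_eq[OF a ab(1)] ab(2) by simp
  ultimately show ?thesis using cg_diff[OF L[OF a] L[OF ab(1)]] by simp
qed

section \<open>Denominators\<close>

lemma K_coprime_cases: obtains a b where "b \<noteq> 0" "coprime a b" "z = polyK a / polyK b"
proof -
  obtain a b where ab: "b \<noteq> 0" "z = polyK a / polyK b" by (rule K_cases)
  define g where "g = gcd a b"
  have g: "g \<noteq> 0" using ab by (simp add: g_def)
  obtain a' b' where e: "a = g * a'" "b = g * b'" using gcd_dvd1[of a b] gcd_dvd2[of a b] unfolding g_def dvd_def by metis
  have "coprime a' b'" using gcd_coprime[of a b a' b'] e g ab by (metis g_def mult.commute)
  moreover have "z = polyK a' / polyK b'" using ab e g by simp
  ultimately show ?thesis using that[of b' a'] ab e by auto
qed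

lemma denom_unique:
  assumes "coprime n d" "lead_coeff d = 1" "coprime n' d'" "lead_coeff d' = 1"
    and "polyK n / polyK d ^ 2 = polyK n' / polyK d' ^ 2"
  shows "d = (d' :: rat poly)"
proof -
  have d0: "d \<noteq> 0" "d' \<noteq> 0" using assms by auto
  have "n * d'^2 = n' * d^2"
    using assms(5) Fract_eq_iff[of "d^2" "d'^2" n n'] d0 by simp
  moreover have "coprime (d^2) n" "coprime (d'^2) n'" using assms by (auto simp: coprime_commute)
  ultimately have "d^2 dvd d'^2" "d'^2 dvd d^2"
    by (metis coprime_dvd_mult_right_iff dvd_triv_right)+
  then have "normalize (d^2) = normalize (d'^2)" by (rule associatedI)
  moreover have "lead_coeff (d^2) = 1" "lead_coeff (d'^2) = 1" using assms by (auto simp: lead_coeff_power)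
  ultimately have "d^2 = d'^2" by (simp add: normalize_rat_poly)
  then have "d = d' \<or> d = - d'" by (simp add: power2_eq_iff)
  then show ?thesis using assms by auto
qed

text \<open>Halving multiplicities gives the monic square root of the denominator; for multiples of
  P the evenness comes from \<open>vfin_X_even\<close>.\<close>

lemma denom_exists:
  assumes ev: "\<And>p. prime p \<Longrightarrow> x \<noteq> 0 \<Longrightarrow> vfin p x < 0 \<Longrightarrow> even (vfin p x)"
  shows "\<exists>d n. coprime n d \<and> lead_coeff d = 1 \<and> x = polyK n / polyK d ^ 2"
proof (cases "x = 0")
  case True
  show ?thesis by (rule exI[of _ 1], rule exI[of _ 0]) (simp add: True)
next
  case False
  obtain a b where ab: "b \<noteq> 0" "coprime a b" "x = polyK a / polyK b" by (rule K_coprime_cases)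
  have a0: "a \<noteq> 0" using False ab by auto
  define d where "d = (\<Prod>p\<in>prime_factors b. p ^ (multiplicity p b div 2))"
  have "d^2 = (\<Prod>p\<in>prime_factors b. p ^ multiplicity p b)"
    unfolding d_def prod_power_distrib
  proof (rule prod.cong[OF refl])
    fix p assume p: "p \<in> prime_factors b"
    then have pp: "prime p" "p dvd b" by (auto simp: in_prime_factors_iff)
    then have "\<not> p dvd a" using ab(2) by (meson coprime_common_divisor not_prime_unit)
    then have "vfin p x = - int (multiplicity p b)"
      using vfin_eq[OF pp(1) a0 ab(1)] ab(3) by (simp add: not_dvd_imp_multiplicity_0)
    moreover have "multiplicity p b > 0" using pp ab(1) by (simp add: prime_multiplicity_gt_zero_iff)
    ultimately have "even (multiplicity p b)" using ev[OF pp(1) False] by simp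
    then show "(p ^ (multiplicity p b div 2))\<^sup>2 = p ^ multiplicity p b" by (simp flip: power_mult)
  qed
  also have "\<dots> = normalize b" by (rule prod_prime_factors[OF ab(1)])
  finally have d2: "d^2 = smult (1 / lead_coeff b) b" by (simp add: normalize_rat_poly)
  have lc: "lead_coeff d = 1"
    unfolding d_def lead_coeff_prod
    by (rule prod.neutral) (auto simp: lead_coeff_power in_prime_factors_iff prime_rat_poly_iff)
  define n where "n = smult (1 / lead_coeff b) a"
  have "coprime n d"
  proof -
    have "d dvd b" using d2 ab(1) by (metis dvd_triv_left power2_eq_square dvd_smult_cancel divide_eq_0_iff leading_coeff_0_iff zero_neq_one)
    moreover have "n dvd a" unfolding n_def using ab(1) by (intro smult_dvd) auto
    ultimately show ?thesis using coprime_divisors ab(2) by blast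
  qed
  moreover have "x = polyK n / polyK d ^ 2"
  proof -
    have "n * b = a * d^2" unfolding n_def d2 by simp
    moreover have "d^2 \<noteq> 0" using lc by auto
    ultimately have "polyK a / polyK b = polyK n / polyK (d^2)" by (subst Fract_eq_iff) (use ab in auto)
    then show ?thesis using ab by simp
  qed
  ultimately show ?thesis using lc by blast
qed

lemma denomB_dvd_iff:
  assumes ev: "\<And>p. prime p \<Longrightarrow> x \<noteq> 0 \<Longrightarrow> vfin p x < 0 \<Longrightarrow> even (vfin p x)" and q: "prime q"
  shows "q dvd denomB (Some (x, y)) \<longleftrightarrow> x \<noteq> 0 \<and> vfin q x < 0" and "denomB (Some (x, y)) \<noteq> 0"
proof -
  obtain d n where dn: "coprime n d" "lead_coeff d = 1" "x = polyK n / polyK d ^ 2"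
    using denom_exists[OF ev] by blast
  have d: "denomB (Some (x, y)) = d"
    unfolding denomB_def
    by (simp, rule the_equality) (use dn denom_unique in blast)+
  have d0: "d \<noteq> 0" using dn by auto
  then show "denomB (Some (x, y)) \<noteq> 0" using d by simp
  show "q dvd denomB (Some (x, y)) \<longleftrightarrow> x \<noteq> 0 \<and> vfin q x < 0"
  proof (cases "n = 0")
    case True
    then have "is_unit d" using dn by simp
    then show ?thesis using d q True dn by (metis div_0 dvd_unit_imp_unit not_prime_unit polyK_simps(5))
  next
    case False
    have x0: "x \<noteq> 0" using dn False d0 by simp
    have "vfin q x = int (multiplicity q n) - int (multiplicity q (d^2))"
      using vfin_eq[OF q False, of "d^2"] d0 dn(3) by simp
    moreover have "multiplicity q (d^2) = 2 * multiplicity q d"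
      using q d0 by (simp add: prime_elem_multiplicity_power_distrib)
    moreover have "q dvd d \<Longrightarrow> multiplicity q n = 0"
      using dn(1) q by (meson coprime_common_divisor not_dvd_imp_multiplicity_0 not_prime_unit)
    moreover have "q dvd d \<longleftrightarrow> multiplicity q d > 0" using q d0 by (simp add: prime_multiplicity_gt_zero_iff)
    ultimately show ?thesis using d x0 by auto
  qed
qed

section \<open>Canonical heights over the rational function field\<close>

locale ec_global =
  fixes A B :: "rat poly" and P :: "K ec_point"
  assumes nonsing: "4 * A ^ 3 + 27 * B ^ 2 \<noteq> 0"
    and minimal: "minimal_poly_model A B"
    and nonconstant: "\<not> (degree A = 0 \<and> degree B = 0)"
    and onE: "on_curve (polyK A) (polyK B) P"
    and nontors: "non_torsion (polyK A) P"
begin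

sublocale nontorsion_point "polyK A" "polyK B" P by unfold_locales (use onE nontors in auto)

text \<open>The least power of t that makes the rescaled equation integral at infinity. By
  \<open>tot_Disc\<close> the minimal discriminant has total degree \<open>12 * chi\<close>, and
  heights and corrections are measured in this unit.\<close>

definition chi :: nat where "chi = (LEAST k. degree A \<le> 4 * k \<and> degree B \<le> 6 * k)"

lemma chi: "degree A \<le> 4 * chi \<and> degree B \<le> 6 * chi"
  unfolding chi_def by (rule LeastI[of _ "degree A + degree B"]) simp

lemma chi_least: "k < chi \<Longrightarrow> \<not> (degree A \<le> 4 * k \<and> degree B \<le> 6 * k)"
  unfolding chi_def by (rule not_less_Least)

lemma chi_pos: "chi \<ge> 1" using chi nonconstant by (cases chi) auto

text \<open>Places are \<open>Some p\<close> for monic irreducible \<open>p\<close> and \<open>None\<close> for infinity, where the equation is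
  rescaled by \<open>t ^ chi\<close> to be integral and minimal.\<close>

definition uu :: "rat poly option \<Rightarrow> K" where "uu pl = (case pl of None \<Rightarrow> tK ^ chi | Some p \<Rightarrow> 1)"
definition val :: "rat poly option \<Rightarrow> K \<Rightarrow> real" where
  "val pl z = (case pl of None \<Rightarrow> real_of_int (vinf z) | Some p \<Rightarrow> real_of_int (vfin p z))"
definition wt :: "rat poly option \<Rightarrow> real" where "wt pl = (case pl of None \<Rightarrow> 1 | Some p \<Rightarrow> real (degree p))"
definition isplace :: "rat poly option \<Rightarrow> bool" where "isplace pl = (case pl of None \<Rightarrow> True | Some p \<Rightarrow> prime p)"

definition AA :: "rat poly option \<Rightarrow> K" where "AA pl = polyK A / uu pl ^ 4"
definition BB :: "rat poly option \<Rightarrow> K" where "BB pl = polyK B / uu pl ^ 6"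
definition XX :: "rat poly option \<Rightarrow> nat \<Rightarrow> K" where "XX pl n = X n / uu pl ^ 2"
definition YY :: "rat poly option \<Rightarrow> nat \<Rightarrow> K" where "YY pl n = Y n / uu pl ^ 3"

lemma uu_nz: "uu pl \<noteq> 0" by (cases pl) (auto simp: uu_def)

lemma val_valuation: "isplace pl \<Longrightarrow> valuation (val pl)"
  using valuation_vinf valuation_vfin by (cases pl) (auto simp: val_def[abs_def] isplace_def)

lemma Disc_scaled: "4 * AA pl ^ 3 + 27 * BB pl ^ 2 = polyK (4 * A^3 + 27 * B^2) / uu pl ^ 12"
proof -
  have "uu pl ^ 12 * (4 * AA pl ^ 3 + 27 * BB pl ^ 2) = 4 * (uu pl ^ 4 * AA pl)^3 + 27 * (uu pl ^ 6 * BB pl)^2" by algebra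
  also have "\<dots> = polyK (4 * A^3 + 27 * B^2)" using uu_nz by (simp add: AA_def BB_def)
  finally show ?thesis using uu_nz[of pl] by (simp add: field_simps)
qed

lemma Disc_nz: "4 * AA pl ^ 3 + 27 * BB pl ^ 2 \<noteq> 0"
  unfolding Disc_scaled using uu_nz nonsing by (simp del: polyK_simps)

lemma place: "isplace pl \<Longrightarrow> place (val pl) (AA pl) (BB pl)"
  using val_valuation Disc_nz by (simp add: place_def place_axioms_def)

lemma ec_seq: "ec_seq (AA pl) (BB pl) (XX pl) (YY pl)"
  using scaled[OF uu_nz[of pl]] unfolding AA_def BB_def XX_def[abs_def] YY_def[abs_def] .

abbreviation muP :: "rat poly option \<Rightarrow> real" where "muP pl \<equiv> place.mu (val pl) (AA pl) (BB pl)"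
abbreviation NP :: "rat poly option \<Rightarrow> real" where "NP pl \<equiv> place.NN (val pl) (AA pl) (BB pl)"

lemma vinf_uu: "vinf (uu None ^ k) = - int (k * chi)"
proof -
  have "uu None ^ k = polyK ([:0, 1:] ^ (k * chi))" by (simp add: uu_def power_mult[symmetric] mult.commute)
  moreover have "degree ([:0, 1:] ^ (k * chi) :: rat poly) = k * chi" by (simp add: degree_power_eq)
  ultimately show ?thesis using vinf_poly[of "[:0, 1:] ^ (k * chi)"] by simp
qed

lemma val_AA: "A \<noteq> 0 \<Longrightarrow> val None (AA None) = 4 * real chi - degree A"
  and val_BB: "B \<noteq> 0 \<Longrightarrow> val None (BB None) = 6 * real chi - degree B"
proof -
  interpret valuation "val None" by (rule val_valuation) (simp add: isplace_def)
  show "A \<noteq> 0 \<Longrightarrow> val None (AA None) = 4 * real chi - degree A"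
    unfolding AA_def using v_divide[of "polyK A" "uu None ^ 4"] uu_nz vinf_poly[of A] vinf_uu[of 4]
    by (simp add: val_def)
  show "B \<noteq> 0 \<Longrightarrow> val None (BB None) = 6 * real chi - degree B"
    unfolding BB_def using v_divide[of "polyK B" "uu None ^ 6"] uu_nz vinf_poly[of B] vinf_uu[of 6]
    by (simp add: val_def)
qed

lemma val_Some_poly: "prime p \<Longrightarrow> a \<noteq> 0 \<Longrightarrow> val (Some p) (polyK a) = real (multiplicity p a)"
  by (simp add: val_def vfin_poly)

text \<open>\<open>mu < 1\<close> is minimality of the given equation at a finite place, and
  leastness of \<open>chi\<close> at infinity.\<close>

lemma PS: assumes pl: "isplace pl" shows "place_seq (val pl) (AA pl) (BB pl) (XX pl) (YY pl)"
proof -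
  interpret place "val pl" "AA pl" "BB pl" by (rule place[OF pl])
  interpret ec_seq "AA pl" "BB pl" "XX pl" "YY pl" by (rule ec_seq)
  have AB: "A \<noteq> 0 \<Longrightarrow> AA pl \<noteq> 0" "B \<noteq> 0 \<Longrightarrow> BB pl \<noteq> 0" "A = 0 \<Longrightarrow> AA pl = 0" "B = 0 \<Longrightarrow> BB pl = 0"
    using uu_nz[of pl] unfolding AA_def BB_def by simp_all
  have A0: "AA pl \<noteq> 0 \<Longrightarrow> val pl (AA pl) \<ge> 0" and B0: "BB pl \<noteq> 0 \<Longrightarrow> val pl (BB pl) \<ge> 0"
  proof -
    assume a: "AA pl \<noteq> 0"
    then have an: "A \<noteq> 0" using AB by auto
    show "val pl (AA pl) \<ge> 0"
    proof (cases pl)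
      case None then show ?thesis using val_AA[OF an] chi by simp
    next
      case (Some p) then show ?thesis using val_Some_poly[of p A] an pl by (simp add: AA_def uu_def isplace_def)
    qed
  next
    assume a: "BB pl \<noteq> 0"
    then have an: "B \<noteq> 0" using AB by auto
    show "val pl (BB pl) \<ge> 0"
    proof (cases pl)
      case None then show ?thesis using val_BB[OF an] chi by simp
    next
      case (Some p) then show ?thesis using val_Some_poly[of p B] an pl by (simp add: BB_def uu_def isplace_def)
    qed
  qed
  have "0 \<le> mu" using v_or A0 B0 by (auto simp: veq_def)
  moreover have "mu < 1"
  proof (rule ccontr)
    assume "\<not> mu < 1"
    then have g: "AA pl = 0 \<or> 4 \<le> val pl (AA pl)" "BB pl = 0 \<or> 6 \<le> val pl (BB pl)"
      using vge_mono[OF vA, of 4] vge_mono[OF vB, of 6] unfolding vge_def by auto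
    show False
    proof (cases pl)
      case None
      have "degree A \<le> 4 * (chi - 1) \<and> degree B \<le> 6 * (chi - 1)"
      proof
        show "degree A \<le> 4 * (chi - 1)"
        proof (cases "A = 0")
          case False
          then have "real (degree A) \<le> real (4 * (chi - 1))"
            using val_AA[OF False] g(1) AB None chi_pos by (simp add: of_nat_diff)
          then show ?thesis by linarith
        qed simp
        show "degree B \<le> 6 * (chi - 1)"
        proof (cases "B = 0")
          case False
          then have "real (degree B) \<le> real (6 * (chi - 1))"
            using val_BB[OF False] g(2) AB None chi_pos by (simp add: of_nat_diff)
          then show ?thesis by linarith
        qed simp
      qed
      then show False using chi_least[of "chi - 1"] chi_pos by simp
    next
      case (Some p)
      have p: "prime p" using pl Some by (simp add: isplace_def)
      have "p ^ 4 dvd A"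
      proof (cases "A = 0")
        case False
        then have "real (multiplicity p A) \<ge> 4" using val_Some_poly[OF p False] g(1) AB Some by (simp add: AA_def uu_def)
        then show ?thesis by (intro multiplicity_dvd') simp
      qed simp
      moreover have "p ^ 6 dvd B"
      proof (cases "B = 0")
        case False
        then have "real (multiplicity p B) \<ge> 6" using val_Some_poly[OF p False] g(2) AB Some by (simp add: BB_def uu_def)
        then show ?thesis by (intro multiplicity_dvd') simp
      qed simp
      ultimately show False using minimal p unfolding minimal_poly_model_def prime_rat_poly_iff by blast
    qed
  qed
  ultimately show ?thesis by unfold_locales
qed

abbreviation lamP :: "rat poly option \<Rightarrow> nat \<Rightarrow> real" where
  "lamP pl n \<equiv> place.lam (val pl) (AA pl) (BB pl) (XX pl n)"
abbreviation betaP :: "rat poly option \<Rightarrow> nat \<Rightarrow> real" where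
  "betaP pl n \<equiv> place_seq.beta (val pl) (XX pl n)"
abbreviation epsP :: "rat poly option \<Rightarrow> nat \<Rightarrow> real" where
  "epsP pl n \<equiv> place_seq.eps (val pl) (AA pl) (BB pl) (XX pl n)"

end

context ec_global
begin

lemma prod_support:
  assumes F: "finite F" "0 \<notin> F"
  shows "\<exists>T. finite T \<and> None \<in> T \<and> (\<forall>pl\<in>T. isplace pl) \<and>
    (\<forall>z\<in>F. (\<Sum>pl\<in>T. wt pl * val pl z) = 0 \<and> (\<forall>pl. isplace pl \<and> pl \<notin> T \<longrightarrow> val pl z = 0))"
proof -
  define U where "U = (\<Union>z\<in>F. places_of z)"
  define T where "T = insert None (Some ` U)"
  have nz: "z \<noteq> 0" if "z \<in> F" for z using that F by auto
  have U: "finite U" "U \<subseteq> Collect prime" using F places_of[OF nz] unfolding U_def by blast+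
  have "(\<Sum>pl\<in>T. wt pl * val pl z) = 0 \<and> (\<forall>pl. isplace pl \<and> pl \<notin> T \<longrightarrow> val pl z = 0)" if z: "z \<in> F" for z
  proof
    have "places_of z \<subseteq> U" using z by (auto simp: U_def)
    then have "(\<Sum>p\<in>U. real (degree p) * real_of_int (vfin p z)) = - real_of_int (vinf z)"
      using places_of[OF nz[OF z]] U by blast
    moreover have "(\<Sum>pl\<in>T. wt pl * val pl z) = real_of_int (vinf z) + (\<Sum>p\<in>U. real (degree p) * real_of_int (vfin p z))"
      unfolding T_def using U by (subst sum.insert) (auto simp: sum.reindex val_def wt_def)
    ultimately show "(\<Sum>pl\<in>T. wt pl * val pl z) = 0" by simp
    show "\<forall>pl. isplace pl \<and> pl \<notin> T \<longrightarrow> val pl z = 0"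
    proof (intro allI impI)
      fix pl assume pl: "isplace pl \<and> pl \<notin> T"
      then obtain p where p: "pl = Some p" "prime p" "p \<notin> U" by (cases pl) (auto simp: T_def isplace_def)
      then have "p \<notin> places_of z" using z by (auto simp: U_def)
      then show "val pl z = 0" using places_of[OF nz[OF z]] p by (simp add: val_def)
    qed
  qed
  moreover have "finite T" "None \<in> T" "\<forall>pl\<in>T. isplace pl" using U by (auto simp: T_def isplace_def)
  ultimately show ?thesis by blast
qed

lemma val_scaled: assumes "isplace pl" "z \<noteq> 0"
  shows "val pl (z / uu pl ^ k) = val pl z + (if pl = None then real k * chi else 0)"
proof -
  interpret valuation "val pl" by (rule val_valuation[OF assms(1)])
  show ?thesis
  proof (cases pl)
    case None
    then show ?thesis using v_divide[OF assms(2), of "uu pl ^ k"] uu_nz vinf_uu[of k] by (simp add: val_def)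
  next
    case (Some p)
    then show ?thesis by (simp add: uu_def)
  qed
qed

lemma XX_Some [simp]: "XX (Some p) n = X n" and YY_Some [simp]: "YY (Some p) n = Y n"
  and AA_Some [simp]: "AA (Some p) = polyK A" and BB_Some [simp]: "BB (Some p) = polyK B"
  by (auto simp: XX_def YY_def AA_def BB_def uu_def)

lemma isplace_None [simp]: "isplace None" and isplace_Some [simp]: "isplace (Some p) = prime p"
  by (auto simp: isplace_def)

lemma wt_nonneg: "0 \<le> wt pl" by (cases pl) (auto simp: wt_def)
lemma eps_eq: "isplace pl \<Longrightarrow> epsP pl n = betaP pl n - lamP pl n"
  by (rule place_seq.eps_def[OF PS])

text \<open>With the multiples cut off at L, only finitely many functions occur, so one finite set
  of places carries the product formula for all of them.\<close>

lemma Ex_support: "\<exists>T. finite T \<and> None \<in> T \<and> (\<forall>pl\<in>T. isplace pl)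
   \<and> (\<forall>pl. isplace pl \<and> pl \<notin> T \<longrightarrow> 12 * muP pl + NP pl = 0)
   \<and> (\<Sum>pl\<in>T. wt pl * val pl (polyK (4 * A^3 + 27 * B^2))) = 0
   \<and> (\<forall>m n. 1 \<le> m \<and> 1 \<le> n \<and> m \<noteq> n \<and> m \<le> L \<and> n \<le> L \<longrightarrow> (\<Sum>pl\<in>T. wt pl * val pl (X m - X n)) = 0)
   \<and> (\<forall>n. 1 \<le> n \<and> n \<le> L \<longrightarrow> (\<Sum>pl\<in>T. wt pl * val pl (Y n)) = 0)"
proof -
  define F where "F = insert (polyK (4 * A^3 + 27 * B^2)) ((\<lambda>(m, n). X m - X n) ` {(m, n). 1 \<le> m \<and> 1 \<le> n \<and> m \<noteq> n \<and> m \<le> L \<and> n \<le> L}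
     \<union> Y ` {1..L})"
  have "finite {(m, n). 1 \<le> m \<and> 1 \<le> n \<and> m \<noteq> n \<and> m \<le> L \<and> n \<le> L}"
    by (rule finite_subset[of _ "{1..L} \<times> {1..L}"]) auto
  then have F: "finite F" by (simp add: F_def)
  have "polyK (4 * A^3 + 27 * B^2) \<noteq> 0" using Disc_nz[of None] unfolding Disc_scaled by auto
  then have "0 \<notin> F" unfolding F_def using X_inj Y_ne_0 by fastforce
  from prod_support[OF F this] obtain T where T: "finite T" "None \<in> T" "\<forall>pl\<in>T. isplace pl"
    and Tz: "\<And>z. z \<in> F \<Longrightarrow> (\<Sum>pl\<in>T. wt pl * val pl z) = 0" "\<And>z pl. z \<in> F \<Longrightarrow> isplace pl \<Longrightarrow> pl \<notin> T \<Longrightarrow> val pl z = 0"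
    by metis
  have "12 * muP pl + NP pl = 0" if "isplace pl" "pl \<notin> T" for pl
  proof -
    interpret place "val pl" "AA pl" "BB pl" by (rule place[OF that(1)])
    have "12 * mu + NN = val pl (polyK (4 * A^3 + 27 * B^2) / uu pl ^ 12)"
      using vDisc unfolding veq_def Disc_scaled by simp
    also have "\<dots> = val pl (polyK (4 * A^3 + 27 * B^2))" using that T by (cases pl) (auto simp: uu_def)
    also have "\<dots> = 0" using Tz(2)[OF _ that] by (simp add: F_def del: polyK_simps)
    finally show ?thesis .
  qed
  moreover have "(\<Sum>pl\<in>T. wt pl * val pl (polyK (4 * A^3 + 27 * B^2))) = 0" by (rule Tz(1)) (simp add: F_def)
  moreover have "\<forall>m n. 1 \<le> m \<and> 1 \<le> n \<and> m \<noteq> n \<and> m \<le> L \<and> n \<le> L \<longrightarrow> (\<Sum>pl\<in>T. wt pl * val pl (X m - X n)) = 0"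
    by (intro allI impI Tz(1)) (auto simp: F_def image_iff)
  moreover have "\<forall>n. 1 \<le> n \<and> n \<le> L \<longrightarrow> (\<Sum>pl\<in>T. wt pl * val pl (Y n)) = 0"
    by (intro allI impI Tz(1)) (simp add: F_def)
  ultimately show ?thesis using T by blast
qed

end

text \<open>The local heights of the first \<open>L\<close> multiples are summed over a finite set \<open>T\<close> of places outside
  of which they vanish.\<close>

locale ec_support = ec_global +
  fixes L :: nat and T :: "rat poly option set"
  assumes finT: "finite T" and NoneT: "None \<in> T" and placeT: "pl \<in> T \<Longrightarrow> isplace pl"
    and outT: "isplace pl \<Longrightarrow> pl \<notin> T \<Longrightarrow> 12 * muP pl + NP pl = 0"
    and prod_Disc: "(\<Sum>pl\<in>T. wt pl * val pl (polyK (4 * A^3 + 27 * B^2))) = 0"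
    and prod_X: "1 \<le> m \<Longrightarrow> 1 \<le> n \<Longrightarrow> m \<noteq> n \<Longrightarrow> m \<le> L \<Longrightarrow> n \<le> L \<Longrightarrow> (\<Sum>pl\<in>T. wt pl * val pl (X m - X n)) = 0"
    and prod_Y: "1 \<le> n \<Longrightarrow> n \<le> L \<Longrightarrow> (\<Sum>pl\<in>T. wt pl * val pl (Y n)) = 0"
begin

definition tot :: "(rat poly option \<Rightarrow> real) \<Rightarrow> real" where "tot f = (\<Sum>pl\<in>T. wt pl * f pl)"

lemma tot_add: "tot (\<lambda>pl. f pl + g pl) = tot f + tot g" by (simp add: tot_def algebra_simps sum.distrib)
lemma tot_diff: "tot (\<lambda>pl. f pl - g pl) = tot f - tot g" by (simp add: tot_def algebra_simps sum_subtractf)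
lemma tot_cmult: "tot (\<lambda>pl. c * f pl) = c * tot f" by (simp add: tot_def sum_distrib_left algebra_simps)
lemma tot_mono: "(\<And>pl. isplace pl \<Longrightarrow> f pl \<le> g pl) \<Longrightarrow> tot f \<le> tot g"
  unfolding tot_def using placeT wt_nonneg by (intro sum_mono mult_left_mono) auto
lemma tot_cong: "(\<And>pl. isplace pl \<Longrightarrow> f pl = g pl) \<Longrightarrow> tot f = tot g"
  unfolding tot_def using placeT by (intro sum.cong) auto
lemma tot_nonneg: "(\<And>pl. isplace pl \<Longrightarrow> 0 \<le> f pl) \<Longrightarrow> 0 \<le> tot f"
  unfolding tot_def using placeT wt_nonneg by (intro sum_nonneg mult_nonneg_nonneg) auto
lemma tot_None: "tot (\<lambda>pl. if pl = None then c else 0) = c"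
  using finT NoneT by (simp add: tot_def if_distrib wt_def sum.delta cong: if_cong)

lemma tot_split: "tot f = f None + (\<Sum>pl\<in>T - {None}. wt pl * f pl)"
  using finT NoneT by (simp add: tot_def sum.remove wt_def)

lemma tot_scaled: assumes "z \<noteq> 0" "(\<Sum>pl\<in>T. wt pl * val pl z) = 0"
  shows "tot (\<lambda>pl. val pl (z / uu pl ^ k)) = real k * chi"
proof -
  have "tot (\<lambda>pl. val pl (z / uu pl ^ k)) = tot (\<lambda>pl. val pl z + (if pl = None then real k * chi else 0))"
    by (rule tot_cong) (rule val_scaled[OF _ assms(1)])
  also have "\<dots> = real k * chi" using assms(2) unfolding tot_add tot_None by (simp add: tot_def)
  finally show ?thesis .
qed

text \<open>Product formula for the discriminant, shifted at infinity by the scaling with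
  \<open>t^(12 chi)\<close>.\<close>

lemma tot_Disc: "tot (\<lambda>pl. 12 * muP pl + NP pl) = 12 * chi"
proof -
  have nz: "polyK (4 * A^3 + 27 * B^2) \<noteq> 0" using Disc_nz[of None] unfolding Disc_scaled by auto
  have "tot (\<lambda>pl. 12 * muP pl + NP pl) = tot (\<lambda>pl. val pl (polyK (4 * A^3 + 27 * B^2) / uu pl ^ 12))"
  proof (rule tot_cong)
    fix pl assume "isplace pl"
    then interpret place "val pl" "AA pl" "BB pl" by (rule place)
    show "12 * mu + NN = val pl (polyK (4 * A^3 + 27 * B^2) / uu pl ^ 12)"
      using vDisc unfolding veq_def Disc_scaled by simp
  qed
  then show ?thesis using tot_scaled[OF nz prod_Disc, of 12] by simp
qed

text \<open>The shift by \<open>chi\<close> makes the total local height exactly quadratic: the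
  scaling at infinity leaves \<open>2 * chi\<close> in \<open>height_add\<close> and
  \<open>3 * chi\<close> in \<open>height_double\<close>.\<close>

definition h :: real where "h = tot (\<lambda>pl. lamP pl 1) + chi"

lemma height_add:
  assumes "n \<ge> 1" "m > n" "m + n \<le> L"
  shows "tot (\<lambda>pl. lamP pl (m + n)) + tot (\<lambda>pl. lamP pl (m - n)) =
    2 * tot (\<lambda>pl. lamP pl m) + 2 * tot (\<lambda>pl. lamP pl n) + 2 * chi"
proof -
  have nz: "X m - X n \<noteq> 0" using X_inj[of m n] assms by auto
  have "tot (\<lambda>pl. lamP pl (m + n) + lamP pl (m - n)) =
    tot (\<lambda>pl. 2 * lamP pl m + 2 * lamP pl n + val pl ((X m - X n) / uu pl ^ 2))"
    by (rule tot_cong) (use place_seq.lam_add_seq[OF PS assms(1,2)] in \<open>simp add: XX_def diff_divide_distrib\<close>)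
  moreover have "tot (\<lambda>pl. val pl ((X m - X n) / uu pl ^ 2)) = 2 * chi"
    using tot_scaled[OF nz prod_X, of 2] assms by simp
  ultimately show ?thesis by (simp add: tot_add tot_cmult)
qed

lemma height_double:
  assumes "n \<ge> 1" "n \<le> L"
  shows "tot (\<lambda>pl. lamP pl (2 * n)) = 4 * tot (\<lambda>pl. lamP pl n) + 3 * chi"
proof -
  have "tot (\<lambda>pl. lamP pl (2 * n)) = tot (\<lambda>pl. 4 * lamP pl n + val pl (Y n / uu pl ^ 3))"
    by (rule tot_cong) (use place_seq.lam_double_seq[OF PS assms(1)] in \<open>simp add: YY_def\<close>)
  moreover have "tot (\<lambda>pl. val pl (Y n / uu pl ^ 3)) = 3 * chi"
    using tot_scaled[OF Y_ne_0 prod_Y, of n 3] assms by simp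
  ultimately show ?thesis by (simp add: tot_add tot_cmult)
qed

lemma height_quadratic: "n \<ge> 1 \<Longrightarrow> n \<le> L \<Longrightarrow> tot (\<lambda>pl. lamP pl n) + chi = real n ^ 2 * h"
proof (induction n rule: less_induct)
  case (less n)
  consider "n = 1" | "n = 2" | "n \<ge> 3" using less.prems by linarith
  then show ?case
  proof cases
    case 1 then show ?thesis by (simp add: h_def)
  next
    case 2 then show ?thesis using height_double[of 1] less.prems by (simp add: h_def)
  next
    case 3
    define m where "m = n - 2"
    have n: "n = m + 2" "m \<ge> 1" using 3 by (auto simp: m_def)
    have "tot (\<lambda>pl. lamP pl n) + tot (\<lambda>pl. lamP pl m) = 2 * tot (\<lambda>pl. lamP pl (m + 1)) + 2 * tot (\<lambda>pl. lamP pl 1) + 2 * chi"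
      using height_add[of 1 "m + 1"] n less.prems by simp
    moreover have "tot (\<lambda>pl. lamP pl m) + chi = real m ^ 2 * h"
      using less.IH[of m] n less.prems by simp
    moreover have "tot (\<lambda>pl. lamP pl (m + 1)) + chi = real (m + 1) ^ 2 * h"
      using less.IH[of "m + 1"] n less.prems by simp
    moreover have "tot (\<lambda>pl. lamP pl 1) + chi = h" by (simp add: h_def)
    ultimately have "tot (\<lambda>pl. lamP pl n) + chi = 2 * (real (m + 1) ^ 2 * h) + 2 * h - real m ^ 2 * h" by linarith
    also have "\<dots> = real n ^ 2 * h" unfolding n by (simp add: power2_eq_square algebra_simps)
    finally show ?thesis .
  qed
qed

definition E :: "nat \<Rightarrow> real" where "E n = tot (\<lambda>pl. epsP pl n)"

lemma E_nonneg: "0 \<le> E n"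
  unfolding E_def by (rule tot_nonneg) (rule place_seq.eps_bounds(1)[OF PS])

text \<open>Half of Shioda's height formula: \<open>chi\<close>, plus the intersection number with
  the zero section, minus the fibre contributions.\<close>

lemma height_eq: "n \<ge> 1 \<Longrightarrow> n \<le> L \<Longrightarrow> real n ^ 2 * h = chi + tot (\<lambda>pl. betaP pl n) - E n"
proof -
  have "E n = tot (\<lambda>pl. betaP pl n) - tot (\<lambda>pl. lamP pl n)"
    unfolding E_def tot_diff[symmetric] by (rule tot_cong) (rule eps_eq)
  then show "n \<ge> 1 \<Longrightarrow> n \<le> L \<Longrightarrow> ?thesis" using height_quadratic[of n] by linarith
qed

lemma betaP_nonneg: "isplace pl \<Longrightarrow> 0 \<le> betaP pl n" by (rule place_seq.beta_nonneg[OF PS])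

lemma height_ge: "n \<ge> 1 \<Longrightarrow> n \<le> L \<Longrightarrow> real chi - E n \<le> real n ^ 2 * h"
  using height_eq[of n] tot_nonneg[of "\<lambda>pl. betaP pl n", OF betaP_nonneg] by simp

end

section \<open>Consequences of a missing primitive divisor\<close>

context ec_global
begin

text \<open>\<open>x / y\<close> has valuation \<open>- v x / 2\<close>, which must be an
  integer.\<close>

lemma vfin_X_even: assumes p: "prime p" and n: "n \<ge> 1" and x: "X n \<noteq> 0" "vfin p (X n) < 0" shows "even (vfin p (X n))"
proof -
  interpret place_seq "val (Some p)" "AA (Some p)" "BB (Some p)" "XX (Some p)" "YY (Some p)" by (rule PS) (simp add: p)
  interpret int_deriv "val (Some p)" dK using int_deriv_vfin[OF p] by (simp add: val_def[abs_def])
  have "veq (- val (Some p) (X n) / 2) (X n / Y n)"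
    by (rule contact_vals(1)[OF _ _ _ A_int B_int _ _ refl refl])
       (use curve[OF n] Y_ne_0[OF n] disc_nz x in \<open>auto simp: val_def\<close>)
  then have "- real_of_int (vfin p (X n)) / 2 \<in> \<int>" using v_int[of "X n / Y n"] by (auto simp: veq_def val_def)
  then obtain k where "- real_of_int (vfin p (X n)) / 2 = of_int k" by (elim Ints_cases)
  then have "real_of_int (vfin p (X n)) = of_int (2 * (- k))" by simp
  then have "vfin p (X n) = 2 * (- k)" by linarith
  then show ?thesis by simp
qed

lemma dvd_eds_iff: assumes p: "prime p" and n: "n \<ge> 1"
  shows "p dvd eds A P n \<longleftrightarrow> X n \<noteq> 0 \<and> vfin p (X n) < 0" and "eds A P n \<noteq> 0"
  using denomB_dvd_iff[OF vfin_X_even[OF _ n] p, of "Y n"] mult_Some[OF n] by (auto simp: eds_def)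

text \<open>Testing the definition with d = p shows that p divides an earlier term;
  \<open>neg_imprimitive\<close> then gives some n/q with the same contact order, so a single
  summand on the right suffices.\<close>

lemma no_primitive_local:
  assumes np: "\<not> has_primitive_divisor A P n" and n: "n \<ge> 1" and p: "prime p"
  shows "betaP (Some p) n \<le> (\<Sum>q\<in>prime_factors n. betaP (Some p) (n div q))"
proof -
  interpret place_seq "val (Some p)" "AA (Some p)" "BB (Some p)" "XX (Some p)" "YY (Some p)" by (rule PS) (simp add: p)
  have neg_iff: "neg (XX (Some p) m) \<longleftrightarrow> p dvd eds A P m" if "m \<ge> 1" for m
    using dvd_eds_iff(1)[OF p that] by (simp add: neg_def val_def)
  show ?thesis
  proof (cases "betaP (Some p) n > 0")
    case True
    then have "neg (XX (Some p) n)" by (simp add: beta_pos neg_def)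
    then have "p dvd eds A P n" using neg_iff[OF n] by simp
    moreover have "\<not> is_unit p" using p not_prime_unit by blast
    ultimately obtain m where m: "m < n" "eds A P m \<noteq> 0" "\<not> is_unit (gcd (eds A P m) p)"
      using np unfolding has_primitive_divisor_def by blast
    have "\<not> coprime (eds A P m) p" using m(3) by (auto simp: coprime_iff_gcd_eq_1)
    then have "p dvd eds A P m" using prime_imp_coprime[OF p] by (metis coprime_commute)
    moreover have m0: "m \<ge> 1" using m(2) by (cases m) (auto simp: eds_def denomB_def)
    ultimately have "neg (XX (Some p) m)" using neg_iff by simp
    from neg_imprimitive[OF \<open>neg (XX (Some p) n)\<close> this] m m0
    obtain q where q: "prime q" "q dvd n" "beta (XX (Some p) (n div q)) = beta (XX (Some p) n)" by auto
    then have "q \<in> prime_factors n" using n by (simp add: in_prime_factors_iff)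
    then have "beta (XX (Some p) (n div q)) \<le> (\<Sum>q\<in>prime_factors n. betaP (Some p) (n div q))"
      by (intro member_le_sum) (auto simp: beta_nonneg)
    then show ?thesis using q by simp
  next
    case False
    then have "betaP (Some p) n = 0" using beta_nonneg[of "XX (Some p) n"] by simp
    then show ?thesis using beta_nonneg by (simp add: sum_nonneg)
  qed
qed

end

context ec_support
begin

text \<open>The sequence sees only finite places, so the contact \<open>betaP None n\<close> at
  infinity survives. The terms \<open>1 / q^2\<close> come from the heights of the multiples
  n/q.\<close>

lemma no_primitive:
  assumes np: "\<not> has_primitive_divisor A P n" and n: "n \<ge> 1" "n \<le> L"
  shows "real n ^ 2 * (1 - (\<Sum>q\<in>prime_factors n. 1 / real q ^ 2)) * h
    \<le> chi + betaP None n - E n + (\<Sum>q\<in>prime_factors n. E (n div q) - chi)"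
proof -
  define F where "F m = (\<Sum>pl\<in>T - {None}. wt pl * betaP pl m)" for m
  have "F n \<le> (\<Sum>pl\<in>T - {None}. wt pl * (\<Sum>q\<in>prime_factors n. betaP pl (n div q)))"
    unfolding F_def
  proof (intro sum_mono mult_left_mono wt_nonneg)
    fix pl assume "pl \<in> T - {None}"
    then obtain p where "pl = Some p" "prime p" using placeT[of pl] by (cases pl) auto
    then show "betaP pl n \<le> (\<Sum>q\<in>prime_factors n. betaP pl (n div q))" using no_primitive_local[OF np n(1)] by simp
  qed
  also have "\<dots> = (\<Sum>q\<in>prime_factors n. F (n div q))"
    unfolding F_def sum_distrib_left by (rule sum.swap)
  also have "\<dots> \<le> (\<Sum>q\<in>prime_factors n. real n ^ 2 * h / real q ^ 2 - chi + E (n div q))"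
  proof (rule sum_mono)
    fix q assume "q \<in> prime_factors n"
    then have q: "prime q" "q dvd n" by (auto simp: in_prime_factors_iff)
    then have m: "n div q \<ge> 1" "n div q \<le> L" using n div_le_dividend[of n q] dvd_imp_le[of q n] prime_gt_0_nat[of q]
      by (auto simp: Suc_le_eq div_greater_zero_iff simp del: div_le_dividend)
    have "real (n div q) = real n / real q" using q by (simp add: real_of_nat_div)
    then have "real n ^ 2 * h / real q ^ 2 = chi + tot (\<lambda>pl. betaP pl (n div q)) - E (n div q)"
      using height_eq[OF m] by (simp add: power_divide)
    moreover have "F (n div q) \<le> tot (\<lambda>pl. betaP pl (n div q))"
      using betaP_nonneg[of None] unfolding tot_split F_def by simp
    ultimately show "F (n div q) \<le> real n ^ 2 * h / real q ^ 2 - chi + E (n div q)" by simp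
  qed
  also have "\<dots> = real n ^ 2 * h * (\<Sum>q\<in>prime_factors n. 1 / real q ^ 2) + (\<Sum>q\<in>prime_factors n. E (n div q) - chi)"
    by (simp add: sum_distrib_left sum.distrib sum_subtractf)
  finally have "F n \<le> \<dots>" .
  moreover have "real n ^ 2 * h = chi + (betaP None n + F n) - E n"
    using height_eq[OF n] unfolding tot_split F_def .
  ultimately show ?thesis by (simp add: algebra_simps)
qed

end

text \<open>Coprime numerator and denominator each divide their own derivative and are therefore
  constant.\<close>

lemma dK_zero_imp_val: assumes z: "z \<noteq> 0" and dz: "dK z = 0" and p: "prime p" shows "vfin p z = 0"
proof -
  obtain a b where ab: "b \<noteq> 0" "coprime a b" "z = polyK a / polyK b" by (rule K_coprime_cases)
  have a: "a \<noteq> 0" using ab z by auto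
  have "polyK (pderiv a * b - a * pderiv b) = 0" using dz dK_eq[OF ab(1), of a] ab by (simp del: polyK_simps)
  then have e: "pderiv a * b = a * pderiv b" using Fract_eq_iff[of 1 1 "pderiv a * b" "a * pderiv b"] by simp
  have "b dvd pderiv b" using e ab(2) by (metis coprime_commute coprime_dvd_mult_right_iff dvd_triv_right)
  moreover have "a dvd pderiv a" using e ab(2) by (metis coprime_dvd_mult_left_iff dvd_triv_left)
  ultimately have "degree a = 0" "degree b = 0"
    using dvd_imp_degree_le[of a "pderiv a"] dvd_imp_degree_le[of b "pderiv b"] pderiv_eq_0_iff[of a] pderiv_eq_0_iff[of b]
      degree_pderiv[of a] degree_pderiv[of b] by (cases "pderiv a = 0"; cases "pderiv b = 0"; force)+
  then have "is_unit a" "is_unit b" using a ab by (auto simp: is_unit_iff_degree)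
  then show ?thesis using vfin_eq[OF p a ab(1)] ab(3) by (simp add: multiplicity_unit_right)
qed

section \<open>Degrees of the differential invariants\<close>

context ec_global
begin

abbreviation "GJ \<equiv> invJ dK (polyK A) (polyK B)"
abbreviation "GZ n \<equiv> invZ dK (polyK A) (polyK B) (X n) (Y n)"
abbreviation "GM n \<equiv> invM dK (polyK A) (polyK B) (X n) (Y n)"

definition nsP :: "rat poly option \<Rightarrow> nat \<Rightarrow> bool" where
  "nsP pl n \<longleftrightarrow> place_seq.nonsing (val pl) (AA pl) (XX pl n) (YY pl n)"

lemma Disc_K: "4 * polyK A ^ 3 + 27 * polyK B ^ 2 \<noteq> 0" using Disc_nz[of "Some 0"] by simp

text \<open>Three kinds of points: poles of x, nonsingular integral points, and singular ones, where
  the pole is at most the valuation of the discriminant.\<close>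

lemma finite_integrality:
  assumes p: "prime p" and n: "n \<ge> 1"
  shows "GM n \<noteq> 0 \<Longrightarrow> nsP (Some p) n \<Longrightarrow> 0 \<le> val (Some p) (GM n)"
    and "GM n \<noteq> 0 \<Longrightarrow> - (12 * muP (Some p) + NP (Some p)) \<le> val (Some p) (GM n)"
    and "GZ n \<noteq> 0 \<Longrightarrow> GJ = 0 \<Longrightarrow> nsP (Some p) n \<Longrightarrow> 0 \<le> val (Some p) (GZ n)"
    and "GZ n \<noteq> 0 \<Longrightarrow> GJ = 0 \<Longrightarrow> - (12 * muP (Some p) + NP (Some p)) \<le> val (Some p) (GZ n)"
    and "GJ \<noteq> 0 \<Longrightarrow> 0 \<le> val (Some p) GJ"
proof -
  interpret place_seq "val (Some p)" "AA (Some p)" "BB (Some p)" "XX (Some p)" "YY (Some p)" by (rule PS) (simp add: p)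
  interpret int_deriv "val (Some p)" dK using int_deriv_vfin[OF p] by (simp add: val_def[abs_def])
  have eq: "(Y n)^2 = (X n)^3 + polyK A * X n + polyK B" "Y n \<noteq> 0" using curve[OF n] Y_ne_0[OF n] by auto
  note pr = eq(1) eq(2) Disc_K A_int[unfolded AA_Some] B_int[unfolded BB_Some]
  have D: "12 * mu + NN = val (Some p) (4 * polyK A ^ 3 + 27 * polyK B ^ 2)" using vDisc by (simp add: veq_def)
  have D0: "0 \<le> 12 * mu + NN" using mu0 NN_nonneg by simp
  show "GJ \<noteq> 0 \<Longrightarrow> 0 \<le> val (Some p) GJ" using J_int[OF pr] by (simp add: vge_def)
  have c: "vge 0 (GM n)" "GJ = 0 \<Longrightarrow> vge 0 (GZ n)" if "\<not> vge 0 (X n)"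
    using contact_int[OF pr _ _ refl refl] that by (auto simp: vge_def)
  have ns: "vge 0 (GM n)" "GJ = 0 \<Longrightarrow> vge 0 (GZ n)" if s: "nsP (Some p) n" for p'
  proof -
    have *: "veq 0 (Y n) \<or> veq 0 (3 * (X n)^2 + polyK A)" if x: "vge 0 (X n)"
      using s x y_int[OF pr x] fx_int[OF pr x] vge_or_vgt[of 0 "Y n"] vge_or_vgt[of 0 "3 * (X n)^2 + polyK A"]
      unfolding nsP_def nonsing_def by auto
    show "vge 0 (GM n)" using M_int_nonsing[OF pr _ *] c by blast
    show "GJ = 0 \<Longrightarrow> vge 0 (GZ n)" using Z_int_nonsing[OF pr _ *] c by blast
  qed
  show "GM n \<noteq> 0 \<Longrightarrow> nsP (Some p) n \<Longrightarrow> 0 \<le> val (Some p) (GM n)"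
    and "GZ n \<noteq> 0 \<Longrightarrow> GJ = 0 \<Longrightarrow> nsP (Some p) n \<Longrightarrow> 0 \<le> val (Some p) (GZ n)"
    using ns by (auto simp: vge_def)
  show "GM n \<noteq> 0 \<Longrightarrow> - (12 * mu + NN) \<le> val (Some p) (GM n)"
  proof (cases "vge 0 (X n)")
    case True
    show "GM n \<noteq> 0 \<Longrightarrow> - (12 * mu + NN) \<le> val (Some p) (GM n)"
      using M_disc_int[OF pr True] Disc_K v_mult[of "GM n" "4 * polyK A ^ 3 + 27 * polyK B ^ 2"]
      unfolding D by (simp add: vge_def del: distrib_left_numeral)
  qed (use c D0 in \<open>auto simp: vge_def\<close>)
  show "GZ n \<noteq> 0 \<Longrightarrow> GJ = 0 \<Longrightarrow> - (12 * mu + NN) \<le> val (Some p) (GZ n)"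
  proof (cases "vge 0 (X n)")
    case True
    show "GZ n \<noteq> 0 \<Longrightarrow> GJ = 0 \<Longrightarrow> - (12 * mu + NN) \<le> val (Some p) (GZ n)"
      using Z_disc_int[OF pr True] Disc_K v_mult[of "GZ n" "4 * polyK A ^ 3 + 27 * polyK B ^ 2"]
      unfolding D by (simp add: vge_def del: distrib_left_numeral)
  qed (use c D0 in \<open>auto simp: vge_def\<close>)
qed

definition theta :: "K \<Rightarrow> K" where "theta z = tK * dK z"

lemma log_place_inf: "log_place (val None) (AA None) (BB None) (XX None) (YY None) theta"
proof -
  interpret place_seq "val None" "AA None" "BB None" "XX None" "YY None" by (rule PS) simp
  have log: "cg (theta u / u) (- of_int (vinf u))" if "u \<noteq> 0" for u
    using theta_log[OF that] unfolding theta_def val_def[abs_def] by simp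
  show ?thesis
  proof (intro log_place.intro place_seq_axioms log_place_axioms.intro)
    show "derivation theta" unfolding theta_def[abs_def] by (rule dK.derivation_scale)
    fix u :: K and k :: real
    assume g: "vge k u"
    show "vge k (theta u)"
    proof (cases "u = 0")
      case False
      then show ?thesis using vge_mult[OF g cg_vge[OF log[OF False]]] by simp
    qed (simp add: theta_def dK.d_0)
  next
    fix u :: K
    assume g: "vge 0 u"
    show "vgt 0 (theta u)"
    proof (cases "u = 0")
      case False
      show ?thesis
      proof (cases "vinf u = 0")
        case True
        then have "vgt 0 (theta u / u)" using log[OF False] by (simp add: cg_0)
        then show ?thesis using vgt_vge_mult[OF _ g, of 0 "theta u / u"] False by simp
      next
        case F: False
        then have "vgt 0 u" using g by (auto simp: vge_def vgt_def val_def)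
        then show ?thesis using vgt_vge_mult[OF _ cg_vge[OF log[OF False]], of 0 u] False by simp
      qed
    qed (simp add: theta_def dK.d_0)
  next
    fix u :: K and i :: int
    assume "u \<noteq> 0" "val None u = of_int i"
    then show "cg (theta u / u) (- of_int i)" using log[of u] by (simp add: val_def)
  qed
qed

text \<open>Passing from \<open>dK\<close> to \<open>theta\<close> multiplies J and Z by t and M by
  \<open>t^3\<close>; the rescaling by \<open>uu None\<close> contributes the weights 10, 11 and
  21.\<close>

lemma inf_invariants:
  shows "GJ * tK = invJ theta (AA None) (BB None) * uu None ^ 10"
    and "GZ n * tK = invZ theta (AA None) (BB None) (XX None n) (YY None n) * uu None ^ 11"
    and "GM n * tK ^ 3 = invM theta (AA None) (BB None) (XX None n) (YY None n) * uu None ^ 21"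
proof -
  define u where "u = uu None"
  have u: "u \<noteq> 0" using uu_nz by (simp add: u_def)
  have e: "polyK A = u^4 * AA None" "polyK B = u^6 * BB None" "X n = u^2 * XX None n" "Y n = u^3 * YY None n"
    using u by (auto simp: AA_def BB_def XX_def YY_def u_def)
  have th: "theta = (\<lambda>z. tK * dK z)" by (rule ext) (simp add: theta_def)
  show "GJ * tK = invJ theta (AA None) (BB None) * uu None ^ 10"
    unfolding e(1,2) dK.invJ_scale th dK.invJ_g u_def[symmetric] by (simp add: mult_ac)
  show "GZ n * tK = invZ theta (AA None) (BB None) (XX None n) (YY None n) * uu None ^ 11"
    using dK.invZ_scale[OF u, of "AA None" "BB None" "XX None n" "YY None n", folded e]
    unfolding th dK.invZ_g u_def[symmetric] by simp
  show "GM n * tK ^ 3 = invM theta (AA None) (BB None) (XX None n) (YY None n) * uu None ^ 21"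
    using dK.invM_scale[OF u Disc_nz[of None], of "XX None n" "YY None n", folded e]
    unfolding th dK.invM_g[OF Disc_nz] u_def[symmetric] by simp
qed

lemma inf_val: assumes "a * tK ^ j = b * uu None ^ k"
  shows "a = 0 \<longleftrightarrow> b = 0" "a \<noteq> 0 \<Longrightarrow> val None b = val None a + real k * chi - j"
proof -
  interpret valuation "val None" by (rule val_valuation) simp
  have t: "tK \<noteq> 0" "val None tK = -1" using vinf_poly[of "[:0,1:]"] by (auto simp: val_def)
  show *: "a = 0 \<longleftrightarrow> b = 0" using assms uu_nz[of None] t
    by (metis mult_eq_0_iff power_not_zero)
  assume a: "a \<noteq> 0"
  have "val None (a * tK ^ j) = val None a - j" using a t v_mult[of a "tK ^ j"] v_power[of tK j] by simp
  moreover have "val None (b * uu None ^ k) = val None b - real k * chi"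
    using a * uu_nz[of None] v_mult[of b "uu None ^ k"] vinf_uu[of k] by (simp add: val_def)
  ultimately show "val None b = val None a + real k * chi - j" using assms by simp
qed

end

context ec_support
begin

text \<open>The product formula as an inequality: lower bounds for the valuations of a nonzero
  function cannot have positive total.\<close>

lemma tot_le_0:
  assumes z: "z \<noteq> 0" and g: "\<And>pl. isplace pl \<Longrightarrow> g pl \<le> val pl z"
    and out: "\<And>pl. isplace pl \<Longrightarrow> pl \<notin> T \<Longrightarrow> 0 \<le> val pl z"
  shows "tot g \<le> 0"
proof -
  obtain T' where T': "finite T'" "None \<in> T'" "\<forall>pl\<in>T'. isplace pl" "(\<Sum>pl\<in>T'. wt pl * val pl z) = 0"
    "\<forall>pl. isplace pl \<and> pl \<notin> T' \<longrightarrow> val pl z = 0"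
    using prod_support[of "{z}"] z by auto
  have "(\<Sum>pl\<in>T \<union> T'. wt pl * val pl z) = (\<Sum>pl\<in>T'. wt pl * val pl z)"
    using finT T' placeT by (intro sum.mono_neutral_right) auto
  moreover have "(\<Sum>pl\<in>T. wt pl * val pl z) \<le> (\<Sum>pl\<in>T \<union> T'. wt pl * val pl z)"
    using finT T' out wt_nonneg by (intro sum_mono2) auto
  moreover have "tot g \<le> (\<Sum>pl\<in>T. wt pl * val pl z)"
    unfolding tot_def using g placeT wt_nonneg by (intro sum_mono mult_left_mono) auto
  ultimately show ?thesis using T' by simp
qed

text \<open>J is integral at all finite places, hence has no zero at infinity; the rest is the
  change of scale and of derivation.\<close>

lemma J_inf_le: assumes "GJ \<noteq> 0" shows "val None (invJ theta (AA None) (BB None)) \<le> 10 * real chi - 1"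
proof -
  have "tot (\<lambda>pl. if pl = None then val None GJ else 0) \<le> 0"
  proof (rule tot_le_0[OF assms])
    fix pl assume "isplace pl"
    then show "(if pl = None then val None GJ else 0) \<le> val pl GJ"
      using finite_integrality(5)[of _ 1] assms by (cases pl) auto
    show "0 \<le> val pl GJ" if "pl \<notin> T"
      using that NoneT finite_integrality(5)[of _ 1] assms \<open>isplace pl\<close> by (cases pl) auto
  qed
  then have "val None GJ \<le> 0" unfolding tot_None .
  then show ?thesis using inf_val(2)[of GJ 1 _ 10] inf_invariants(1) assms by simp
qed

text \<open>\<open>J = 0\<close> makes \<open>Disc / A^3\<close> constant, whereas its valuation
  would be \<open>NN\<close>.\<close>

lemma J_zero_NN: assumes J: "GJ = 0" and p: "prime p" shows "NP (Some p) = 0"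
proof (rule ccontr)
  interpret place "val (Some p)" "AA (Some p)" "BB (Some p)" by (rule place) (simp add: p)
  assume "NN \<noteq> 0"
  then have N: "NN > 0" using NN_nonneg by simp
  define D where "D = 4 * polyK A ^ 3 + 27 * polyK B ^ 2"
  define a where "a = polyK A"
  have a: "a \<noteq> 0" using A_nz[OF N] by (simp add: a_def)
  have D0: "D \<noteq> 0" using Disc_K by (simp add: D_def)
  have "27 * polyK B * GJ = a * dK D - 3 * D * dK a"
    unfolding D_def a_def dK.d_disc invJ_def invD_def by algebra
  then have "a * dK D = 3 * D * dK a" using J by simp
  then have "dK (D / a ^ 3) = 0" using a unfolding dK.d_divide[OF power_not_zero[OF a, of 3]] dK.d_cube
    by simp algebra
  then have "vfin p (D / a ^ 3) = 0" using dK_zero_imp_val[of "D / a^3"] D0 a p by simp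
  then have "val (Some p) D = 3 * val (Some p) a"
    using v_divide[of D "a^3"] v_power[of a 3] D0 a by (simp add: val_def)
  then show False using vDisc NN_pos_eq(1)[OF N] N by (simp add: veq_def a_def D_def)
qed

text \<open>Differentiating a polynomial loses at most one order at p; this is applied to A and the
  discriminant in \<open>27 B J = A Disc' - 3 Disc A'\<close>.\<close>

lemma J_finite_mult: assumes p: "prime p" and N: "NP (Some p) > 0"
  shows "GJ \<noteq> 0" "10 * muP (Some p) + NP (Some p) - 1 \<le> val (Some p) GJ"
proof -
  show J: "GJ \<noteq> 0" using J_zero_NN[OF _ p] N by auto
  interpret place "val (Some p)" "AA (Some p)" "BB (Some p)" by (rule place) (simp add: p)
  define a b where "a = polyK A" and "b = polyK B"
  define D where "D = 4 * a ^ 3 + 27 * b ^ 2"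
  have DK: "D = polyK (4 * A^3 + 27 * B^2)" using Disc_scaled[of "Some p"] by (simp add: D_def a_def b_def uu_def)
  have va: "veq (4 * mu) a" and vb: "veq (6 * mu) b" and vD: "veq (12 * mu + NN) D"
    using NN_pos_eq[OF N] vDisc by (simp_all add: a_def b_def D_def)
  have der: "vge (val (Some p) (polyK f) - 1) (dK (polyK f))" for f
    using vfin_pderiv[OF p, of f] dK_poly[of f] by (cases "pderiv f = 0") (auto simp: vge_def val_def)
  have da: "vge (4 * mu - 1) (dK a)" using der[of A] va by (simp add: a_def veq_def)
  have dD: "vge (12 * mu + NN - 1) (dK D)" using der[of "4 * A^3 + 27 * B^2"] vD unfolding DK by (simp add: veq_def del: polyK_simps)
  have e: "b * (27 * GJ) = a * dK D - 3 * (D * dK a)"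
    unfolding D_def dK.d_disc unfolding a_def b_def invJ_def invD_def by algebra
  have "vge (16 * mu + NN - 1) (a * dK D)" using vge_mult[OF veq_vge[OF va] dD] by (simp add: algebra_simps)
  moreover have "vge (16 * mu + NN - 1) (3 * (D * dK a))" using vge_mult[OF veq_vge[OF vD] da] unfolding vge_cmult by (simp add: algebra_simps)
  ultimately have "vge (16 * mu + NN - 1) (b * (27 * GJ))" unfolding e by (rule vge_diff)
  from vge_divide[OF this vb] have "vge (10 * mu + NN - 1) (27 * GJ)" using vb by (simp add: veq_def algebra_simps)
  then show "10 * mu + NN - 1 \<le> val (Some p) GJ" using J by (simp add: vge_def)
qed

lemma J_inf_mult: assumes "NP None > 0"
  shows "GJ \<noteq> 0" "val None (invJ theta (AA None) (BB None)) = 10 * muP None + NP None"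
    "10 * muP None + NP None \<le> 10 * real chi - 1"
proof -
  interpret log_place "val None" "AA None" "BB None" "XX None" "YY None" theta by (rule log_place_inf)
  obtain i where "NN = of_int i" using NN_int by (elim Ints_cases)
  from J_mult(1)[OF assms this] have v: "veq (10 * mu + NN) LJ" .
  then show "val None LJ = 10 * mu + NN" by (simp add: veq_def)
  show J: "GJ \<noteq> 0" using v inf_val(1)[of GJ 1 LJ 10] inf_invariants(1) by (simp add: veq_def)
  show "10 * mu + NN \<le> 10 * real chi - 1" using J_inf_le[OF J] v by (simp add: veq_def)
qed

text \<open>Szpiro's inequality, from the degree of the Wronskian \<open>J\<close> of \<open>A^3\<close> and \<open>B^2\<close>.\<close>

lemma szpiro: "tot (\<lambda>pl. if NP pl > 0 then 10 * muP pl + NP pl - 1 else 0) \<le> 10 * chi"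
proof (cases "GJ = 0")
  case True
  have "NP pl = 0" if "isplace pl" for pl
  proof (cases pl)
    case None
    then show ?thesis using J_inf_mult(1) True place.NN_nonneg[OF place[OF isplace_None]] by fastforce
  qed (use J_zero_NN[OF True] that in auto)
  then have "tot (\<lambda>pl. if NP pl > 0 then 10 * muP pl + NP pl - 1 else 0) \<le> tot (\<lambda>pl. 0)" by (intro tot_mono) simp
  then show ?thesis by (simp add: tot_def)
next
  case False
  define g where "g pl = (if NP pl > 0 then 10 * muP pl + NP pl - 1 else 0) - (if pl = None then 10 * real chi else 0)" for pl
  have v0: "val None (invJ theta (AA None) (BB None)) = val None GJ + 10 * real chi - 1"
    using inf_val(2)[of GJ 1 _ 10] inf_invariants(1) False by simp
  have "tot g \<le> 0"
  proof (rule tot_le_0[OF False])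
    fix pl assume pl: "isplace pl"
    show "g pl \<le> val pl GJ"
    proof (cases pl)
      case (Some p)
      then show ?thesis using finite_integrality(5)[of p 1] J_finite_mult[of p] False pl by (simp add: g_def)
    next
      case None
      show ?thesis
      proof (cases "NP None > 0")
        case True
        then show ?thesis using J_inf_mult(2)[OF True] v0 None by (simp add: g_def)
      next
        case F: False
        interpret log_place "val None" "AA None" "BB None" "XX None" "YY None" theta by (rule log_place_inf)
        have "LJ \<noteq> 0" using False inf_val(1)[of GJ 1 LJ 10] inf_invariants(1) by simp
        then have "0 \<le> val None LJ" using J_ge mu0 by (simp add: vge_def)
        then show ?thesis using F v0 None by (simp add: g_def)
      qed
    qed
    show "0 \<le> val pl GJ" if "pl \<notin> T"
      using that NoneT finite_integrality(5)[of _ 1] False \<open>isplace pl\<close> by (cases pl) auto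
  qed
  then show ?thesis unfolding g_def tot_diff tot_None by simp
qed

text \<open>The order of contact with the origin at infinity is bounded by the degree of the Manin map.\<close>

lemma contact_bound:
  assumes n: "n \<ge> 1" and R: "betaP None n > 0"
    and g: "\<And>p. prime p \<Longrightarrow> nsP (Some p) n \<and> g (Some p) = 0 \<or> g (Some p) = 12 * muP (Some p) + NP (Some p)"
    and D: "D = (\<Sum>pl\<in>T - {None}. wt pl * g pl)"
  shows "NP None > 0 \<Longrightarrow> betaP None n \<le> 21 * real chi - 3 - 22 * muP None - 2 * NP None + D"
    and "NP None = 0 \<Longrightarrow> betaP None n \<le> 21 * real chi - 3 - 22 * muP None + D
      \<or> betaP None n \<le> 11 * real chi - 1 - 11 * muP None + D"
proof -
  interpret log_place "val None" "AA None" "BB None" "XX None" "YY None" theta by (rule log_place_inf)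
  define x y where "x = XX None n" and "y = YY None n"
  have x: "x \<noteq> 0" "val None x < 0" using R by (auto simp: beta_pos x_def)
  have eq: "y^2 = x^3 + AA None * x + BB None" "y \<noteq> 0" using curve[OF n] Y_ne_0[OF n] by (auto simp: x_def y_def)
  have "veq (- val None x / 2) (x / y)"
    by (rule contact_vals(1)[OF eq disc_nz A_int B_int x refl refl])
  then obtain Ri :: int where Ri: "- val None x / 2 = of_int Ri" using v_int_ex[of "x / y"] by (auto simp: veq_def)
  have bR: "betaP None n = of_int Ri" using x Ri by (simp add: beta_def x_def)
  have Rp: "Ri > 0" using R bR by simp
  have vx: "val None x = - 2 * of_int Ri" using Ri by simp
  obtain Di where Di: "val None Disc = of_int Di" using v_int_ex[OF disc_nz] by blast
  have DN: "of_int Di = 12 * mu + NN" using vDisc Di by (simp add: veq_def)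
  note pr = n x_def y_def refl refl vx Rp x(1) Di refl refl
  \<comment> \<open>The divisor of z has degree 0: zeros at infinity are paid for by poles at finite
    places, which occur only at singular reductions.\<close>
  have bound: "val None z \<le> D" if z: "z \<noteq> 0"
    and z1: "\<And>p. prime p \<Longrightarrow> nsP (Some p) n \<Longrightarrow> 0 \<le> val (Some p) z"
    and z2: "\<And>p. prime p \<Longrightarrow> - (12 * muP (Some p) + NP (Some p)) \<le> val (Some p) z" for z
  proof -
    have "tot (\<lambda>pl. if pl = None then val None z else - g pl) \<le> 0"
    proof (rule tot_le_0[OF z])
      fix pl assume pl: "isplace pl"
      show "(if pl = None then val None z else - g pl) \<le> val pl z"
        using pl g z1 z2 by (cases pl) fastforce+
      show "0 \<le> val pl z" if "pl \<notin> T"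
        using that NoneT outT[OF pl that] z2 pl by (cases pl) fastforce+
    qed
    moreover have "(\<Sum>pl\<in>T - {None}. wt pl * (if pl = None then val None z else - g pl)) = - D"
      unfolding D sum_negf[symmetric] by (rule sum.cong) auto
    ultimately show ?thesis unfolding tot_split by simp
  qed
  have D0: "0 \<le> D"
  proof -
    have "0 \<le> g pl" if plT: "pl \<in> T - {None}" for pl
    proof -
      obtain p where p: "pl = Some p" "prime p" using plT placeT[of pl] by (cases pl) auto
      have "0 \<le> 12 * muP (Some p) + NP (Some p)"
        using place_seq.mu0[OF PS[of "Some p"]] place.NN_nonneg[OF place[of "Some p"]] p by simp
      then show ?thesis using g[OF p(2)] p(1) by auto
    qed
    then show ?thesis unfolding D using wt_nonneg by (intro sum_nonneg mult_nonneg_nonneg) auto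
  qed
  define M where "M = invM theta (AA None) (BB None) x y"
  define Z where "Z = invZ theta (AA None) (BB None) x y"
  have MG: "M \<noteq> 0 \<Longrightarrow> val None M \<le> D + 21 * real chi - 3"
    using inf_val[of "GM n" 3 M 21] inf_invariants(3)[of n] bound[OF _ finite_integrality(1,2)[OF _ n]]
    unfolding M_def x_def y_def by simp
  have ZG: "Z \<noteq> 0 \<Longrightarrow> GJ = 0 \<Longrightarrow> val None Z \<le> D + 11 * real chi - 1"
    using inf_val[of "GZ n" 1 Z 11] inf_invariants(2)[of n] bound[OF _ finite_integrality(3,4)[OF _ n]]
    unfolding Z_def x_def y_def by simp
  have JG: "GJ = 0 \<longleftrightarrow> LJ = 0" using inf_val(1)[of GJ 1 LJ 10] inf_invariants(1) by simp
  show "betaP None n \<le> 21 * real chi - 3 - 22 * mu - 2 * NN + D" if N: "NN > 0"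
    using inf_M_mult[OF pr N] MG unfolding bR M_def[symmetric] by linarith
  show "betaP None n \<le> 21 * real chi - 3 - 22 * mu + D \<or> betaP None n \<le> 11 * real chi - 1 - 11 * mu + D" if N: "NN = 0"
  proof (cases "GJ = 0")
    case True
    then show ?thesis using inf_Z[OF pr] ZG JG DN N mu0 unfolding bR Z_def[symmetric] by fastforce
  next
    case False
    then have J: "LJ \<noteq> 0" using JG by simp
    obtain ii where ii: "val None LJ = of_int ii" using v_int_ex[OF J] by blast
    \<comment> \<open>In the exceptional case of \<open>inf_M_good\<close> the contact order is
      \<open>ii - 11 * mu\<close>, and the degree of J bounds \<open>ii\<close>.\<close>
    have "10 * mu \<le> of_int ii" using J_ge J ii by (simp add: vge_def)
    moreover have "of_int ii \<le> 10 * real chi - 1" using J_inf_le[OF False] ii by simp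
    ultimately show ?thesis
      using inf_M_good[OF pr N J ii] MG D0 unfolding bR M_def[symmetric] by (elim disjE) linarith+
  qed
qed

end

section \<open>Elementary estimates for prime factors and corrections\<close>

lemma sum_odd_squares: "(\<Sum>k=1..m. 1 / (2 * real k + 1) ^ 2) \<le> 1/4 - 1 / (4 * (real m + 1))"
proof (induction m)
  case (Suc m)
  have "1 / (2 * real (Suc m) + 1) ^ 2 \<le> 1 / (4 * (real m + 1) * (real m + 2))"
    by (intro divide_left_mono mult_pos_pos zero_less_power) (auto simp: power2_eq_square algebra_simps)
  also have "\<dots> = 1 / (4 * (real m + 1)) - 1 / (4 * (real m + 2))" by (simp add: divide_simps)
  finally show ?case using Suc by (simp add: add.commute)
qed simp

text \<open>The prime 2 contributes 1/4; odd primes are replaced by all odd numbers from 3 on, whose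
  inverse squares stay below a telescoping sum with limit 1/4.\<close>

lemma sum_prime_squares:
  fixes n :: nat
  shows "(\<Sum>q\<in>prime_factors n. 1 / real q ^ 2) \<le> 1/2"
proof -
  define Q where "Q = prime_factors n - {2}"
  define m where "m = Max (insert 0 Q)"
  have odd: "\<exists>k. k \<in> {1..m} \<and> q = 2 * k + 1" if q: "q \<in> Q" for q
  proof -
    have p: "prime q" "q \<noteq> 2" using q by (auto simp: Q_def)
    then have "q > 2" using prime_ge_2_nat[of q] by simp
    then have "odd q" using prime_odd_nat p by blast
    then obtain k where k: "q = 2 * k + 1" by (elim oddE)
    have "q \<le> m" unfolding m_def using q by (intro Max_ge) (auto simp: Q_def)
    then show ?thesis using k \<open>q > 2\<close> by auto
  qed
  have "(\<Sum>q\<in>prime_factors n. 1 / real q ^ 2) \<le> (\<Sum>q\<in>insert 2 Q. 1 / real q ^ 2)"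
    by (rule sum_mono2) (auto simp: Q_def)
  also have "\<dots> = 1/4 + (\<Sum>q\<in>Q. 1 / real q ^ 2)" by (subst sum.insert) (auto simp: Q_def)
  also have "(\<Sum>q\<in>Q. 1 / real q ^ 2) \<le> (\<Sum>q\<in>(\<lambda>k. 2 * k + 1) ` {1..m}. 1 / real q ^ 2)"
    by (rule sum_mono2) (use odd in \<open>blast | simp\<close>)+
  also have "\<dots> = (\<Sum>k=1..m. 1 / (2 * real k + 1) ^ 2)"
    by (subst sum.reindex) (auto simp: inj_on_def add.commute)
  also have "\<dots> \<le> 1/4" using sum_odd_squares[of m] by (rule order_trans) simp
  finally show ?thesis by simp
qed

text \<open>A product of w distinct primes is at least \<open>2 * 3^(w-1)\<close>; multiplying by 3
  avoids the exponent w - 1.\<close>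

lemma prime_factors_card: fixes n :: nat assumes n: "n \<ge> 1" shows "2 * 3 ^ card (prime_factors n) \<le> 3 * n"
proof -
  define Q where "Q = prime_factors n"
  have fin: "finite Q" by (simp add: Q_def)
  have Q2: "q \<ge> 2" "q \<noteq> 2 \<Longrightarrow> q \<ge> 3" if "q \<in> Q" for q
    using that prime_ge_2_nat[of q] by (auto simp: Q_def in_prime_factors_iff)
  have "(\<Prod>q\<in>Q. q) \<le> (\<Prod>q\<in>Q. q ^ multiplicity q n)"
  proof (rule prod_mono, rule conjI)
    fix q assume q: "q \<in> Q"
    then have "multiplicity q n > 0" using n by (simp add: Q_def prime_factors_multiplicity)
    then show "q \<le> q ^ multiplicity q n" using Q2[OF q] by (simp add: self_le_power)
  qed simp
  also have "\<dots> = n" unfolding Q_def using prod_prime_factors[of n] n by simp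
  finally have le: "\<Prod>Q \<le> n" by simp
  have "3 ^ card (Q - {2}) \<le> \<Prod>(Q - {2})"
    using prod_mono[of "Q - {2}" "\<lambda>_. 3::nat" "\<lambda>q. q"] Q2(2) by (auto simp: Ball_def)
  then show ?thesis
  proof (cases "2 \<in> Q")
    case True
    then have "\<Prod>Q = 2 * \<Prod>(Q - {2})" "card Q = Suc (card (Q - {2}))"
      using fin prod.remove[of Q 2 "\<lambda>q. q"] card.remove[of Q 2] by auto
    then show ?thesis using \<open>3 ^ card (Q - {2}) \<le> \<Prod>(Q - {2})\<close> le unfolding Q_def[symmetric] by simp
  next
    case False
    then show ?thesis using \<open>3 ^ card (Q - {2}) \<le> \<Prod>(Q - {2})\<close> le unfolding Q_def[symmetric] by simp
  qed
qed

text \<open>\<open>162 k - 567\<close> and \<open>18 k - 27\<close> are the secants of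
  \<open>3^k\<close> through k = 4, 5 and k = 2, 3. Convexity turns
  \<open>prime_factors_card\<close> into linear bounds.\<close>

lemma card_prime_factors_bounds:
  fixes n :: nat assumes n: "n \<ge> 1"
  defines "w \<equiv> real (card (prime_factors n))"
  shows "w \<le> 3.5 + n / 108" "w \<le> 1.5 + n / 12" "w > 2 \<Longrightarrow> n \<ge> 18"
proof -
  have b: "real (2 * 3 ^ card (prime_factors n)) \<le> real (3 * n)" using prime_factors_card[OF n] by (rule of_nat_mono)
  have 1: "162 * real k - 567 \<le> 3 ^ k" for k :: nat
  proof (cases "k \<le> 4")
    case True
    then have "k \<in> {0,1,2,3,4}" by auto
    then show ?thesis by auto
  next
    case False
    then obtain j where k: "k = 5 + j" using le_Suc_ex[of 5 k] by auto
    have "1 + real j * 2 \<le> 3 ^ j" using Bernoulli_inequality[of "2::real" j] by simp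
    then show ?thesis unfolding k power_add by simp
  qed
  have 2: "18 * real k - 27 \<le> 3 ^ k" for k :: nat
  proof (cases "k \<le> 2")
    case True
    then have "k \<in> {0,1,2}" by auto
    then show ?thesis by auto
  next
    case False
    then obtain j where k: "k = 3 + j" using le_Suc_ex[of 3 k] by auto
    have "1 + real j * 2 \<le> 3 ^ j" using Bernoulli_inequality[of "2::real" j] by simp
    then show ?thesis unfolding k power_add by simp
  qed
  show "w \<le> 3.5 + n / 108" "w \<le> 1.5 + n / 12"
    using 1[of "card (prime_factors n)"] 2[of "card (prime_factors n)"] b by (simp_all add: w_def field_simps)
  assume "w > 2"
  then have "(3::nat) ^ 3 \<le> 3 ^ card (prime_factors n)" by (intro power_increasing) (auto simp: w_def)
  then show "n \<ge> 18" using prime_factors_card[OF n] by simp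
qed

lemma conjugate_le:
  fixes x :: real assumes "0 \<le> x" "x \<le> a" "a \<le> 1/2" shows "x * (1 - x) \<le> a * (1 - a)"
proof -
  have "0 \<le> (a - x) * (1 - a - x)" using assms by (intro mult_nonneg_nonneg) auto
  then show ?thesis by (simp add: algebra_simps)
qed

text \<open>Rational approximations of \<open>x\<close> with denominator at most 4 give a multiple of small correction term.\<close>

lemma interval_bound:
  fixes h c N x :: real
  assumes c: "c > 0" and N: "0 \<le> N" "N \<le> 10 * c" and x: "0 \<le> x" "x \<le> 1/2"
    and h1: "h \<ge> c - N * (x * (1 - x)) / 2"
    and h2: "4 * h \<ge> c - N * ((2 * x) * (1 - 2 * x)) / 2"
    and h3: "x \<ge> 1/4 \<Longrightarrow> 9 * h \<ge> c - N * (\<bar>3 * x - 1\<bar> * (1 - \<bar>3 * x - 1\<bar>)) / 2"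
    and h4: "x \<ge> 1/4 \<Longrightarrow> 16 * h \<ge> c - N * (\<bar>4 * x - 1\<bar> * (1 - \<bar>4 * x - 1\<bar>)) / 2"
  shows "120 * h \<ge> 21.25 * c - 1.875 * N"
proof -
  have mN: "N * y \<le> N * b" if "y \<le> b" for y b using N that by (intro mult_left_mono) auto
  \<comment> \<open>P, 4P, 3P and 2P have small corrections near x = 0, 1/4, 1/3 and 1/2
    respectively.\<close>
  consider "x \<le> 0.26" | "0.26 \<le> x" "x \<le> 0.2812" | "0.2812 \<le> x" "x \<le> 0.3855" | "0.3855 \<le> x" by linarith
  then show ?thesis
  proof cases
    case 1
    have "N * (x * (1 - x)) \<le> N * (0.26 * (1 - 0.26))" using x 1 by (intro mN conjugate_le) auto
    then show ?thesis using h1 N c by simp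
  next
    case 2
    define u w where "u = N * (\<bar>4 * x - 1\<bar> * (1 - \<bar>4 * x - 1\<bar>))" and "w = N * (x * (1 - x))"
    have "\<bar>4 * x - 1\<bar> * (1 - \<bar>4 * x - 1\<bar>) \<le> 0.1248 * (1 - 0.1248)" using 2 by (intro conjugate_le) auto
    then have "u \<le> N * (11/100)" unfolding u_def by (intro mN) simp
    moreover have "x * (1 - x) \<le> 0.2812 * (1 - 0.2812)" using x 2 by (intro conjugate_le) auto
    then have "w \<le> N * (203/1000)" unfolding w_def by (intro mN) simp
    moreover have "16 * h \<ge> c - u / 2" "h \<ge> c - w / 2" using h1 h4 2 by (auto simp: u_def w_def)
    \<comment> \<open>For smaller N the bound from P is enough, for N close to \<open>10 * c\<close>
      the one from 4P.\<close>
    ultimately show ?thesis using N c by (cases "N \<le> 9.5 * c") simp_all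
  next
    case 3
    define u w where "u = N * (\<bar>3 * x - 1\<bar> * (1 - \<bar>3 * x - 1\<bar>))" and "w = N * (x * (1 - x))"
    have "\<bar>3 * x - 1\<bar> * (1 - \<bar>3 * x - 1\<bar>) \<le> 0.1565 * (1 - 0.1565)" using 3 by (intro conjugate_le) (auto simp: abs_if)
    then have "u \<le> N * (1321/10000)" unfolding u_def by (intro mN) simp
    moreover have "x * (1 - x) \<le> 0.3855 * (1 - 0.3855)" using x 3 by (intro conjugate_le) auto
    then have "w \<le> N * (237/1000)" unfolding w_def by (intro mN) simp
    moreover have "9 * h \<ge> c - u / 2" "h \<ge> c - w / 2" using h1 h3 3 by (auto simp: u_def w_def)
    ultimately show ?thesis using N c by (cases "N \<le> 8 * c") simp_all
  next
    case 4
    have "(1 - 2 * x) * (1 - (1 - 2 * x)) \<le> 0.229 * (1 - 0.229)" using x 4 by (intro conjugate_le) auto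
    then have "N * ((2 * x) * (1 - 2 * x)) \<le> N * (0.229 * (1 - 0.229))" by (intro mN) (simp add: mult.commute)
    then show ?thesis using h2 N c by simp
  qed
qed

text \<open>For n = 12 the factor \<open>n^2 (1 - 1/4 - 1/9) = 92\<close> is too small for the
  general argument. Contact of 12P at infinity puts 12P on the identity component, so x is a
  multiple of 1/12 and seven values remain.\<close>

lemma interval_bound_12:
  fixes h c N x :: real and k :: nat
  assumes c: "c > 0" and N: "0 \<le> N" "N \<le> 10 * c" and x: "12 * x = k" "k \<le> 6"
    and h1: "h \<ge> c - N * (x * (1 - x)) / 2"
    and h2: "4 * h \<ge> c - N * ((2 * x) * (1 - 2 * x)) / 2"
    and h3: "x \<ge> 1/4 \<Longrightarrow> 9 * h \<ge> c - N * (\<bar>3 * x - 1\<bar> * (1 - \<bar>3 * x - 1\<bar>)) / 2"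
  shows "92 * h > 20 * c - 3 - 1.75 * N"
proof -
  have xk: "x = real k / 12" using x by simp
  have "k \<in> {0,1,2,3,4,5,6}" using x by auto
  then consider "k \<in> {0,1,2,3}" | "k = 4" | "k \<in> {5,6}" by auto
  then show ?thesis
  proof cases
    case 1 then show ?thesis using h1 N c unfolding xk by auto
  next
    case 2 then show ?thesis using h1 h3 N c unfolding xk by (cases "N \<le> 7 * c") auto
  next
    case 3 then show ?thesis using h2 N c unfolding xk by auto
  qed
qed

lemma fr_int: assumes "N > 0" shows "fr (real N) (of_int z) = of_int (z mod int N)"
proof (rule fr_unique)
  show "real_of_int z = real N * of_int (z div int N) + of_int (z mod int N)"
    by (metis mult_div_mod_eq of_int_add of_int_mult of_int_of_nat_eq)
  have "z mod int N < int N" using assms by simp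
  then show "real_of_int (z mod int N) < real N" by linarith
qed (use assms in auto)

lemma dst_minus: assumes "N > 0" shows "dst N (- t) = dst N t"
proof -
  obtain k :: int where k: "t = N * of_int k + dst N t \<or> t = N * of_int k - dst N t"
    using dst_decomp[OF assms] by blast
  have "dst N (- t) = min (dst N t) (N - dst N t)"
    by (rule dst_eqI[OF assms, of _ "- k"]) (use k dst_bounds[OF assms, of t] assms in auto)
  then show ?thesis using dst_bounds[OF assms, of t] by simp
qed

context place_seq
begin

lemma multiples: assumes "c \<ge> 1" shows "place_seq v A B (\<lambda>j. X (c * j)) (\<lambda>j. Y (c * j))"
proof -
  have "ec_seq A B (\<lambda>j. X (c * j)) (\<lambda>j. Y (c * j))"
  proof
    fix m n :: nat
    assume n: "n \<ge> 1"
    have cn: "c * n \<ge> 1" using n assms by (simp add: Suc_le_eq)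
    show "(Y (c * n))\<^sup>2 = X (c * n) ^ 3 + A * X (c * n) + B" by (rule curve[OF cn])
    show "Y (c * n) \<noteq> 0" by (rule Y_ne_0[OF cn])
    show "X (c * (2 * n)) * (4 * (Y (c * n))\<^sup>2) = ((X (c * n))\<^sup>2 - A)\<^sup>2 - 8 * B * X (c * n)"
      using X_double[OF cn] by (simp add: mult.left_commute)
    { assume "m \<ge> 1" "m \<noteq> n"
      then show "X (c * m) \<noteq> X (c * n)" using assms n by (intro X_inj) (auto simp: Suc_le_eq) }
    assume "m > n"
    then have cm: "c * m > c * n" using assms by simp
    show "(X (c * (m + n)) + X (c * (m - n))) * (X (c * m) - X (c * n))\<^sup>2
        = 2 * ((X (c * m) * X (c * n) + A) * (X (c * m) + X (c * n)) + 2 * B)"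
      using X_add[OF cn cm] by (simp add: distrib_left diff_mult_distrib2)
    show "X (c * (m + n)) * X (c * (m - n)) * (X (c * m) - X (c * n))\<^sup>2
        = (X (c * m) * X (c * n) - A)\<^sup>2 - 4 * B * (X (c * m) + X (c * n))"
      using X_mult[OF cn cm] by (simp add: distrib_left diff_mult_distrib2)
  qed
  then show ?thesis
    by (intro place_seq.intro place_seq_axioms.intro place_axioms mu0 mu1)
qed

text \<open>x is the position of the component of P on a circle of length 1, folded to
  [0, 1/2].\<close>

lemma corr_small:
  assumes N: "NN > 0" defines "x \<equiv> K (X 1) / NN"
  shows "0 \<le> x" "x \<le> 1/2"
    "corr (X 1) = NN * (x * (1 - x)) / 2"
    "corr (X 2) = NN * ((2 * x) * (1 - 2 * x)) / 2"
    "x \<ge> 1/4 \<Longrightarrow> corr (X 3) = NN * (\<bar>3 * x - 1\<bar> * (1 - \<bar>3 * x - 1\<bar>)) / 2"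
    "x \<ge> 1/4 \<Longrightarrow> corr (X 4) = NN * (\<bar>4 * x - 1\<bar> * (1 - \<bar>4 * x - 1\<bar>)) / 2"
proof -
  show x: "0 \<le> x" "x \<le> 1/2" using K_bounds[of "X 1"] N by (auto simp: x_def field_simps)
  have K1: "K (X 1) = NN * x" using N by (simp add: x_def)
  have C: "corr (X n) = NN * (y * (1 - y)) / 2"
    if n: "n \<ge> 1" and y: "0 \<le> y" "y \<le> 1" and k: "real n * x = of_int k + y \<or> real n * x = of_int k - y" for n k y
  proof -
    have "real n * K (X 1) = NN * (real n * x)" unfolding K1 by (rule mult.left_commute)
    then have t: "real n * K (X 1) = NN * of_int k + NN * y \<or> real n * K (X 1) = NN * of_int k - NN * y"
      using k by (metis distrib_left right_diff_distrib)
    have b: "0 \<le> NN * y" "NN * y \<le> NN" using N y mult_left_mono[of y 1 NN] by auto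
    have "K (X n) = min (NN * y) (NN - NN * y)" using K_seq[OF N n] dst_eqI[OF N t b] by (rule trans)
    then have "K (X n) = NN * y \<or> K (X n) = NN - NN * y" by linarith
    then have "K (X n) * (NN - K (X n)) = NN * y * (NN - NN * y)" by algebra
    also have "\<dots> = (2 * NN) * (NN * (y * (1 - y)) / 2)" by (simp add: algebra_simps)
    finally show ?thesis unfolding corr_def using N by simp
  qed
  show "corr (X 1) = NN * (x * (1 - x)) / 2" by (rule C[of 1 x 0]) (use x in simp_all)
  show "corr (X 2) = NN * ((2 * x) * (1 - 2 * x)) / 2" by (rule C[of 2 "2 * x" 0]) (use x in simp_all)
  show "corr (X 3) = NN * (\<bar>3 * x - 1\<bar> * (1 - \<bar>3 * x - 1\<bar>)) / 2" if "x \<ge> 1/4"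
    by (rule C[of 3 _ 1]) (use x that in \<open>auto simp: abs_if\<close>)
  show "corr (X 4) = NN * (\<bar>4 * x - 1\<bar> * (1 - \<bar>4 * x - 1\<bar>)) / 2" if "x \<ge> 1/4"
    by (rule C[of 4 _ 1]) (use x that in \<open>auto simp: abs_if\<close>)
qed

text \<open>Arranged for summation over the places: \<open>mu + NN / 12\<close> sums to
  \<open>chi\<close>, \<open>12 * mu + NN\<close> to \<open>12 * chi\<close>, and s to at most
  \<open>10 * chi\<close> by Szpiro, which leaves \<open>35/36 * chi\<close>. Steps of 6 remove
  potentially good places, I_N^* costs at most 1/2, and multiplicative fibres are averaged by
  \<open>negative_type\<close>.\<close>

lemma pairs_eps:
  defines "s \<equiv> (if NN > 0 then 10 * mu + NN - 1 else 0)"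
  shows "(\<Sum>i<M. \<Sum>j<M. if i = j then 0 else eps (X (6 * nat \<bar>int i - int j\<bar>)))
    \<le> real M ^ 2 * ((mu + NN / 12) - 11/432 * (12 * mu + NN) + s / 36)"
proof -
  have pos: "nat \<bar>int i - int j\<bar> \<ge> 1" if "i \<noteq> j" for i j :: nat using that by linarith
  consider "NN = 0" | "NN > 0" "mu > 0" | "NN > 0" "mu = 0" using NN_nonneg mu0 by linarith
  then show ?thesis
  proof cases
    case 1
    then have "(\<Sum>i<M. \<Sum>j<M. if i = j then 0 else eps (X (6 * nat \<bar>int i - int j\<bar>))) = 0"
      using eps_6[OF 1 pos] by (intro sum.neutral ballI) auto
    moreover have "0 \<le> real M ^ 2 * (mu - 11/36 * mu)" using mu0 by (intro mult_nonneg_nonneg) auto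
    ultimately show ?thesis using 1 by (simp add: s_def)
  next
    case 2
    have m: "mu = 1/2" by (rule mu_half[OF 2])
    obtain i where "NN = of_int i" using NN_int by (elim Ints_cases)
    then have N1: "NN \<ge> 1" using 2 by simp
    have "eps (X (6 * nat \<bar>int i - int j\<bar>)) \<le> 1/2" if "i \<noteq> j" for i j :: nat
    proof -
      have "K (X (2 * (3 * nat \<bar>int i - int j\<bar>))) = 0" by (rule K_double_zero[OF 2]) (use pos[OF that] in simp)
      then have "corr (X (6 * nat \<bar>int i - int j\<bar>)) = 0" by (simp add: corr_def mult.assoc[symmetric])
      then show ?thesis using eps_bounds(2)[of "X (6 * nat \<bar>int i - int j\<bar>)"] m by simp
    qed
    then have "(\<Sum>i<M. \<Sum>j<M. if i = j then 0 else eps (X (6 * nat \<bar>int i - int j\<bar>))) \<le> (\<Sum>i<M. \<Sum>j<M. 1/2)"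
      by (intro sum_mono) auto
    also have "\<dots> = real M ^ 2 * (1/2)" by (simp add: power2_eq_square)
    also have "\<dots> \<le> real M ^ 2 * ((mu + NN / 12) - 11/432 * (12 * mu + NN) + s / 36)"
    proof (rule mult_left_mono)
      have "s = 4 + NN" using 2 by (simp add: s_def m)
      then show "1/2 \<le> (mu + NN / 12) - 11/432 * (12 * mu + NN) + s / 36" using N1 unfolding m by (simp add: field_simps)
    qed simp
    finally show ?thesis .
  next
    case 3
    obtain Ni where Ni: "NN = of_int Ni" using NN_int by (elim Ints_cases)
    define N where "N = nat Ni"
    have N: "NN = real N" "N > 0" using Ni 3 by (auto simp: N_def)
    obtain k where k: "K (X 1) = of_int k" using K_int[OF 3, of 1] by (auto elim: Ints_cases)
    define t where "t i = 6 * int i * k" for i :: nat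
    have c: "eps (X (6 * nat \<bar>int i - int j\<bar>)) \<le>
        real_of_int ((t i - t j) mod int N) * (N - real_of_int ((t i - t j) mod int N)) / N / 2" if "i \<noteq> j" for i j :: nat
    proof -
      define d where "d = 6 * nat \<bar>int i - int j\<bar>"
      have d: "d \<ge> 1" using pos[OF that] by (simp add: d_def)
      have sg: "real d * K (X 1) = of_int (t i - t j) \<or> real d * K (X 1) = - of_int (t i - t j)"
      proof (cases "i \<ge> j")
        case True
        then have rd: "real d = 6 * (real i - real j)" by (simp add: d_def of_nat_diff)
        show ?thesis unfolding k t_def rd by (simp add: algebra_simps)
      next
        case False
        then have rd: "real d = 6 * (real j - real i)" by (simp add: d_def of_nat_diff)
        show ?thesis unfolding k t_def rd by (simp add: algebra_simps)
      qed
      then have "dst NN (real d * K (X 1)) = dst NN (of_int (t i - t j))" using dst_minus[OF 3(1)] by metis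
      then have "K (X d) = dst NN (of_int (t i - t j))" using K_seq[OF 3(1) d] by simp
      then have "corr (X d) = fr NN (of_int (t i - t j)) * (NN - fr NN (of_int (t i - t j))) / (2 * NN)"
        unfolding corr_def using dst_mult_fr[of NN] by simp
      then show ?thesis
        using eps_bounds(2)[of "X d"] 3(2) unfolding d_def[symmetric] N(1) fr_int[OF N(2)] by simp
    qed
    have "(\<Sum>i<M. \<Sum>j<M. if i = j then 0 else eps (X (6 * nat \<bar>int i - int j\<bar>)))
      \<le> (\<Sum>i<M. \<Sum>j<M. real_of_int ((t i - t j) mod int N) * (N - real_of_int ((t i - t j) mod int N)) / N / 2)"
      using c by (intro sum_mono) auto
    also have "\<dots> = (\<Sum>i<M. \<Sum>j<M. real_of_int ((t i - t j) mod int N) * (N - real_of_int ((t i - t j) mod int N)) / N) / 2"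
      by (simp only: sum_divide_distrib)
    also have "\<dots> \<le> real M ^ 2 * (real N - 1 / N) / 6 / 2"
      using negative_type[OF N(2), of t M] by (rule divide_right_mono) simp
    also have "\<dots> = real M ^ 2 * ((real N - 1 / N) / 12)" by simp
    also have "\<dots> \<le> real M ^ 2 * ((mu + NN / 12) - 11/432 * (12 * mu + NN) + s / 36)"
    proof (rule mult_left_mono)
      define q where "q = 1 / real N"
      have q: "real N * q = 1" "q \<ge> 0" using N(2) by (auto simp: q_def)
      \<comment> \<open>\<open>1 / N\<close> is linearised at N = 6, which produces the constants
        11/432 and 1/36.\<close>
      have "0 \<le> (real N - 6)^2 * q" using q by simp
      also have "\<dots> = real N - 12 + 36 * q" using q(1) by algebra
      finally have "12 \<le> real N + 36 * q" by simp
      moreover have "s = real N - 1" using 3 N by (simp add: s_def)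
      ultimately show "(real N - 1 / N) / 12 \<le> (mu + NN / 12) - 11/432 * (12 * mu + NN) + s / 36"
        unfolding q_def[symmetric] 3(2) N(1) by (simp add: field_simps)
    qed simp
    finally show ?thesis .
  qed
qed

text \<open>The definition of good reduction allows any scaling u, but two minimal equations at v
  differ by a unit.\<close>

lemma minimal_unit:
  assumes u: "u \<noteq> 0" and "vge 0 (A / u^4)" "vge 0 (B / u^6)" "\<not> (vge 4 (A / u^4) \<and> vge 6 (B / u^6))"
  shows "v u = 0"
proof -
  have vu: "veq (4 * v u) (u^4)" "veq (6 * v u) (u^6)" using u v_power[OF u] by (auto simp: veq_def)
  obtain k :: int where k: "v u = of_int k" using v_int_ex[OF u] by blast
  consider "k \<ge> 1" | "k \<le> -1" | "k = 0" by linarith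
  then show ?thesis
  proof cases
    case 1
    have "vge (0 + 4 * v u) (A / u^4 * u^4)" "vge (0 + 6 * v u) (B / u^6 * u^6)"
      using vge_mult[OF assms(2) veq_vge[OF vu(1)]] vge_mult[OF assms(3) veq_vge[OF vu(2)]] by auto
    then have "vge (4 * v u) A" "vge (6 * v u) B" using u by auto
    moreover have "v u \<ge> 1" using 1 k by simp
    ultimately show ?thesis using v_or mu1 by (auto simp: vge_def veq_def)
  next
    case 2
    have "vge (4 * mu - 4 * v u) (A / u^4)" "vge (6 * mu - 6 * v u) (B / u^6)"
      by (rule vge_divide[OF vA vu(1)], rule vge_divide[OF vB vu(2)])
    moreover have "v u \<le> -1" using 2 k by simp
    ultimately have "vge 4 (A / u^4)" "vge 6 (B / u^6)" using mu0 by (auto simp: vge_def)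
    then show ?thesis using assms by blast
  qed (use k in simp)
qed

lemma nonsing_scale:
  assumes u: "u \<noteq> 0" "v u = 0"
    and ns: "\<not> vge 0 (x / u^2) \<or> \<not> (vgt 0 (y / u^3) \<and> vgt 0 (3 * (x / u^2)^2 + A / u^4))"
  shows "nonsing x y"
proof -
  have vu: "veq 0 (u^k)" for k using u v_power[OF u(1)] by (auto simp: veq_def)
  have 1: "vge 0 x \<Longrightarrow> vge 0 (x / u^2)" using vge_divide[OF _ vu[of 2], of 0 x] by simp
  have 2: "vgt 0 z \<Longrightarrow> vgt 0 (z / u^k)" for z k using vgt_divide[OF _ vu[of k], of 0 z] by simp
  have "3 * (x / u^2)^2 + A / u^4 = (3 * x^2 + A) / u^4" using u by (simp add: field_simps)
  then show ?thesis using ns 1 2[of y 3] 2[of "3 * x^2 + A" 4] unfolding nonsing_def by auto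
qed

end

lemma sum_square_differences:
  "(\<Sum>i<n. \<Sum>j<n. (real i - real j) ^ 2) = real n ^ 2 * (real n ^ 2 - 1) / 6"
proof -
  have 1: "(\<Sum>j<n. (x - real j) ^ 2) = n * x^2 - n * (real n - 1) * x + n * (real n - 1) * (2 * real n - 1) / 6" for x n
    by (induction n) (simp_all add: power2_eq_square field_simps)
  have 2: "(\<Sum>i<m. b * (real i)^2 - c * real i + d) = b * (m * (real m - 1) * (2 * real m - 1)) / 6 - c * (m * (real m - 1)) / 2 + m * d"
    for b c d m by (induction m) (simp_all add: power2_eq_square field_simps)
  show ?thesis unfolding 1 2 by (simp add: power2_eq_square field_simps)
qed

section \<open>Reduction types from the j-invariant and from good reduction\<close>

context ec_global
begin

lemma j_val: assumes pl: "isplace pl" and N: "NP pl > 0"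
  shows "j_inv A B \<noteq> 0" "val pl (j_inv A B) = - NP pl"
proof -
  interpret place "val pl" "AA pl" "BB pl" by (rule place[OF pl])
  have e: "j_inv A B = 1728 * (4 * AA pl ^ 3) / (4 * AA pl ^ 3 + 27 * BB pl ^ 2)"
  proof -
    define D where "D = 4 * polyK A ^ 3 + 27 * polyK B ^ 2"
    have "polyK (4 * A ^ 3 + 27 * B ^ 2) = D" using Disc_scaled[of "Some 0"] by (simp add: D_def uu_def)
    then have "4 * AA pl ^ 3 + 27 * BB pl ^ 2 = D / uu pl ^ 12" unfolding Disc_scaled by simp
    moreover have "AA pl ^ 3 = polyK A ^ 3 / uu pl ^ 12" by (simp add: AA_def power_divide flip: power_mult)
    ultimately show ?thesis unfolding j_inv_def D_def[symmetric] using uu_nz[of pl] by simp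
  qed
  have a: "AA pl \<noteq> 0" by (rule A_nz[OF N])
  then show "j_inv A B \<noteq> 0" unfolding e using disc_nz by simp
  have va: "veq (4 * mu) (AA pl)" by (rule NN_pos_eq(1)[OF N])
  have "veq (0 + (0 + 3 * (4 * mu)) - (12 * mu + NN)) (1728 * (4 * AA pl ^ 3) / Disc)"
    by (intro veq_divide veq_mult vDisc) (use va v_power[OF a, of 3] in \<open>auto simp: veq_def\<close>)
  then show "val pl (j_inv A B) = - NN" unfolding e by (simp add: veq_def)
qed

lemma polynomial_j_NN: assumes "polynomial_j A B" "prime p" shows "NP (Some p) = 0"
proof (rule ccontr)
  assume "NP (Some p) \<noteq> 0"
  then have N: "NP (Some p) > 0" using place.NN_nonneg[OF place[of "Some p"]] assms by simp
  obtain f where f: "j_inv A B = polyK f" using assms by (auto simp: polynomial_j_def)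
  have p: "isplace (Some p)" using assms by simp
  have "f \<noteq> 0" using j_val(1)[OF p N] f by auto
  then have "val (Some p) (j_inv A B) \<ge> 0" using f vfin_poly[OF assms(2)] by (simp add: val_def)
  then show False using j_val(2)[OF p N] N by simp
qed

lemma isotrivial_NN: assumes i: "isotrivial A B" and pl: "isplace pl" shows "NP pl = 0"
proof (cases pl)
  case (Some p)
  have "polynomial_j A B" using i by (auto simp: isotrivial_def polynomial_j_def)
  then show ?thesis using polynomial_j_NN Some pl by simp
next
  case None
  obtain c where c: "j_inv A B = polyK [:c:]" using i by (auto simp: isotrivial_def)
  show ?thesis
  proof (rule ccontr)
    assume "NP pl \<noteq> 0"
    then have N: "NP pl > 0" using place.NN_nonneg[OF place[OF pl]] by simp
    have "c \<noteq> 0" using j_val(1)[OF pl N] c by auto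
    then have "val pl (j_inv A B) = 0" using c vinf_poly[of "[:c:]"] None by (simp add: val_def)
    then show False using j_val(2)[OF pl N] N by simp
  qed
qed

text \<open>The equation in the definition of good reduction and the one at the place are both
  minimal, so the quotient of the scalings is a unit and nonsingularity carries over;
  \<open>good_multiples\<close> passes to nP.\<close>

lemma good_reduction_place:
  assumes pl: "isplace pl" and w: "val pl = (\<lambda>z. real_of_int (w z))"
    and g: "good_reduction_at w (polyK A) (polyK B) P" and n: "n \<ge> 1"
  shows "nsP pl n" "epsP pl n = 0"
proof -
  interpret place_seq "val pl" "AA pl" "BB pl" "XX pl" "YY pl" by (rule PS[OF pl])
  have ge: "val_ge w k z \<longleftrightarrow> vge (of_int k) z" for k z by (simp add: val_ge_def vge_def fun_cong[OF w])
  have gt: "val_ge w 1 z \<longleftrightarrow> vgt 0 z" for z by (auto simp: val_ge_def vgt_def fun_cong[OF w])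
  obtain u where u: "u \<noteq> 0" and m: "minimal_at w (polyK A / u ^ 4) (polyK B / u ^ 6)"
    and ns: "nonsing_reduction w (polyK A / u ^ 4) (map_option (\<lambda>(x, y). (x / u ^ 2, y / u ^ 3)) P)"
    using g unfolding good_reduction_at_def by blast
  define r where "r = u / uu pl"
  have r: "r \<noteq> 0" "u = r * uu pl" using u uu_nz[of pl] by (auto simp: r_def)
  have e: "polyK A / u ^ 4 = AA pl / r ^ 4" "polyK B / u ^ 6 = BB pl / r ^ 6"
    "X 1 / u ^ 2 = XX pl 1 / r ^ 2" "Y 1 / u ^ 3 = YY pl 1 / r ^ 3"
    unfolding r(2) by (simp_all add: AA_def BB_def XX_def YY_def power_mult_distrib)
  have vr: "val pl r = 0"
    by (rule minimal_unit[OF r(1)]) (use m in \<open>auto simp: minimal_at_def ge e\<close>)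
  have "map_option (\<lambda>(x, y). (x / u ^ 2, y / u ^ 3)) P = Some (X 1 / u ^ 2, Y 1 / u ^ 3)"
    using arg_cong[OF P_eq, of "map_option (\<lambda>(x, y). (x / u ^ 2, y / u ^ 3))"] by (simp only: option.map prod.case)
  from ns[unfolded this e nonsing_reduction_def option.case prod.case gt, unfolded ge]
  have "nonsing (XX pl 1) (YY pl 1)" by (intro nonsing_scale[OF r(1) vr]) (auto simp flip: times_divide_eq_right)
  then have "good (XX pl 1)" by (intro nonsing_good) auto
  then have "good (XX pl n)" by (rule good_multiples[OF _ n])
  then show "epsP pl n = 0" "nsP pl n" using good_eps good_nonsing[OF n] by (auto simp: nsP_def)
qed

lemma good_finite:
  assumes g: "good_reduction_finite A B P" and p: "prime p" and n: "n \<ge> 1"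
  shows "nsP (Some p) n" "epsP (Some p) n = 0"
proof -
  have "good_reduction_at (vfin p) (polyK A) (polyK B) P"
    using g p unfolding good_reduction_finite_def prime_rat_poly_iff by blast
  moreover have "val (Some p) = (\<lambda>z. real_of_int (vfin p z))" by (rule ext) (simp add: val_def)
  moreover have "isplace (Some p)" using p by simp
  ultimately show "nsP (Some p) n" "epsP (Some p) n = 0" using good_reduction_place n by blast+
qed

lemma good_infinite:
  assumes g: "good_reduction_at vinf (polyK A) (polyK B) P" and n: "n \<ge> 1"
  shows "epsP None n = 0"
proof -
  have "val None = (\<lambda>z. real_of_int (vinf z))" by (rule ext) (simp add: val_def)
  from good_reduction_place(2)[OF isplace_None this g n] show ?thesis .
qed

end

section \<open>Height bounds and the five estimates\<close>

context ec_support
begin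

lemma mu_NP: "isplace pl \<Longrightarrow> 0 \<le> muP pl" "isplace pl \<Longrightarrow> muP pl < 1" "isplace pl \<Longrightarrow> 0 \<le> NP pl"
  using place_seq.mu0[OF PS] place_seq.mu1[OF PS] place.NN_nonneg[OF place] by auto

lemma eps_le: "isplace pl \<Longrightarrow> epsP pl n \<le> muP pl + NP pl / 8" by (rule place_seq.eps_le[OF PS])
lemma tot_mu: "12 * tot muP + tot NP = 12 * chi" using tot_Disc unfolding tot_add tot_cmult .

text \<open>\<open>mu + NN / 8\<close> is a twelfth of the valuation of the discriminant plus
  \<open>NN / 24\<close>.\<close>

lemma E_le: "E n \<le> chi + tot NP / 24"
proof -
  have "E n \<le> tot (\<lambda>pl. muP pl + (1/8) * NP pl)" unfolding E_def by (rule tot_mono) (use eps_le in simp)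
  then show ?thesis using tot_mu unfolding tot_add tot_cmult by linarith
qed

lemma tot_only_None: assumes "\<And>p. prime p \<Longrightarrow> f (Some p) = 0" shows "tot f = f None"
proof -
  have "tot f = tot (\<lambda>pl. if pl = None then f None else 0)"
  proof (rule tot_cong)
    fix pl assume "isplace pl"
    then show "f pl = (if pl = None then f None else 0)" using assms by (cases pl) auto
  qed
  then show ?thesis unfolding tot_None .
qed

lemma E_None: assumes "\<And>p. prime p \<Longrightarrow> epsP (Some p) n = 0" shows "E n = epsP None n"
  unfolding E_def by (rule tot_only_None) (rule assms)

abbreviation "om n \<equiv> real (card (prime_factors n))"

lemma no_primitive_le:
  assumes np: "\<not> has_primitive_divisor A P n" and n: "n \<ge> 1" "n \<le> L" and e: "\<And>m. m \<ge> 1 \<Longrightarrow> E m - chi \<le> e"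
  shows "real n ^ 2 * (1 - (\<Sum>q\<in>prime_factors n. 1 / real q ^ 2)) * h \<le> chi + betaP None n + om n * e"
    and "h \<ge> 0 \<Longrightarrow> real n ^ 2 / 2 * h \<le> chi + betaP None n + om n * e"
proof -
  have "(\<Sum>q\<in>prime_factors n. E (n div q) - chi) \<le> (\<Sum>q\<in>prime_factors n. e)"
  proof (rule sum_mono, rule e)
    fix q assume "q \<in> prime_factors n"
    then have "prime q" "q dvd n" by (auto simp: in_prime_factors_iff)
    then show "n div q \<ge> 1" using n dvd_imp_le[of q n] prime_gt_0_nat[of q]
      by (auto simp: Suc_le_eq div_greater_zero_iff)
  qed
  then show *: "real n ^ 2 * (1 - (\<Sum>q\<in>prime_factors n. 1 / real q ^ 2)) * h \<le> chi + betaP None n + om n * e"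
    using no_primitive[OF np n] E_nonneg[of n] by simp
  assume h: "h \<ge> 0"
  have "real n ^ 2 * (1/2) * h \<le> real n ^ 2 * (1 - (\<Sum>q\<in>prime_factors n. 1 / real q ^ 2)) * h"
    using sum_prime_squares[of n] h by (intro mult_right_mono mult_left_mono) auto
  then show "real n ^ 2 / 2 * h \<le> chi + betaP None n + om n * e" using * by simp
qed

lemma chi1: "real chi \<ge> 1" using chi_pos by simp

text \<open>Without control of the finite reductions, the poles of M may use the whole finite
  discriminant: \<open>21 * chi + 12 * chi\<close>, less the part at infinity.\<close>

lemma contact_crude:
  assumes n: "n \<ge> 1"
  shows "betaP None n \<le> 33 * chi" "NP None > 0 \<Longrightarrow> betaP None n \<le> 33 * chi - 3 * NP None"
proof -
  define D where "D = (\<Sum>pl\<in>T - {None}. wt pl * (12 * muP pl + NP pl))"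
  have D: "12 * muP None + NP None + D = 12 * chi" using tot_Disc unfolding tot_split D_def .
  note m = mu_NP[OF isplace_None]
  have N: "NP None > 0 \<Longrightarrow> NP None \<le> 10 * real chi" using J_inf_mult(3) m(1) by fastforce
  show 2: "NP None > 0 \<Longrightarrow> betaP None n \<le> 33 * chi - 3 * NP None"
    using contact_bound(1)[OF n _ _ D_def] N D m(1) by (cases "betaP None n > 0") fastforce+
  have "NP None = 0 \<Longrightarrow> betaP None n \<le> 33 * chi"
    using contact_bound(2)[OF n _ _ D_def] D m(1) chi1 by (cases "betaP None n > 0") fastforce+
  then show "betaP None n \<le> 33 * chi" using 2 m(3) by fastforce
qed

text \<open>Sum \<open>height_ge\<close> over the differences of 72 multiples of 6P: the main terms
  give \<open>72 * 71 * chi\<close>, the corrections at most \<open>35/36 * 72^2 * chi\<close>, and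
  \<open>72 * chi\<close> remains. A positive remainder needs more than 36 multiples. The largest
  index is \<open>6 * 71 = 426\<close>, and 161212032 is
  \<open>36 * 72^2 * (72^2 - 1) / 6\<close>.\<close>

lemma height_lower: assumes L: "426 \<le> L" shows "72 * real chi \<le> 161212032 * h"
proof -
  define s where "s pl = (if NP pl > 0 then 10 * muP pl + NP pl - 1 else 0)" for pl
  define d where "d i j = 6 * nat \<bar>int i - int j\<bar>" for i j :: nat
  have "(\<Sum>i<72. \<Sum>j<72. if i = j then 0 else E (d i j)) = tot (\<lambda>pl. \<Sum>i<72. \<Sum>j<72. if i = j then 0 else epsP pl (d i j))"
  proof -
    have "(if i = j then 0 else E (d i j)) = tot (\<lambda>pl. if i = j then 0 else epsP pl (d i j))" for i j
      by (simp add: E_def tot_def)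
    then show ?thesis unfolding tot_def by (simp add: sum_distrib_left sum.swap[of _ _ T])
  qed
  also have "\<dots> \<le> tot (\<lambda>pl. real 72 ^ 2 * ((muP pl + NP pl / 12) - 11/432 * (12 * muP pl + NP pl) + s pl / 36))"
    by (rule tot_mono) (unfold d_def s_def, rule place_seq.pairs_eps[OF PS])
  also have "\<dots> = 5184 * (25/36 * tot muP + 25/432 * tot NP + 1/36 * tot s)"
    unfolding tot_cmult[symmetric] tot_add[symmetric] by (rule tot_cong) (simp add: algebra_simps)
  also have "\<dots> \<le> 5040 * real chi" using tot_mu szpiro[folded s_def] by simp
  finally have E: "(\<Sum>i<72. \<Sum>j<72. if i = j then 0 else E (d i j)) \<le> 5040 * real chi" .
  have "(\<Sum>i<72::nat. \<Sum>j<72::nat. if i = j then 0 else real chi - E (d i j)) \<le> (\<Sum>i<72. \<Sum>j<72. 36 * (real i - real j) ^ 2 * h)"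
  proof (intro sum_mono)
    fix i j :: nat assume ij: "i \<in> {..<72}" "j \<in> {..<72}"
    show "(if i = j then 0 else real chi - E (d i j)) \<le> 36 * (real i - real j) ^ 2 * h"
    proof (cases "i = j")
      case False
      then have "d i j \<ge> 1" "d i j \<le> L" using ij L by (auto simp: d_def)
      then have "real chi - E (d i j) \<le> real (d i j) ^ 2 * h" by (rule height_ge)
      moreover have "real (d i j) ^ 2 = 36 * (real i - real j) ^ 2"
        by (cases "i \<ge> j") (auto simp: d_def of_nat_diff power2_eq_square algebra_simps)
      ultimately show ?thesis using False by simp
    qed simp
  qed
  also have "(\<Sum>i<72::nat. \<Sum>j<72::nat. 36 * (real i - real j) ^ 2 * h) = 36 * (\<Sum>i<72::nat. \<Sum>j<72::nat. (real i - real j) ^ 2) * h"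
    by (simp add: sum_distrib_left sum_distrib_right)
  also have "(\<Sum>i<72::nat. \<Sum>j<72::nat. (real i - real j) ^ 2) = 4478112" by (simp add: sum_square_differences)
  also have "(\<Sum>i<72::nat. \<Sum>j<72::nat. if i = j then 0 else real chi - E (d i j)) =
      (\<Sum>i<72::nat. \<Sum>j<72::nat. if i = j then 0 else real chi) - (\<Sum>i<72. \<Sum>j<72. if i = j then 0 else E (d i j))"
    unfolding sum_subtractf[symmetric] by (intro sum.cong) auto
  also have "(\<Sum>i<72::nat. \<Sum>j<72::nat. if i = j then 0 else real chi) = 5112 * real chi"
  proof -
    have "(\<Sum>j<72::nat. if i = j then 0 else real chi) = 71 * real chi" if "i < 72" for i
    proof -
      have "(\<Sum>j<72::nat. if i = j then 0 else real chi) = (\<Sum>j<72::nat. real chi - (if j = i then real chi else 0))"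
        by (rule sum.cong) auto
      then show ?thesis using that by (simp add: sum_subtractf)
    qed
    then have "(\<Sum>i<72::nat. \<Sum>j<72::nat. if i = j then 0 else real chi) = (\<Sum>i<72::nat. 71 * real chi)"
      by (intro sum.cong) auto
    then show ?thesis by simp
  qed
  finally have "5112 * real chi - (\<Sum>i<72. \<Sum>j<72. if i = j then 0 else E (d i j)) \<le> 36 * 4478112 * h" .
  then show ?thesis using E by linarith
qed

lemma part_general:
  assumes np: "\<not> has_primitive_divisor A P n" and n: "n \<le> L" and L: "426 \<le> L"
  shows "n < 190000"
proof (rule ccontr)
  assume "\<not> n < 190000"
  then have n0: "real n \<ge> 190000" and n1: "n \<ge> 1" by auto
  have "tot NP \<le> 12 * chi" using tot_mu tot_nonneg[of muP, OF mu_NP(1)] by simp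
  then have e: "E m - chi \<le> real chi / 2" for m using E_le[of m] by simp
  have h: "h \<ge> 72 / 161212032 * chi" using height_lower[OF L] by simp
  moreover have "72 / 161212032 * real chi \<ge> 0" by simp
  ultimately have h0: "h \<ge> 0" by linarith
  define c where "c = real chi"
  have c: "c \<ge> 1" using chi1 by (simp add: c_def)
  have 1: "real n ^ 2 / 2 * h \<le> c + betaP None n + om n * (c / 2)"
    using no_primitive_le(2)[OF np n1 n e h0] by (simp add: c_def)
  have 2: "betaP None n \<le> 33 * c" using contact_crude(1)[OF n1] by (simp add: c_def)
  \<comment> \<open>Each prime factor may cost \<open>chi / 2\<close>; a linear bound for their
    number suffices against \<open>n^2\<close>.\<close>
  have "om n * (c / 2) \<le> (3.5 + n / 108) * (c / 2)"
    using card_prime_factors_bounds(1)[OF n1] c by (intro mult_right_mono) auto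
  then have 3: "om n * (c / 2) \<le> 7/4 * c + real n * c / 216" by (simp add: algebra_simps)
  have "real n ^ 2 / 2 * (72 / 161212032 * c) \<le> real n ^ 2 / 2 * h"
    using h by (intro mult_left_mono) (auto simp: c_def)
  then have 4: "36 / 161212032 * (real n * (real n * c)) \<le> real n ^ 2 / 2 * h" by (simp add: power2_eq_square mult_ac)
  have 5: "190000 * c \<le> real n * c" using n0 c by (intro mult_right_mono) auto
  have 6: "190000 * (real n * c) \<le> real n * (real n * c)" using n0 c by (intro mult_right_mono) auto
  show False using 1 2 3 4 5 6 c by linarith
qed

text \<open>No correction is left at 6P, so \<open>36 * h >= chi\<close>, whereas a failure gives
  \<open>n^2 / 2 * h <= 34 * chi\<close>.\<close>

lemma part_potentially_good:
  assumes np: "\<not> has_primitive_divisor A P n" and n: "n \<le> L" and L: "6 \<le> L" and N: "\<And>pl. isplace pl \<Longrightarrow> NP pl = 0"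
  shows "n < 133"
proof (rule ccontr)
  assume "\<not> n < 133"
  then have n0: "real n \<ge> 133" and n1: "n \<ge> 1" by auto
  have t: "tot NP = 0" using tot_cong[of NP "\<lambda>_. 0"] N by (simp add: tot_def)
  have e: "E m - chi \<le> 0" for m using E_le[of m] t by simp
  have "E 6 = tot (\<lambda>_. 0)" unfolding E_def
    by (rule tot_cong) (use place_seq.eps_6[OF PS N, of _ 1] in auto)
  then have h: "36 * h \<ge> chi" using height_ge[of 6] L by (simp add: tot_def)
  then have h0: "h \<ge> 0" using chi1 by simp
  have "real n ^ 2 / 2 * h \<le> 34 * chi"
    using no_primitive_le(2)[OF np n1 n e h0] contact_crude(1)[OF n1] by simp
  moreover have "133^2 / 2 * h \<le> real n ^ 2 / 2 * h" using n0 h0 by (intro mult_right_mono divide_right_mono power_mono) auto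
  then have "17689 / 2 * h \<le> real n ^ 2 / 2 * h" by simp
  ultimately show False using h chi1 by linarith
qed

text \<open>Used with c = 6 for polynomial j, where multiplication by 6 removes all finite
  corrections, and with c = 1 if P is nonsingular at all finite places.\<close>

lemma inf_interval:
  assumes N: "NP None > 0" and m: "muP None = 0" and c: "c \<ge> 1" "4 * c \<le> L"
    and E: "\<And>j. j \<ge> 1 \<Longrightarrow> E (c * j) = epsP None (c * j)"
  shows "120 * (real c ^ 2 * h) \<ge> 21.25 * chi - 1.875 * NP None"
    and "c = 1 \<Longrightarrow> betaP None 12 > 0 \<Longrightarrow> 92 * h > 20 * real chi - 3 - 1.75 * NP None"
proof -
  interpret S: place_seq "val None" "AA None" "BB None" "XX None" "YY None" by (rule PS) simp
  interpret M: place_seq "val None" "AA None" "BB None" "\<lambda>j. XX None (c * j)" "\<lambda>j. YY None (c * j)"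
    by (rule S.multiples[OF c(1)])
  define x where "x = S.K (XX None (c * 1)) / NP None"
  note s = M.corr_small[OF N, folded x_def]
  have H: "real j ^ 2 * (real c ^ 2 * h) \<ge> chi - S.corr (XX None (c * j))" if j: "j \<ge> 1" "j \<le> 4" for j
  proof -
    have "c * j \<le> 4 * c" using j by simp
    then have "c * j \<le> L" using c by linarith
    then have "chi - E (c * j) \<le> real (c * j) ^ 2 * h" using j c by (intro height_ge) (auto simp: Suc_le_eq)
    moreover have "E (c * j) \<le> S.corr (XX None (c * j))"
      using E[OF j(1)] S.eps_bounds(2)[of "XX None (c * j)"] m by simp
    ultimately show ?thesis by (simp add: power_mult_distrib mult_ac)
  qed
  have N10: "NP None \<le> 10 * real chi" using J_inf_mult(3)[OF N] m by simp
  have c0: "real chi > 0" using chi1 by simp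
  note h1 = H[of 1, unfolded s(3)] and h2 = H[of 2, unfolded s(4)]
  have h3: "x \<ge> 1/4 \<Longrightarrow> 9 * (real c ^ 2 * h) \<ge> chi - NP None * (\<bar>3 * x - 1\<bar> * (1 - \<bar>3 * x - 1\<bar>)) / 2"
    using H[of 3] s(5) by simp
  have h4: "x \<ge> 1/4 \<Longrightarrow> 16 * (real c ^ 2 * h) \<ge> chi - NP None * (\<bar>4 * x - 1\<bar> * (1 - \<bar>4 * x - 1\<bar>)) / 2"
    using H[of 4] s(6) by simp
  have h1': "real c ^ 2 * h \<ge> chi - NP None * (x * (1 - x)) / 2" using h1 by simp
  have h2': "4 * (real c ^ 2 * h) \<ge> chi - NP None * ((2 * x) * (1 - 2 * x)) / 2" using h2 by simp
  show "120 * (real c ^ 2 * h) \<ge> 21.25 * chi - 1.875 * NP None"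
    by (rule interval_bound[OF c0 _ N10 s(1,2) h1' h2' h3 h4]) (use N in auto)
  show "92 * h > 20 * real chi - 3 - 1.75 * NP None" if c1: "c = 1" and b: "betaP None 12 > 0"
  proof -
    \<comment> \<open>Contact of 12P with the origin makes its component index 0, so 12 times the
      index of P is a multiple of \<open>NP None\<close>.\<close>
    have "XX None 12 \<noteq> 0" "val None (XX None 12) < 0" using b by (auto simp: S.beta_pos)
    then have "S.K (XX None 12) = 0" using S.K_zero m by simp
    then have "dst (NP None) (12 * S.K (XX None 1)) = 0" using S.K_seq[OF N, of 12] by simp
    then obtain k :: int where "12 * S.K (XX None 1) = NP None * of_int k" using dst_decomp[OF N, of "12 * S.K (XX None 1)"] by auto
    then have k: "12 * x = of_int k" using N c1 by (simp add: x_def field_simps)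
    have "0 \<le> k" "k \<le> 6" using s(1,2) k by linarith+
    then have k': "12 * x = real (nat k)" "nat k \<le> 6" using k by auto
    show ?thesis using interval_bound_12[OF c0 _ N10 k' h1' h2' h3] N c1 by simp
  qed
qed

text \<open>Type I_N^* at infinity: doubling kills the index, and the remaining correction is at
  most \<open>mu\<close>.\<close>

lemma inf_half:
  assumes N: "NP None > 0" and m: "muP None \<noteq> 0" and c: "c \<ge> 1" "2 * c \<le> L" and E: "E (2 * c) = epsP None (2 * c)"
  shows "muP None = 1/2" "4 * (real c ^ 2 * h) \<ge> chi - 1/2"
proof -
  interpret S: place_seq "val None" "AA None" "BB None" "XX None" "YY None" by (rule PS) simp
  have m0: "S.mu > 0" using S.mu0 m by simp
  show mu: "S.mu = 1/2" by (rule S.mu_half[OF N m0])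
  have "S.K (XX None (2 * c)) = 0" by (rule S.K_double_zero[OF N m0 c(1)])
  then have "E (2 * c) \<le> 1/2" using E S.eps_bounds(2)[of "XX None (2 * c)"] mu by (simp add: S.corr_def)
  then show "4 * (real c ^ 2 * h) \<ge> chi - 1/2" using height_ge[of "2 * c"] c by (simp add: power_mult_distrib)
qed

text \<open>The critical case is N near \<open>10 * chi\<close>: the lower bound for h drops to
  \<open>2.5 * chi / 4320\<close>, but the contact bound \<open>33 * chi - 3 * N\<close> drops too.
  The excess of n over 151 is carried as a linear parameter, since the bound for the number of prime
  factors grows with n.\<close>

lemma part_polynomial_j:
  assumes np: "\<not> has_primitive_divisor A P n" and n: "n \<le> L" and L: "24 \<le> L" and j: "polynomial_j A B"
  shows "n < 151"
proof (rule ccontr)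
  assume "\<not> n < 151"
  then have n0: "n \<ge> 151" and n1: "n \<ge> 1" by auto
  note F = polynomial_j_NN[OF j]
  define c N where "c = real chi" and "N = NP None"
  have c: "c \<ge> 1" using chi1 by (simp add: c_def)
  have "N > 0"
  proof (rule ccontr)
    assume "\<not> N > 0"
    then have "NP pl = 0" if "isplace pl" for pl using F mu_NP(3)[OF isplace_None] that by (cases pl) (auto simp: N_def)
    then show False using part_potentially_good[OF np n] L n0 by simp
  qed
  have N: "NP None > 0" "N > 0" using \<open>N > 0\<close> by (auto simp: N_def)
  have N10: "N \<le> 10 * c" using J_inf_mult(3)[OF N(1)] mu_NP(1)[OF isplace_None] by (simp add: c_def N_def)
  have E6: "E (6 * k) = epsP None (6 * k)" if "k \<ge> 1" for k
    by (rule E_None) (use place_seq.eps_6[OF PS F that] in auto)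
  have e: "E m - chi \<le> N / 24" for m using E_le[of m] tot_only_None[of NP, OF F] by (simp add: N_def)
  have R: "betaP None n \<le> 33 * c - 3 * N" using contact_crude(2)[OF n1 N(1)] by (simp add: c_def N_def)
  have w: "om n * (N / 24) \<le> (3.5 + n / 108) * (N / 24)"
    using card_prime_factors_bounds(1)[OF n1] N by (intro mult_right_mono) auto
  obtain k where k: "n = 151 + k" using n0 le_Suc_ex by blast
  define kr where "kr = real k"
  have kr: "kr \<ge> 0" "real n = 151 + kr" by (auto simp: kr_def k)
  have sq: "real n ^ 2 \<ge> 22801 + 302 * kr" unfolding kr(2) using kr(1) by (simp add: power2_eq_square algebra_simps)
  have kN: "kr * N \<le> 10 * (kr * c)" using mult_left_mono[OF N10 kr(1)] by simp
  have kc: "0 \<le> kr * c" "0 \<le> kr * N" using kr c N by auto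
  define y z where "y = kr * c" and "z = kr * N"
  have w': "om n * (N / 24) \<le> 0.2042 * N + kr * N / 2592"
  proof -
    have "(3.5 + n / 108) * (N / 24) = (3.5 + 151 / 108) / 24 * N + kr * N / 2592" unfolding kr(2) by (simp add: field_simps)
    moreover have "(3.5 + 151 / 108) / 24 * N \<le> 0.2042 * N" using N by (intro mult_right_mono) auto
    ultimately show ?thesis using w by linarith
  qed
  show False
  proof (cases "muP None = 0")
    case True
    \<comment> \<open>4320 is \<open>120 * 6^2\<close>.\<close>
    have H: "4320 * h \<ge> 21.25 * c - 1.875 * N"
      using inf_interval(1)[OF N(1) True, of 6] E6 L by (simp add: c_def N_def)
    define H' where "H' = 21.25 * c - 1.875 * N"
    have H': "H' \<ge> 2.5 * c" using N10 by (simp add: H'_def)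
    have h0: "h \<ge> 0" using H H' c unfolding H'_def[symmetric] by simp
    have 1: "real n ^ 2 / 2 * h \<le> c + (33 * c - 3 * N) + om n * (N / 24)"
      using no_primitive_le(2)[OF np n1 n e h0] R by (simp add: c_def)
    have "(22801 + 302 * kr) / 2 * (H' / 4320) \<le> real n ^ 2 / 2 * h"
      using sq H H' h0 c kr unfolding H'_def[symmetric] by (intro mult_mono) auto
    moreover have "kr * H' \<ge> 2.5 * (kr * c)" using mult_left_mono[OF H' kr(1)] by simp
    then have "(22801 + 302 * kr) / 2 * (H' / 4320) \<ge> 22801 / 8640 * H' + 302 / 8640 * (2.5 * (kr * c))"
      by (simp add: algebra_simps)
    ultimately have "22801 / 8640 * H' + 302 / 8640 * (2.5 * (kr * c)) \<le> 34 * c - 3 * N + 0.2042 * N + kr * N / 2592"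
      using 1 w' by linarith
    then have "22801 / 8640 * (21.25 * c - 1.875 * N) + 302 / 8640 * (2.5 * y) \<le> 34 * c - 3 * N + 0.2042 * N + z / 2592"
      unfolding H'_def y_def z_def .
    then show False using kN kc N10 c N unfolding y_def[symmetric] z_def[symmetric] by (simp add: field_simps)
  next
    case False
    have "36 * h \<ge> c - 1/2" using inf_half(2)[OF N(1) False, of 3] E6[of 1] L by (simp add: c_def)
    then have h: "72 * h \<ge> c" using c by simp
    then have h0: "h \<ge> 0" using c by simp
    have 1: "real n ^ 2 / 2 * h \<le> c + (33 * c - 3 * N) + om n * (N / 24)"
      using no_primitive_le(2)[OF np n1 n e h0] R by (simp add: c_def)
    have "(22801 + 302 * kr) / 2 * (c / 72) \<le> real n ^ 2 / 2 * h"
      using sq h h0 c kr by (intro mult_mono) auto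
    moreover have "(22801 + 302 * kr) / 2 * (c / 72) = 22801 / 144 * c + 302 / 144 * (kr * c)"
      by (simp add: field_simps)
    ultimately have "22801 / 144 * c + 302 / 144 * y \<le> 34 * c - 3 * N + 0.2042 * N + z / 2592"
      using 1 w' unfolding y_def z_def by linarith
    then show False using kN kc N10 c N unfolding y_def[symmetric] z_def[symmetric] by (simp add: field_simps)
  qed
qed

end

lemma prime_factors_pair: fixes p q :: nat assumes "prime p" "prime q" shows "prime_factors (p * q) = {p, q}"
proof -
  have "p * q \<noteq> 0" using assms by auto
  then show ?thesis using assms by (auto simp: in_prime_factors_iff prime_dvd_mult_iff primes_dvd_imp_eq)
qed

lemma prime_factors_12: "prime_factors (12 :: nat) = {2, 3}"
proof -
  have "prime_factors (2 * (2 * 3) :: nat) = prime_factors 2 \<union> prime_factors (2 * 3)" by (rule prime_factors_product) auto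
  also have "\<dots> = {2, 3}" using prime_factors_pair[of 2 3] by (auto simp: prime_prime_factors)
  finally show ?thesis by simp
qed

text \<open>Equality holds at the prime 11, which fixes 120; 12 yields only 92 and is treated apart.
  From 16 on, \<open>n^2 / 2\<close> is enough.\<close>

lemma primitive_part_bound:
  fixes n :: nat assumes n: "n \<ge> 11" "n \<noteq> 12"
  shows "real n ^ 2 * (1 - (\<Sum>q\<in>prime_factors n. 1 / real q ^ 2)) \<ge> 120"
proof -
  consider "n = 11" | "n = 13" | "n = 14" | "n = 15" | "n \<ge> 16" using n by linarith
  then show ?thesis
  proof cases
    case 1
    have "prime (11::nat)" by simp
    then show ?thesis using 1 by (simp add: prime_prime_factors)
  next
    case 2
    have "prime (13::nat)" by simp
    then show ?thesis using 2 by (simp add: prime_prime_factors)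
  next
    case 3 then show ?thesis using prime_factors_pair[of 2 7] by simp
  next
    case 4 then show ?thesis using prime_factors_pair[of 3 5] by simp
  next
    case 5
    have "real n ^ 2 * (1/2) \<le> real n ^ 2 * (1 - (\<Sum>q\<in>prime_factors n. 1 / real q ^ 2))"
      using sum_prime_squares[of n] by (intro mult_left_mono) auto
    moreover have "16^2 \<le> real n ^ 2" using 5 by (intro power_mono) auto
    ultimately show ?thesis by simp
  qed
qed

lemma card_prime_factors_pos: fixes n :: nat assumes "n \<ge> 2" shows "card (prime_factors n) \<ge> 1"
proof -
  obtain p where "prime p" "p dvd n" using prime_factor_nat[of n] assms by auto
  then have "p \<in> prime_factors n" using assms by (simp add: in_prime_factors_iff)
  then have "card (prime_factors n) > 0" using card_gt_0_iff by blast
  then show ?thesis by simp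
qed

text \<open>With one prime factor the upper bound is \<open>21 * c - 3 - 1.875 * N\<close>, just
  below the lower bound H; this explains \<open>21.25 * c - 1.875 * N\<close>. Further prime factors
  hurt only for \<open>N > 8 * c\<close>.\<close>

lemma mult_reduction_contradiction:
  fixes h c N w W :: real and n :: nat
  assumes c: "c \<ge> 1" and N: "N > 0" "N \<le> 10 * c" and H: "120 * h \<ge> 21.25 * c - 1.875 * N"
    and W: "W \<ge> 120" "W \<ge> real n ^ 2 / 2" and w: "w \<ge> 1" "w \<le> 1.5 + n / 12" "w > 2 \<Longrightarrow> n \<ge> 18"
    and le: "W * h \<le> 22 * c - 3 - 2 * N + w * (N / 8 - c)"
  shows False
proof -
  define Q where "Q = 21.25 * c - 1.875 * N"
  have Q: "Q \<ge> 2.5 * c" using N by (simp add: Q_def)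
  have hQ: "h \<ge> Q / 120" using H by (simp add: Q_def)
  have h0: "h \<ge> 0" using hQ Q c by simp
  show False
  proof (cases "w > 2")
    case False
    have "120 * h \<le> W * h" using W(1) h0 by (rule mult_right_mono)
    then have 1: "Q \<le> 22 * c - 3 - 2 * N + w * (N / 8 - c)" using le hQ by simp
    show False
    proof (cases "N / 8 \<le> c")
      case True
      have "w * (N / 8 - c) \<le> 1 * (N / 8 - c)" using w(1) True by (intro mult_right_mono_neg) auto
      then show False using 1 c N by (simp add: Q_def)
    next
      case F: False
      have "w * (N / 8 - c) \<le> 2 * (N / 8 - c)" using False F by (intro mult_right_mono) auto
      then show False using 1 c N by (simp add: Q_def)
    qed
  next
    case True
    \<comment> \<open>Three prime factors force n to be at least 18, and \<open>n^2\<close> then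
      outgrows the linear bound for w.\<close>
    obtain k where k: "n = 18 + k" using w(3)[OF True] le_Suc_ex by blast
    define kr where "kr = real k"
    have kr: "kr \<ge> 0" "real n = 18 + kr" by (auto simp: kr_def k)
    have sq: "real n ^ 2 \<ge> 324 + 36 * kr" unfolding kr(2) using kr(1) by (simp add: power2_eq_square algebra_simps)
    define y where "y = kr * c"
    have y0: "y \<ge> 0" using kr c by (simp add: y_def)
    have "(324 + 36 * kr) / 2 * (Q / 120) \<le> W * h"
      using W(2) sq hQ h0 Q c kr by (intro mult_mono) auto
    moreover have "kr * Q \<ge> 2.5 * y" using mult_left_mono[OF Q kr(1)] by (simp add: y_def)
    then have "(324 + 36 * kr) / 2 * (Q / 120) \<ge> 1.35 * Q + 3/8 * y" by (simp add: algebra_simps)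
    ultimately have 1: "1.35 * Q + 3/8 * y \<le> 22 * c - 2 * N + w * (N / 8 - c)" using le by linarith
    have 2: "Q = 85/4 * c - 15/8 * N" and 3: "27/20 * Q + 3/8 * y \<le> 22 * c - 2 * N + w * (N / 8 - c)" using 1 by (simp_all add: Q_def)
    show False
    proof (cases "N / 8 \<le> c")
      case True
      then have "w * (N / 8 - c) \<le> 0" using w(1) by (intro mult_nonneg_nonpos) auto
      then show False using 2 3 c N True y0 by linarith
    next
      case False
      have "w \<le> 3 + kr / 12" using w(2) unfolding kr(2) by (simp add: field_simps)
      then have "w * (N / 8 - c) \<le> (3 + kr / 12) * (N / 8 - c)" using False by (intro mult_right_mono) auto
      also have "\<dots> = 3 * (N / 8 - c) + kr * (N / 8 - c) / 12" by (simp only: distrib_right times_divide_eq_left)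
      also have "kr * (N / 8 - c) \<le> kr * (c / 4)" using N kr by (intro mult_left_mono) auto
      finally have "w * (N / 8 - c) \<le> 3 * (N / 8 - c) + y / 48" by (simp add: y_def)
      then have "27/20 * (85/4 * c - 15/8 * N) + 3/8 * y \<le> 22 * c - 2 * N + 3 * (N / 8 - c) + y / 48"
        using 3 unfolding 2 by linarith
      then show False using c N y0 by (simp add: field_simps)
    qed
  qed
qed

text \<open>The case \<open>mu = 1/2\<close> at infinity: \<open>10 * c - 6\<close> and
  \<open>21 * c - 14\<close> are \<open>10 * c - 1 - 10 * mu\<close> and
  \<open>21 * c - 3 - 22 * mu\<close>.\<close>

lemma additive_reduction_contradiction:
  fixes h c N w W R :: real and n :: nat
  assumes c: "c \<ge> 1" and N: "N > 0" "N \<le> 10 * c - 6" and H: "4 * h \<ge> c - 1/2"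
    and W: "W \<ge> 92" "W \<ge> real n ^ 2 / 2" and n: "n \<ge> 11" and w: "w \<ge> 1" "w \<le> 1.5 + n / 12"
    and R: "R \<le> 0 \<or> R \<le> 21 * c - 14 - 2 * N"
    and le: "W * h \<le> c + R + w * (1/2 + N / 8 - c)"
  shows False
proof -
  have h0: "h \<ge> 0" using H c by simp
  have h8: "h \<ge> c / 8" using H c by simp
  show False
  proof (cases "1/2 + N / 8 \<le> c")
    case True
    then have "w * (1/2 + N / 8 - c) \<le> 0" using w(1) by (intro mult_nonneg_nonpos) auto
    moreover have "92 * h \<le> W * h" using W(1) h0 by (rule mult_right_mono)
    ultimately show False using le R H c N by (elim disjE) simp_all
  next
    case False
    have "w * (1/2 + N / 8 - c) \<le> (1.5 + n / 12) * (c / 4)"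
      using w N c False by (intro mult_mono) auto
    then have 1: "w * (1/2 + N / 8 - c) \<le> 3/8 * c + real n * c / 48" by (simp add: field_simps)
    have "real n ^ 2 / 2 * (c / 8) \<le> W * h" using W(2) h8 h0 c W(1) by (intro mult_mono) auto
    moreover have "11 * (real n * c) \<le> real n * (real n * c)" using n c by (intro mult_right_mono) auto
    then have "11 / 16 * (real n * c) \<le> real n ^ 2 / 2 * (c / 8)" by (simp add: power2_eq_square field_simps)
    moreover have "11 * c \<le> real n * c" using n c by (intro mult_right_mono) auto
    ultimately show False using le R 1 c N False by (elim disjE) linarith+
  qed
qed

context ec_support
begin

context
  assumes G: "\<And>p m. prime p \<Longrightarrow> m \<ge> 1 \<Longrightarrow> nsP (Some p) m" and G0: "\<And>p m. prime p \<Longrightarrow> m \<ge> 1 \<Longrightarrow> epsP (Some p) m = 0"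
begin

lemma good_E: "m \<ge> 1 \<Longrightarrow> E m = epsP None m" using E_None G0 by blast

lemma good_contact:
  assumes n: "n \<ge> 1" and R: "betaP None n > 0"
  shows "NP None > 0 \<Longrightarrow> betaP None n \<le> 21 * real chi - 3 - 22 * muP None - 2 * NP None"
    and "NP None = 0 \<Longrightarrow> betaP None n \<le> 21 * real chi - 3 - 22 * muP None
      \<or> betaP None n \<le> 11 * real chi - 1 - 11 * muP None"
  using contact_bound[OF n R, of "\<lambda>_. 0" 0] G n by simp_all

text \<open>All corrections vanish, so \<open>h >= chi\<close>, and every prime factor of n lowers
  the right-hand side by \<open>chi\<close>. As there is at least one, at most
  \<open>21 * chi\<close> faces \<open>49 / 2 * chi\<close>.\<close>

lemma part_good_everywhere:
  assumes np: "\<not> has_primitive_divisor A P n" and n: "n \<le> L" and L: "1 \<le> L" and I: "\<And>m. m \<ge> 1 \<Longrightarrow> epsP None m = 0"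
  shows "n < 7"
proof (rule ccontr)
  assume "\<not> n < 7"
  then have n0: "real n \<ge> 7" and n1: "n \<ge> 1" "n \<ge> 2" by auto
  note m = mu_NP[OF isplace_None]
  have E: "E k = 0" if "k \<ge> 1" for k using good_E I that by simp
  have h: "h \<ge> chi" using height_ge[of 1] E[of 1] L by simp
  then have h0: "h \<ge> 0" by simp
  have "betaP None n \<le> 21 * real chi"
  proof (cases "betaP None n > 0")
    case True
    then show ?thesis using good_contact[OF n1(1) True] m chi1 by (cases "NP None = 0") fastforce+
  qed (use chi1 in simp)
  moreover have "real n ^ 2 / 2 * h \<le> chi + betaP None n + om n * (- real chi)"
    using no_primitive_le(2)[OF np n1(1) n, of "- real chi"] E h0 by simp
  moreover have "om n * real chi \<ge> 1 * real chi"
    using card_prime_factors_pos[OF n1(2)] by (intro mult_right_mono) auto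
  moreover have "7^2 / 2 * h \<le> real n ^ 2 / 2 * h" using n0 h0 by (intro mult_right_mono divide_right_mono power_mono) auto
  then have "49 / 2 * h \<le> real n ^ 2 / 2 * h" by simp
  ultimately show False using h chi1 by simp
qed

text \<open>Corrections occur only at infinity, in three regimes: potentially good, I_N^* and
  multiplicative. In the last one n = 12 needs the refined bound of
  \<open>inf_interval\<close>.\<close>

lemma part_good_finite:
  assumes np: "\<not> has_primitive_divisor A P n" and n: "n \<le> L" and L: "4 \<le> L"
  shows "n < 11"
proof (rule ccontr)
  assume "\<not> n < 11"
  then have n0: "n \<ge> 11" and n1: "n \<ge> 1" "n \<ge> 2" by auto
  note m = mu_NP[OF isplace_None]
  define c N mu R where "c = real chi" and "N = NP None" and "mu = muP None" and "R = betaP None n"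
  define W where "W = real n ^ 2 * (1 - (\<Sum>q\<in>prime_factors n. 1 / real q ^ 2))"
  have c: "c \<ge> 1" using chi1 by (simp add: c_def)
  have Wn: "W \<ge> real n ^ 2 / 2"
  proof -
    have "real n ^ 2 * (1/2) \<le> W" unfolding W_def using sum_prime_squares[of n] by (intro mult_left_mono) auto
    then show ?thesis by simp
  qed
  have W12: "W = 92" if "n = 12" using that by (simp add: W_def prime_factors_12)
  have W120: "W \<ge> 120" if "n \<noteq> 12" unfolding W_def by (rule primitive_part_bound[OF n0 that])
  have w1: "om n \<ge> 1" using card_prime_factors_pos[OF n1(2)] by simp
  have e: "E k - chi \<le> mu + N / 8 - c" if "k \<ge> 1" for k
    using good_E[OF that] eps_le[OF isplace_None, of k] by (simp add: c_def mu_def N_def)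
  have le: "W * h \<le> c + R + om n * (mu + N / 8 - c)"
    using no_primitive_le(1)[OF np n1(1) n e] by (simp add: W_def c_def R_def)
  have R0: "R \<ge> 0" using betaP_nonneg[OF isplace_None] by (simp add: R_def)
  show False
  proof (cases "N > 0")
    case False
    then have N: "N = 0" using m(3) by (simp add: N_def)
    have "chi - (mu + N / 8) \<le> h"
      using height_ge[of 1] good_E[of 1] eps_le[OF isplace_None, of 1] L by (simp add: mu_def N_def)
    then have h: "h \<ge> c - mu" using N by (simp add: c_def)
    \<comment> \<open>\<open>12 * mu\<close> is an integer below 12, which keeps
      \<open>c - mu\<close> at least 1/12.\<close>
    have mu: "0 \<le> mu" "mu \<le> 11 / 12"
    proof -
      obtain i where i: "12 * mu = of_int i" using place.mu_int[OF place[OF isplace_None]] by (auto simp: mu_def elim: Ints_cases)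
      then have "i < 12" using m(2) by (simp add: mu_def)
      then show "mu \<le> 11 / 12" using i by linarith
    qed (use m in \<open>simp add: mu_def\<close>)
    have h0: "h \<ge> 0" using h mu c by simp
    have "om n * (mu + N / 8 - c) \<le> 0" using mu c N by (intro mult_nonneg_nonpos) auto
    then have "W * h \<le> c + R" using le by simp
    moreover have "60 * h \<le> W * h"
    proof (rule mult_right_mono[OF _ h0])
      have "11^2 \<le> real n ^ 2" using n0 by (intro power_mono) auto
      then show "60 \<le> W" using Wn by simp
    qed
    moreover have "R = 0 \<or> R \<le> 21 * c - 3 - 22 * mu \<or> R \<le> 11 * c - 1 - 11 * mu"
      using good_contact(2)[OF n1(1)] R0 N unfolding R_def c_def mu_def N_def by fastforce
    ultimately show False using h mu c by (elim disjE) simp_all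
  next
    case True
    then have N: "NP None > 0" "N > 0" by (auto simp: N_def)
    have N10: "N + 10 * mu \<le> 10 * c - 1" using J_inf_mult(3)[OF N(1)] by (simp add: N_def mu_def c_def)
    have R: "R = 0 \<or> R \<le> 21 * c - 3 - 22 * mu - 2 * N"
      using good_contact(1)[OF n1(1) _ N(1)] R0 unfolding R_def c_def mu_def N_def by fastforce
    show False
    proof (cases "mu = 0")
      case False
      then have F: "muP None \<noteq> 0" by (simp add: mu_def)
      have H: "mu = 1/2" "4 * h \<ge> c - 1/2"
        using inf_half[OF N(1) F, of 1] good_E[of 2] L by (simp_all add: mu_def c_def)
      show False
      proof (rule additive_reduction_contradiction[OF c N(2) _ H(2) _ Wn n0 w1])
        show "N \<le> 10 * c - 6" using N10 H by simp
        show "92 \<le> W" using W12 W120 by (cases "n = 12") auto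
        show "om n \<le> 1.5 + n / 12" by (rule card_prime_factors_bounds(2)[OF n1(1)])
        show "R \<le> 0 \<or> R \<le> 21 * c - 14 - 2 * N" using R H by auto
        show "W * h \<le> c + R + om n * (1/2 + N / 8 - c)" using le H by simp
      qed
    next
      case True
      then have mu: "muP None = 0" by (simp add: mu_def)
      have N10': "N \<le> 10 * c - 1" using N10 True by simp
      have R': "R \<le> 21 * c - 3 - 2 * N" using R True N10' c by (elim disjE) simp_all
      have H: "120 * h \<ge> 21.25 * c - 1.875 * N"
        using inf_interval(1)[OF N(1) mu, of 1] good_E L by (simp add: c_def N_def)
      show False
      proof (cases "n = 12")
        case False
        show False
        proof (rule mult_reduction_contradiction[OF c N(2) _ H W120[OF False] Wn w1])
          show "N \<le> 10 * c" using N10' by simp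
          show "om n \<le> 1.5 + n / 12" by (rule card_prime_factors_bounds(2)[OF n1(1)])
          show "2 < om n \<Longrightarrow> 18 \<le> n" by (rule card_prime_factors_bounds(3)[OF n1(1)])
          show "W * h \<le> 22 * c - 3 - 2 * N + om n * (N / 8 - c)" using le R' True by simp
        qed
      next
        case n12: True
        have "om n = 2" using n12 by (simp add: prime_factors_12)
        then have le': "92 * h \<le> c + R + 2 * (N / 8 - c)" using le W12[OF n12] True by simp
        show False
        proof (cases "R > 0")
          case True
          then have "92 * h > 20 * c - 3 - 1.75 * N"
            using inf_interval(2)[OF N(1) mu, of 1] good_E L n12 by (simp add: c_def N_def R_def)
          then show False using le' R' by simp
        next
          case False
          then show False using le' H N10' c N(2) R0 by simp
        qed
      qed
    qed
  qed
qed

end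

end

context ec_global
begin

lemma support_ex: "\<exists>T. ec_support A B P L T"
proof -
  obtain T where "finite T" "None \<in> T" "\<forall>pl\<in>T. isplace pl"
   "\<forall>pl. isplace pl \<and> pl \<notin> T \<longrightarrow> 12 * muP pl + NP pl = 0"
   "(\<Sum>pl\<in>T. wt pl * val pl (polyK (4 * A^3 + 27 * B^2))) = 0"
   "\<forall>m n. 1 \<le> m \<and> 1 \<le> n \<and> m \<noteq> n \<and> m \<le> L \<and> n \<le> L \<longrightarrow> (\<Sum>pl\<in>T. wt pl * val pl (X m - X n)) = 0"
   "\<forall>n. 1 \<le> n \<and> n \<le> L \<longrightarrow> (\<Sum>pl\<in>T. wt pl * val pl (Y n)) = 0"
    using Ex_support[of L] by blast
  then have "ec_support A B P L T" by (unfold_locales) blast+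
  then show ?thesis by blast
qed

lemma bounds:
  assumes np: "\<not> has_primitive_divisor A P n"
  shows "n < 190000" "good_reduction_everywhere A B P \<Longrightarrow> n < 7" "good_reduction_finite A B P \<Longrightarrow> n < 11"
    "isotrivial A B \<Longrightarrow> n < 133" "polynomial_j A B \<Longrightarrow> n < 151"
proof -
  \<comment> \<open>426 is the largest multiple used in \<open>height_lower\<close>.\<close>
  define L where "L = max n 426"
  have L: "n \<le> L" "426 \<le> L" "6 \<le> L" "24 \<le> L" "1 \<le> L" "4 \<le> L" by (auto simp: L_def)
  obtain T where "ec_support A B P L T" using support_ex by blast
  then interpret ec_support A B P L T .
  show "n < 190000" by (rule part_general[OF np L(1,2)])
  show "isotrivial A B \<Longrightarrow> n < 133" using part_potentially_good[OF np L(1,3)] isotrivial_NN by blast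
  show "polynomial_j A B \<Longrightarrow> n < 151" by (rule part_polynomial_j[OF np L(1,4)])
  show "good_reduction_finite A B P \<Longrightarrow> n < 11" using part_good_finite[OF _ _ np L(1,6)] good_finite by blast
  show "good_reduction_everywhere A B P \<Longrightarrow> n < 7"
    using part_good_everywhere[OF _ _ np L(1,5)] good_finite good_infinite unfolding good_reduction_everywhere_def by blast
qed

end

theorem theorem3p10:
  fixes A B :: "rat poly" and P :: "K ec_point"
  assumes nonsing: "4 * A ^ 3 + 27 * B ^ 2 \<noteq> 0"
    and minimal: "minimal_poly_model A B"
    and nonconstant: "\<not> (degree A = 0 \<and> degree B = 0)"
    and onE: "on_curve (polyK A) (polyK B) P"
    and nontors: "non_torsion (polyK A) P"
  shows "(\<forall>n\<ge>190000. has_primitive_divisor A P n)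
    \<and> (good_reduction_everywhere A B P \<longrightarrow> (\<forall>n\<ge>7. has_primitive_divisor A P n))
    \<and> (good_reduction_finite A B P \<longrightarrow> (\<forall>n\<ge>11. has_primitive_divisor A P n))
    \<and> (isotrivial A B \<longrightarrow> (\<forall>n\<ge>133. has_primitive_divisor A P n))
    \<and> (polynomial_j A B \<longrightarrow> (\<forall>n\<ge>151. has_primitive_divisor A P n))"
proof -
  interpret ec_global A B P by unfold_locales (use assms in auto)
  show ?thesis using bounds by (meson not_less)
qed

end
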